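(* Let $\mathbf{k}$ be an algebraically closed field of characteristic $p$, let $V_1,V_2$ be finite dimensional $\mathbf{k}$-vector spaces with $n_i=\dim(V_i)\geq2$, let $V=V_1\oplus V_2$, and let $K\subseteq V_1\otimes V_2$ be a subspace. Suppose that $p=0$ or $p\geq n_1+n_2-3$. Then $$W_{d,e}(V,K)=0\ \text{ for } d,e\gg0\quad\Longleftrightarrow\quad W_{n_2-2,n_1-2}(V,K)=0.$$
   Context: Let $S=\operatorname{Sym}(V)$, bi-graded so that $S_{1,0}=V_1$, $S_{0,1}=V_2$; thus $S_{d,e}=\operatorname{Sym}^d(V_1)\otimes\operatorname{Sym}^e(V_2)$ (zero if $d<0$ or $e<0$). Regard $K\subseteq V_1\otimes V_2\subset\bigwedge^2V$. The bi-graded Koszul module $W(V,K)$ is the middle homology of $K\otimes S\to V\otimes S\to S$, where the maps are the (restrictions of the) Koszul differentials: $(v_1\otimes v_2)\otimes f\mapsto v_1\otimes v_2f-v_2\otimes v_1f$ for $v_i\in V_i$, and $v\otimes f\mapsto vf$. Its bi-degree $(d,e)$ component $W_{d,e}(V,K)$ is the middle homology of $$K\otimes S_{d,e}\to V_1\otimes S_{d,e+1}\oplus V_2\otimes S_{d+1,e}\to S_{d+1,e+1}.$$ *)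

theory Defs
  imports "HOL-Algebra.QuotRing" "HOL-Library.Poly_Mapping" "Jordan_Normal_Form.VS_Connect"
begin

text \<open>
  A vector space over the field \<open>'k\<close> is a \<^locale>\<open>vectorspace\<close> over \<^term>\<open>class_ring\<close>;
  its carrier may be a proper subset of the type of its elements.  The multiplicative fields of
  the record \<^typ>\<open>('k, 'v) module\<close> are meaningful only for the symmetric algebra.
\<close>


section \<open>Quotients and free vector spaces\<close>

definition quotient_module :: "('k, 'v) module \<Rightarrow> 'v set \<Rightarrow> ('k, 'v set) module"
  where "quotient_module M N =
    ring.extend (M Quot N) \<lparr> smult = (\<lambda>c X. \<Union>x\<in>X. N +>\<^bsub>M\<^esub> (c \<odot>\<^bsub>M\<^esub> x)) \<rparr>"

definition free_space :: "'x set \<Rightarrow> ('k::field, 'x \<Rightarrow>\<^sub>0 'k) module"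
  where "free_space X =
    \<lparr> carrier = {f. Poly_Mapping.keys f \<subseteq> X}, mult = (\<lambda>_ _. 0), one = 0, zero = 0, add = (+),
      smult = (\<lambda>c. Poly_Mapping.map ((*) c)) \<rparr>"

text \<open>
  The polynomial algebra on a set \<open>X\<close> of variables, as the monoid algebra of the free commutative
  monoid on \<open>X\<close>: a monomial is the multiset of its variables.
\<close>

definition free_comm_algebra :: "'x set \<Rightarrow> ('k::field, 'x multiset \<Rightarrow>\<^sub>0 'k) module"
  where "free_comm_algebra X =
    \<lparr> carrier = {f. \<forall>m \<in> Poly_Mapping.keys f. set_mset m \<subseteq> X},
      mult = (*), one = 1, zero = 0, add = (+),
      smult = (\<lambda>c. Poly_Mapping.map ((*) c)) \<rparr>"


section \<open>Tensor products\<close>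

definition tensor_relations ::
    "('k::field, 'a) module \<Rightarrow> ('k, 'b) module \<Rightarrow> ('a \<times> 'b \<Rightarrow>\<^sub>0 'k) set"
  where "tensor_relations M N =
    LinearCombinations.module.span class_ring (free_space (carrier M \<times> carrier N))
     ({Poly_Mapping.single (u \<oplus>\<^bsub>M\<^esub> u', v) 1 - Poly_Mapping.single (u, v) 1
         - Poly_Mapping.single (u', v) 1
       | u u' v. u \<in> carrier M \<and> u' \<in> carrier M \<and> v \<in> carrier N} \<union>
      {Poly_Mapping.single (u, v \<oplus>\<^bsub>N\<^esub> v') 1 - Poly_Mapping.single (u, v) 1
         - Poly_Mapping.single (u, v') 1
       | u v v'. u \<in> carrier M \<and> v \<in> carrier N \<and> v' \<in> carrier N} \<union>
      {Poly_Mapping.single (c \<odot>\<^bsub>M\<^esub> u, v) 1 - Poly_Mapping.single (u, v) c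
       | c u v. u \<in> carrier M \<and> v \<in> carrier N} \<union>
      {Poly_Mapping.single (u, c \<odot>\<^bsub>N\<^esub> v) 1 - Poly_Mapping.single (u, v) c
       | c u v. u \<in> carrier M \<and> v \<in> carrier N})"

definition tensor ::
    "('k::field, 'a) module \<Rightarrow> ('k, 'b) module \<Rightarrow> ('k, ('a \<times> 'b \<Rightarrow>\<^sub>0 'k) set) module"
  where "tensor M N =
    quotient_module (free_space (carrier M \<times> carrier N)) (tensor_relations M N)"

definition pure_tensor ::
    "('k::field, 'a) module \<Rightarrow> ('k, 'b) module \<Rightarrow> 'a \<Rightarrow> 'b \<Rightarrow> ('a \<times> 'b \<Rightarrow>\<^sub>0 'k) set"
  where "pure_tensor M N u v =
    tensor_relations M N +>\<^bsub>free_space (carrier M \<times> carrier N)\<^esub> Poly_Mapping.single (u, v) 1"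

text \<open>
  The linear map out of a tensor product induced by a bilinear map \<open>\<phi>\<close>: the class of a formal sum
  \<open>\<Sum> c\<^sub>i (u\<^sub>i, v\<^sub>i)\<close> is sent to \<open>\<Sum> c\<^sub>i \<phi> u\<^sub>i v\<^sub>i\<close>, independently of the representative.
\<close>

definition tensor_lift ::
    "('k::field, 'c) module \<Rightarrow> ('a \<Rightarrow> 'b \<Rightarrow> 'c) \<Rightarrow> ('a \<times> 'b \<Rightarrow>\<^sub>0 'k) set \<Rightarrow> 'c"
  where "tensor_lift P \<phi> X =
    (THE y. \<forall>x\<in>X.
       y = (\<Oplus>\<^bsub>P\<^esub> z \<in> Poly_Mapping.keys x. Poly_Mapping.lookup x z \<odot>\<^bsub>P\<^esub> \<phi> (fst z) (snd z)))"


section \<open>Symmetric algebras\<close>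

definition sym_relations :: "('k::field, 'v) module \<Rightarrow> ('v multiset \<Rightarrow>\<^sub>0 'k) set"
  where "sym_relations V =
    Idl\<^bsub>free_comm_algebra (carrier V)\<^esub>
     ({Poly_Mapping.single {#u \<oplus>\<^bsub>V\<^esub> v#} 1 - Poly_Mapping.single {#u#} 1
         - Poly_Mapping.single {#v#} 1
       | u v. u \<in> carrier V \<and> v \<in> carrier V} \<union>
      {Poly_Mapping.single {#c \<odot>\<^bsub>V\<^esub> v#} 1 - Poly_Mapping.single {#v#} c
       | c v. v \<in> carrier V})"

definition sym_algebra :: "('k::field, 'v) module \<Rightarrow> ('k, ('v multiset \<Rightarrow>\<^sub>0 'k) set) module"
  where "sym_algebra V = quotient_module (free_comm_algebra (carrier V)) (sym_relations V)"

definition sym_incl :: "('k::field, 'v) module \<Rightarrow> 'v \<Rightarrow> ('v multiset \<Rightarrow>\<^sub>0 'k) set"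
  where "sym_incl V v =
    sym_relations V +>\<^bsub>free_comm_algebra (carrier V)\<^esub> Poly_Mapping.single {#v#} 1"


section \<open>Bi-graded Koszul modules\<close>

context
  fixes V1 :: "('k::field, 'a) module" and V2 :: "('k, 'b) module"
begin

abbreviation bisym :: "('k, (('a \<times> 'b) multiset \<Rightarrow>\<^sub>0 'k) set) module"
  where "bisym \<equiv> sym_algebra (direct_sum V1 V2)"

definition var1 :: "'a \<Rightarrow> (('a \<times> 'b) multiset \<Rightarrow>\<^sub>0 'k) set"
  where "var1 v = sym_incl (direct_sum V1 V2) (inj1 V1 V2 v)"

definition var2 :: "'b \<Rightarrow> (('a \<times> 'b) multiset \<Rightarrow>\<^sub>0 'k) set"
  where "var2 v = sym_incl (direct_sum V1 V2) (inj2 V1 V2 v)"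

text \<open>
  \<open>S\<^sub>d\<^sub>,\<^sub>e\<close> is spanned by the products of \<open>d\<close> elements of \<open>V1\<close> and \<open>e\<close> elements of \<open>V2\<close>.
\<close>

definition sym_part :: "nat \<Rightarrow> nat \<Rightarrow> ('k, (('a \<times> 'b) multiset \<Rightarrow>\<^sub>0 'k) set) module"
  where "sym_part d e = bisym \<lparr> carrier := LinearCombinations.module.span class_ring bisym
    {(\<Otimes>\<^bsub>bisym\<^esub> i\<in>{..<d}. var1 (x i)) \<otimes>\<^bsub>bisym\<^esub> (\<Otimes>\<^bsub>bisym\<^esub> j\<in>{..<e}. var2 (y j)) | x y.
       x \<in> {..<d} \<rightarrow> carrier V1 \<and> y \<in> {..<e} \<rightarrow> carrier V2} \<rparr>"

definition koszul_source where
  "koszul_source K d e = tensor ((tensor V1 V2) \<lparr> carrier := K \<rparr>) (sym_part d e)"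

definition koszul_middle where
  "koszul_middle d e =
     direct_sum (tensor V1 (sym_part d (e + 1))) (tensor V2 (sym_part (d + 1) e))"

text \<open>\<open>(v\<^sub>1 \<otimes> v\<^sub>2) \<otimes> f \<mapsto> v\<^sub>1 \<otimes> v\<^sub>2 f - v\<^sub>2 \<otimes> v\<^sub>1 f\<close>\<close>

definition koszul_map2 where
  "koszul_map2 d e = tensor_lift (koszul_middle d e) (\<lambda>t f. tensor_lift (koszul_middle d e)
     (\<lambda>v1 v2.
        (pure_tensor V1 (sym_part d (e + 1)) v1 (var2 v2 \<otimes>\<^bsub>bisym\<^esub> f),
         \<ominus>\<^bsub>tensor V2 (sym_part (d + 1) e)\<^esub>
           pure_tensor V2 (sym_part (d + 1) e) v2 (var1 v1 \<otimes>\<^bsub>bisym\<^esub> f))) t)"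

text \<open>\<open>v \<otimes> f \<mapsto> v f\<close> on both summands\<close>

definition koszul_map1 where
  "koszul_map1 d e = (\<lambda>(a, b).
     tensor_lift (sym_part (d + 1) (e + 1)) (\<lambda>v f. var1 v \<otimes>\<^bsub>bisym\<^esub> f) a
     \<oplus>\<^bsub>sym_part (d + 1) (e + 1)\<^esub>
     tensor_lift (sym_part (d + 1) (e + 1)) (\<lambda>v f. var2 v \<otimes>\<^bsub>bisym\<^esub> f) b)"

text \<open>The component \<open>W\<^sub>d\<^sub>,\<^sub>e(V, K)\<close> for \<open>K \<subseteq> V1 \<otimes> V2\<close>.\<close>

definition koszul_module where
  "koszul_module K d e = quotient_module
     ((koszul_middle d e) \<lparr> carrier := {w \<in> carrier (koszul_middle d e).
        koszul_map1 d e w = \<zero>\<^bsub>sym_part (d + 1) (e + 1)\<^esub>} \<rparr>)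
     (koszul_map2 d e ` carrier (koszul_source K d e))"

end

definition zero_space :: "('k, 'v) module \<Rightarrow> bool"
  where "zero_space M \<longleftrightarrow> carrier M = {\<zero>\<^bsub>M\<^esub>}"

end

(*
  Choose bases z_0,...,z_{n1-1} of V1 and z_{n1},...,z_{n1+n2-1} of V2.  In coordinates an element
  of the middle term in bidegree (d,e) is a family (F_v) of bihomogeneous polynomials, the map to
  S_{d+1,e+1} is F |-> sum_v z_v F_v, and a matrix A in K contributes the column of linear forms
  "form A".  The kernel of the map is generated by the Koszul syzygies z_b f_a - z_a f_b with a an
  index of V1 and b one of V2, so vanishing in bidegree (d,e) propagates to all larger bidegrees.

  Conversely, vanishing in large bidegrees means that the columns of K generate the kernel bundle
  locally on P(V1) x P(V2), i.e. after inverting any z_a z_b.  There the Buchsbaum-Rim complex of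
  the columns is exact, by a homotopy that divides by the integers up to n1+n2-4; this is where
  p >= n1+n2-3 enters.  The Cech complex of the charts is exact in the degrees that occur for
  (d,e) = (n2-2, n1-2), so a zigzag through the double complex lifts every kernel element to the
  image of K in that bidegree.
*)

theory Submission
  imports Defs "HOL-Library.Function_Algebras"
begin

section \<open>Exterior and symmetric contractions\<close>

text \<open>The bidegree \<open>(n2 - 2, n1 - 2)\<close> comes from the augmentation
  \<open>cr\<close> of the Buchsbaum-Rim complex: it contracts with all rows but one and divides by
  the variable of the omitted row, which raises bidegrees by \<open>(n2 - 1, n1 - 1)\<close>. The
  rest of the complex sits in twist \<open>(-1, -1)\<close>, where every term that is needed is a
  sum of line bundles without any cohomology. The kernel bundle has rank N - 1 and no convenient
  global basis. Its dual is R^N modulo the vector z, and the divided powers of this quotient are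
  replaced by those of R^N modulo multiplication by z (\<open>pm\<close>). That is harmless only
  where the integers up to the divided degree are invertible, and the largest degree needed is N -
  4. Hence cycles are cycles up to \<open>pm\<close>, and the zigzag carries correction terms in
  twist \<open>(-2, -2)\<close>. All charts lie in one Laurent polynomial ring and are spanned by
  monomials, so that restriction is inclusion and homotopies can be built monomial by monomial.
  Exterior degrees are never separated: the operators act on the whole exterior algebra.\<close>

definition alt :: "nat \<Rightarrow> nat set \<Rightarrow> 'b::ab_group_add \<Rightarrow> 'b"
  where "alt v A x = (if even (card {u\<in>A. u < v}) then x else - x)"

text \<open>\<open>a A\<close> is the coefficient of the exterior basis element indexed by A. The
  sign counts only elements below v, so infinite sets cause no trouble. Values lie in an arbitrary
  abelian group because the same operators later act on Cech cochains, with A the set of inverted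
  variables.\<close>

definition ext_wedge :: "nat \<Rightarrow> (nat set \<Rightarrow> 'b::ab_group_add) \<Rightarrow> nat set \<Rightarrow> 'b"
  where "ext_wedge v a A = (if v \<in> A then alt v A (a (A - {v})) else 0)"

definition ext_contract :: "nat \<Rightarrow> (nat set \<Rightarrow> 'b::ab_group_add) \<Rightarrow> nat set \<Rightarrow> 'b"
  where "ext_contract v a A = (if v \<in> A then 0 else alt v A (a (insert v A)))"

lemma alt_add: "alt v A (x + y) = alt v A x + alt v A y"
  and alt_minus: "alt v A (- x) = - alt v A x"
  and alt_0 [simp]: "alt v A 0 = 0"
  by (simp_all add: alt_def)

lemma alt_comm: "alt v A (alt u B x) = alt u B (alt v A x)"
  by (simp add: alt_def)

lemma alt_alt [simp]: "alt v A (alt v A x) = x"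
  by (simp add: alt_def)

lemma alt_remove:
  assumes "u \<in> A" "u \<noteq> v"
  shows "alt v (A - {u}) x = (if u < v then - alt v A x else alt v A x)"
proof (cases "u < v")
  case True
  have *: "{w \<in> A. w < v} = insert u {w \<in> A - {u}. w < v}" using assms True by auto
  have "finite {w \<in> A - {u}. w < v}" by (rule finite_subset[of _ "{..<v}"]) auto
  then have "card {w \<in> A. w < v} = Suc (card {w \<in> A - {u}. w < v})"
    unfolding * by (subst card_insert_disjoint) auto
  then show ?thesis using True by (simp add: alt_def)
next
  case False
  then have "{w \<in> A - {u}. w < v} = {w \<in> A. w < v}" using assms by auto
  then show ?thesis using False by (simp add: alt_def)
qed

lemma alt_remove_self: "alt v (A - {v}) x = alt v A x"
proof -
  have "{w \<in> A - {v}. w < v} = {w \<in> A. w < v}" by auto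
  then show ?thesis by (simp add: alt_def)
qed

lemma alt_insert_self: "alt v (insert v A) x = alt v A x"
proof -
  have "{w \<in> insert v A. w < v} = {w \<in> A. w < v}" by auto
  then show ?thesis by (simp add: alt_def)
qed

lemma alt_insert:
  assumes "u \<notin> A" "u \<noteq> v"
  shows "alt v (insert u A) x = (if u < v then - alt v A x else alt v A x)"
  using alt_remove[of u "insert u A" v "x"] assms by (auto split: if_splits)

lemma ext_contract_add: "ext_contract v (a + b) = ext_contract v a + ext_contract v b"
  by (rule ext) (simp add: ext_contract_def alt_add)

lemma ext_contract_0 [simp]: "ext_contract v 0 = 0"
  by (rule ext) (simp add: ext_contract_def)

lemma ext_wedge_add: "ext_wedge v (a + b) = ext_wedge v a + ext_wedge v b"
  by (rule ext) (simp add: ext_wedge_def alt_add)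

lemma ext_wedge_0 [simp]: "ext_wedge v 0 = 0"
  by (rule ext) (simp add: ext_wedge_def)

lemma ext_contract_self [simp]: "ext_contract v (ext_contract v a) = 0"
  by (rule ext) (simp add: ext_contract_def)

lemma ext_wedge_self [simp]: "ext_wedge v (ext_wedge v a) = 0"
  by (rule ext) (simp add: ext_wedge_def)

lemma ext_contract_anticomm: "ext_contract u (ext_contract v a) = - ext_contract v (ext_contract u a)"
proof (rule ext)
  fix A
  show "ext_contract u (ext_contract v a) A = (- ext_contract v (ext_contract u a)) A"
  proof (cases "u = v \<or> u \<in> A \<or> v \<in> A")
    case True
    then show ?thesis by (auto simp: ext_contract_def)
  next
    case False
    then show ?thesis
      by (auto simp: ext_contract_def alt_insert insert_commute alt_minus alt_comm)
  qed
qed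

lemma ext_wedge_anticomm: "ext_wedge u (ext_wedge v a) = - ext_wedge v (ext_wedge u a)"
proof (rule ext)
  fix A
  show "ext_wedge u (ext_wedge v a) A = (- ext_wedge v (ext_wedge u a)) A"
  proof (cases "u = v \<or> u \<notin> A \<or> v \<notin> A")
    case True
    then show ?thesis by (auto simp: ext_wedge_def)
  next
    case False
    then have "A - {u} - {v} = A - {v} - {u}" by auto
    then show ?thesis using False
      by (auto simp: ext_wedge_def alt_remove alt_minus alt_comm)
  qed
qed

text \<open>The Clifford relation, source of every homotopy below: the local splittings use it
  through \<open>wedge_contract\<close>, the Cech homotopy uses it directly. For distinct u and v
  only sets containing u but not v need an argument.\<close>

lemma ext_wedge_contract:
  "ext_wedge u (ext_contract v a) = (if u = v then a else 0) - ext_contract v (ext_wedge u a)"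
proof (rule ext)
  fix A
  show "ext_wedge u (ext_contract v a) A
      = ((if u = v then a else 0) - ext_contract v (ext_wedge u a)) A"
  proof (cases "u = v")
    case True
    then show ?thesis
      by (cases "v \<in> A")
        (auto simp: ext_contract_def ext_wedge_def alt_remove_self alt_insert_self insert_absorb)
  next
    case uv: False
    show ?thesis
    proof (cases "u \<in> A \<and> v \<notin> A")
      case True
      then have "insert v (A - {u}) = insert v A - {u}" using uv by auto
      then show ?thesis using True uv
        by (auto simp: ext_contract_def ext_wedge_def alt_remove alt_insert alt_minus alt_comm)
    next
      case False
      then show ?thesis using uv by (auto simp: ext_contract_def ext_wedge_def)
    qed
  qed
qed

definition scl :: "'r::comm_ring_1 \<Rightarrow> ('a \<Rightarrow> 'r) \<Rightarrow> 'a \<Rightarrow> 'r"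
  where "scl c a = (\<lambda>A. c * a A)"

lemma scl_add: "scl c (a + b) = scl c a + scl c b"
  and scl_add_left: "scl (c + d) a = scl c a + scl d a"
  and scl_scl [simp]: "scl c (scl d a) = scl (c * d) a"
  and scl_0 [simp]: "scl c 0 = 0"
  and scl_0_left [simp]: "scl 0 a = 0"
  and scl_1 [simp]: "scl 1 a = a"
  and scl_uminus: "scl c (- a) = - scl c a"
  and scl_minus_left: "scl (- c) a = - scl c a"
  and scl_diff: "scl c (a - b) = scl c a - scl c b"
  by (rule ext, simp add: scl_def algebra_simps)+

lemma ext_contract_scl: "ext_contract v (scl c a) = scl c (ext_contract v a)"
  by (rule ext) (simp add: ext_contract_def scl_def alt_def)

lemma ext_wedge_scl: "ext_wedge v (scl c a) = scl c (ext_wedge v a)"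
  by (rule ext) (simp add: ext_wedge_def scl_def alt_def)

lemma scl_sum: "scl c (sum f S) = (\<Sum>i\<in>S. scl c (f i))"
  by (induction S rule: infinite_finite_induct)
    (simp_all only: sum.infinite sum.empty sum.insert not_False_eq_True scl_add scl_0)

lemma scl_sum_left: "scl (sum f S) a = (\<Sum>i\<in>S. scl (f i) a)"
  by (induction S rule: infinite_finite_induct)
    (simp_all only: sum.infinite sum.empty sum.insert not_False_eq_True scl_add_left scl_0_left)

lemma ext_contract_uminus: "ext_contract v (- a) = - ext_contract v a"
  by (rule ext) (simp add: ext_contract_def alt_minus)

lemma ext_wedge_uminus: "ext_wedge v (- a) = - ext_wedge v a"
  by (rule ext) (simp add: ext_wedge_def alt_minus)

lemma ext_contract_sum: "ext_contract v (sum f S) = (\<Sum>i\<in>S. ext_contract v (f i))"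
  by (induction S rule: infinite_finite_induct)
    (simp_all only: sum.infinite sum.empty sum.insert not_False_eq_True ext_contract_add ext_contract_0)

lemma ext_wedge_sum: "ext_wedge v (sum f S) = (\<Sum>i\<in>S. ext_wedge v (f i))"
  by (induction S rule: infinite_finite_induct)
    (simp_all only: sum.infinite sum.empty sum.insert not_False_eq_True ext_wedge_add ext_wedge_0)

lemma fun_sum_apply: "(sum f S) x = (\<Sum>i\<in>S. f i x)"
  by (induction S rule: infinite_finite_induct) simp_all

section \<open>Contraction with a linear form and wedging with a vector\<close>

definition contract :: "nat \<Rightarrow> (nat \<Rightarrow> 'r::comm_ring_1) \<Rightarrow> (nat set \<Rightarrow> 'r) \<Rightarrow> nat set \<Rightarrow> 'r"
  where "contract \<kappa> f a = (\<Sum>l<\<kappa>. scl (f l) (ext_contract l a))"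

definition wedge :: "nat \<Rightarrow> (nat \<Rightarrow> 'r::comm_ring_1) \<Rightarrow> (nat set \<Rightarrow> 'r) \<Rightarrow> nat set \<Rightarrow> 'r"
  where "wedge \<kappa> k a = (\<Sum>l<\<kappa>. scl (k l) (ext_wedge l a))"

lemma contract_add: "contract \<kappa> f (a + b) = contract \<kappa> f a + contract \<kappa> f b"
  by (simp add: contract_def ext_contract_add scl_add sum.distrib)

lemma contract_scl: "contract \<kappa> f (scl c a) = scl c (contract \<kappa> f a)"
  by (simp add: contract_def ext_contract_scl scl_sum mult.commute)

lemma contract_0 [simp]: "contract \<kappa> f 0 = 0"
  by (simp add: contract_def)

lemma contract_uminus: "contract \<kappa> f (- a) = - contract \<kappa> f a"
  by (simp add: contract_def ext_contract_uminus scl_uminus sum_negf)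

lemma contract_diff: "contract \<kappa> f (a - b) = contract \<kappa> f a - contract \<kappa> f b"
  using contract_add[of \<kappa> f a "- b"] by (simp add: contract_uminus)

lemma contract_sum: "contract \<kappa> f (sum g S) = (\<Sum>i\<in>S. contract \<kappa> f (g i))"
  by (induction S rule: infinite_finite_induct)
    (simp_all only: sum.infinite sum.empty sum.insert not_False_eq_True contract_add contract_0)

lemma wedge_add: "wedge \<kappa> f (a + b) = wedge \<kappa> f a + wedge \<kappa> f b"
  by (simp add: wedge_def ext_wedge_add scl_add sum.distrib)

lemma wedge_0 [simp]: "wedge \<kappa> f 0 = 0"
  by (simp add: wedge_def)

lemma wedge_sum: "wedge \<kappa> f (sum g S) = (\<Sum>i\<in>S. wedge \<kappa> f (g i))"
  by (induction S rule: infinite_finite_induct)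
    (simp_all only: sum.infinite sum.empty sum.insert not_False_eq_True wedge_add wedge_0)

lemma contract_combination:
  "(\<Sum>v\<in>S. scl (z v) (contract \<kappa> (f v) a)) = contract \<kappa> (\<lambda>l. \<Sum>v\<in>S. z v * f v l) a"
  by (simp add: contract_def scl_sum scl_sum_left sum.swap[of _ S])

lemma ext_contract_contract:
  "ext_contract u (contract \<kappa> f a) = - contract \<kappa> f (ext_contract u a)"
proof -
  have "ext_contract u (contract \<kappa> f a)
      = (\<Sum>l<\<kappa>. - scl (f l) (ext_contract l (ext_contract u a)))"
    unfolding contract_def ext_contract_sum ext_contract_scl
    by (intro sum.cong refl) (metis ext_contract_anticomm scl_uminus)
  then show ?thesis by (simp add: contract_def sum_negf)
qed

lemma contract_anticomm: "contract \<kappa> f (contract \<kappa> g a) = - contract \<kappa> g (contract \<kappa> f a)"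
proof -
  have "contract \<kappa> f (contract \<kappa> g a)
      = (\<Sum>l<\<kappa>. - scl (f l) (contract \<kappa> g (ext_contract l a)))"
    unfolding contract_def[of \<kappa> f]
    by (intro sum.cong refl) (simp add: ext_contract_contract scl_uminus)
  also have "\<dots> = - contract \<kappa> g (contract \<kappa> f a)"
    by (simp add: contract_def[of \<kappa> f] contract_sum contract_scl sum_negf)
  finally show ?thesis .
qed

text \<open>Anticommutation gives only twice the claim, and 2 may be zero. In the induction on
  \<open>\<kappa>\<close> the square of the last summand vanishes by itself and the cross terms
  cancel.\<close>

lemma contract_self [simp]: "contract \<kappa> f (contract \<kappa> f a) = 0"
proof (induction \<kappa>)
  case 0
  then show ?case by (simp add: contract_def)
next
  case (Suc n)
  have *: "contract (Suc n) f b = contract n f b + scl (f n) (ext_contract n b)" for b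
    by (simp add: contract_def)
  show ?case
    by (simp del: plus_fun_apply zero_fun_apply add: * contract_add ext_contract_add contract_scl ext_contract_scl scl_add Suc
        ext_contract_contract scl_uminus)
qed

text \<open>The Clifford relation extended bilinearly; the scalar is the pairing of the form f with
  the vector k.\<close>

lemma wedge_contract:
  "wedge \<kappa> k (contract \<kappa> f a) = scl (\<Sum>l<\<kappa>. f l * k l) a - contract \<kappa> f (wedge \<kappa> k a)"
proof -
  have "ext_wedge u (contract \<kappa> f a)
      = (if u < \<kappa> then scl (f u) a else 0) - contract \<kappa> f (ext_wedge u a)" for u
  proof -
    have "ext_wedge u (contract \<kappa> f a)
      = (\<Sum>l<\<kappa>. scl (f l) ((if u = l then a else 0) - ext_contract l (ext_wedge u a)))"
      by (simp add: contract_def ext_wedge_sum ext_wedge_scl ext_wedge_contract)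
    also have "\<dots> = (\<Sum>l<\<kappa>. (if u = l then scl (f l) a else 0)) - contract \<kappa> f (ext_wedge u a)"
      unfolding contract_def sum_subtractf[symmetric]
      by (intro sum.cong refl) (simp add: scl_diff scl_uminus)
    finally show ?thesis by simp
  qed
  then have "wedge \<kappa> k (contract \<kappa> f a)
      = (\<Sum>l<\<kappa>. scl (k l) (scl (f l) a) - scl (k l) (contract \<kappa> f (ext_wedge l a)))"
    unfolding wedge_def by (intro sum.cong refl) (simp add: scl_diff)
  also have "\<dots> = scl (\<Sum>l<\<kappa>. f l * k l) a - contract \<kappa> f (wedge \<kappa> k a)"
    by (simp add: sum_subtractf scl_sum_left mult.commute wedge_def contract_sum contract_scl)
  finally show ?thesis .
qed

lemmas fun_apply = plus_fun_apply zero_fun_apply minus_apply uminus_apply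

text \<open>From here on functions are vectors, and most equations are between whole functions;
  evaluation at a point happens only on request.\<close>

declare fun_apply [simp del]

text \<open>The diagonal is a separate assumption because antisymmetry does not kill it in
  characteristic two.\<close>

lemma sum_antisymmetric:
  fixes X :: "nat \<Rightarrow> nat \<Rightarrow> 'b::ab_group_add"
  assumes "\<And>u v. X u v = - X v u" "\<And>u. X u u = 0"
  shows "(\<Sum>u<n. \<Sum>v<n. X u v) = 0"
proof (induction n)
  case (Suc n)
  have "(\<Sum>v<n. X n v) = - (\<Sum>u<n. X u n)"
    unfolding sum_negf[symmetric] by (intro sum.cong refl assms(1))
  then show ?case using Suc by (simp add: sum.distrib assms(2))
qed simp

text \<open>Counting multiplicities is what produces the integers that later have to be invertible;
  \<open>funpow_add_scl\<close> turns the iterate into a scalar.\<close>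

lemma sum_mset_if_eq:
  "(\<Sum>v\<in>#M. if v = w then X else (0::'b::comm_monoid_add)) = ((+) X ^^ count M w) 0"
  by (induction M) auto

lemma funpow_add_scl:
  "((+) (X :: 'a \<Rightarrow> 'r::comm_ring_1) ^^ n) 0 = scl (of_nat n) X"
  by (induction n) (simp_all add: scl_add_left)

lemma contract_sum_mset:
  "contract \<kappa> f (\<Sum>v\<in>#M. g v) = (\<Sum>v\<in>#M. contract \<kappa> f (g v))"
  by (induction M) (simp_all add: contract_add)

lemma sum_sum_mset_swap:
  "(\<Sum>u<n. \<Sum>v\<in>#M. g u v) = (\<Sum>v\<in>#M. \<Sum>u<(n::nat). g u v :: 'b::comm_monoid_add)"
  by (induction M) (simp_all add: sum.distrib)

section \<open>The Buchsbaum-Rim differentials of a matrix whose columns are annihilated by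
  z\<close>

locale koszul_data =
  fixes N \<kappa> :: nat and z zi :: "nat \<Rightarrow> 'r::comm_ring_1" and f :: "nat \<Rightarrow> nat \<Rightarrow> 'r"
  assumes rel: "\<And>l. l < \<kappa> \<Longrightarrow> (\<Sum>v<N. z v * f v l) = 0"
    and zi: "\<And>v. v < N \<Longrightarrow> z v * zi v = 1"
    and N_pos: "0 < N"
begin

text \<open>Row v acting as a functional on R^kappa. By \<open>rel\<close> the assignment of
  \<open>ct v\<close> to e_v factors through R^N modulo z, the dual of the kernel of z. The inverses
  \<open>zi\<close> exist in the ambient ring; whether they are regular is decided chart by chart in
  \<open>koszul_local\<close>.\<close>

definition ct :: "nat \<Rightarrow> (nat set \<Rightarrow> 'r) \<Rightarrow> nat set \<Rightarrow> 'r"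
  where "ct v = contract \<kappa> (f v)"

lemma ct_add: "ct v (a + b) = ct v a + ct v b"
  and ct_diff: "ct v (a - b) = ct v a - ct v b"
  and ct_uminus: "ct v (- a) = - ct v a"
  and ct_0 [simp]: "ct v 0 = 0"
  and ct_scl: "ct v (scl c a) = scl c (ct v a)"
  and ct_sum: "ct v (sum g S) = (\<Sum>i\<in>S. ct v (g i))"
  and ct_sum_mset: "ct v (\<Sum>u\<in>#M. h u) = (\<Sum>u\<in>#M. ct v (h u))"
  and ct_anticomm: "ct u (ct v a) = - ct v (ct u a)"
  and ct_self [simp]: "ct v (ct v a) = 0"
  unfolding ct_def
  by (rule contract_add contract_diff contract_uminus contract_0 contract_scl contract_sum
      contract_sum_mset contract_anticomm contract_self)+

lemma ct_rel: "(\<Sum>v<N. scl (z v) (ct v a)) = 0"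
proof -
  have "(\<Sum>v<N. scl (z v) (ct v a)) = contract \<kappa> (\<lambda>l. \<Sum>v<N. z v * f v l) a"
    by (simp add: ct_def contract_combination)
  also have "\<dots> = 0" by (simp add: contract_def rel)
  finally show ?thesis .
qed

text \<open>\<open>c \<gamma>\<close> is the coefficient of the divided power monomial with
  exponents \<open>\<gamma>\<close>. Removing a factor e_v from a divided power monomial produces no
  multiplicity, so this is the Koszul differential on exterior algebra tensor divided
  powers.\<close>

definition del :: "(nat multiset \<Rightarrow> nat set \<Rightarrow> 'r) \<Rightarrow> nat multiset \<Rightarrow> nat set \<Rightarrow> 'r"
  where "del c \<gamma> = (\<Sum>v<N. ct v (c (add_mset v \<gamma>)))"

text \<open>Multiplication by the sum of the z_v e_v in the divided power algebra. The sum runs over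
  \<open>\<gamma>\<close> with multiplicity because multiplying a divided power monomial by e_v
  gives the new exponent of v as a factor.\<close>

definition pm :: "(nat multiset \<Rightarrow> nat set \<Rightarrow> 'r) \<Rightarrow> nat multiset \<Rightarrow> nat set \<Rightarrow> 'r"
  where "pm e \<gamma> = (\<Sum>v\<in>#\<gamma>. scl (z v) (e (\<gamma> - {#v#})))"

lemma del_add: "del (a + b) = del a + del b"
  and del_diff: "del (a - b) = del a - del b"
  and del_0 [simp]: "del 0 = 0"
  by (rule ext; simp add: del_def fun_apply ct_add ct_diff sum.distrib sum_subtractf)+

lemma pm_add: "pm (a + b) = pm a + pm b"
  by (rule ext) (simp add: pm_def fun_apply scl_add sum_mset.distrib)

lemma pm_0 [simp]: "pm 0 = 0"
  by (rule ext) (simp add: pm_def fun_apply)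

lemma pm_uminus: "pm (- a) = - pm a"
  using pm_add[of a "- a"] by (simp add: eq_neg_iff_add_eq_0 add.commute)

lemma pm_diff: "pm (a - b) = pm a - pm b"
  using pm_add[of a "- b"] by (simp add: pm_uminus)

lemma del_uminus: "del (- a) = - del a"
  using del_diff[of 0 a] by simp

lemma del_del [simp]: "del (del c) = 0"
proof (rule ext)
  fix \<gamma>
  have "del (del c) \<gamma> = (\<Sum>v<N. \<Sum>u<N. ct v (ct u (c (add_mset u (add_mset v \<gamma>)))))"
    by (simp add: del_def ct_sum)
  also have "\<dots> = 0"
  proof (rule sum_antisymmetric)
    show "ct u (ct v (c (add_mset v (add_mset u \<gamma>)))) =
        - ct v (ct u (c (add_mset u (add_mset v \<gamma>))))" for u v
      by (subst ct_anticomm) (simp add: add_mset_commute)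
  qed simp
  finally show "del (del c) \<gamma> = 0 \<gamma>" by (simp add: fun_apply)
qed

text \<open>If the inserted index is the one that is removed, the terms add up to the sum of the z_v
  \<open>ct v\<close>, which is zero by \<open>ct_rel\<close>; all other terms match. So
  \<open>del\<close> descends to the quotient by the image of \<open>pm\<close>.\<close>

lemma del_pm: "del (pm e) = pm (del e)"
proof (rule ext)
  fix \<gamma>
  have *: "(\<Sum>u\<in>#\<gamma>. scl (z u) (ct v (e (add_mset v \<gamma> - {#u#}))))
      = (\<Sum>u\<in>#\<gamma>. scl (z u) (ct v (e (add_mset v (\<gamma> - {#u#})))))" for v
    by (intro arg_cong[where f = sum_mset] image_mset_cong) simp
  have "del (pm e) \<gamma> = (\<Sum>v<N. scl (z v) (ct v (e \<gamma>))
      + (\<Sum>u\<in>#\<gamma>. scl (z u) (ct v (e (add_mset v (\<gamma> - {#u#}))))))"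
    by (simp add: del_def pm_def ct_add ct_sum_mset ct_scl *)
  also have "\<dots> = pm (del e) \<gamma>"
    by (simp add: sum.distrib ct_rel sum_sum_mset_swap pm_def del_def scl_sum)
  finally show "del (pm e) \<gamma> = pm (del e) \<gamma>" .
qed

section \<open>Products of contractions and the augmentation\<close>

definition cts :: "nat list \<Rightarrow> (nat set \<Rightarrow> 'r) \<Rightarrow> nat set \<Rightarrow> 'r"
  where "cts xs = foldr ct xs"

lemma cts_simps [simp]: "cts [] a = a" "cts (x # xs) a = ct x (cts xs a)"
  and cts_append: "cts (xs @ ys) a = cts xs (cts ys a)"
  by (simp_all add: cts_def)

lemma cts_add: "cts xs (a + b) = cts xs a + cts xs b"
  by (induction xs) (simp_all add: ct_add)

lemma cts_0 [simp]: "cts xs 0 = 0"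
  by (induction xs) simp_all

lemma cts_scl: "cts xs (scl c a) = scl c (cts xs a)"
  by (induction xs) (simp_all add: ct_scl)

lemma ct_cts_commute: "ct v (cts xs a) = scl ((- 1) ^ length xs) (cts xs (ct v a))"
proof (induction xs)
  case (Cons x xs)
  have "ct v (cts (x # xs) a) = - ct x (ct v (cts xs a))"
    by (simp add: ct_anticomm[of v x])
  also have "\<dots> = - ct x (scl ((- 1) ^ length xs) (cts xs (ct v a)))"
    by (simp only: Cons.IH)
  also have "\<dots> = scl ((- 1) ^ length (x # xs)) (cts (x # xs) (ct v a))"
    by (simp add: ct_scl scl_minus_left)
  finally show ?case .
qed simp

lemma ct_cts_mem: "v \<in> set xs \<Longrightarrow> ct v (cts xs a) = 0"
proof (induction xs)
  case (Cons x xs)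
  show ?case
  proof (cases "v = x")
    case False
    then have "ct v (cts xs a) = 0" using Cons by simp
    then show ?thesis by (simp add: ct_anticomm[of v x])
  qed simp
qed simp

lemma cts_ct_mem: "v \<in> set xs \<Longrightarrow> cts xs (ct v a) = 0"
proof -
  assume v: "v \<in> set xs"
  have "scl ((- 1) ^ length xs * (- 1) ^ length xs) (cts xs (ct v a)) = 0"
    using ct_cts_commute[of v xs a] ct_cts_mem[OF v, of a]
    by (metis scl_0 scl_scl)
  then show ?thesis by (simp flip: power_mult_distrib)
qed

definition others :: "nat \<Rightarrow> nat list"
  where "others w = filter (\<lambda>v. v \<noteq> w) [0..<N]"

lemma set_others [simp]: "set (others w) = {..<N} - {w}"
  and distinct_others [simp]: "distinct (others w)"
  by (auto simp: others_def)

text \<open>Contraction with the generator of the top exterior power of R^N modulo z, which has rank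
  N - 1. The product of all e_v except e_w, divided by z_w, is up to sign the same for every w; the
  index 0 is one choice.\<close>

definition cr :: "(nat set \<Rightarrow> 'r) \<Rightarrow> nat set \<Rightarrow> 'r"
  where "cr a = scl (zi 0) (cts (others 0) a)"

text \<open>The products omitting 0 and omitting w share all factors except \<open>ct w\<close> and
  \<open>ct 0\<close>. Applied to the shared product X, the relation between the rows retains only
  its terms at 0 and w, since any other \<open>ct v\<close> already occurs in X.\<close>

lemma cts_others:
  assumes w: "w < N"
  shows "\<exists>s. s * s = 1 \<and> s \<in> {1, - 1} \<and>
    (\<forall>a. scl (z 0) (cts (others w) a) = scl (s * z w) (cts (others 0) a))"
proof (cases "w = 0")
  case True
  then show ?thesis by (intro exI[of _ 1]) auto
next
  case False
  have up: "[0..<N] = 0 # [1..<N]" using upt_conv_Cons[OF N_pos] by simp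
  have o0: "others 0 = [1..<N]"
    unfolding others_def up by (auto simp: filter_id_conv)
  have ow: "others w = 0 # filter (\<lambda>v. v \<noteq> w) [1..<N]"
    unfolding others_def up using False by simp
  define ys where "ys = [1..<w]"
  define zs where "zs = [Suc w..<N]"
  have sp: "[1..<N] = ys @ w # zs"
  proof -
    have "[1..<N] = [1..<w] @ [w..<N]"
      using False w upt_add_eq_append[of 1 w "N - w"] by (simp del: upt_Suc)
    then show ?thesis using upt_conv_Cons[OF w] by (simp add: ys_def zs_def)
  qed
  have fl: "filter (\<lambda>v. v \<noteq> w) [1..<N] = ys @ zs"
    unfolding sp by (auto simp: ys_def zs_def filter_id_conv)
  \<comment> \<open>The power of -1 moves \<open>ct w\<close> past \<open>ys\<close> to its place in
    the list; the extra minus comes from solving the two-term relation.\<close>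
  define s :: 'r where "s = - ((- 1) ^ length ys)"
  have s1: "s * s = 1" by (simp add: s_def flip: power_mult_distrib)
  have s2: "s \<in> {1, - 1}" by (cases "even (length ys)") (simp_all add: s_def)
  have "scl (z 0) (cts (others w) a) = scl (s * z w) (cts (others 0) a)" for a
  proof -
    define X where "X = cts (ys @ zs) a"
    have "scl (z v) (ct v X) = 0" if "v \<in> {..<N} - {0, w}" for v
    proof -
      have "v \<in> set (ys @ zs)" using that unfolding fl[symmetric] by auto
      then show ?thesis by (simp add: X_def ct_cts_mem)
    qed
    then have "(\<Sum>v\<in>{..<N} - {0, w}. scl (z v) (ct v X)) = 0" by (intro sum.neutral) auto
    moreover have "(\<Sum>v<N. scl (z v) (ct v X))
      = scl (z 0) (ct 0 X) + (scl (z w) (ct w X) + (\<Sum>v\<in>{..<N} - {0, w}. scl (z v) (ct v X)))"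
      using N_pos w False
      by (simp add: sum.remove[of "{..<N}" 0] sum.remove[of "{..<N} - {0}" w] Diff_insert2[symmetric]
          insert_commute)
    ultimately have "scl (z 0) (ct 0 X) + scl (z w) (ct w X) = 0"
      using ct_rel[of X] by simp
    then have e1: "scl (z 0) (cts (others w) a) = - scl (z w) (ct w X)"
      unfolding ow fl X_def by (simp add: eq_neg_iff_add_eq_0)
    have "ct w X = scl ((- 1) ^ length ys) (cts (others 0) a)"
    proof -
      have "ct w X = ct w (cts ys (cts zs a))" by (simp add: X_def cts_append)
      also have "\<dots> = scl ((- 1) ^ length ys) (cts ys (ct w (cts zs a)))"
        by (rule ct_cts_commute)
      finally show ?thesis unfolding o0 sp by (simp add: cts_append)
    qed
    then show ?thesis unfolding e1 by (rule_tac ext) (simp add: s_def scl_def fun_apply)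
  qed
  with s1 s2 show ?thesis by blast
qed

text \<open>Any index can be the omitted one. On a chart the division can therefore be made by a
  variable that is inverted there, although the definition divides by z_0.\<close>

lemma cr_others:
  assumes w: "w < N"
  shows "\<exists>s. s \<in> {1, - 1} \<and> (\<forall>a. cr a = scl (s * zi w) (cts (others w) a))"
proof -
  obtain s where s: "s * s = 1" "s \<in> {1, - 1}"
    "\<And>a. scl (z 0) (cts (others w) a) = scl (s * z w) (cts (others 0) a)"
    using cts_others[OF w] by blast
  have "cr a = scl (s * zi w) (cts (others w) a)" for a
  proof -
    have "cr a = scl (zi 0 * s * zi w) (scl (s * z w) (cts (others 0) a))"
    proof -
      have "zi 0 * s * zi w * (s * z w) = zi 0 * (s * s) * (z w * zi w)" by (simp add: algebra_simps)
      then show ?thesis by (simp add: cr_def s(1) zi[OF w])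
    qed
    also have "\<dots> = scl (zi 0 * s * zi w) (scl (z 0) (cts (others w) a))"
      by (simp only: s(3))
    also have "\<dots> = scl (zi 0 * s * zi w * z 0) (cts (others w) a)" by simp
    also have "zi 0 * s * zi w * z 0 = s * zi w"
      using zi[OF N_pos] by (metis mult.assoc mult.commute mult.right_neutral)
    finally show ?thesis .
  qed
  then show ?thesis using s(2) by blast
qed

text \<open>For v other than 0 the contraction repeats a factor. For v = 0 the augmentation is
  rewritten with index 1 omitted, which requires N > 1; if N = 1, the relation itself says that z_0
  times \<open>ct 0\<close> vanishes.\<close>

lemma ct_cr [simp]: "v < N \<Longrightarrow> ct v (cr a) = 0"
proof -
  assume v: "v < N"
  show ?thesis
  proof (cases "v = 0")
    case False
    then have "v \<in> set (others 0)" using v by auto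
    then show ?thesis by (simp add: cr_def ct_scl ct_cts_mem)
  next
    case True
    show ?thesis
    proof (cases "N = 1")
      case True
      have "scl (z 0) (ct 0 a) = 0" using ct_rel[of a] True by simp
      then have "scl (zi 0) (scl (z 0) (ct 0 a)) = 0" by simp
      moreover have "zi 0 * z 0 = 1" using zi[OF N_pos] by (simp add: mult.commute)
      ultimately have "ct 0 a = 0" by simp
      moreover have "others 0 = []" by (subst others_def, subst True) simp
      ultimately show ?thesis using \<open>v = 0\<close> by (simp add: cr_def ct_scl)
    next
      case False
      then have "1 < N" using N_pos by simp
      from cr_others[OF this] obtain s where s: "\<And>a. cr a = scl (s * zi 1) (cts (others 1) a)"
        by blast
      have "v \<in> set (others 1)" using v \<open>v = 0\<close> by auto
      then show ?thesis by (simp add: s ct_scl ct_cts_mem)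
    qed
  qed
qed

lemma cr_ct [simp]: "v < N \<Longrightarrow> cr (ct v a) = 0"
proof -
  assume v: "v < N"
  show ?thesis
  proof (cases "v = 0")
    case False
    then have "v \<in> set (others 0)" using v by auto
    then show ?thesis by (simp add: cr_def cts_ct_mem)
  next
    case True
    have "cr (ct v a) = scl (zi 0 * (- 1) ^ length (others 0)) (scl ((- 1) ^ length (others 0)) (cts (others 0) (ct v a)))"
      by (simp add: cr_def mult.assoc flip: power_mult_distrib)
    also have "\<dots> = scl ((- 1) ^ length (others 0)) (ct v (cr a))"
      by (simp add: cr_def ct_scl ct_cts_commute mult.commute mult.left_commute)
    finally show ?thesis using v by simp
  qed
qed

lemma cr_add: "cr (a + b) = cr a + cr b"
  by (simp add: cr_def cts_add scl_add)

lemma cr_0 [simp]: "cr 0 = 0" by (simp add: cr_def)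

lemma cr_uminus: "cr (- a) = - cr a"
  using cr_add[of a "- a"] by (simp add: eq_neg_iff_add_eq_0 add.commute)

lemma cr_sum: "cr (sum g S) = (\<Sum>i\<in>S. cr (g i))"
  by (induction S rule: infinite_finite_induct) (simp_all add: cr_add)

lemma cr_del [simp]: "cr (del c \<gamma>) = 0"
  by (simp add: del_def cr_sum)

end

section \<open>Local exactness of the Buchsbaum-Rim complex\<close>

lemma arr_apply:
  fixes \<gamma> :: "nat multiset" and a b :: "nat multiset \<Rightarrow> 'b::ab_group_add"
  shows "(a + b) \<gamma> = a \<gamma> + b \<gamma>" "(a - b) \<gamma> = a \<gamma> - b \<gamma>"
    "(- a) \<gamma> = - a \<gamma>" "(0 :: nat multiset \<Rightarrow> 'b) \<gamma> = 0"
  by (simp_all add: fun_apply)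

text \<open>R is the ring of a chart inside the ambient ring and z_w a unit of it. By
  \<open>dual\<close> the vectors \<open>k v\<close> with v different from w split the rows, which
  expresses that the columns generate the kernel bundle on the chart. The bound t says which
  integers are units.\<close>

locale koszul_local = koszul_data +
  fixes R :: "'a::comm_ring_1 set" and k :: "nat \<Rightarrow> nat \<Rightarrow> 'a" and w t :: nat
  assumes R_0: "0 \<in> R" and R_1: "1 \<in> R"
    and R_add: "\<And>a b. a \<in> R \<Longrightarrow> b \<in> R \<Longrightarrow> a + b \<in> R"
    and R_mult: "\<And>a b. a \<in> R \<Longrightarrow> b \<in> R \<Longrightarrow> a * b \<in> R"
    and R_uminus: "\<And>a. a \<in> R \<Longrightarrow> - a \<in> R"
    and R_z: "\<And>v. z v \<in> R"
    and R_zi: "zi w \<in> R"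
    and R_f: "\<And>v l. v < N \<Longrightarrow> l < \<kappa> \<Longrightarrow> f v l \<in> R"
    and R_k: "\<And>v l. v < N \<Longrightarrow> v \<noteq> w \<Longrightarrow> l < \<kappa> \<Longrightarrow> k v l \<in> R"
    and dual: "\<And>u v. u < N \<Longrightarrow> u \<noteq> w \<Longrightarrow> v < N \<Longrightarrow> v \<noteq> w \<Longrightarrow>
      (\<Sum>l<\<kappa>. f u l * k v l) = (if u = v then 1 else 0)"
    and w: "w < N"
    and R_inv: "\<And>n. 0 < n \<Longrightarrow> n \<le> t \<Longrightarrow> \<exists>i\<in>R. of_nat n * i = 1"
begin

definition wd :: "nat \<Rightarrow> (nat set \<Rightarrow> 'a) \<Rightarrow> nat set \<Rightarrow> 'a"
  where "wd v = wedge \<kappa> (k v)"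

lemma wd_0 [simp]: "wd v 0 = 0"
  and wd_sum: "wd v (sum g S) = (\<Sum>i\<in>S. wd v (g i))"
  unfolding wd_def by (rule wedge_0 wedge_sum)+

lemma wd_ct:
  assumes "u < N" "u \<noteq> w" "v < N" "v \<noteq> w"
  shows "wd v (ct u a) = (if u = v then a else 0) - ct u (wd v a)"
  using assms by (simp add: wd_def ct_def wedge_contract dual)

definition E :: "(nat set \<Rightarrow> 'a) set"
  where "E = {a. \<forall>A. a A \<in> R}"

lemma R_sum: "(\<And>i. i \<in> S \<Longrightarrow> g i \<in> R) \<Longrightarrow> sum g S \<in> R"
  by (induction S rule: infinite_finite_induct) (auto intro: R_add R_0)

lemma alt_R: "a \<in> R \<Longrightarrow> alt v A a \<in> R"
  by (simp add: alt_def R_uminus)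

lemma E_0 [simp]: "0 \<in> E"
  by (simp add: E_def fun_apply R_0)

lemma E_add: "a \<in> E \<Longrightarrow> b \<in> E \<Longrightarrow> a + b \<in> E"
  by (simp add: E_def fun_apply R_add)

lemma E_uminus: "a \<in> E \<Longrightarrow> - a \<in> E"
  by (simp add: E_def fun_apply R_uminus)

lemma E_diff: "a \<in> E \<Longrightarrow> b \<in> E \<Longrightarrow> a - b \<in> E"
  using E_add[of a "- b"] by (simp add: E_uminus)

lemma E_scl: "c \<in> R \<Longrightarrow> a \<in> E \<Longrightarrow> scl c a \<in> E"
  by (simp add: E_def scl_def R_mult)

lemma E_sum: "(\<And>i. i \<in> S \<Longrightarrow> g i \<in> E) \<Longrightarrow> sum g S \<in> E"
  by (induction S rule: infinite_finite_induct) (auto intro: E_add)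

lemma E_sum_mset: "(\<And>i. i \<in># M \<Longrightarrow> g i \<in> E) \<Longrightarrow> (\<Sum>i\<in>#M. g i) \<in> E"
  by (induction M) (auto intro: E_add)

lemma E_ct: "v < N \<Longrightarrow> a \<in> E \<Longrightarrow> ct v a \<in> E"
  unfolding ct_def contract_def
  by (intro E_sum E_scl R_f) (auto simp: E_def ext_contract_def R_0 alt_R)

lemma E_wd: "v < N \<Longrightarrow> v \<noteq> w \<Longrightarrow> a \<in> E \<Longrightarrow> wd v a \<in> E"
  unfolding wd_def wedge_def
  by (intro E_sum E_scl R_k) (auto simp: E_def ext_wedge_def R_0 alt_R)

lemma E_del: "(\<And>\<gamma>. c \<gamma> \<in> E) \<Longrightarrow> del c \<gamma> \<in> E"
  unfolding del_def by (intro E_sum E_ct) auto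

lemma wds_ct_zero:
  assumes "set ys \<subseteq> {..<N} - {w}" "x < N" "x \<noteq> w" "x \<notin> set ys" "ct x g = 0"
  shows "ct x (foldr wd ys g) = 0"
  using assms
proof (induction ys)
  case (Cons y ys)
  have "wd y (ct x (foldr wd ys g)) = - ct x (wd y (foldr wd ys g))"
    using Cons.prems by (subst wd_ct) auto
  then show ?case using Cons by simp
qed simp

text \<open>Each \<open>ct x\<close> undoes the matching \<open>wd x\<close> by the Clifford
  relation: it kills g, and it passes through the wedges with other indices up to sign.\<close>

lemma cts_wds:
  assumes "distinct xs" "set xs \<subseteq> {..<N} - {w}" "\<And>x. x \<in> set xs \<Longrightarrow> ct x g = 0"
  shows "cts xs (foldr wd (rev xs) g) = g"
  using assms
proof (induction xs rule: rev_induct)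
  case (snoc x xs)
  let ?Y = "foldr wd (rev xs) g"
  have "ct x ?Y = 0" using snoc.prems by (intro wds_ct_zero) auto
  then have "ct x (wd x ?Y) = ?Y" using wd_ct[of x x ?Y] snoc.prems by (auto simp: algebra_simps)
  then show ?case using snoc by (simp add: cts_append)
qed simp

lemma E_wds: "set ys \<subseteq> {..<N} - {w} \<Longrightarrow> g \<in> E \<Longrightarrow> foldr wd ys g \<in> E"
  by (induction ys) (auto intro: E_wd)

text \<open>A preimage is obtained by wedging g with all the vectors \<open>k v\<close>, v different
  from w, and rescaling by z_w and a sign.\<close>

lemma cr_exact:
  assumes "g \<in> E" "\<And>v. v < N \<Longrightarrow> ct v g = 0"
  shows "\<exists>a\<in>E. cr a = g"
proof -
  obtain s where s: "s \<in> {1, - 1}" "\<And>a. cr a = scl (s * zi w) (cts (others w) a)"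
    using cr_others[OF w] by blast
  have ss: "s * s = 1" using s(1) by auto
  have sR: "s \<in> R" using s(1) R_1 R_uminus by auto
  let ?a = "scl (s * z w) (foldr wd (rev (others w)) g)"
  have "cts (others w) (foldr wd (rev (others w)) g) = g"
    by (rule cts_wds) (use assms in auto)
  moreover have "s * zi w * (s * z w) = 1"
  proof -
    have "s * zi w * (s * z w) = (s * s) * (z w * zi w)" by (simp add: algebra_simps)
    then show ?thesis by (simp add: ss zi w)
  qed
  ultimately have "cr ?a = g" by (simp add: s(2) cts_scl)
  moreover have "?a \<in> E" by (intro E_scl R_mult sR R_z E_wds assms) auto
  ultimately show ?thesis by blast
qed

text \<open>The homotopy formula \<open>a = ct x (wd x a) + wd x (ct x a)\<close>: the first term
  has the required form, and the induction hypothesis for \<open>ct x a\<close> handles the second,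
  since \<open>wd x\<close> moves past every other \<open>ct v\<close> at the cost of a
  sign.\<close>

lemma cts_exact:
  assumes "distinct xs" "set xs \<subseteq> {..<N} - {w}" "a \<in> E" "cts (rev xs) a = 0"
  shows "\<exists>b. (\<forall>v. b v \<in> E) \<and> a = (\<Sum>v\<in>set xs. ct v (b v))"
  using assms
proof (induction xs arbitrary: a)
  case (Cons x xs)
  have x: "x < N" "x \<noteq> w" using Cons.prems by auto
  have "cts (rev xs) (ct x a) = 0" using Cons.prems by (simp add: cts_append)
  then obtain b where b: "\<And>v. b v \<in> E" "ct x a = (\<Sum>v\<in>set xs. ct v (b v))"
    using Cons.IH[of "ct x a"] Cons.prems E_ct by auto
  have "wd x (ct x a) = (\<Sum>v\<in>set xs. ct v (- wd x (b v)))"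
    unfolding b(2) wd_sum using Cons.prems
    by (intro sum.cong refl) (subst wd_ct, auto simp: ct_uminus)
  moreover have "a = ct x (wd x a) + wd x (ct x a)"
    using wd_ct[OF x x] by simp
  ultimately have "a = ct x (wd x a) + (\<Sum>v\<in>set xs. ct v (- wd x (b v)))" by simp
  moreover define b' where "b' = (\<lambda>v. if v = x then wd x a else - wd x (b v))"
  have "(\<Sum>v\<in>set xs. ct v (- wd x (b v))) = (\<Sum>v\<in>set xs. ct v (b' v))"
    using Cons.prems by (intro sum.cong refl) (auto simp: b'_def)
  moreover have "ct x (wd x a) = ct x (b' x)" by (simp add: b'_def)
  ultimately have "a = (\<Sum>v\<in>set (x # xs). ct v (b' v))"
    using Cons.prems by simp
  moreover have "b' v \<in> E" for v
    using b(1) Cons.prems x by (auto simp: b'_def intro: E_wd E_uminus)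
  ultimately show ?case by blast
next
  case Nil
  then show ?case by (intro exI[of _ "\<lambda>_. 0"]) simp
qed

lemma cr_kernel:
  assumes "a \<in> E" "cr a = 0"
  shows "\<exists>b. (\<forall>v. b v \<in> E) \<and> a = (\<Sum>v\<in>{..<N} - {w}. ct v (b v))"
proof -
  obtain s where s: "s \<in> {1, - 1}" "\<And>a. cr a = scl (s * zi w) (cts (others w) a)"
    using cr_others[OF w] by blast
  have ss: "s * s = 1" using s(1) by auto
  have "z w * s * (s * zi w) = (s * s) * (z w * zi w)" by (simp add: algebra_simps)
  then have "z w * s * (s * zi w) = 1" by (simp add: ss zi w)
  moreover have "scl (z w * s) (scl (s * zi w) (cts (others w) a)) = 0"
    using assms(2) s(2) by simp
  ultimately have "cts (others w) a = 0" by simp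
  then show ?thesis using cts_exact[of "rev (others w)" a] assms(1) by simp
qed

section \<open>Homotopies for the divided power differential\<close>

definition hm :: "nat \<Rightarrow> (nat multiset \<Rightarrow> nat set \<Rightarrow> 'a) \<Rightarrow> nat multiset \<Rightarrow> nat set \<Rightarrow> 'a"
  where "hm v c \<gamma> = (if v \<in># \<gamma> then wd v (c (\<gamma> - {#v#})) else 0)"

text \<open>Appending a factor e_v to a divided power monomial and deleting it again is the
  identity, without any multiplicity. Where v occurs in \<open>\<gamma>\<close>, the Clifford
  relation therefore leaves \<open>c \<gamma>\<close> and a remainder \<open>wd v\<close> applied to
  \<open>del c\<close>, which is zero.\<close>

lemma hm_homotopy:
  assumes v: "v < N" "v \<noteq> w" and c: "\<And>\<gamma>. w \<in># \<gamma> \<Longrightarrow> c \<gamma> = 0" "del c = 0"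
  shows "c \<gamma> - del (hm v c) \<gamma> = (if v \<in># \<gamma> then 0 else wd v (ct v (c \<gamma>)))"
proof (cases "v \<in># \<gamma>")
  case True
  let ?\<delta> = "\<gamma> - {#v#}"
  have d: "add_mset v ?\<delta> = \<gamma>" using True by simp
  have t: "ct u (hm v c (add_mset u \<gamma>))
      = (if u = v then c \<gamma> else 0) - wd v (ct u (c (add_mset u ?\<delta>)))" if u: "u < N" for u
  proof (cases "u = w")
    case True
    then show ?thesis using v c(1) \<open>v \<in># \<gamma>\<close> by (simp add: hm_def)
  next
    case False
    have "add_mset u \<gamma> - {#v#} = add_mset u ?\<delta>" using True by simp
    then show ?thesis using True wd_ct[OF u False v] d by (simp add: hm_def)
  qed
  have "del (hm v c) \<gamma> = (\<Sum>u<N. (if u = v then c \<gamma> else 0) - wd v (ct u (c (add_mset u ?\<delta>))))"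
    unfolding del_def by (intro sum.cong refl t) simp
  also have "\<dots> = c \<gamma> - wd v (del c ?\<delta>)"
    using v by (simp add: sum_subtractf wd_sum del_def)
  finally show ?thesis using True c(2) by (simp add: arr_apply)
next
  case False
  have t: "ct u (hm v c (add_mset u \<gamma>)) = (if u = v then ct v (wd v (c \<gamma>)) else 0)" for u
    using False by (auto simp: hm_def)
  have "del (hm v c) \<gamma> = ct v (wd v (c \<gamma>))"
    unfolding del_def t using v by simp
  then show ?thesis using False wd_ct[OF v v, of "c \<gamma>"] by simp
qed

text \<open>The indices v different from w are treated one after the other; each \<open>hm v\<close>
  clears all entries whose monomial contains v. Entries cleared earlier stay zero because the
  remainder at \<open>\<gamma>\<close> is computed from the entry at \<open>\<gamma>\<close>
  alone.\<close>

lemma del_exact_reduced: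
  assumes c: "\<And>\<gamma>. w \<in># \<gamma> \<Longrightarrow> c \<gamma> = 0" "del c = 0" "\<And>\<gamma>. c \<gamma> \<in> E"
  shows "\<exists>b. (\<forall>\<gamma>. b \<gamma> \<in> E) \<and> (\<forall>\<gamma>. \<gamma> \<noteq> {#} \<longrightarrow> set_mset \<gamma> \<subseteq> {..<N} \<longrightarrow> c \<gamma> = del b \<gamma>)"
proof -
  have "\<exists>b. (\<forall>\<gamma>. b \<gamma> \<in> E) \<and> (\<forall>\<gamma>. w \<in># \<gamma> \<longrightarrow> (c - del b) \<gamma> = 0) \<and>
      (\<forall>\<gamma>. set_mset \<gamma> \<inter> set xs \<noteq> {} \<longrightarrow> (c - del b) \<gamma> = 0)"
    if "set xs \<subseteq> {..<N} - {w}" for xs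
    using that
  proof (induction xs)
    case Nil
    have "(c - del 0) \<gamma> = c \<gamma>" for \<gamma> by (simp only: del_0 arr_apply diff_zero)
    then have "(c - del 0) \<gamma> = 0" if "w \<in># \<gamma>" for \<gamma> using c(1)[OF that] by (simp only:)
    then show ?case by (intro exI[of _ 0] conjI allI impI) (simp only: arr_apply(4) E_0, blast, simp only: list.set Int_empty_right simp_thms)
  next
    case (Cons v xs)
    have v: "v < N" "v \<noteq> w" using Cons.prems by auto
    obtain b where b: "\<And>\<gamma>. b \<gamma> \<in> E" "\<And>\<gamma>. w \<in># \<gamma> \<Longrightarrow> (c - del b) \<gamma> = 0"
      "\<And>\<gamma>. set_mset \<gamma> \<inter> set xs \<noteq> {} \<Longrightarrow> (c - del b) \<gamma> = 0"
      using Cons by auto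
    define c' where "c' = c - del b"
    have d: "del c' = 0" by (simp add: c'_def del_diff c(2))
    have h: "(c - del (b + hm v c')) \<gamma> = (if v \<in># \<gamma> then 0 else wd v (ct v (c' \<gamma>)))" for \<gamma>
    proof -
      have "c - del (b + hm v c') = c' - del (hm v c')"
        by (simp add: c'_def del_add algebra_simps)
      then show ?thesis using hm_homotopy[OF v, of c' \<gamma>] b(2) d
        by (simp add: c'_def[symmetric] arr_apply)
    qed
    have c'E: "c' \<gamma> \<in> E" for \<gamma>
      unfolding c'_def arr_apply by (intro E_diff c(3) E_del b(1))
    show ?case
    proof (intro exI[of _ "b + hm v c'"] conjI allI impI)
      show "(b + hm v c') \<gamma> \<in> E" for \<gamma>
        by (auto simp: arr_apply hm_def intro!: E_add b(1) E_wd v c'E)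
      show "(c - del (b + hm v c')) \<gamma> = 0" if "w \<in># \<gamma>" for \<gamma>
        unfolding h using b(2)[OF that] by (simp add: c'_def)
      show "(c - del (b + hm v c')) \<gamma> = 0" if "set_mset \<gamma> \<inter> set (v # xs) \<noteq> {}" for \<gamma>
      proof (cases "v \<in># \<gamma>")
        case False
        then have "set_mset \<gamma> \<inter> set xs \<noteq> {}" using that by auto
        then show ?thesis unfolding h using b(3) by (simp add: c'_def)
      qed (simp add: h)
    qed
  qed
  from this[of "others w"] obtain b where b: "\<And>\<gamma>. b \<gamma> \<in> E"
    "\<And>\<gamma>. w \<in># \<gamma> \<Longrightarrow> (c - del b) \<gamma> = 0"
    "\<And>\<gamma>. set_mset \<gamma> \<inter> set (others w) \<noteq> {} \<Longrightarrow> (c - del b) \<gamma> = 0"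
    by auto
  have "c \<gamma> = del b \<gamma>" if \<gamma>: "\<gamma> \<noteq> {#}" "set_mset \<gamma> \<subseteq> {..<N}" for \<gamma>
  proof -
    obtain v where "v \<in># \<gamma>" using \<gamma>(1) by blast
    then have "(c - del b) \<gamma> = 0" using \<gamma> b(2,3)[of \<gamma>] by (cases "v = w") auto
    then show ?thesis by (simp add: arr_apply)
  qed
  then show ?thesis using b(1) by blast
qed

text \<open>Only removing a copy of w reaches an entry that can be nonzero, and there are n + 1
  copies to remove.\<close>

lemma pm_at_top:
  assumes "\<And>\<delta>. count \<delta> w = Suc n \<Longrightarrow> e \<delta> = 0" "count \<gamma> w = Suc n"
  shows "pm e \<gamma> = scl (of_nat (Suc n) * z w) (e (\<gamma> - {#w#}))"
proof -
  have "pm e \<gamma> = (\<Sum>v\<in>#\<gamma>. if v = w then scl (z w) (e (\<gamma> - {#w#})) else 0)"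
    unfolding pm_def using assms
    by (intro arg_cong[where f = sum_mset] image_mset_cong) auto
  also have "\<dots> = scl (of_nat (Suc n)) (scl (z w) (e (\<gamma> - {#w#})))"
    unfolding sum_mset_if_eq assms(2) by (rule funpow_add_scl)
  finally show ?thesis by simp
qed

text \<open>Since z_w is a unit, e_w can be eliminated modulo \<open>pm\<close>, lowering its
  highest multiplicity step by step. Each step divides by that multiplicity, which is where the
  integers up to t must be invertible.\<close>

lemma pm_reduce:
  assumes "\<And>\<gamma>. c \<gamma> \<in> E" "\<And>\<gamma>. n < count \<gamma> w \<Longrightarrow> c \<gamma> = 0" "n \<le> t"
    and "\<And>\<gamma>. size \<gamma> \<noteq> \<tau> \<Longrightarrow> c \<gamma> = 0"
  shows "\<exists>e. (\<forall>\<gamma>. e \<gamma> \<in> E) \<and> (\<forall>\<gamma>. Suc (size \<gamma>) \<noteq> \<tau> \<longrightarrow> e \<gamma> = 0) \<and> (\<forall>\<gamma>. w \<in># \<gamma> \<longrightarrow> (c - pm e) \<gamma> = 0)"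
  using assms
proof (induction n arbitrary: c)
  case 0
  show ?case
  proof (intro exI[of _ 0] conjI allI impI)
    show "(c - pm 0) \<gamma> = 0" if "w \<in># \<gamma>" for \<gamma>
      using 0(2)[of \<gamma>] that by (simp add: arr_apply)
  qed (simp_all add: arr_apply)
next
  case (Suc n)
  obtain i where i: "i \<in> R" "of_nat (Suc n) * i = 1" using R_inv[of "Suc n"] Suc.prems by auto
  \<comment> \<open>By \<open>pm_at_top\<close> this is the element whose product with z agrees with
    c at multiplicity n + 1 of w.\<close>
  define e1 where "e1 = (\<lambda>\<gamma>. if count \<gamma> w = n then scl (i * zi w) (c (add_mset w \<gamma>)) else 0)"
  have e1E: "e1 \<gamma> \<in> E" for \<gamma>
    by (auto simp: e1_def intro!: E_scl R_mult i R_zi Suc.prems)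
  have e1s: "e1 \<gamma> = 0" if "Suc (size \<gamma>) \<noteq> \<tau>" for \<gamma>
    using that Suc.prems(4)[of "add_mset w \<gamma>"] by (simp add: e1_def)
  have "(c - pm e1) \<gamma> = 0" if s: "size \<gamma> \<noteq> \<tau>" for \<gamma>
  proof -
    have "e1 (\<gamma> - {#v#}) = 0" if "v \<in># \<gamma>" for v
      using that s by (intro e1s) (simp only: size_Suc_Diff1 not_False_eq_True)
    then have "pm e1 \<gamma> = (\<Sum>v\<in>#\<gamma>. 0)"
      unfolding pm_def by (intro arg_cong[where f = sum_mset] image_mset_cong) auto
    then show ?thesis using Suc.prems(4)[OF s] by (simp add: arr_apply)
  qed
  moreover have "(c - pm e1) \<gamma> = 0" if \<gamma>: "n < count \<gamma> w" for \<gamma>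
  proof (cases "count \<gamma> w = Suc n")
    case True
    have "pm e1 \<gamma> = scl (of_nat (Suc n) * z w) (e1 (\<gamma> - {#w#}))"
      by (rule pm_at_top) (use True in \<open>auto simp: e1_def\<close>)
    also have "e1 (\<gamma> - {#w#}) = scl (i * zi w) (c \<gamma>)"
    proof -
      have "w \<in># \<gamma>" using True by (metis count_eq_zero_iff nat.distinct(1))
      then show ?thesis using True by (simp add: e1_def)
    qed
    also have "scl (of_nat (Suc n) * z w) (scl (i * zi w) (c \<gamma>)) = c \<gamma>"
    proof -
      have "of_nat (Suc n) * z w * (i * zi w) = (of_nat (Suc n) * i) * (z w * zi w)"
        by (simp only: mult.assoc mult.commute mult.left_commute)
      then show ?thesis by (simp only: scl_scl i zi[OF w] mult_1 scl_1)
    qed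
    finally show ?thesis by (simp add: arr_apply)
  next
    case False
    then have "pm e1 \<gamma> = (\<Sum>v\<in>#\<gamma>. 0)"
      unfolding pm_def using \<gamma>
      by (intro arg_cong[where f = sum_mset] image_mset_cong) (auto simp: e1_def)
    then show ?thesis using Suc.prems(2)[of \<gamma>] False \<gamma> by (simp add: arr_apply)
  qed
  moreover have "(c - pm e1) \<gamma> \<in> E" for \<gamma>
    unfolding arr_apply pm_def
    by (intro E_diff Suc.prems E_sum_mset E_scl R_z e1E)
  ultimately have "\<exists>e. (\<forall>\<gamma>. e \<gamma> \<in> E) \<and> (\<forall>\<gamma>. Suc (size \<gamma>) \<noteq> \<tau> \<longrightarrow> e \<gamma> = 0) \<and> (\<forall>\<gamma>. w \<in># \<gamma> \<longrightarrow> (c - pm e1 - pm e) \<gamma> = 0)"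
    using Suc.prems by (intro Suc.IH) auto
  then obtain e where e: "\<And>\<gamma>. e \<gamma> \<in> E" "\<And>\<gamma>. Suc (size \<gamma>) \<noteq> \<tau> \<Longrightarrow> e \<gamma> = 0" "\<And>\<gamma>. w \<in># \<gamma> \<Longrightarrow> (c - pm e1 - pm e) \<gamma> = 0" by blast
  show ?case
  proof (intro exI[of _ "e1 + e"] conjI allI impI)
    show "(c - pm (e1 + e)) \<gamma> = 0" if "w \<in># \<gamma>" for \<gamma>
      using e(3)[OF that] by (simp add: pm_add arr_apply algebra_simps)
  qed (simp_all add: arr_apply E_add e1E e1s e)
qed

text \<open>The entries of g with the largest multiplicity of w reappear in \<open>pm g\<close> with
  one more copy of w, multiplied by a unit; downward induction on that multiplicity removes them
  all.\<close>

lemma pm_unique: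
  assumes "\<And>\<gamma>. w \<in># \<gamma> \<Longrightarrow> pm g \<gamma> = 0" "\<And>\<gamma>. n \<le> count \<gamma> w \<Longrightarrow> g \<gamma> = 0" "n \<le> t"
  shows "g \<gamma> = 0"
  using assms
proof (induction n arbitrary: \<gamma>)
  case (Suc n)
  obtain i where i: "i \<in> R" "of_nat (Suc n) * i = 1" using R_inv[of "Suc n"] Suc.prems by auto
  have g: "g \<gamma> = 0" if "n \<le> count \<gamma> w" for \<gamma>
  proof (cases "count \<gamma> w = n")
    case True
    have "scl (of_nat (Suc n) * z w) (g \<gamma>) = pm g (add_mset w \<gamma>)"
      using pm_at_top[of n g "add_mset w \<gamma>"] Suc.prems(2) True by simp
    then have "scl (i * zi w) (scl (of_nat (Suc n) * z w) (g \<gamma>)) = 0"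
      using Suc.prems(1)[of "add_mset w \<gamma>"] by simp
    moreover have "i * zi w * (of_nat (Suc n) * z w) = (of_nat (Suc n) * i) * (z w * zi w)"
      by (simp only: mult.assoc mult.commute mult.left_commute)
    ultimately show ?thesis by (simp only: scl_scl i zi[OF w] mult_1 scl_1)
  qed (use that Suc.prems in auto)
  show ?case
    by (rule Suc.IH[OF Suc.prems(1) g]) (use Suc.prems(3) in simp_all)
qed auto

text \<open>After e_w has been eliminated modulo \<open>pm\<close>, the condition that
  \<open>del c0\<close> is a multiple of z becomes \<open>del c0 = 0\<close>: the multiple vanishes
  on all monomials containing w, and \<open>pm_unique\<close> applies. What remains is the reduced
  complex.\<close>

theorem del_exact:
  assumes c: "\<And>\<gamma>. c \<gamma> \<in> E" "\<And>\<gamma>. size \<gamma> \<noteq> \<tau> \<Longrightarrow> c \<gamma> = 0" and \<tau>: "0 < \<tau>" "\<tau> \<le> t"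
    and e': "del c = pm e'" "\<And>\<gamma>. Suc (Suc (size \<gamma>)) \<noteq> \<tau> \<Longrightarrow> e' \<gamma> = 0"
  shows "\<exists>b e. (\<forall>\<gamma>. b \<gamma> \<in> E) \<and> (\<forall>\<gamma>. e \<gamma> \<in> E) \<and>
    (\<forall>\<gamma>. size \<gamma> = \<tau> \<longrightarrow> set_mset \<gamma> \<subseteq> {..<N} \<longrightarrow> c \<gamma> = (del b + pm e) \<gamma>)"
proof -
  have "c \<gamma> = 0" if "\<tau> < count \<gamma> w" for \<gamma>
    using that count_le_size[of \<gamma> w] by (intro c(2)) auto
  then obtain e where e: "\<And>\<gamma>. e \<gamma> \<in> E" "\<And>\<gamma>. Suc (size \<gamma>) \<noteq> \<tau> \<Longrightarrow> e \<gamma> = 0"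
    "\<And>\<gamma>. w \<in># \<gamma> \<Longrightarrow> (c - pm e) \<gamma> = 0"
    using pm_reduce[of c \<tau> \<tau>] c \<tau> by blast
  define c0 where "c0 = c - pm e"
  have d: "del c0 = pm (e' - del e)" by (simp add: c0_def del_diff e' del_pm pm_diff)
  have "(e' - del e) \<gamma> = 0" for \<gamma>
  \<comment> \<open>Both terms live in divided degree \<open>\<tau> - 2\<close>, so w occurs fewer
    than \<open>\<tau> - 1\<close> times.\<close>
  proof (rule pm_unique[of "e' - del e" "\<tau> - 1"])
    show "pm (e' - del e) \<gamma> = 0" if "w \<in># \<gamma>" for \<gamma>
    proof -
      have "c0 (add_mset v \<gamma>) = 0" for v using e(3) that by (simp add: c0_def)
      then show ?thesis by (simp add: d[symmetric] del_def)
    qed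
    show "(e' - del e) \<gamma> = 0" if "\<tau> - 1 \<le> count \<gamma> w" for \<gamma>
    proof -
      have "\<tau> \<le> Suc (size \<gamma>)" using that count_le_size[of \<gamma> w] by auto
      then have "e' \<gamma> = 0" "e (add_mset v \<gamma>) = 0" for v by (intro e' e; simp)+
      then show ?thesis by (simp add: arr_apply del_def)
    qed
  qed (use \<tau> in auto)
  then have "e' - del e = 0" by (rule_tac ext) (simp add: arr_apply)
  then have "del c0 = 0" by (simp add: d)
  moreover have "c0 \<gamma> \<in> E" for \<gamma>
    unfolding c0_def arr_apply pm_def by (intro E_diff c E_sum_mset E_scl R_z e)
  ultimately obtain b where b: "\<And>\<gamma>. b \<gamma> \<in> E"
    "\<And>\<gamma>. \<gamma> \<noteq> {#} \<Longrightarrow> set_mset \<gamma> \<subseteq> {..<N} \<Longrightarrow> c0 \<gamma> = del b \<gamma>"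
    using del_exact_reduced[of c0] e(3) by (auto simp: c0_def)
  show ?thesis
  proof (rule exI[of _ b], rule exI[of _ e], intro conjI allI impI)
    fix \<gamma> assume "size \<gamma> = \<tau>" "set_mset \<gamma> \<subseteq> {..<N}"
    then have "c0 \<gamma> = del b \<gamma>" using \<tau> by (intro b) auto
    then show "c \<gamma> = (del b + pm e) \<gamma>" by (simp add: c0_def arr_apply algebra_simps)
  qed (use b e in auto)
qed

text \<open>The end of the complex, where the cycle condition is \<open>cr a = 0\<close>; the
  summands of \<open>cr_kernel\<close> become a family supported on singletons.\<close>

theorem cr_del_exact:
  assumes "a \<in> E" "cr a = 0"
  shows "\<exists>b. (\<forall>\<gamma>. b \<gamma> \<in> E) \<and> a = del b {#}"
proof -
  obtain b where b: "\<And>v. b v \<in> E" "a = (\<Sum>v\<in>{..<N} - {w}. ct v (b v))"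
    using cr_kernel[OF assms] by blast
  define b' where "b' = (\<lambda>\<gamma>. if \<exists>v<N. v \<noteq> w \<and> \<gamma> = {#v#} then b (THE v. \<gamma> = {#v#}) else 0)"
  have "del b' {#} = (\<Sum>v<N. if v = w then 0 else ct v (b v))"
    unfolding del_def by (intro sum.cong refl) (auto simp: b'_def)
  also have "\<dots> = a"
    unfolding b(2) using w by (subst sum.remove[of _ w]) (auto intro!: sum.cong)
  finally have "a = del b' {#}" by simp
  moreover have "b' \<gamma> \<in> E" for \<gamma> by (auto simp: b'_def b(1))
  ultimately show ?thesis by blast
qed

end

section \<open>Bigraded Laurent polynomials\<close>

text \<open>All variables are inverted at once, so every chart is a subring cut out by conditions on
  exponents, and sections on different charts can be compared by plain equality.\<close>

type_synonym 'k laurent = "(nat \<Rightarrow>\<^sub>0 int) \<Rightarrow>\<^sub>0 'k"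

abbreviation lkp :: "('a \<Rightarrow>\<^sub>0 'b::zero) \<Rightarrow> 'a \<Rightarrow> 'b" where "lkp \<equiv> Poly_Mapping.lookup"
abbreviation kys :: "('a \<Rightarrow>\<^sub>0 'b::zero) \<Rightarrow> 'a set" where "kys \<equiv> Poly_Mapping.keys"

lemma kys_iff: "x \<in> kys s \<longleftrightarrow> lkp s x \<noteq> 0"
  by (rule in_keys_iff)

lemma kys_uminus: "kys (- f) = kys (f :: 'a \<Rightarrow>\<^sub>0 'b::ab_group_add)"
  by (auto simp: kys_iff)

lemma kys_sum: "\<alpha> \<in> kys (sum f S) \<Longrightarrow> \<exists>i\<in>S. \<alpha> \<in> kys (f i)"
  by (metis (mono_tags, lifting) kys_iff lookup_sum sum.neutral)

lemma kys_mult: "\<alpha> \<in> kys (f * g) \<Longrightarrow> \<exists>a b. \<alpha> = a + b \<and> a \<in> kys f \<and> b \<in> kys g"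
  using keys_mult[of f g] by blast

definition filt :: "('a \<Rightarrow> bool) \<Rightarrow> ('a \<Rightarrow>\<^sub>0 'b) \<Rightarrow> ('a \<Rightarrow>\<^sub>0 'b::comm_monoid_add)"
  where "filt P f = (\<Sum>\<alpha>\<in>{\<alpha> \<in> kys f. P \<alpha>}. Poly_Mapping.single \<alpha> (lkp f \<alpha>))"

lemma lookup_filt: "lkp (filt P f) \<alpha> = (if P \<alpha> then lkp f \<alpha> else 0)"
proof -
  have "lkp (filt P f) \<alpha> = (\<Sum>\<beta>\<in>{\<beta> \<in> kys f. P \<beta>}. if \<alpha> = \<beta> then lkp f \<beta> else 0)"
    unfolding filt_def lookup_sum by (intro sum.cong refl) (simp add: lookup_single when_def)
  also have "\<dots> = (if \<alpha> \<in> {\<beta> \<in> kys f. P \<beta>} then lkp f \<alpha> else 0)"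
    by (rule sum.delta') simp
  finally show ?thesis by (auto simp: kys_iff)
qed

lemma kys_filt: "kys (filt P f) = {\<alpha> \<in> kys f. P \<alpha>}"
  by (auto simp: kys_iff lookup_filt split: if_splits)

lemma filt_add: "filt P (f + g) = filt P f + filt P g"
  by (rule poly_mapping_eqI) (simp add: lookup_filt lookup_add)

lemma filt_0 [simp]: "filt P 0 = 0"
  by (rule poly_mapping_eqI) (simp add: lookup_filt)

lemma filt_uminus: "filt P (- f) = - filt P (f :: 'a \<Rightarrow>\<^sub>0 'b::ab_group_add)"
  by (rule poly_mapping_eqI) (simp add: lookup_filt)

lemma filt_sum: "filt P (sum f S) = (\<Sum>i\<in>S. filt P (f i))"
  by (induction S rule: infinite_finite_induct) (simp_all add: filt_add)

lemma filt_id: "(\<And>\<alpha>. \<alpha> \<in> kys f \<Longrightarrow> P \<alpha>) \<Longrightarrow> filt P f = f"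
  by (rule poly_mapping_eqI) (auto simp: lookup_filt kys_iff)

lemma filt_none: "(\<And>\<alpha>. \<alpha> \<in> kys f \<Longrightarrow> \<not> P \<alpha>) \<Longrightarrow> filt P f = 0"
  by (rule poly_mapping_eqI) (auto simp: lookup_filt kys_iff)

lemma filt_split: "f = filt P f + filt (\<lambda>\<alpha>. \<not> P \<alpha>) f"
  by (rule poly_mapping_eqI) (simp add: lookup_filt lookup_add)

lemma filt_mult:
  fixes s f :: "('a::comm_monoid_add) \<Rightarrow>\<^sub>0 ('b::comm_ring_1)"
  assumes "\<And>\<beta> \<alpha>. \<beta> \<in> kys s \<Longrightarrow> P (\<beta> + \<alpha>) \<longleftrightarrow> Q \<alpha>"
  shows "filt P (s * f) = s * filt Q f"
proof -
  have "s * f = s * filt Q f + s * filt (\<lambda>\<alpha>. \<not> Q \<alpha>) f"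
    by (subst filt_split[of f Q]) (rule distrib_left)
  moreover have "filt P (s * filt Q f) = s * filt Q f"
    by (rule filt_id) (use assms in \<open>auto dest!: kys_mult simp: kys_filt\<close>)
  moreover have "filt P (s * filt (\<lambda>\<alpha>. \<not> Q \<alpha>) f) = 0"
    by (rule filt_none) (use assms in \<open>auto dest!: kys_mult simp: kys_filt\<close>)
  ultimately show ?thesis by (simp add: filt_add)
qed

locale bigraded =
  fixes n1 n2 \<kappa> :: nat and K :: "nat \<Rightarrow> nat \<Rightarrow> nat \<Rightarrow> 'k::field"
  assumes n1: "2 \<le> n1" and n2: "2 \<le> n2"
begin

definition N :: nat where "N = n1 + n2"

definition xd :: "(nat \<Rightarrow>\<^sub>0 int) \<Rightarrow> int" where "xd \<alpha> = (\<Sum>v<n1. lkp \<alpha> v)"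
definition yd :: "(nat \<Rightarrow>\<^sub>0 int) \<Rightarrow> int" where "yd \<alpha> = (\<Sum>v\<in>{n1..<N}. lkp \<alpha> v)"
definition gx :: "nat multiset \<Rightarrow> int" where "gx \<gamma> = int (size (filter_mset (\<lambda>v. v < n1) \<gamma>))"
definition gy :: "nat multiset \<Rightarrow> int" where "gy \<gamma> = int (size (filter_mset (\<lambda>v. n1 \<le> v) \<gamma>))"

definition z :: "nat \<Rightarrow> 'k laurent"
  where "z v = (if v < N then Poly_Mapping.single (Poly_Mapping.single v 1) 1 else 0)"
definition zi :: "nat \<Rightarrow> 'k laurent"
  where "zi v = Poly_Mapping.single (Poly_Mapping.single v (- 1)) 1"
text \<open>Column l is the Koszul image of the tensor with coefficient matrix \<open>K l\<close>:
  the rows of V1 carry linear forms in the second group of variables, the rows of V2 carry negated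
  forms in the first group.\<close>

definition f :: "nat \<Rightarrow> nat \<Rightarrow> 'k laurent"
  where "f v l = (if v < n1 then
      \<Sum>j<n2. Poly_Mapping.single (Poly_Mapping.single (n1 + j) 1) (K l v j)
    else if v < N then
      - (\<Sum>i<n1. Poly_Mapping.single (Poly_Mapping.single i 1) (K l i (v - n1)))
    else 0)"

definition rg :: "nat set \<Rightarrow> (nat \<Rightarrow>\<^sub>0 int) \<Rightarrow> bool"
  where "rg W \<alpha> \<longleftrightarrow> kys \<alpha> \<subseteq> {..<N} \<and> (\<forall>v. lkp \<alpha> v < 0 \<longrightarrow> v \<in> W)"
definition R :: "nat set \<Rightarrow> 'k laurent set" where "R W = {h. \<forall>\<alpha>\<in>kys h. rg W \<alpha>}"

lemma xd_add: "xd (\<alpha> + \<beta>) = xd \<alpha> + xd \<beta>" and yd_add: "yd (\<alpha> + \<beta>) = yd \<alpha> + yd \<beta>"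
  by (simp_all add: xd_def yd_def lookup_add sum.distrib)

lemma xd_single: "xd (Poly_Mapping.single v c) = (if v < n1 then c else 0)"
  and yd_single: "yd (Poly_Mapping.single v c) = (if n1 \<le> v \<and> v < N then c else 0)"
  by (simp_all add: xd_def yd_def lookup_single when_def sum.delta' sum.delta)

lemma gx_add: "gx (add_mset v \<gamma>) = gx \<gamma> + (if v < n1 then 1 else 0)"
  and gy_add: "gy (add_mset v \<gamma>) = gy \<gamma> + (if v < n1 then 0 else 1)"
  by (simp_all add: gx_def gy_def)

lemma gx_gy: "gx \<gamma> + gy \<gamma> = int (size \<gamma>)"
proof -
  have "\<gamma> = filter_mset (\<lambda>v. v < n1) \<gamma> + filter_mset (\<lambda>v. \<not> v < n1) \<gamma>"
    by (rule multiset_partition)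
  then have "size \<gamma> = size (filter_mset (\<lambda>v. v < n1) \<gamma>) + size (filter_mset (\<lambda>v. \<not> v < n1) \<gamma>)"
    by (metis size_union)
  then show ?thesis by (simp add: gx_def gy_def not_less)
qed

lemma gx_nonneg: "0 \<le> gx \<gamma>" and gy_nonneg: "0 \<le> gy \<gamma>"
  by (simp_all add: gx_def gy_def)

lemma kys_z: "\<beta> \<in> kys (z v) \<Longrightarrow> v < N \<and> \<beta> = Poly_Mapping.single v 1"
  by (auto simp: z_def split: if_splits)

lemma kys_zi: "\<beta> \<in> kys (zi v) \<Longrightarrow> \<beta> = Poly_Mapping.single v (- 1)"
  by (auto simp: zi_def)

lemma kys_f: "\<beta> \<in> kys (f v l) \<Longrightarrow> v < N \<and>
    (\<exists>u<N. \<beta> = Poly_Mapping.single u 1 \<and> (u < n1 \<longleftrightarrow> n1 \<le> v))"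
  by (auto simp: f_def kys_uminus N_def split: if_splits dest!: kys_sum)
    (metis add_less_cancel_left not_add_less1, metis trans_less_add1)

lemma z_zi: "v < N \<Longrightarrow> z v * zi v = 1"
  by (simp add: z_def zi_def mult_single flip: single_add)

text \<open>Each coefficient \<open>K l i j\<close> meets the product of z_i and z_(n1+j) twice,
  with opposite signs.\<close>

lemma z_f_rel: "(\<Sum>v<N. z v * f v l) = 0"
proof -
  have s: "{..<N} = {..<n1} \<union> {n1..<N}" by (auto simp: N_def)
  have "(\<Sum>v<n1. z v * f v l) = (\<Sum>v<n1. \<Sum>j<n2. Poly_Mapping.single (Poly_Mapping.single v 1 + Poly_Mapping.single (n1 + j) 1) (K l v j))"
    by (intro sum.cong refl) (simp add: z_def f_def N_def sum_distrib_left mult_single)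
  moreover have "(\<Sum>v\<in>{n1..<N}. z v * f v l) = - (\<Sum>v\<in>{n1..<N}. \<Sum>i<n1. Poly_Mapping.single (Poly_Mapping.single v 1 + Poly_Mapping.single i 1) (K l i (v - n1)))"
    unfolding sum_negf[symmetric] by (intro sum.cong refl) (simp add: z_def f_def sum_distrib_left mult_single sum_negf)
  moreover have "(\<Sum>v\<in>{n1..<N}. \<Sum>i<n1. Poly_Mapping.single (Poly_Mapping.single v 1 + Poly_Mapping.single i 1) (K l i (v - n1)))
    = (\<Sum>j<n2. \<Sum>i<n1. Poly_Mapping.single (Poly_Mapping.single i 1 + Poly_Mapping.single (n1 + j) (1::int)) (K l i j))"
    by (rule sum.reindex_bij_witness[of _ "\<lambda>j. n1 + j" "\<lambda>v. v - n1"]) (auto simp: N_def add.commute)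
  ultimately show ?thesis
    unfolding s by (subst sum.union_disjoint) (auto simp: sum.swap[of _ "{..<n2}"])
qed

sublocale koszul_data N \<kappa> z zi f
  by unfold_locales (use z_f_rel z_zi n1 in \<open>auto simp: N_def\<close>)

section \<open>Charts as subrings, and twisted bidegrees\<close>

lemma R_mono: "V \<subseteq> W \<Longrightarrow> R V \<subseteq> R W"
  by (auto simp: R_def rg_def)

lemma rg_add: "rg W \<alpha> \<Longrightarrow> rg W \<beta> \<Longrightarrow> rg W (\<alpha> + \<beta>)"
proof -
  assume a: "rg W \<alpha>" "rg W \<beta>"
  have "kys (\<alpha> + \<beta>) \<subseteq> {..<N}" using a keys_add[of \<alpha> \<beta>] by (auto simp: rg_def)
  moreover have "v \<in> W" if "lkp (\<alpha> + \<beta>) v < 0" for v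
    using a that by (cases "lkp \<alpha> v < 0") (auto simp: rg_def lookup_add)
  ultimately show ?thesis by (simp add: rg_def)
qed

lemma R_0: "0 \<in> R W" and R_1: "1 \<in> R W"
  by (auto simp: R_def rg_def)

lemma R_add: "a \<in> R W \<Longrightarrow> b \<in> R W \<Longrightarrow> a + b \<in> R W"
  using keys_add[of a b] by (auto simp: R_def)

lemma R_uminus: "a \<in> R W \<Longrightarrow> - a \<in> R W"
  by (simp add: R_def kys_uminus)

lemma R_mult: "a \<in> R W \<Longrightarrow> b \<in> R W \<Longrightarrow> a * b \<in> R W"
  by (auto simp: R_def intro: rg_add dest!: kys_mult)

lemma R_sum: "(\<And>i. i \<in> S \<Longrightarrow> g i \<in> R W) \<Longrightarrow> sum g S \<in> R W"
  by (induction S rule: infinite_finite_induct) (auto intro: R_0 R_add)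

lemma rg_single: "v < N \<Longrightarrow> c < 0 \<longrightarrow> v \<in> W \<Longrightarrow> rg W (Poly_Mapping.single v c)"
  by (auto simp: rg_def lookup_single when_def split: if_splits)

lemma R_z: "z v \<in> R W"
  by (auto simp: R_def dest!: kys_z intro!: rg_single)

lemma R_zi: "v < N \<Longrightarrow> v \<in> W \<Longrightarrow> zi v \<in> R W"
  by (auto simp: R_def dest!: kys_zi intro!: rg_single)

lemma R_f: "f v l \<in> R W"
  by (auto simp: R_def dest!: kys_f intro!: rg_single)

lemma R_const: "Poly_Mapping.single 0 c \<in> R W"
  by (auto simp: R_def rg_def split: if_splits)

text \<open>A row of the first group raises the degree in the second group of variables, and
  conversely. Twisting the entry at \<open>\<gamma>\<close> down accordingly makes
  \<open>del\<close> preserve the pair (a, b); the entry is a section of the line bundle of bidegree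
  (a - gy, b - gx).\<close>

definition dg :: "int \<Rightarrow> int \<Rightarrow> nat multiset \<Rightarrow> (nat \<Rightarrow>\<^sub>0 int) \<Rightarrow> bool"
  where "dg a b \<gamma> \<alpha> \<longleftrightarrow> xd \<alpha> = a - gy \<gamma> \<and> yd \<alpha> = b - gx \<gamma>"

definition ok :: "nat \<Rightarrow> nat multiset \<Rightarrow> bool"
  where "ok \<tau> \<gamma> \<longleftrightarrow> size \<gamma> = \<tau> \<and> set_mset \<gamma> \<subseteq> {..<N}"

text \<open>The homotopies on a chart ignore degrees. Their results are made homogeneous afterwards
  by this projection, which is compatible with \<open>del\<close>, \<open>pm\<close> and the
  augmentation.\<close>

definition pj :: "nat \<Rightarrow> int \<Rightarrow> int \<Rightarrow> (nat multiset \<Rightarrow> nat set \<Rightarrow> 'k laurent) \<Rightarrow> nat multiset \<Rightarrow> nat set \<Rightarrow> 'k laurent"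
  where "pj \<tau> a b c \<gamma> = (\<lambda>A. if ok \<tau> \<gamma> then filt (dg a b \<gamma>) (c \<gamma> A) else 0)"

definition Loc :: "nat set \<Rightarrow> nat \<Rightarrow> int \<Rightarrow> int \<Rightarrow> (nat multiset \<Rightarrow> nat set \<Rightarrow> 'k laurent) \<Rightarrow> bool"
  where "Loc W \<tau> a b c \<longleftrightarrow> (\<forall>\<gamma> A. \<forall>\<alpha>\<in>kys (c \<gamma> A). ok \<tau> \<gamma> \<and> rg W \<alpha> \<and> dg a b \<gamma> \<alpha>)"

definition EW :: "nat set \<Rightarrow> (nat set \<Rightarrow> 'k laurent) set"
  where "EW W = {a. \<forall>A. a A \<in> R W}"

lemma Loc_pj: "(\<And>\<gamma>. c \<gamma> \<in> EW W) \<Longrightarrow> Loc W \<tau> a b (pj \<tau> a b c)"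
  unfolding Loc_def pj_def EW_def R_def by (auto simp: kys_filt split: if_splits)

lemma pj_id: "Loc W \<tau> a b c \<Longrightarrow> pj \<tau> a b c = c"
proof (intro ext)
  fix \<gamma> A assume L: "Loc W \<tau> a b c"
  show "pj \<tau> a b c \<gamma> A = c \<gamma> A"
  proof (cases "ok \<tau> \<gamma>")
    case True
    then show ?thesis using L by (auto simp: pj_def Loc_def intro!: filt_id)
  next
    case False
    then have "kys (c \<gamma> A) = {}" using L unfolding Loc_def by blast
    then show ?thesis using False by (simp add: pj_def)
  qed
qed

lemma Loc_EW: "Loc W \<tau> a b c \<Longrightarrow> c \<gamma> \<in> EW W"
  by (auto simp: Loc_def EW_def R_def)

lemma Loc_zero: "Loc W \<tau> a b c \<Longrightarrow> \<not> ok \<tau> \<gamma> \<Longrightarrow> c \<gamma> = 0"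
proof (rule ext)
  fix A assume "Loc W \<tau> a b c" "\<not> ok \<tau> \<gamma>"
  then have "kys (c \<gamma> A) = {}" unfolding Loc_def by blast
  then show "c \<gamma> A = 0 A" by (simp add: fun_apply)
qed

lemma pj_add: "pj \<tau> a b (c + d) = pj \<tau> a b c + pj \<tau> a b d"
  by (intro ext) (simp add: pj_def fun_apply filt_add)

lemma Loc_0 [simp]: "Loc W \<tau> a b 0"
  by (simp add: Loc_def fun_apply)

lemma Loc_add: "Loc W \<tau> a b c \<Longrightarrow> Loc W \<tau> a b d \<Longrightarrow> Loc W \<tau> a b (c + d)"
  unfolding Loc_def fun_apply
proof (intro allI ballI)
  fix \<gamma> A \<alpha>
  assume "\<forall>\<gamma> A. \<forall>\<alpha>\<in>kys (c \<gamma> A). ok \<tau> \<gamma> \<and> rg W \<alpha> \<and> dg a b \<gamma> \<alpha>"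
    "\<forall>\<gamma> A. \<forall>\<alpha>\<in>kys (d \<gamma> A). ok \<tau> \<gamma> \<and> rg W \<alpha> \<and> dg a b \<gamma> \<alpha>"
    "\<alpha> \<in> kys (c \<gamma> A + d \<gamma> A)"
  then show "ok \<tau> \<gamma> \<and> rg W \<alpha> \<and> dg a b \<gamma> \<alpha>"
    using keys_add[of "c \<gamma> A" "d \<gamma> A"] by (meson Un_iff subsetD)
qed

lemma Loc_uminus: "Loc W \<tau> a b c \<Longrightarrow> Loc W \<tau> a b (- c)"
  by (simp add: Loc_def fun_apply kys_uminus)

lemma Loc_diff: "Loc W \<tau> a b c \<Longrightarrow> Loc W \<tau> a b d \<Longrightarrow> Loc W \<tau> a b (c - d)"
  using Loc_add[of W \<tau> a b c "- d"] by (simp add: Loc_uminus)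

lemma filt_contract:
  assumes "\<And>l \<beta> \<alpha>. \<beta> \<in> kys (h l) \<Longrightarrow> P (\<beta> + \<alpha>) \<longleftrightarrow> Q \<alpha>"
  shows "filt P (contract \<kappa> h a A) = contract \<kappa> h (\<lambda>A. filt Q (a A)) A"
proof -
  have "filt P (contract \<kappa> h a A) = (\<Sum>l<\<kappa>. filt P (h l * ext_contract l a A))"
    by (simp add: contract_def fun_sum_apply scl_def filt_sum)
  also have "\<dots> = (\<Sum>l<\<kappa>. h l * filt Q (ext_contract l a A))"
    by (intro sum.cong refl filt_mult assms)
  also have "\<dots> = contract \<kappa> h (\<lambda>A. filt Q (a A)) A"
    by (simp add: contract_def fun_sum_apply scl_def ext_contract_def alt_def filt_uminus if_distrib[of "filt Q"] cong: if_cong)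
  finally show ?thesis .
qed

definition fd :: "int \<Rightarrow> int \<Rightarrow> (nat set \<Rightarrow> 'k laurent) \<Rightarrow> nat set \<Rightarrow> 'k laurent"
  where "fd a b c A = filt (\<lambda>\<alpha>. xd \<alpha> = a \<and> yd \<alpha> = b) (c A)"

lemma fd_ct: "fd (a + (if v < n1 then 0 else 1)) (b + (if v < n1 then 1 else 0)) (ct v c) = ct v (fd a b c)"
  unfolding fd_def[abs_def] ct_def
  by (intro ext filt_contract) (auto dest!: kys_f simp: xd_add yd_add xd_single yd_single)

lemma pj_alt: "pj \<tau> a b c \<gamma> = (if ok \<tau> \<gamma> then fd (a - gy \<gamma>) (b - gx \<gamma>) (c \<gamma>) else 0)"
  by (rule ext) (simp add: pj_def fd_def dg_def[abs_def] fun_apply)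

lemma fd_0 [simp]: "fd a b 0 = 0"
  by (rule ext) (simp add: fd_def fun_apply)

lemma fd_sum: "fd a b (sum g S) = (\<Sum>i\<in>S. fd a b (g i))"
  by (rule ext) (simp add: fd_def fun_sum_apply filt_sum)

lemma fd_add: "fd a b (c + d) = fd a b c + fd a b d"
  by (rule ext) (simp add: fd_def fun_apply filt_add)

lemma fd_sum_mset: "fd a b (\<Sum>i\<in>#M. g i) = (\<Sum>i\<in>#M. fd a b (g i))"
  by (induction M) (simp_all add: fd_add)

lemma pj_del: "pj \<tau> a b (del c) = del (pj (Suc \<tau>) a b c)"
proof (rule ext)
  fix \<gamma>
  show "pj \<tau> a b (del c) \<gamma> = del (pj (Suc \<tau>) a b c) \<gamma>"
  proof (cases "ok \<tau> \<gamma>")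
    case False
    then have "\<not> ok (Suc \<tau>) (add_mset v \<gamma>)" if "v < N" for v using that by (auto simp: ok_def)
    then show ?thesis using False by (simp add: pj_alt del_def)
  next
    case True
    then have o: "ok (Suc \<tau>) (add_mset v \<gamma>)" if "v < N" for v using that by (auto simp: ok_def)
    have "pj \<tau> a b (del c) \<gamma> = (\<Sum>v<N. fd (a - gy \<gamma>) (b - gx \<gamma>) (ct v (c (add_mset v \<gamma>))))"
      using True by (simp add: pj_alt del_def fd_sum)
    also have "\<dots> = (\<Sum>v<N. ct v (fd (a - gy (add_mset v \<gamma>)) (b - gx (add_mset v \<gamma>)) (c (add_mset v \<gamma>))))"
      by (intro sum.cong refl, subst fd_ct[symmetric]) (simp add: gx_add gy_add)
    finally show ?thesis using o by (simp add: pj_alt del_def)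
  qed
qed

lemma fd_z: "fd (a + (if v < n1 then 1 else 0)) (b + (if v < n1 then 0 else 1)) (scl (z v) c) = scl (z v) (fd a b c)"
  by (intro ext; unfold fd_def scl_def; intro filt_mult)
    (auto dest!: kys_z simp: xd_add yd_add xd_single yd_single)

text \<open>Multiplying by z_v raises one degree by one, while adding v to the multiset relaxes the
  twist of the other degree by one: both shift together. Correction terms for twist (-1, -1) thus
  live in twist (-2, -2).\<close>

lemma pj_pm: "pj (Suc \<tau>) (a + 1) (b + 1) (pm e) = pm (pj \<tau> a b e)"
proof (rule ext)
  fix \<gamma>
  show "pj (Suc \<tau>) (a + 1) (b + 1) (pm e) \<gamma> = pm (pj \<tau> a b e) \<gamma>"
  proof (cases "ok (Suc \<tau>) \<gamma>")
    case False
    have "scl (z v) (pj \<tau> a b e (\<gamma> - {#v#})) = 0" if v: "v \<in># \<gamma>" for v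
    proof (cases "v < N")
      case True
      obtain \<gamma>' where g: "\<gamma> = add_mset v \<gamma>'" using v by (metis insert_DiffM)
      have "\<not> ok \<tau> (\<gamma> - {#v#})" using False True by (auto simp: ok_def g)
      then show ?thesis by (simp add: pj_alt)
    qed (simp add: z_def)
    then have "pm (pj \<tau> a b e) \<gamma> = (\<Sum>v\<in>#\<gamma>. 0)"
      unfolding pm_def by (intro arg_cong[where f = sum_mset] image_mset_cong) auto
    then show ?thesis using False by (simp add: pj_alt)
  next
    case True
    have t: "fd (a + 1 - gy \<gamma>) (b + 1 - gx \<gamma>) (scl (z v) (e (\<gamma> - {#v#}))) = scl (z v) (pj \<tau> a b e (\<gamma> - {#v#}))"
      if v: "v \<in># \<gamma>" for v
    proof -
      obtain \<gamma>' where g: "\<gamma> = add_mset v \<gamma>'" using v by (metis insert_DiffM)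
      have "ok \<tau> \<gamma>'" using True by (auto simp: ok_def g)
      then show ?thesis using fd_z[of "a - gy \<gamma>'" v "b - gx \<gamma>'" "e \<gamma>'"]
        by (simp add: pj_alt g gx_add gy_add algebra_simps split: if_splits)
    qed
    then show ?thesis using True
      unfolding pj_alt[of "Suc \<tau>"] pm_def fd_sum_mset
      by (auto intro!: arg_cong[where f = sum_mset] image_mset_cong)
  qed
qed

lemma fd_cts:
  "fd (a + int (length (filter (\<lambda>v. n1 \<le> v) xs))) (b + int (length (filter (\<lambda>v. v < n1) xs))) (cts xs c)
    = cts xs (fd a b c)"
proof (induction xs)
  case (Cons v xs)
  show ?case
    using fd_ct[of "a + int (length (filter (\<lambda>v. n1 \<le> v) xs))" v
        "b + int (length (filter (\<lambda>v. v < n1) xs))" "cts xs c"] Cons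
    by (auto simp: algebra_simps split: if_splits)
qed simp

text \<open>Among the rows other than 0, the n2 rows of the second group raise the first degree and
  the n1 - 1 rows of the first group raise the second; dividing by z_0 takes one first degree back.
  Starting in (-1, -1), this gives the critical bidegree.\<close>

lemma fd_cr: "fd (a + int n2 - 1) (b + int n1 - 1) (cr c) = cr (fd a b c)"
proof -
  have "filter (\<lambda>v. n1 \<le> v) (others 0) = [n1..<N]"
  proof -
    have "[0..<N] = [0..<n1] @ [n1..<N]" using upt_add_eq_append[of 0 n1 n2] by (simp add: N_def)
    then show ?thesis using n1 by (auto simp: others_def filter_empty_conv filter_id_conv)
  qed
  then have 1: "length (filter (\<lambda>v. n1 \<le> v) (others 0)) = n2" by (simp add: N_def)
  have l: "length (filter (\<lambda>v. v < n1) (others 0)) = card ({..<n1} - {0})"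
  proof -
    have "n1 \<le> N" by (simp add: N_def)
    then have "set (filter (\<lambda>v. v < n1) (others 0)) = {..<n1} - {0}" by auto
    then show ?thesis by (metis distinct_card distinct_filter distinct_others)
  qed
  then have 2: "int (length (filter (\<lambda>v. v < n1) (others 0))) = int n1 - 1"
    using n1 by (simp add: l)
  have "fd (a + int n2 - 1) (b + int n1 - 1) (cr c)
    = scl (zi 0) (fd (a + int n2) (b + int n1 - 1) (cts (others 0) c))"
    unfolding cr_def
    by (intro ext; unfold fd_def scl_def; intro filt_mult)
      (use n1 in \<open>auto dest!: kys_zi simp: xd_add yd_add xd_single yd_single\<close>)
  also have "fd (a + int n2) (b + int n1 - 1) (cts (others 0) c) = cts (others 0) (fd a b c)"
    using fd_cts[of a "others 0" b c] by (simp only: 1 2 add_diff_eq)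
  finally show ?thesis by (simp add: cr_def)
qed

end

section \<open>The Cech complex\<close>

context bigraded
begin

text \<open>W is the set of inverted variables of a chart of the product of two projective spaces,
  one or more from each group. A union of nonempty W1 and W2 has total Cech degree |W1| - 1 + |W2| -
  1, hence the 2 in \<open>Coch\<close>.\<close>

definition adm :: "nat set \<Rightarrow> bool"
  where "adm W \<longleftrightarrow> W \<subseteq> {..<N} \<and> (\<exists>v\<in>W. v < n1) \<and> (\<exists>v\<in>W. n1 \<le> v)"

definition Coch :: "nat \<Rightarrow> nat \<Rightarrow> int \<Rightarrow> int \<Rightarrow> (nat set \<Rightarrow> nat multiset \<Rightarrow> nat set \<Rightarrow> 'k laurent) \<Rightarrow> bool"
  where "Coch s \<tau> a b c \<longleftrightarrow> (\<forall>W \<gamma> A. \<forall>\<alpha>\<in>kys (c W \<gamma> A).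
    adm W \<and> card W = s + 2 \<and> ok \<tau> \<gamma> \<and> rg W \<alpha> \<and> dg a b \<gamma> \<alpha>)"

text \<open>Wedging with the sum of all basis vectors is the alternating sum over the deleted
  elements of W, that is, the Cech differential.\<close>

definition cech :: "(nat set \<Rightarrow> 'b::ab_group_add) \<Rightarrow> nat set \<Rightarrow> 'b"
  where "cech c = (\<Sum>u<N. ext_wedge u c)"

lemma Coch_Loc: "Coch s \<tau> a b c \<Longrightarrow> Loc W \<tau> a b (c W)"
  unfolding Coch_def Loc_def by blast

lemma Coch_zero:
  assumes "Coch s \<tau> a b c" "\<not> (adm W \<and> card W = s + 2)"
  shows "c W = 0"
proof (intro ext)
  fix \<gamma> A
  have "kys (c W \<gamma> A) = {}" using assms unfolding Coch_def by blast
  then show "c W \<gamma> A = 0 \<gamma> A" by (simp add: fun_apply)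
qed

lemma CochI:
  assumes "\<And>W. adm W \<Longrightarrow> card W = s + 2 \<Longrightarrow> Loc W \<tau> a b (c W)"
    "\<And>W. \<not> (adm W \<and> card W = s + 2) \<Longrightarrow> c W = 0"
  shows "Coch s \<tau> a b c"
  unfolding Coch_def
proof (intro allI ballI)
  fix W \<gamma> A \<alpha> assume k: "\<alpha> \<in> kys (c W \<gamma> A)"
  have "adm W \<and> card W = s + 2"
  proof (rule ccontr)
    assume "\<not> (adm W \<and> card W = s + 2)"
    from assms(2)[OF this] k show False by (simp add: fun_apply)
  qed
  with assms(1)[of W] k show "adm W \<and> card W = s + 2 \<and> ok \<tau> \<gamma> \<and> rg W \<alpha> \<and> dg a b \<gamma> \<alpha>"
    unfolding Loc_def by blast
qed

lemma Coch_0 [simp]: "Coch s \<tau> a b 0"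
  by (rule CochI) (simp_all add: fun_apply(2))

lemma Coch_diff:
  assumes c: "Coch s \<tau> a b c" and d: "Coch s \<tau> a b d"
  shows "Coch s \<tau> a b (c - d)"
proof (rule CochI)
  fix W
  have e: "(c - d) W = c W - d W" by (simp add: fun_apply)
  show "Loc W \<tau> a b ((c - d) W)"
    unfolding e by (intro Loc_diff Coch_Loc[OF c] Coch_Loc[OF d])
  show "(c - d) W = 0" if "\<not> (adm W \<and> card W = s + 2)"
    unfolding e using Coch_zero[OF c that] Coch_zero[OF d that] by simp
qed

lemma Coch_add:
  assumes c: "Coch s \<tau> a b c" and d: "Coch s \<tau> a b d"
  shows "Coch s \<tau> a b (c + d)"
  using Coch_diff[OF c Coch_diff[OF Coch_0 d]] by simp

lemma Coch_map:
  assumes c: "Coch s \<tau> a b c" and "\<And>W x. adm W \<Longrightarrow> Loc W \<tau> a b x \<Longrightarrow> Loc W \<tau>' a' b' (h x)" "h 0 = 0"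
  shows "Coch s \<tau>' a' b' (\<lambda>W. h (c W))"
proof (rule CochI)
  fix W
  show "Loc W \<tau>' a' b' (h (c W))" if "adm W" using that by (intro assms(2) Coch_Loc[OF c])
  show "h (c W) = 0" if "\<not> (adm W \<and> card W = s + 2)"
    using Coch_zero[OF c that] by (simp add: assms(3))
qed

lemma cech_add: "cech (c + d) = cech c + cech d"
  by (simp add: cech_def ext_wedge_add sum.distrib)

lemma cech_0 [simp]: "cech 0 = 0"
  by (simp add: cech_def)

lemma cech_uminus: "cech (- d) = - cech d"
  by (simp add: cech_def ext_wedge_uminus sum_negf)

lemma cech_diff: "cech (c - d) = cech c - cech d"
  using cech_add[of c "- d"] by (simp add: cech_uminus)

lemma cech_cech [simp]: "cech (cech c) = 0"
  unfolding cech_def ext_wedge_sum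
  by (rule sum_antisymmetric) (rule ext_wedge_anticomm, rule ext_wedge_self)

lemma ext_wedge_map:
  assumes "\<And>x. h (- x) = - h x" "h 0 = 0"
  shows "ext_wedge u (\<lambda>W. h (c W)) = (\<lambda>W. h (ext_wedge u c W))"
  by (rule ext) (simp add: ext_wedge_def alt_def assms)

lemma cech_map:
  assumes "\<And>x y. h (x + y) = h x + h y" "\<And>x. h (- x) = - h x" "h 0 = 0"
  shows "cech (\<lambda>W. h (c W)) = (\<lambda>W. h (cech c W))"
proof -
  have s: "h (sum g S) = (\<Sum>i\<in>S. h (g i))" for g and S :: "nat set"
    by (induction S rule: infinite_finite_induct) (simp_all add: assms)
  show ?thesis unfolding cech_def
    by (rule ext) (simp add: fun_sum_apply s ext_wedge_map assms)
qed

lemma cech_del: "cech (\<lambda>W. del (c W)) = (\<lambda>W. del (cech c W))"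
  by (rule cech_map[of del, OF del_add del_uminus del_0])

lemma cech_pm: "cech (\<lambda>W. pm (c W)) = (\<lambda>W. pm (cech c W))"
  by (rule cech_map[of pm, OF pm_add pm_uminus pm_0])

lemma alt_arr: "alt v W (x :: 'c \<Rightarrow> 'b::ab_group_add) y = alt v W (x y)"
  by (simp add: alt_def fun_apply)

lemma kys_alt: "kys (alt v W x) = kys (x :: 'c \<Rightarrow>\<^sub>0 'b::ab_group_add)"
  by (simp add: alt_def kys_uminus)

lemma adm_mono: "adm V \<Longrightarrow> V \<subseteq> W \<Longrightarrow> W \<subseteq> {..<N} \<Longrightarrow> adm W"
  unfolding adm_def by blast

lemma adm_finite: "adm W \<Longrightarrow> finite W"
  unfolding adm_def using finite_subset by blast

lemma Coch_cech:
  assumes c: "Coch s \<tau> a b c"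
  shows "Coch (Suc s) \<tau> a b (cech c)"
  unfolding Coch_def
proof (intro allI ballI)
  fix W \<gamma> A \<alpha> assume k: "\<alpha> \<in> kys (cech c W \<gamma> A)"
  then have "\<alpha> \<in> kys (\<Sum>u<N. ext_wedge u c W \<gamma> A)" by (simp add: cech_def fun_sum_apply)
  then obtain u where u: "u < N" "\<alpha> \<in> kys (ext_wedge u c W \<gamma> A)" by (auto dest: kys_sum)
  then have uW: "u \<in> W" and k': "\<alpha> \<in> kys (c (W - {u}) \<gamma> A)"
    by (auto simp: ext_wedge_def alt_arr kys_alt fun_apply split: if_splits)
  from c k' have *: "adm (W - {u})" "card (W - {u}) = s + 2" "ok \<tau> \<gamma>" "rg (W - {u}) \<alpha>" "dg a b \<gamma> \<alpha>"
    unfolding Coch_def by blast+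
  have "finite W" using adm_finite[OF *(1)] by simp
  then have "card W = Suc s + 2" using *(2) uW by (simp add: card_Diff_singleton_if)
  moreover have "adm W"
    using *(1) by (rule adm_mono) (use *(1) u(1) in \<open>auto simp: adm_def\<close>)
  moreover have "rg W \<alpha>" using *(4) unfolding rg_def by blast
  ultimately show "adm W \<and> card W = Suc s + 2 \<and> ok \<tau> \<gamma> \<and> rg W \<alpha> \<and> dg a b \<gamma> \<alpha>"
    using * by blast
qed

text \<open>The homotopy inserts, monomial by monomial, a variable that occurs in the monomial with
  nonnegative exponent while another variable of the same group occurs with negative exponent;
  then neither regularity nor admissibility is lost on removing the variable.\<close>

lemma cech_exact:
  assumes tg: "\<And>\<gamma> \<alpha>. ok \<tau> \<gamma> \<Longrightarrow> dg a b \<gamma> \<alpha> \<Longrightarrow>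
      \<exists>v<N. 0 \<le> lkp \<alpha> v \<and> (\<exists>u. lkp \<alpha> u < 0 \<and> (u < n1 \<longleftrightarrow> v < n1))"
    and c: "Coch (Suc s) \<tau> a b c" "cech c = 0"
  shows "\<exists>d. Coch s \<tau> a b d \<and> cech d = c"
proof -
  obtain T where T: "\<And>\<gamma> \<alpha>. ok \<tau> \<gamma> \<Longrightarrow> dg a b \<gamma> \<alpha> \<Longrightarrow>
      T \<gamma> \<alpha> < N \<and> 0 \<le> lkp \<alpha> (T \<gamma> \<alpha>) \<and> (\<exists>u. lkp \<alpha> u < 0 \<and> (u < n1 \<longleftrightarrow> T \<gamma> \<alpha> < n1))"
    using tg by metis
  define F where "F = (\<lambda>v (x :: nat multiset \<Rightarrow> nat set \<Rightarrow> 'k laurent) \<gamma> A. filt (\<lambda>\<alpha>. T \<gamma> \<alpha> = v) (x \<gamma> A))"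
  have F0: "F v 0 = 0" and Fu: "F v (- x) = - F v x" and Fa: "F v (x + y) = F v x + F v y" for v x y
    by (intro ext; simp add: F_def fun_apply filt_uminus filt_add)+
  define d where "d = (\<Sum>v<N. (\<lambda>W. F v (ext_contract v c W)))"
  have dk: "adm W \<and> card W = s + 2 \<and> ok \<tau> \<gamma> \<and> rg W \<alpha> \<and> dg a b \<gamma> \<alpha>"
    if k: "\<alpha> \<in> kys (d W \<gamma> A)" for W \<gamma> A \<alpha>
  proof -
    have "\<alpha> \<in> kys (\<Sum>v<N. F v (ext_contract v c W) \<gamma> A)"
      using k by (simp add: d_def fun_sum_apply)
    then obtain v where v: "v < N" "\<alpha> \<in> kys (F v (ext_contract v c W) \<gamma> A)"
      by (auto dest: kys_sum)
    then have t: "T \<gamma> \<alpha> = v" and "\<alpha> \<in> kys (ext_contract v c W \<gamma> A)"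
      by (auto simp: F_def kys_filt)
    then have vW: "v \<notin> W" and k': "\<alpha> \<in> kys (c (insert v W) \<gamma> A)"
      by (auto simp: ext_contract_def alt_arr kys_alt fun_apply split: if_splits)
    from c(1) k' have *: "adm (insert v W)" "card (insert v W) = Suc s + 2" "ok \<tau> \<gamma>"
      "rg (insert v W) \<alpha>" "dg a b \<gamma> \<alpha>"
      unfolding Coch_def by blast+
    from T[OF *(3,5)] t obtain u where u: "0 \<le> lkp \<alpha> v" "lkp \<alpha> u < 0" "u < n1 \<longleftrightarrow> v < n1"
      by blast
    have neg: "x \<in> W" if "lkp \<alpha> x < 0" for x
      using *(4) that u(1) unfolding rg_def by (metis insertE leD)
    have "rg W \<alpha>" using *(4) neg unfolding rg_def by blast
    moreover have "adm W"
      using *(1) neg[OF u(2)] u(3) unfolding adm_def by (auto simp: not_less)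
    moreover have "card W = s + 2" using *(2) vW adm_finite[OF \<open>adm W\<close>] by simp
    ultimately show ?thesis using * by blast
  qed
  then have "Coch s \<tau> a b d" unfolding Coch_def by blast
  moreover have "cech d = c"
  proof -
    have h: "(\<Sum>u<N. ext_wedge u (ext_contract v c)) = c" if "v < N" for v
    proof -
      have "(\<Sum>u<N. ext_wedge u (ext_contract v c))
        = (\<Sum>u<N. (if u = v then c else 0)) - (\<Sum>u<N. ext_contract v (ext_wedge u c))"
        unfolding sum_subtractf[symmetric] by (intro sum.cong refl ext_wedge_contract)
      also have "(\<Sum>u<N. ext_contract v (ext_wedge u c)) = ext_contract v (cech c)"
        by (simp only: cech_def ext_contract_sum)
      also have "\<dots> = 0" by (simp only: c(2) ext_contract_0)
      finally show ?thesis using that by simp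
    qed
    have "cech d = (\<Sum>v<N. cech (\<lambda>W. F v (ext_contract v c W)))"
      unfolding d_def cech_def ext_wedge_sum by (rule sum.swap)
    also have "\<dots> = (\<Sum>v<N. (\<lambda>W. F v (cech (ext_contract v c) W)))"
    proof (rule sum.cong[OF refl])
      fix v
      show "cech (\<lambda>W. F v (ext_contract v c W)) = (\<lambda>W. F v (cech (ext_contract v c) W))"
        by (rule cech_map[of "F v", OF Fa Fu F0])
    qed
    also have "\<dots> = (\<Sum>v<N. (\<lambda>W. F v (c W)))"
      by (intro sum.cong refl) (simp only: cech_def h lessThan_iff)
    also have "\<dots> = c"
    proof (intro ext)
      fix W \<gamma> A
      show "(\<Sum>v<N. (\<lambda>W. F v (c W))) W \<gamma> A = c W \<gamma> A"
      proof (rule poly_mapping_eqI)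
        fix \<alpha>
        have "lkp ((\<Sum>v<N. (\<lambda>W. F v (c W))) W \<gamma> A) \<alpha> = (\<Sum>v<N. if T \<gamma> \<alpha> = v then lkp (c W \<gamma> A) \<alpha> else 0)"
          by (simp add: fun_sum_apply F_def lookup_sum lookup_filt)
        also have "\<dots> = (if T \<gamma> \<alpha> < N then lkp (c W \<gamma> A) \<alpha> else 0)" by simp
        also have "\<dots> = lkp (c W \<gamma> A) \<alpha>"
        proof (cases "\<alpha> \<in> kys (c W \<gamma> A)")
          case True
          then have "ok \<tau> \<gamma>" "dg a b \<gamma> \<alpha>" using c(1) unfolding Coch_def by blast+
          then show ?thesis using T by simp
        qed (simp add: kys_iff)
        finally show "lkp ((\<Sum>v<N. (\<lambda>W. F v (c W))) W \<gamma> A) \<alpha> = lkp (c W \<gamma> A) \<alpha>" .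
      qed
    qed
    finally show ?thesis .
  qed
  ultimately show ?thesis by blast
qed

section \<open>Line bundles without cohomology\<close>

lemma mixed_signs:
  fixes \<alpha> :: "nat \<Rightarrow>\<^sub>0 int"
  assumes "finite S" "- int (card S) < (\<Sum>v\<in>S. lkp \<alpha> v)" "(\<Sum>v\<in>S. lkp \<alpha> v) < 0"
  shows "\<exists>v\<in>S. \<exists>u\<in>S. 0 \<le> lkp \<alpha> v \<and> lkp \<alpha> u < 0"
proof -
  have "\<exists>v\<in>S. 0 \<le> lkp \<alpha> v"
  proof (rule ccontr)
    assume "\<not> ?thesis"
    then have "(\<Sum>v\<in>S. lkp \<alpha> v) \<le> (\<Sum>v\<in>S. - 1)" by (intro sum_mono) force
    then show False using assms(2) by simp
  qed
  moreover have "\<exists>u\<in>S. lkp \<alpha> u < 0"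
  proof (rule ccontr)
    assume "\<not> ?thesis"
    then have "0 \<le> (\<Sum>v\<in>S. lkp \<alpha> v)" by (intro sum_nonneg) force
    then show False using assms(3) by simp
  qed
  ultimately show ?thesis by blast
qed

text \<open>Monomial form of the fact that a line bundle of degree strictly between -n1 and 0 on a
  projective space of dimension n1 - 1 has no cohomology: exponents of both signs must
  occur.\<close>

lemma toggle_x:
  assumes "- int n1 < xd \<alpha>" "xd \<alpha> < 0"
  shows "\<exists>v<N. 0 \<le> lkp \<alpha> v \<and> (\<exists>u. lkp \<alpha> u < 0 \<and> (u < n1 \<longleftrightarrow> v < n1))"
proof -
  obtain v u where "v < n1" "u < n1" "0 \<le> lkp \<alpha> v" "lkp \<alpha> u < 0"
    using mixed_signs[of "{..<n1}" \<alpha>] assms by (auto simp: xd_def)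
  then show ?thesis by (intro exI[of _ v]) (auto simp: N_def)
qed

lemma toggle_y:
  assumes "- int n2 < yd \<alpha>" "yd \<alpha> < 0"
  shows "\<exists>v<N. 0 \<le> lkp \<alpha> v \<and> (\<exists>u. lkp \<alpha> u < 0 \<and> (u < n1 \<longleftrightarrow> v < n1))"
proof -
  have "card {n1..<N} = n2" by (simp add: N_def)
  then obtain v u where "n1 \<le> v" "v < N" "n1 \<le> u" "0 \<le> lkp \<alpha> v" "lkp \<alpha> u < 0"
    using mixed_signs[of "{n1..<N}" \<alpha>] assms unfolding yd_def by auto
  then show ?thesis by (intro exI[of _ v]) auto
qed

text \<open>The first degree is -1 - gy, which is at most -n1 only if gy is at least n1 - 1. Then gx
  + gy at most N - 3 leaves gx at most n2 - 2, and the second factor has no cohomology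
  instead.\<close>

lemma toggle:
  assumes "ok \<tau> \<gamma>" "dg (- 1) (- 1) \<gamma> \<alpha>" "\<tau> \<le> N - 3"
  shows "\<exists>v<N. 0 \<le> lkp \<alpha> v \<and> (\<exists>u. lkp \<alpha> u < 0 \<and> (u < n1 \<longleftrightarrow> v < n1))"
proof (cases "gy \<gamma> \<le> int n1 - 2")
  case True
  then show ?thesis using assms(2) gy_nonneg[of \<gamma>] by (intro toggle_x) (simp_all add: dg_def)
next
  case False
  then have "gx \<gamma> \<le> int n2 - 2"
    using gx_gy[of \<gamma>] assms(1,3) n1 n2 by (simp add: ok_def N_def)
  then show ?thesis using assms(2) gx_nonneg[of \<gamma>] by (intro toggle_y) (simp_all add: dg_def)
qed

text \<open>The twist is lower by one in each factor, so the room for gx + gy shrinks by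
  two.\<close>

lemma toggle2:
  assumes "ok \<tau> \<gamma>" "dg (- 2) (- 2) \<gamma> \<alpha>" "\<tau> + 5 \<le> N"
  shows "\<exists>v<N. 0 \<le> lkp \<alpha> v \<and> (\<exists>u. lkp \<alpha> u < 0 \<and> (u < n1 \<longleftrightarrow> v < n1))"
proof (cases "gy \<gamma> \<le> int n1 - 3")
  case True
  then show ?thesis using assms(2) gy_nonneg[of \<gamma>] by (intro toggle_x) (simp_all add: dg_def)
next
  case False
  then have "gx \<gamma> \<le> int n2 - 3"
    using gx_gy[of \<gamma>] assms(1,3) n1 n2 by (simp add: ok_def N_def)
  then show ?thesis using assms(2) gx_nonneg[of \<gamma>] by (intro toggle_y) (simp_all add: dg_def)
qed

end

section \<open>Splittings on the charts from generation up to powers of variables\<close>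

locale bigraded_generated = bigraded +
  assumes char: "\<And>k. 0 < k \<Longrightarrow> k + 4 \<le> n1 + n2 \<Longrightarrow> of_nat k \<noteq> (0 :: 'a)"
    and gen: "\<exists>D. \<forall>i<n1. \<forall>j<n2. \<forall>i'<n1. \<forall>j'<n2. \<exists>g. (\<forall>l. g l \<in> R {}) \<and>
      (\<forall>v<N. (\<Sum>l<\<kappa>. f v l * g l) = (z i' * z (n1 + j')) ^ D *
        ((if v = i then z (n1 + j) else 0) - (if v = n1 + j then z i else 0)))"
begin

text \<open>On the chart a power of z_w z_y becomes a unit, so the Koszul syzygies themselves are
  combinations of columns. Suitable combinations have a unit vector as coordinates away from w; the
  coordinate at w is left free because the relation determines it.\<close>

lemma koszul_local_adm:
  assumes W: "adm W"
  shows "\<exists>k w. w < n1 \<and> w \<in> W \<and> koszul_local N \<kappa> z zi f (R W) k w (N - 4)"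
proof -
  obtain w y where w: "w \<in> W" "w < n1" and y: "y \<in> W" "n1 \<le> y" and WN: "W \<subseteq> {..<N}"
    using W unfolding adm_def by blast
  have wN: "w < N" and yN: "y < N" using w y WN by auto
  obtain D where D: "\<And>i j i' j'. i < n1 \<Longrightarrow> j < n2 \<Longrightarrow> i' < n1 \<Longrightarrow> j' < n2 \<Longrightarrow> \<exists>g. (\<forall>l. g l \<in> R {}) \<and>
      (\<forall>v<N. (\<Sum>l<\<kappa>. f v l * g l) = (z i' * z (n1 + j')) ^ D *
        ((if v = i then z (n1 + j) else 0) - (if v = n1 + j then z i else 0)))"
    using gen by blast
  define u where "u = (zi w * zi y) ^ D"
  have uR: "u \<in> R W"
  proof -
    have "zi w * zi y \<in> R W" by (intro R_mult R_zi w y wN yN)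
    then show ?thesis unfolding u_def by (induction D) (auto intro: R_1 R_mult)
  qed
  have u1: "u * (z w * z y) ^ D = 1"
  proof -
    have "zi w * zi y * (z w * z y) = (z w * zi w) * (z y * zi y)" by (simp add: algebra_simps)
    then show ?thesis by (simp add: u_def z_zi wN yN flip: power_mult_distrib)
  qed
  define P where "P = (\<lambda>i j G. (\<forall>l. G l \<in> R W) \<and> (\<forall>v<N. (\<Sum>l<\<kappa>. f v l * G l) =
        (if v = i then z j else 0) - (if v = j then z i else 0)))"
  have ex: "\<exists>G. P i j G" if ij: "i < n1" "n1 \<le> j" "j < N" for i j
  proof -
    have e: "n1 + (j - n1) = j" "n1 + (y - n1) = y" and "j - n1 < n2" "y - n1 < n2"
      using ij y yN by (auto simp: N_def)
    then obtain g where g: "\<And>l. g l \<in> R {}" "\<And>v. v < N \<Longrightarrow> (\<Sum>l<\<kappa>. f v l * g l)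
        = (z w * z y) ^ D * ((if v = i then z j else 0) - (if v = j then z i else 0))"
      using D[of i "j - n1" w "y - n1", unfolded e] ij w y by blast
    have "(\<Sum>l<\<kappa>. f v l * (u * g l)) = (if v = i then z j else 0) - (if v = j then z i else 0)"
      if "v < N" for v
    proof -
      have "(\<Sum>l<\<kappa>. f v l * (u * g l)) = u * (\<Sum>l<\<kappa>. f v l * g l)"
        by (simp add: sum_distrib_left algebra_simps)
      also have "\<dots> = (u * (z w * z y) ^ D) * ((if v = i then z j else 0) - (if v = j then z i else 0))"
        by (simp only: g(2)[OF that] mult.assoc)
      finally show ?thesis by (simp only: u1 mult_1)
    qed
    moreover have "u * g l \<in> R W" for l
      using g(1)[of l] R_mono[of "{}" W] by (intro R_mult uR) auto
    ultimately show ?thesis 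
      unfolding P_def by (intro exI[of _ "\<lambda>l. u * g l"]) blast
  qed
  define G where "G = (\<lambda>i j. SOME G. P i j G)"
  have GP: "P i j (G i j)" if "i < n1" "n1 \<le> j" "j < N" for i j
    unfolding G_def using someI_ex[OF ex[OF that]] .
  have G: "i < n1 \<Longrightarrow> n1 \<le> j \<Longrightarrow> j < N \<Longrightarrow> G i j l \<in> R W"
    "i < n1 \<Longrightarrow> n1 \<le> j \<Longrightarrow> j < N \<Longrightarrow> v < N \<Longrightarrow> (\<Sum>l<\<kappa>. f v l * G i j l) =
        (if v = i then z j else 0) - (if v = j then z i else 0)" for i j v l
    using GP unfolding P_def by blast+
  \<comment> \<open>For v in the second group the syzygy of w and v, divided by -z_w, has entry 1 at
    v and otherwise only an entry at w. For v in the first group a multiple of the syzygy of w and y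
    is subtracted to cancel the entry at y.\<close>
  define k where "k = (\<lambda>v l. if n1 \<le> v then - (zi w * G w v l)
      else zi y * (G v y l - z v * zi w * G w y l))"
  have kR: "k v l \<in> R W" if "v < N" for v l
    using that w y yN wN unfolding k_def
    by (auto simp: diff_conv_add_uminus simp del: add_uminus_conv_diff
        intro!: R_uminus R_mult R_zi R_add R_z G)
  have dual: "(\<Sum>l<\<kappa>. f u l * k v l) = (if u = v then 1 else 0)"
    if uv: "u < N" "u \<noteq> w" "v < N" "v \<noteq> w" for u v
  proof (cases "n1 \<le> v")
    case True
    have g: "(\<Sum>l<\<kappa>. f u l * G w v l) = (if u = v then - z w else 0)"
      using uv True w by (subst G(2)) auto
    have "(\<Sum>l<\<kappa>. f u l * k v l) = - (zi w * (\<Sum>l<\<kappa>. f u l * G w v l))"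
      using True by (simp add: k_def sum_distrib_left sum_negf algebra_simps)
    also have "\<dots> = (if u = v then z w * zi w else 0)"
      unfolding g by (simp add: mult.commute)
    finally show ?thesis using z_zi wN by simp
  next
    case False
    have g1: "(\<Sum>l<\<kappa>. f u l * G v y l) = (if u = v then z y else 0) - (if u = y then z v else 0)"
      using uv False y yN by (subst G(2)) auto
    have g2: "(\<Sum>l<\<kappa>. f u l * G w y l) = (if u = y then - z w else 0)"
      using uv w y yN by (subst G(2)) auto
    have "(\<Sum>l<\<kappa>. f u l * k v l)
      = zi y * ((\<Sum>l<\<kappa>. f u l * G v y l) - z v * zi w * (\<Sum>l<\<kappa>. f u l * G w y l))"
      using False by (simp add: k_def sum_distrib_left sum_subtractf algebra_simps)
    also have "\<dots> = zi y * ((if u = v then z y else 0) - (if u = y then z v else 0)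
        + (if u = y then z v * (z w * zi w) else 0))"
      unfolding g1 g2 by (simp add: algebra_simps)
    also have "\<dots> = (if u = v then z y * zi y else 0)"
      by (simp add: z_zi[OF wN] mult.commute[of "zi y"])
    finally show ?thesis using z_zi yN by simp
  qed
  have "koszul_local N \<kappa> z zi f (R W) k w (N - 4)"
  proof unfold_locales
    fix n :: nat assume n: "0 < n" "n \<le> N - 4"
    then have "of_nat n \<noteq> (0 :: 'a)" using char by (simp add: N_def)
    then have "of_nat n * (Poly_Mapping.single 0 (inverse (of_nat n)) :: 'a laurent) = 1"
      by (simp add: mult_single flip: single_of_nat)
    then show "\<exists>i\<in>R W. of_nat n * i = 1" using R_const by blast
  qed (use w wN in \<open>simp_all add: R_0 R_1 R_add R_mult R_uminus R_z R_zi R_f kR dual\<close>)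
  then show ?thesis using w by blast
qed

end

section \<open>The zigzag\<close>

context bigraded
begin

lemma EW_0 [simp]: "0 \<in> EW W"
  by (simp add: EW_def fun_apply R_0)

lemma EW_sum: "(\<And>i. i \<in> S \<Longrightarrow> g i \<in> EW W) \<Longrightarrow> sum g S \<in> EW W"
  unfolding EW_def by (auto simp: fun_sum_apply intro!: R_sum)

lemma EW_scl: "c \<in> R W \<Longrightarrow> a \<in> EW W \<Longrightarrow> scl c a \<in> EW W"
  by (simp add: EW_def scl_def R_mult)

lemma EW_add: "a \<in> EW W \<Longrightarrow> b \<in> EW W \<Longrightarrow> a + b \<in> EW W"
  by (simp add: EW_def fun_apply R_add)

lemma EW_ct: "a \<in> EW W \<Longrightarrow> ct v a \<in> EW W"
  unfolding ct_def contract_def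
  by (intro EW_sum EW_scl R_f) (auto simp: EW_def ext_contract_def alt_def R_0 R_uminus)

lemma EW_cts: "a \<in> EW W \<Longrightarrow> cts xs a \<in> EW W"
  by (induction xs) (simp_all add: EW_ct)

lemma EW_del: "(\<And>\<gamma>. c \<gamma> \<in> EW W) \<Longrightarrow> del c \<gamma> \<in> EW W"
  unfolding del_def by (intro EW_sum EW_ct)

lemma EW_sum_mset: "(\<And>i. i \<in># M \<Longrightarrow> g i \<in> EW W) \<Longrightarrow> (\<Sum>i\<in>#M. g i) \<in> EW W"
  by (induction M) (auto intro: EW_add)

lemma EW_pm: "(\<And>\<gamma>. c \<gamma> \<in> EW W) \<Longrightarrow> pm c \<gamma> \<in> EW W"
  unfolding pm_def by (intro EW_sum_mset EW_scl R_z)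

lemma EW_cr:
  assumes "adm W" "a \<in> EW W"
  shows "cr a \<in> EW W"
proof -
  obtain w where w: "w \<in> W" "w < N" using assms(1) unfolding adm_def by blast
  obtain s where s: "s \<in> {1, - 1}" "cr a = scl (s * zi w) (cts (others w) a)"
    using cr_others[OF w(2)] by blast
  have "s \<in> R W" using s(1) R_1 R_uminus by auto
  then show ?thesis unfolding s(2) by (intro EW_scl R_mult R_zi w EW_cts assms)
qed

lemma Loc_del: "Loc W (Suc \<tau>) a b c \<Longrightarrow> Loc W \<tau> a b (del c)"
  using Loc_pj[of "del c" W \<tau> a b] by (simp add: pj_del pj_id Loc_EW EW_del)

lemma Loc_pm: "Loc W \<tau> a b c \<Longrightarrow> Loc W (Suc \<tau>) (a + 1) (b + 1) (pm c)"
  using Loc_pj[of "pm c" W "Suc \<tau>" "a + 1" "b + 1"] by (simp add: pj_pm pj_id Loc_EW EW_pm)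

text \<open>The augmentation as an operator on families, so that it acts on Cech cochains like
  \<open>del\<close>; only the empty multiset matters in divided degree zero.\<close>

definition crr :: "(nat multiset \<Rightarrow> nat set \<Rightarrow> 'k laurent) \<Rightarrow> nat multiset \<Rightarrow> nat set \<Rightarrow> 'k laurent"
  where "crr c \<gamma> = (if \<gamma> = {#} then cr (c {#}) else 0)"

lemma crr_add: "crr (c + d) = crr c + crr d" and crr_uminus: "crr (- c) = - crr c"
  and crr_0 [simp]: "crr 0 = 0"
  by (rule ext; simp add: crr_def arr_apply cr_add cr_uminus)+

lemma crr_diff: "crr (c - d) = crr c - crr d"
  using crr_add[of c "- d"] by (simp add: crr_uminus)

lemma ok_empty: "ok 0 \<gamma> \<longleftrightarrow> \<gamma> = {#}"
  by (auto simp: ok_def)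

lemma gx_empty [simp]: "gx {#} = 0" and gy_empty [simp]: "gy {#} = 0"
  by (simp_all add: gx_def gy_def)

lemma pj_crr: "pj 0 (a + int n2 - 1) (b + int n1 - 1) (crr c) = crr (pj 0 a b c)"
  by (rule ext) (simp add: pj_alt ok_empty crr_def fd_cr)

lemma Loc_crr: "adm W \<Longrightarrow> Loc W 0 a b c \<Longrightarrow> Loc W 0 (a + int n2 - 1) (b + int n1 - 1) (crr c)"
  using Loc_pj[of "crr c" W 0 "a + int n2 - 1" "b + int n1 - 1"]
  by (simp add: pj_crr pj_id) (simp add: crr_def Loc_EW EW_cr)

text \<open>Correction terms for divided degree \<open>\<tau>\<close> have degree
  \<open>\<tau> - 1\<close> and the lower twist (-2, -2); in degree 0 there are none.\<close>

definition Pch :: "nat \<Rightarrow> nat \<Rightarrow> (nat set \<Rightarrow> nat multiset \<Rightarrow> nat set \<Rightarrow> 'k laurent) \<Rightarrow> bool"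
  where "Pch s \<tau> e \<longleftrightarrow> (case \<tau> of 0 \<Rightarrow> e = 0 | Suc t \<Rightarrow> Coch s t (- 2) (- 2) e)"

text \<open>Cycles of the Buchsbaum-Rim complex modulo \<open>pm\<close>, with the augmentation in
  place of \<open>del\<close> in degree 0.\<close>

definition Zc :: "nat \<Rightarrow> nat \<Rightarrow> (nat set \<Rightarrow> nat multiset \<Rightarrow> nat set \<Rightarrow> 'k laurent) \<Rightarrow> bool"
  where "Zc s \<tau> c \<longleftrightarrow> (case \<tau> of 0 \<Rightarrow> \<forall>W. cr (c W {#}) = 0
    | Suc t \<Rightarrow> \<exists>e. Pch s t e \<and> (\<lambda>W. del (c W)) = (\<lambda>W. pm (e W)))"

lemma Pch_0 [simp]: "Pch s \<tau> 0"
  by (simp add: Pch_def split: nat.split)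

lemma Pch_add: "Pch s \<tau> c \<Longrightarrow> Pch s \<tau> d \<Longrightarrow> Pch s \<tau> (c + d)"
  by (cases \<tau>) (simp_all add: Pch_def Coch_add)

lemma Pch_diff: "Pch s \<tau> c \<Longrightarrow> Pch s \<tau> d \<Longrightarrow> Pch s \<tau> (c - d)"
  by (cases \<tau>) (simp_all add: Pch_def Coch_diff)

lemma Pch_cech: "Pch s \<tau> c \<Longrightarrow> Pch (Suc s) \<tau> (cech c)"
  by (cases \<tau>) (simp_all add: Pch_def Coch_cech)

lemma Coch_del: "Coch s (Suc \<tau>) a b c \<Longrightarrow> Coch s \<tau> a b (\<lambda>W. del (c W))"
  by (rule Coch_map) (auto intro: Loc_del)

lemma Coch_pm: "Coch s \<tau> (- 2) (- 2) c \<Longrightarrow> Coch s (Suc \<tau>) (- 1) (- 1) (\<lambda>W. pm (c W))"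
  by (rule Coch_map) (auto dest: Loc_pm)

lemma Pch_del:
  assumes "Coch s \<tau> (- 2) (- 2) c"
  shows "Pch s \<tau> (\<lambda>W. del (c W))"
proof (cases \<tau>)
  case 0
  have "del (c W) = 0" for W
  proof (rule ext)
    fix \<gamma>
    have "c W (add_mset v \<gamma>) = 0" for v
      using Coch_Loc[OF assms] by (rule Loc_zero) (simp add: 0 ok_def)
    then show "del (c W) \<gamma> = 0 \<gamma>" by (simp add: del_def arr_apply)
  qed
  then show ?thesis by (simp add: Pch_def 0 zero_fun_def)
qed (use assms in \<open>simp add: Pch_def Coch_del\<close>)

lemma Zc_del:
  assumes "Coch s (Suc \<tau>) a b c"
  shows "Zc s \<tau> (\<lambda>W. del (c W))"
  unfolding Zc_def
proof (cases \<tau>)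
  case (Suc t)
  have "(\<lambda>W. del (del (c W))) = (\<lambda>W. pm ((0 :: nat set \<Rightarrow> _) W))" by (simp add: fun_apply(2))
  then show "case \<tau> of 0 \<Rightarrow> \<forall>W. cr (del (c W) {#}) = 0
      | Suc t \<Rightarrow> \<exists>e. Pch s t e \<and> (\<lambda>W. del (del (c W))) = (\<lambda>W. pm (e W))"
    unfolding Suc nat.case by (intro exI[of _ 0] conjI Pch_0)
qed simp

end

context bigraded_generated
begin

text \<open>A solution on the chart exists by \<open>cr_del_exact\<close> or
  \<open>del_exact\<close>; projecting it to its bidegree keeps it a solution because c is
  homogeneous already.\<close>

lemma local_exact:
  assumes W: "adm W" and c: "Loc W \<tau> (- 1) (- 1) c" and \<tau>: "\<tau> + 4 \<le> N"
    and Z: "\<tau> = 0 \<Longrightarrow> cr (c {#}) = 0"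
      "0 < \<tau> \<Longrightarrow> del c = pm e'" "\<And>\<gamma>. Suc (Suc (size \<gamma>)) \<noteq> \<tau> \<Longrightarrow> e' \<gamma> = 0"
  shows "\<exists>b e. Loc W (Suc \<tau>) (- 1) (- 1) b \<and>
    (case \<tau> of 0 \<Rightarrow> e = 0 | Suc t \<Rightarrow> Loc W t (- 2) (- 2) e) \<and> c = del b + pm e"
proof -
  obtain k w where "koszul_local N \<kappa> z zi f (R W) k w (N - 4)"
    using koszul_local_adm[OF W] by blast
  then interpret L: koszul_local N \<kappa> z zi f "R W" k w "N - 4" .
  have E: "L.E = EW W" by (simp add: L.E_def EW_def)
  show ?thesis
  proof (cases \<tau>)
    case 0
    obtain b where b: "\<And>\<gamma>. b \<gamma> \<in> EW W" "c {#} = del b {#}"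
      using L.cr_del_exact[of "c {#}"] Z(1) 0 Loc_EW[OF c] unfolding E by blast
    have "pj 0 (- 1) (- 1) c = pj 0 (- 1) (- 1) (del b)"
      by (rule ext) (simp add: pj_alt ok_empty b(2))
    then have "c = del (pj 1 (- 1) (- 1) b)" using c by (simp add: 0 pj_id pj_del)
    moreover have "Loc W 1 (- 1) (- 1) (pj 1 (- 1) (- 1) b)" by (intro Loc_pj b)
    ultimately show ?thesis
      by (intro exI[of _ "pj 1 (- 1) (- 1) b"] exI[of _ 0]) (simp add: 0)
  next
    case (Suc t)
    have "\<exists>b e. (\<forall>\<gamma>. b \<gamma> \<in> EW W) \<and> (\<forall>\<gamma>. e \<gamma> \<in> EW W) \<and>
      (\<forall>\<gamma>. size \<gamma> = \<tau> \<longrightarrow> set_mset \<gamma> \<subseteq> {..<N} \<longrightarrow> c \<gamma> = (del b + pm e) \<gamma>)"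
      unfolding E[symmetric]
    proof (rule L.del_exact)
      show "c \<gamma> \<in> L.E" for \<gamma> unfolding E using Loc_EW[OF c] .
      show "c \<gamma> = 0" if "size \<gamma> \<noteq> \<tau>" for \<gamma> using Loc_zero[OF c] that by (simp add: ok_def)
      show "del c = pm e'" using Z(2) Suc by simp
      show "e' \<gamma> = 0" if "Suc (Suc (size \<gamma>)) \<noteq> \<tau>" for \<gamma> using Z(3) that .
    qed (use \<tau> Suc in auto)
    then obtain b e where be: "\<And>\<gamma>. b \<gamma> \<in> EW W" "\<And>\<gamma>. e \<gamma> \<in> EW W"
      "\<And>\<gamma>. ok \<tau> \<gamma> \<Longrightarrow> c \<gamma> = (del b + pm e) \<gamma>"
      unfolding ok_def by blast
    have "pj \<tau> (- 1) (- 1) c = pj \<tau> (- 1) (- 1) (del b + pm e)"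
      by (rule ext) (simp add: pj_alt be(3))
    then have "c = del (pj (Suc \<tau>) (- 1) (- 1) b) + pm (pj t (- 2) (- 2) e)"
      using pj_pm[of t "- 2" "- 2" e] c by (simp add: pj_id pj_add pj_del Suc)
    moreover have "Loc W (Suc \<tau>) (- 1) (- 1) (pj (Suc \<tau>) (- 1) (- 1) b)"
      "Loc W t (- 2) (- 2) (pj t (- 2) (- 2) e)"
      by (intro Loc_pj be)+
    ultimately show ?thesis
      by (intro exI[of _ "pj (Suc \<tau>) (- 1) (- 1) b"] exI[of _ "pj t (- 2) (- 2) e"]) (simp add: Suc)
  qed
qed

text \<open>Cochains are arbitrary families over the charts, so the solutions on single charts only
  have to be chosen, with zero at sets that are not indices of the given Cech degree.\<close>

lemma cochain_exact:
  assumes c: "Coch s \<tau> (- 1) (- 1) c" "Zc s \<tau> c" and \<tau>: "\<tau> + 4 \<le> N"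
  shows "\<exists>b e. Coch s (Suc \<tau>) (- 1) (- 1) b \<and> Pch s \<tau> e \<and> c = (\<lambda>W. del (b W)) + (\<lambda>W. pm (e W))"
proof -
  define Q where "Q = (\<lambda>W b e. Loc W (Suc \<tau>) (- 1) (- 1) b \<and>
    (case \<tau> of 0 \<Rightarrow> e = 0 | Suc t \<Rightarrow> Loc W t (- 2) (- 2) e) \<and> c W = del b + pm e)"
  have ex: "\<exists>b e. Q W b e" if W: "adm W" for W
  proof (cases \<tau>)
    case 0
    then show ?thesis
      unfolding Q_def using local_exact[OF W Coch_Loc[OF c(1)] \<tau>, of 0] c(2) by (simp add: Zc_def fun_apply(2))
  next
    case (Suc t)
    then obtain e where e: "Pch s t e" "\<And>W. del (c W) = pm (e W)"
      using c(2) by (auto simp: Zc_def fun_eq_iff)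
    have "e W \<gamma> = 0" if "Suc (Suc (size \<gamma>)) \<noteq> \<tau>" for \<gamma>
    proof (cases t)
      case 0
      then show ?thesis using e(1) by (simp add: Pch_def fun_apply)
    next
      case (Suc t')
      then have "Coch s t' (- 2) (- 2) e" using e(1) by (simp add: Pch_def)
      from Coch_Loc[OF this] show ?thesis
        by (rule Loc_zero) (use that \<open>\<tau> = Suc t\<close> Suc in \<open>simp add: ok_def\<close>)
    qed
    then show ?thesis
      unfolding Q_def using local_exact[OF W Coch_Loc[OF c(1)] \<tau>, of "e W"] e(2) Suc by simp
  qed
  define b where "b = (\<lambda>W. if adm W \<and> card W = s + 2 then SOME b. \<exists>e. Q W b e else 0)"
  define e where "e = (\<lambda>W. if adm W \<and> card W = s + 2 then SOME e. Q W (b W) e else 0)"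
  have Q: "Q W (b W) (e W)" if W: "adm W \<and> card W = s + 2" for W
  proof -
    have "\<exists>e. Q W (b W) e" using someI_ex[OF ex, of W] W by (simp add: b_def)
    from someI_ex[OF this] show ?thesis using W by (simp add: e_def)
  qed
  have "Coch s (Suc \<tau>) (- 1) (- 1) b"
  proof (rule CochI)
    show "Loc W (Suc \<tau>) (- 1) (- 1) (b W)" if "adm W" "card W = s + 2" for W
      using Q[of W] that by (simp add: Q_def)
    show "b W = 0" if "\<not> (adm W \<and> card W = s + 2)" for W
      unfolding b_def using that by (rule if_not_P)
  qed
  moreover have "Pch s \<tau> e"
  proof (cases \<tau>)
    case 0
    have "e W = 0" for W
      using Q[of W] by (cases "adm W \<and> card W = s + 2") (auto simp: Q_def 0 e_def)
    then show ?thesis by (simp add: Pch_def 0 fun_eq_iff fun_apply)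
  next
    case (Suc t)
    have "Coch s t (- 2) (- 2) e"
    proof (rule CochI)
      show "Loc W t (- 2) (- 2) (e W)" if "adm W" "card W = s + 2" for W
        using Q[of W] that by (simp add: Q_def Suc)
      show "e W = 0" if "\<not> (adm W \<and> card W = s + 2)" for W
        unfolding e_def using that by (rule if_not_P)
    qed
    then show ?thesis by (simp add: Pch_def Suc)
  qed
  moreover have "c = (\<lambda>W. del (b W)) + (\<lambda>W. pm (e W))"
  proof (rule ext)
    fix W
    have "c W = del (b W) + pm (e W)"
    proof (cases "adm W \<and> card W = s + 2")
      case True
      then show ?thesis using Q[OF True] by (simp add: Q_def)
    next
      case False
      then have "b W = 0" "e W = 0" "c W = 0" using Coch_zero[OF c(1) False] by (auto simp: b_def e_def)
      then show ?thesis by simp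
    qed
    then show "c W = ((\<lambda>W. del (b W)) + (\<lambda>W. pm (e W))) W" by (simp add: fun_apply(1))
  qed
  ultimately show ?thesis by blast
qed

section \<open>Vanishing cohomology of the cycles by descending induction\<close>

lemma pm_inject:
  assumes c: "Coch s \<tau> (- 2) (- 2) c" "\<And>W. pm (c W) = 0" and \<tau>: "\<tau> + 5 \<le> N"
  shows "c = 0"
proof (rule ext)
  fix W
  show "c W = 0 W"
  proof (cases "adm W")
    case False
    then show ?thesis using Coch_zero[OF c(1)] by (simp add: fun_apply)
  next
    case True
    obtain k w where "koszul_local N \<kappa> z zi f (R W) k w (N - 4)"
      using koszul_local_adm[OF True] by blast
    then interpret L: koszul_local N \<kappa> z zi f "R W" k w "N - 4" .
    \<comment> \<open>Multiplicities are at most \<open>\<tau>\<close>, so undoing \<open>pm\<close>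
      divides by integers up to \<open>\<tau> + 1\<close>; the bound
      \<open>\<tau> + 5 \<le> N\<close> makes them units.\<close>
    have "c W \<gamma> = 0" for \<gamma>
    proof (rule L.pm_unique[of "c W" "Suc \<tau>"])
      show "pm (c W) \<gamma> = 0" for \<gamma> by (simp add: c(2) arr_apply)
      show "c W \<gamma> = 0" if "Suc \<tau> \<le> count \<gamma> w" for \<gamma>
        using Coch_Loc[OF c(1)] by (rule Loc_zero) (use that count_le_size[of \<gamma> w] in \<open>auto simp: ok_def\<close>)
    qed (use \<tau> in auto)
    then show ?thesis by (intro ext) (simp add: fun_apply)
  qed
qed

text \<open>Cech cohomology in degree \<open>\<tau> + 2\<close> of the cycles in divided degree
  \<open>\<tau>\<close> vanishes, everything modulo \<open>pm\<close>. The offset 2 is the Cech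
  degree in which the obstruction to a global lift appears for \<open>\<tau> = 0\<close>.\<close>

definition HZ :: "nat \<Rightarrow> bool"
  where "HZ \<tau> \<longleftrightarrow> (\<forall>c e. Coch (\<tau> + 2) \<tau> (- 1) (- 1) c \<longrightarrow> Zc (\<tau> + 2) \<tau> c \<longrightarrow> Pch (\<tau> + 3) \<tau> e \<longrightarrow>
    cech c = (\<lambda>W. pm (e W)) \<longrightarrow>
    (\<exists>b e'. Coch (\<tau> + 1) \<tau> (- 1) (- 1) b \<and> Zc (\<tau> + 1) \<tau> b \<and> Pch (\<tau> + 2) \<tau> e' \<and>
      c = cech b + (\<lambda>W. pm (e' W))))"

text \<open>Lifting c along \<open>del\<close> gives b in Cech degree N - 2, the dimension of the
  product of projective spaces and hence the last one. So b is closed for lack of larger index sets,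
  and exact because its twist has no cohomology.\<close>

lemma HZ_top: "HZ (N - 4)"
  unfolding HZ_def
proof (intro allI impI)
  have N4: "4 \<le> N" using n1 n2 by (simp add: N_def)
  fix c e
  assume c: "Coch (N - 4 + 2) (N - 4) (- 1) (- 1) c" "Zc (N - 4 + 2) (N - 4) c"
  have s2: "N - 4 + 2 = N - 2" and s1: "N - 4 + 1 = N - 3" and t: "Suc (N - 4) = N - 3" using N4 by auto
  obtain b e1 where b: "Coch (N - 2) (N - 3) (- 1) (- 1) b" and e1: "Pch (N - 2) (N - 4) e1"
    and ce: "c = (\<lambda>W. del (b W)) + (\<lambda>W. pm (e1 W))"
    using cochain_exact[OF c] N4 unfolding s2 t by auto
  have "cech b = 0"
  proof (rule ext)
    fix W
    have "\<not> (adm W \<and> card W = Suc (N - 2) + 2)"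
    proof
      assume a: "adm W \<and> card W = Suc (N - 2) + 2"
      then have "card W \<le> N" unfolding adm_def using card_mono[of "{..<N}" W] by simp
      then show False using a N4 by simp
    qed
    from Coch_zero[OF Coch_cech[OF b] this] show "cech b W = 0 W" by (simp add: fun_apply(2))
  qed
  moreover have "N - 2 = Suc (N - 3)" using N4 by simp
  ultimately obtain b2 where b2: "Coch (N - 3) (N - 3) (- 1) (- 1) b2" "cech b2 = b"
    using cech_exact[of "N - 3" "- 1" "- 1" "N - 3" b] toggle b by auto
  have "c = cech (\<lambda>W. del (b2 W)) + (\<lambda>W. pm (e1 W))" by (simp add: ce cech_del b2(2))
  moreover have "Coch (N - 3) (N - 4) (- 1) (- 1) (\<lambda>W. del (b2 W))"
    and "Zc (N - 3) (N - 4) (\<lambda>W. del (b2 W))"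
    using b2(1) by (auto simp flip: t intro: Coch_del Zc_del)
  ultimately show "\<exists>b e'. Coch (N - 4 + 1) (N - 4) (- 1) (- 1) b \<and> Zc (N - 4 + 1) (N - 4) b \<and>
      Pch (N - 4 + 2) (N - 4) e' \<and> c = cech b + (\<lambda>W. pm (e' W))"
    unfolding s1 s2 using e1 by blast
qed

text \<open>The long exact sequence of cycles, chains and boundaries: the chains in divided degree
  \<open>\<tau> + 1\<close> have no cohomology, so the group for \<open>\<tau>\<close> embeds into
  the one for \<open>\<tau> + 1\<close>, which vanishes by assumption. The correction terms have to
  be chased along.\<close>

lemma HZ_step:
  assumes IH: "HZ (Suc \<tau>)" and \<tau>: "\<tau> + 5 \<le> N"
  shows "HZ \<tau>"
  unfolding HZ_def
proof (intro allI impI)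
  fix c e
  assume c: "Coch (\<tau> + 2) \<tau> (- 1) (- 1) c" "Zc (\<tau> + 2) \<tau> c" and e: "Pch (\<tau> + 3) \<tau> e"
    "cech c = (\<lambda>W. pm (e W))"
  obtain b e1 where b: "Coch (\<tau> + 2) (Suc \<tau>) (- 1) (- 1) b" and e1: "Pch (\<tau> + 2) \<tau> e1"
    and ce: "c = (\<lambda>W. del (b W)) + (\<lambda>W. pm (e1 W))"
    using cochain_exact[OF c] \<tau> by auto
  have db: "Coch (\<tau> + 3) (Suc \<tau>) (- 1) (- 1) (cech b)"
    using Coch_cech[OF b] by (simp add: eval_nat_numeral)
  have "(\<lambda>W. del (cech b W)) = cech c - cech (\<lambda>W. pm (e1 W))"
    by (simp add: ce cech_add cech_del)
  also have "\<dots> = (\<lambda>W. pm ((e - cech e1) W))"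
    by (rule ext) (simp add: e(2) cech_pm fun_apply(3) pm_diff)
  finally have "(\<lambda>W. del (cech b W)) = (\<lambda>W. pm ((e - cech e1) W))" .
  moreover have "Pch (\<tau> + 3) \<tau> (e - cech e1)"
    using Pch_cech[OF e1] by (intro Pch_diff e) (simp add: eval_nat_numeral)
  ultimately have "Zc (\<tau> + 3) (Suc \<tau>) (cech b)" unfolding Zc_def by auto
  moreover have "cech (cech b) = (\<lambda>W. pm ((0 :: nat set \<Rightarrow> _) W))"
    by (rule ext) (simp add: fun_apply(2))
  ultimately obtain b' e2 where b': "Coch (\<tau> + 2) (Suc \<tau>) (- 1) (- 1) b'" "Zc (\<tau> + 2) (Suc \<tau>) b'"
    and e2: "Pch (\<tau> + 3) (Suc \<tau>) e2" and be: "cech b = cech b' + (\<lambda>W. pm (e2 W))"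
    using IH[unfolded HZ_def, rule_format, of "cech b" 0] db Pch_0 by (auto simp: eval_nat_numeral)
  have e2c: "Coch (\<tau> + 3) \<tau> (- 2) (- 2) e2" using e2 by (simp add: Pch_def)
  \<comment> \<open>The correction e2 is itself Cech closed, since \<open>pm\<close> is injective in
    this range; twist (-2, -2) then makes it a coboundary.\<close>
  have "(\<lambda>W. pm (cech e2 W)) = 0"
  proof -
    have "cech (\<lambda>W. pm (e2 W)) = cech (cech b - cech b')" by (simp add: be)
    then show ?thesis by (simp add: cech_pm cech_diff)
  qed
  then have "pm (cech e2 W) = 0" for W by (simp add: fun_eq_iff[of "\<lambda>W. pm (cech e2 W)"] fun_apply(2))
  then have "cech e2 = 0" using pm_inject[OF Coch_cech[OF e2c]] \<tau> by blast
  moreover have "\<tau> + 3 = Suc (\<tau> + 2)" by simp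
  then have "Coch (Suc (\<tau> + 2)) \<tau> (- 2) (- 2) e2" using e2c by (simp only:)
  ultimately obtain e3 where e3: "Coch (\<tau> + 2) \<tau> (- 2) (- 2) e3" "cech e3 = e2"
    using cech_exact[of \<tau> "- 2" "- 2" "\<tau> + 2" e2] toggle2 \<tau> by blast
  \<comment> \<open>Removing the cycle b' and the correction turns b into a genuine Cech cocycle,
    not merely one up to \<open>pm\<close>.\<close>
  define b2 where "b2 = b - b' - (\<lambda>W. pm (e3 W))"
  have "Coch (\<tau> + 2) (Suc \<tau>) (- 1) (- 1) b2"
    unfolding b2_def by (intro Coch_diff b b' Coch_pm e3)
  moreover have "cech b2 = 0" by (simp add: b2_def cech_diff cech_pm e3(2) be)
  moreover have "Suc \<tau> \<le> N - 3" using \<tau> by simp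
  moreover have "\<tau> + 2 = Suc (\<tau> + 1)" by simp
  ultimately obtain b3 where b3: "Coch (\<tau> + 1) (Suc \<tau>) (- 1) (- 1) b3" "cech b3 = b2"
    using cech_exact[of "Suc \<tau>" "- 1" "- 1" "\<tau> + 1" b2] toggle by metis
  obtain e4 where e4: "Pch (\<tau> + 2) \<tau> e4" "(\<lambda>W. del (b' W)) = (\<lambda>W. pm (e4 W))"
    using b'(2) by (auto simp: Zc_def)
  have "b = b' + (\<lambda>W. pm (e3 W)) + cech b3" by (simp add: b3(2) b2_def)
  then have "c W = del (b' W) + del (pm (e3 W)) + cech (\<lambda>W. del (b3 W)) W + pm (e1 W)" for W
    by (simp add: ce fun_apply(1) del_add cech_del)
  then have "c W = cech (\<lambda>W. del (b3 W)) W + pm (e4 W + del (e3 W) + e1 W)" for W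
    using fun_cong[OF e4(2), of W] by (simp add: del_pm pm_add)
  then have "c = cech (\<lambda>W. del (b3 W)) + (\<lambda>W. pm ((e4 + (\<lambda>W. del (e3 W)) + e1) W))"
    by (intro ext[where 'a = "nat set"]) (simp add: fun_apply(1))
  moreover have "Pch (\<tau> + 2) \<tau> (e4 + (\<lambda>W. del (e3 W)) + e1)"
    by (intro Pch_add Pch_del e4 e3 e1)
  ultimately show "\<exists>b e'. Coch (\<tau> + 1) \<tau> (- 1) (- 1) b \<and> Zc (\<tau> + 1) \<tau> b \<and>
      Pch (\<tau> + 2) \<tau> e' \<and> c = cech b + (\<lambda>W. pm (e' W))"
    using Coch_del[OF b3(1)] Zc_del[OF b3(1)] by blast
qed

lemma HZ_0: "HZ 0"
proof -
  have "HZ (N - 4 - k)" if "k \<le> N - 4" for k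
    using that
  proof (induction k)
    case (Suc k)
    have *: "Suc (N - 4 - Suc k) = N - 4 - k" using Suc.prems by linarith
    have "HZ (N - 4 - k)" by (rule Suc.IH) (use Suc.prems in linarith)
    then have "HZ (Suc (N - 4 - Suc k))" by (simp only: *)
    then show ?case by (rule HZ_step) (use Suc.prems in linarith)
  qed (simp add: HZ_top)
  from this[of "N - 4"] show ?thesis by simp
qed

end

section \<open>From local lifts to a global lift\<close>

context bigraded_generated
begin

text \<open>The sum of the wedges \<open>wd v (F v)\<close> over v different from w has the right
  contractions by the Clifford relation, because every \<open>ct u\<close> kills every
  \<open>F v\<close>. The row w then agrees as well, by the relation and since z_w is a
  unit.\<close>

lemma wd_lift:
  assumes W: "adm W" and F: "\<And>v. v < N \<Longrightarrow> F v \<in> EW W" "\<And>u v. ct u (F v) = 0"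
    and rel: "(\<Sum>v<N. scl (z v) (F v)) = 0"
  shows "\<exists>h\<in>EW W. \<forall>v<N. ct v h = F v"
proof -
  obtain k w where w: "w < n1" "koszul_local N \<kappa> z zi f (R W) k w (N - 4)"
    using koszul_local_adm[OF W] by blast
  interpret L: koszul_local N \<kappa> z zi f "R W" k w "N - 4" by (rule w(2))
  have E: "L.E = EW W" by (simp add: L.E_def EW_def)
  have wN: "w < N" using w(1) by (simp add: N_def)
  define h where "h = (\<Sum>v\<in>{..<N} - {w}. L.wd v (F v))"
  have hE: "h \<in> EW W"
    unfolding h_def E[symmetric] by (intro L.E_sum L.E_wd) (use F(1) E in auto)
  have 1: "ct u h = F u" if u: "u < N" "u \<noteq> w" for u
  proof -
    have "ct u (L.wd v (F v)) = (if u = v then F v else 0)" if v: "v \<in> {..<N} - {w}" for v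
      using L.wd_ct[of u v "F v"] u v F(2)[of u v] by simp
    then have "ct u h = (\<Sum>v\<in>{..<N} - {w}. if u = v then F v else 0)"
      unfolding h_def ct_sum by (intro sum.cong refl) auto
    then show ?thesis using u by simp
  qed
  have "scl (z w) (ct w h) + (\<Sum>v\<in>{..<N} - {w}. scl (z v) (ct v h)) = 0"
    using ct_rel[of h] wN by (simp add: sum.remove[of "{..<N}" w])
  moreover have "scl (z w) (F w) + (\<Sum>v\<in>{..<N} - {w}. scl (z v) (F v)) = 0"
    using rel wN by (simp add: sum.remove[of "{..<N}" w])
  moreover have "(\<Sum>v\<in>{..<N} - {w}. scl (z v) (ct v h)) = (\<Sum>v\<in>{..<N} - {w}. scl (z v) (F v))"
    by (intro sum.cong refl) (simp add: 1)
  ultimately have "scl (z w) (ct w h) + (\<Sum>v\<in>{..<N} - {w}. scl (z v) (F v))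
      = scl (z w) (F w) + (\<Sum>v\<in>{..<N} - {w}. scl (z v) (F v))" by simp
  then have "scl (z w) (ct w h) = scl (z w) (F w)" by (rule add_right_imp_eq)
  then have "scl (zi w) (scl (z w) (ct w h)) = scl (zi w) (scl (z w) (F w))" by simp
  moreover have "zi w * z w = 1" using z_zi[OF wN] by (simp add: mult.commute)
  ultimately have "ct w h = F w" by simp
  with 1 have "ct v h = F v" if "v < N" for v using that by (cases "v = w") auto
  with hE show ?thesis by blast
qed

text \<open>In an admissible set of three, one group has two elements. Exactly the two deletions of
  these leave an admissible pair, and since they are neighbours in the order, their signs are
  opposite.\<close>

lemma cech_const:
  fixes X :: "'b::ab_group_add"
  assumes "adm W" "card W = 3"
  shows "cech (\<lambda>W. if adm W \<and> card W = 2 then X else 0) W = 0"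
proof -
  have fin: "finite W" "W \<subseteq> {..<N}" using assms(1) adm_finite by (auto simp: adm_def)
  define c where "c = (\<lambda>W. if adm W \<and> card W = 2 then X else 0)"
  have "cech c W = (\<Sum>u<N. ext_wedge u c W)" by (simp add: cech_def fun_sum_apply)
  also have "\<dots> = (\<Sum>u\<in>W. ext_wedge u c W)"
    by (rule sum.mono_neutral_right) (use fin in \<open>auto simp: ext_wedge_def\<close>)
  finally have s: "cech c W = (\<Sum>u\<in>W. ext_wedge u c W)" .
  obtain x y t where W: "W = {x, y, t}" "x < y" "y < t"
  proof -
    obtain l where l: "sorted_wrt (<) l" "set l = W" "length l = 3"
      using sorted_list_of_set(1)[OF fin(1)] assms(2) fin(1)
      by (metis sorted_list_of_set.length_sorted_key_list_of_set sorted_list_of_set.strict_sorted_key_list_of_set)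
    then obtain x y t where "l = [x, y, t]"
      by (metis (no_types) length_0_conv length_Suc_conv numeral_3_eq_3)
    then show ?thesis using l that[of x y t] by auto
  qed
  have d: "W - {x} = {y, t}" "W - {y} = {x, t}" "W - {t} = {x, y}" using W by auto
  have a: "alt x W q = q" "alt y W q = - q" "alt t W q = q" for q :: 'b
  proof -
    have s: "{u \<in> W. u < x} = {}" "{u \<in> W. u < y} = {x}" "{u \<in> W. u < t} = {x, y}"
      using W by auto
    have "even (card {u \<in> W. u < x})" "odd (card {u \<in> W. u < y})" "even (card {u \<in> W. u < t})"
      unfolding s using W(2) by simp_all
    then show "alt x W q = q" "alt y W q = - q" "alt t W q = q" by (simp_all add: alt_def)
  qed
  have m: "x \<in> W" "y \<in> W" "t \<in> W" using W by auto
  have "cech c W = c {y, t} - c {x, t} + c {x, y}"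
  proof -
    have "cech c W = ext_wedge x c W + (ext_wedge y c W + ext_wedge t c W)"
      unfolding s using W(2,3) by (simp add: W(1))
    also have "\<dots> = c {y, t} - c {x, t} + c {x, y}"
      using m by (simp add: ext_wedge_def d a)
    finally show ?thesis .
  qed
  moreover have N: "x < N" "y < N" "t < N" "x < n1" "n1 \<le> t"
    using fin W assms(1) by (auto simp: adm_def)
  ultimately show ?thesis using W unfolding c_def adm_def by (cases "y < n1") auto
qed

text \<open>Two local lifts differ by an element killed by all rows, hence by \<open>crr\<close> of
  some y. The coboundary of y is a cycle in Cech degree 2, so \<open>HZ_0\<close> corrects y by a
  cochain b of cycles to a Cech cocycle, which is a coboundary of some b3; subtracting
  \<open>crr\<close> of b3 makes the lifts agree.\<close>

theorem kernel_in_image: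
  assumes F: "\<And>v \<alpha>. v < N \<Longrightarrow> \<alpha> \<in> kys (F v) \<Longrightarrow> rg {} \<alpha> \<and>
      xd \<alpha> = int n2 - 2 + (if v < n1 then 0 else 1) \<and> yd \<alpha> = int n1 - 2 + (if v < n1 then 1 else 0)"
    and rel: "(\<Sum>v<N. z v * F v) = 0"
  shows "\<exists>g. (\<forall>l. \<forall>\<alpha>\<in>kys (g l). rg {} \<alpha> \<and> xd \<alpha> = int n2 - 2 \<and> yd \<alpha> = int n1 - 2) \<and>
    (\<forall>v<N. (\<Sum>l<\<kappa>. f v l * g l) = F v)"
proof -
  define d e where "d = int n2 - 2" and "e = int n1 - 2"
  \<comment> \<open>The bidegree of a lift is the twist (-1, -1) moved by the shift of
    \<open>cr\<close>.\<close>
  have de: "- 1 + int n2 - 1 = d" "- 1 + int n1 - 1 = e" by (simp_all add: d_def e_def)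
  have N4: "4 \<le> N" using n1 n2 by (simp add: N_def)
  \<comment> \<open>F is placed in exterior degree 0. Contractions lower the exterior degree, so the
    coefficients of a lift sit at singletons.\<close>
  define Fe where "Fe = (\<lambda>v (A :: nat set). if A = {} then F v else 0)"
  have FeE: "Fe v \<in> EW W" if "v < N" for v W
  proof -
    have "rg {} \<alpha> \<Longrightarrow> rg W \<alpha>" for \<alpha> unfolding rg_def by blast
    then have "F v \<in> R W" using F[OF that] unfolding R_def by blast
    then show ?thesis by (simp add: EW_def Fe_def R_0)
  qed
  have Fec: "ct u (Fe v) = 0" for u v
  proof -
    have "ext_contract l (Fe v) = 0" for l
      by (rule ext) (simp add: ext_contract_def Fe_def fun_apply)
    then show ?thesis by (simp add: ct_def contract_def)
  qed
  have Fer: "(\<Sum>v<N. scl (z v) (Fe v)) = 0"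
  proof (rule ext)
    fix A :: "nat set"
    show "(\<Sum>v<N. scl (z v) (Fe v)) A = 0 A"
      by (cases "A = {}") (simp_all add: fun_sum_apply scl_def Fe_def rel fun_apply)
  qed
  have Feh: "fd (d + (if v < n1 then 0 else 1)) (e + (if v < n1 then 1 else 0)) (Fe v) = Fe v"
    if v: "v < N" for v
    by (rule ext) (auto simp: fd_def Fe_def d_def e_def F[OF v] intro!: filt_id)
  have "\<exists>g. Loc W 0 d e g \<and> (\<forall>v<N. ct v (g {#}) = Fe v)" if W: "adm W" for W
  proof -
    obtain h where h: "h \<in> EW W" "\<And>v. v < N \<Longrightarrow> ct v h = Fe v"
      using wd_lift[OF W, of Fe] FeE Fec Fer by auto
    define g where "g = pj 0 d e (\<lambda>\<gamma>. if \<gamma> = {#} then h else 0)"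
    have "Loc W 0 d e g" unfolding g_def by (rule Loc_pj) (simp add: h)
    moreover have "ct v (g {#}) = Fe v" if v: "v < N" for v
    proof -
      have "ct v (g {#}) = ct v (fd d e h)" by (simp add: g_def pj_alt ok_empty)
      also have "\<dots> = Fe v" by (simp only: fd_ct[symmetric] h(2)[OF v] Feh[OF v])
      finally show ?thesis .
    qed
    ultimately show ?thesis by blast
  qed
  then obtain g0 where g0: "\<And>W. adm W \<Longrightarrow> Loc W 0 d e (g0 W)"
    "\<And>W v. adm W \<Longrightarrow> v < N \<Longrightarrow> ct v (g0 W {#}) = Fe v"
    by metis
  define g where "g = (\<lambda>W. if adm W \<and> card W = 2 then g0 W else 0)"
  have g: "Coch 0 0 d e g"
  proof (rule CochI)
    show "Loc W 0 d e (g W)" if "adm W" "card W = 0 + 2" for W using g0(1) that by (simp add: g_def)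
    show "g W = 0" if "\<not> (adm W \<and> card W = 0 + 2)" for W
      using that unfolding g_def by auto
  qed
  have gF: "(\<lambda>W. ct v (g W {#})) = (\<lambda>W. if adm W \<and> card W = 2 then Fe v else 0)" if "v < N" for v
    by (rule ext) (simp add: g_def g0(2) that arr_apply)
  have cg: "Coch 1 0 d e (cech g)" using Coch_cech[OF g] by simp
  have map_ct: "cech (\<lambda>W. ct v (c W {#})) = (\<lambda>W. ct v (cech c W {#}))"
    for v and c :: "nat set \<Rightarrow> nat multiset \<Rightarrow> nat set \<Rightarrow> 'a laurent"
    by (rule cech_map[of "\<lambda>x. ct v (x {#})"]) (simp_all add: arr_apply ct_add ct_uminus)
  have map_crr: "cech (\<lambda>W. crr (c W)) = (\<lambda>W. crr (cech c W))" for c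
    by (rule cech_map[of crr, OF crr_add crr_uminus crr_0])
  \<comment> \<open>All local lifts have the same contractions, so contracting \<open>cech g\<close>
    gives the coboundary of a constant cochain.\<close>
  have cg0: "ct v (cech g W {#}) = 0" if v: "v < N" for v W
  proof (cases "adm W \<and> card W = 3")
    case True
    have "ct v (cech g W {#}) = cech (\<lambda>W. if adm W \<and> card W = 2 then Fe v else 0) W"
      using map_ct[of v g] gF[OF v] by (simp add: fun_eq_iff)
    also have "\<dots> = 0" by (rule cech_const) (use True in auto)
    finally show ?thesis .
  next
    case False
    have "cech g W = 0" by (rule Coch_zero[OF cg]) (use False in auto)
    then show ?thesis by (simp add: arr_apply)
  qed
  \<comment> \<open>Exactness at the source of the columns, \<open>cr_exact\<close>, followed by
    projection to the right bidegree.\<close>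
  have "\<exists>y. Loc W 0 (- 1) (- 1) y \<and> crr y = cech g W" if W: "adm W" for W
  proof -
    obtain k w where "koszul_local N \<kappa> z zi f (R W) k w (N - 4)"
      using koszul_local_adm[OF W] by blast
    then interpret L: koszul_local N \<kappa> z zi f "R W" k w "N - 4" .
    have E: "L.E = EW W" by (simp add: L.E_def EW_def)
    obtain a where a: "a \<in> EW W" "cr a = cech g W {#}"
      using L.cr_exact[of "cech g W {#}"] cg0 Loc_EW[OF Coch_Loc[OF cg]] unfolding E by blast
    define y where "y = pj 0 (- 1) (- 1) (\<lambda>\<gamma>. if \<gamma> = {#} then a else 0)"
    have "crr y = pj 0 d e (crr (\<lambda>\<gamma>. if \<gamma> = {#} then a else 0))"
      unfolding y_def pj_crr[symmetric] de ..
    also have "crr (\<lambda>\<gamma>. if \<gamma> = {#} then a else 0) = cech g W"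
    proof (rule ext)
      fix \<gamma>
      show "crr (\<lambda>\<gamma>. if \<gamma> = {#} then a else 0) \<gamma> = cech g W \<gamma>"
        using Loc_zero[OF Coch_Loc[OF cg], of \<gamma> W] by (cases "\<gamma> = {#}") (simp_all add: crr_def a ok_empty)
    qed
    also have "pj 0 d e (cech g W) = cech g W" by (rule pj_id[OF Coch_Loc[OF cg]])
    finally have "crr y = cech g W" .
    moreover have "Loc W 0 (- 1) (- 1) y" unfolding y_def by (rule Loc_pj) (simp add: a)
    ultimately show ?thesis by blast
  qed
  then obtain y0 where y0: "\<And>W. adm W \<Longrightarrow> Loc W 0 (- 1) (- 1) (y0 W)"
    "\<And>W. adm W \<Longrightarrow> crr (y0 W) = cech g W"
    by metis
  define y where "y = (\<lambda>W. if adm W \<and> card W = 3 then y0 W else 0)"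
  have y: "Coch 1 0 (- 1) (- 1) y"
  proof (rule CochI)
    show "Loc W 0 (- 1) (- 1) (y W)" if "adm W" "card W = 1 + 2" for W
      using y0(1) that by (simp add: y_def)
    show "y W = 0" if "\<not> (adm W \<and> card W = 1 + 2)" for W
      using that unfolding y_def by auto
  qed
  have yg: "(\<lambda>W. crr (y W)) = cech g"
  proof (rule ext)
    fix W
    show "crr (y W) = cech g W"
    proof (cases "adm W \<and> card W = 3")
      case False
      have "cech g W = 0" by (rule Coch_zero[OF cg]) (use False in auto)
      moreover have "y W = 0" unfolding y_def using False by (rule if_not_P)
      ultimately show ?thesis by simp
    qed (use y0(2) in \<open>simp add: y_def\<close>)
  qed
  have cy: "Coch 2 0 (- 1) (- 1) (cech y)" using Coch_cech[OF y] by (simp add: numeral_2_eq_2)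
  have "(\<lambda>W. crr (cech y W)) = 0" using map_crr[of y] by (simp add: yg)
  then have "crr (cech y W) {#} = 0" for W by (simp add: fun_eq_iff[of "\<lambda>W. crr (cech y W)"] fun_apply)
  then have "Zc 2 0 (cech y)" by (simp add: Zc_def crr_def)
  moreover have "cech (cech y) = (\<lambda>W. pm ((0 :: nat set \<Rightarrow> _) W))" by (rule ext) (simp add: fun_apply(2))
  ultimately obtain b e' where b: "Coch 1 0 (- 1) (- 1) b" "Zc 1 0 b" "Pch 2 0 e'"
    "cech y = cech b + (\<lambda>W. pm (e' W))"
    using HZ_0[unfolded HZ_def add_0, rule_format, of "cech y" 0] cy Pch_0[of 3 0] by blast
  \<comment> \<open>Divided degree 0 admits no correction terms, so the identity is exact
    here.\<close>
  have "e' = 0" using b(3) by (simp add: Pch_def)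
  then have "cech y = cech b" using b(4) by (simp add: fun_eq_iff[of "cech y"] fun_apply(1,2))
  then have "cech (y - b) = 0" by (simp add: cech_diff)
  then obtain b3 where b3: "Coch 0 0 (- 1) (- 1) b3" "cech b3 = y - b"
    using cech_exact[of 0 "- 1" "- 1" 0 "y - b"] toggle[of 0] Coch_diff[OF y b(1)] by auto
  have crb: "crr (b W) = 0" for W
    using b(2) by (intro ext) (simp add: Zc_def crr_def arr_apply)
  define G where "G = g - (\<lambda>W. crr (b3 W))"
  have GC: "Coch 0 0 d e G"
    unfolding G_def de[symmetric] using g unfolding de[symmetric]
    by (intro Coch_diff Coch_map[OF b3(1)] Loc_crr) simp_all
  have "cech G = 0"
  proof -
    have "cech (\<lambda>W. crr (b3 W)) = (\<lambda>W. crr (y W - b W))"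
      by (simp add: map_crr b3(2) fun_apply(3))
    also have "\<dots> = cech g" by (simp add: crr_diff crb yg)
    finally show ?thesis by (simp add: G_def cech_diff)
  qed
  have Gct: "ct v (G W {#}) = Fe v" if "v < N" "adm W" "card W = 2" for v W
  proof -
    have "ct v (crr (b3 W) {#}) = 0" using that by (simp add: crr_def)
    moreover have "G W = g W - crr (b3 W)" unfolding G_def by (rule fun_apply(3))
    moreover have "g W = g0 W" using that by (simp add: g_def)
    ultimately show ?thesis using g0(2)[OF that(2,1)] by (simp add: arr_apply ct_diff)
  qed
  \<comment> \<open>Being closed at a set of three says that the alternating sum of the three pairs
    vanishes; for a mixed set one of the pairs is inadmissible, and the other two sections
    coincide.\<close>
  have glue: "G {y', t} - G {x, t} + G {x, y'} = 0"
    if "x < y'" "y' < t" "t < N" for x y' t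
  proof -
    define W where "W = {x, y', t}"
    have WN: "W \<subseteq> {..<N}" using that by (auto simp: W_def)
    have "cech G W = (\<Sum>u<N. ext_wedge u G W)" by (simp add: cech_def fun_sum_apply)
    also have "\<dots> = (\<Sum>u\<in>W. ext_wedge u G W)"
      by (rule sum.mono_neutral_right) (use WN in \<open>auto simp: ext_wedge_def\<close>)
    finally have s: "cech G W = (\<Sum>u\<in>W. ext_wedge u G W)" .
    have dd: "W - {x} = {y', t}" "W - {y'} = {x, t}" "W - {t} = {x, y'}" using that by (auto simp: W_def)
    have a: "alt x W q = q" "alt y' W q = - q" "alt t W q = q" for q :: "nat multiset \<Rightarrow> nat set \<Rightarrow> 'a laurent"
    proof -
      have s: "{u \<in> W. u < x} = {}" "{u \<in> W. u < y'} = {x}" "{u \<in> W. u < t} = {x, y'}"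
        using that by (auto simp: W_def)
      have "even (card {u \<in> W. u < x})" "odd (card {u \<in> W. u < y'})" "even (card {u \<in> W. u < t})"
        unfolding s using that(1) by simp_all
      then show "alt x W q = q" "alt y' W q = - q" "alt t W q = q" by (simp_all add: alt_def)
    qed
    have m: "x \<in> W" "y' \<in> W" "t \<in> W" by (auto simp: W_def)
    have "cech G W = ext_wedge x G W + (ext_wedge y' G W + ext_wedge t G W)"
      unfolding s using that by (simp add: W_def)
    also have "\<dots> = G {y', t} - G {x, t} + G {x, y'}"
      by (simp add: ext_wedge_def dd a m)
    finally show ?thesis by (simp only: \<open>cech G = 0\<close> fun_apply(2))
  qed
  have nadm: "G W = 0" if "\<not> adm W" for W using Coch_zero[OF GC] that by blast
  have same_t: "G {x, t} = G {x', t}" if "x < x'" "x' < n1" "n1 \<le> t" "t < N" for x x' t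
  proof -
    have "\<not> adm {x, x'}" using that by (auto simp: adm_def)
    then show ?thesis using glue[of x x' t] nadm[of "{x, x'}"] that by simp
  qed
  have same_x: "G {x, t} = G {x, t'}" if "x < n1" "n1 \<le> t" "t < t'" "t' < N" for x t t'
  proof -
    have "\<not> adm {t, t'}" using that by (auto simp: adm_def)
    then show ?thesis using glue[of x t t'] nadm[of "{t, t'}"] that by simp
  qed
  \<comment> \<open>The section is the same on two charts without a common inverted variable, so no
    exponent can be negative. Two variables in each group are needed for this.\<close>
  have G2: "G {0, n1} = G {1, Suc n1}"
    using same_t[of 0 1 n1] same_x[of 1 n1 "Suc n1"] n1 n2 by (simp add: N_def)
  have a0: "adm {0, n1}" "card {0, n1} = 2" using n1 n2 by (auto simp: adm_def N_def)
  define gg where "gg = (\<lambda>l. G {0, n1} {#} {l})"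
  have "rg {} \<alpha> \<and> xd \<alpha> = int n2 - 2 \<and> yd \<alpha> = int n1 - 2" if "\<alpha> \<in> kys (gg l)" for l \<alpha>
  proof -
    have k: "\<alpha> \<in> kys (G {0, n1} {#} {l})" using that by (simp add: gg_def)
    then have r: "rg {0, n1} \<alpha>" "dg d e {#} \<alpha>" using GC unfolding Coch_def by blast+
    have r': "rg {1, Suc n1} \<alpha>" using GC k unfolding G2 Coch_def by blast
    have "\<not> lkp \<alpha> v < 0" for v
    proof
      assume "lkp \<alpha> v < 0"
      then have "v \<in> {0, n1}" "v \<in> {1, Suc n1}" using r(1) r' unfolding rg_def by blast+
      then show False using n1 by auto
    qed
    then show ?thesis using r by (simp add: rg_def dg_def d_def e_def)
  qed
  moreover have "(\<Sum>l<\<kappa>. f v l * gg l) = F v" if v: "v < N" for v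
  proof -
    have "F v = ct v (G {0, n1} {#}) {}" using Gct[OF v a0] by (simp add: Fe_def)
    also have "\<dots> = (\<Sum>l<\<kappa>. f v l * gg l)"
      by (simp add: ct_def contract_def fun_sum_apply scl_def ext_contract_def alt_def gg_def)
    finally show ?thesis by simp
  qed
  ultimately show ?thesis by blast
qed

end

section \<open>Quotients and tensor products of vector spaces\<close>

text \<open>The axioms pass along a surjection that respects the operations. The target is only a
  record with operations, as is the case for explicitly defined quotients.\<close>

lemma vs_image:
  fixes A :: "('k::field, 'a) module" and B :: "('k, 'b) module"
  assumes A: "vectorspace class_ring A" and img: "h ` carrier A = carrier B"
    and add: "\<And>x y. x \<in> carrier A \<Longrightarrow> y \<in> carrier A \<Longrightarrow> h (x \<oplus>\<^bsub>A\<^esub> y) = h x \<oplus>\<^bsub>B\<^esub> h y"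
    and smult: "\<And>c x. x \<in> carrier A \<Longrightarrow> h (c \<odot>\<^bsub>A\<^esub> x) = c \<odot>\<^bsub>B\<^esub> h x"
    and zero: "h \<zero>\<^bsub>A\<^esub> = \<zero>\<^bsub>B\<^esub>"
  shows "vectorspace class_ring B"
proof -
  interpret A: vectorspace class_ring A by (rule A)
  have ex: "\<exists>x\<in>carrier A. y = h x" if "y \<in> carrier B" for y using that img by blast
  have im: "h x \<in> carrier B" if "x \<in> carrier A" for x using that img by blast
  show ?thesis
  proof (rule vs_criteria)
    show "field (class_ring :: 'k ring)" by (rule class_field)
    show "\<zero>\<^bsub>B\<^esub> \<in> carrier B" using im[of "\<zero>\<^bsub>A\<^esub>"] by (simp add: zero)
    show "\<forall>v w. v \<in> carrier B \<and> w \<in> carrier B \<longrightarrow> v \<oplus>\<^bsub>B\<^esub> w \<in> carrier B"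
      by (metis A.M.a_closed add ex im)
    show "\<forall>v\<in>carrier B. \<exists>neg_v\<in>carrier B. v \<oplus>\<^bsub>B\<^esub> neg_v = \<zero>\<^bsub>B\<^esub>"
      by (metis A.M.a_inv_closed A.M.r_neg add ex im zero)
    show "\<forall>c v. c \<in> carrier class_ring \<and> v \<in> carrier B \<longrightarrow> c \<odot>\<^bsub>B\<^esub> v \<in> carrier B"
      by (metis A.smult_closed smult ex im)
    show "\<forall>v w. v \<in> carrier B \<and> w \<in> carrier B \<longrightarrow> v \<oplus>\<^bsub>B\<^esub> w = w \<oplus>\<^bsub>B\<^esub> v"
      by (metis A.M.a_comm add ex)
    show "\<forall>v w x. v \<in> carrier B \<and> w \<in> carrier B \<and> x \<in> carrier B \<longrightarrow>
        v \<oplus>\<^bsub>B\<^esub> w \<oplus>\<^bsub>B\<^esub> x = v \<oplus>\<^bsub>B\<^esub> (w \<oplus>\<^bsub>B\<^esub> x)"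
      by (metis A.M.a_assoc A.M.a_closed add ex)
    show "\<forall>v\<in>carrier B. v \<oplus>\<^bsub>B\<^esub> \<zero>\<^bsub>B\<^esub> = v"
      by (metis A.M.r_zero A.M.zero_closed add ex zero)
    show "\<forall>a b v. a \<in> carrier class_ring \<and> b \<in> carrier class_ring \<and> v \<in> carrier B \<longrightarrow>
        (a \<otimes>\<^bsub>class_ring\<^esub> b) \<odot>\<^bsub>B\<^esub> v = a \<odot>\<^bsub>B\<^esub> (b \<odot>\<^bsub>B\<^esub> v)"
      by (metis A.smult_assoc1 A.smult_closed smult ex)
    show "\<forall>v\<in>carrier B. \<one>\<^bsub>class_ring\<^esub> \<odot>\<^bsub>B\<^esub> v = v"
      by (metis A.smult_one smult ex)
    show "\<forall>a b v. a \<in> carrier class_ring \<and> b \<in> carrier class_ring \<and> v \<in> carrier B \<longrightarrow>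
        (a \<oplus>\<^bsub>class_ring\<^esub> b) \<odot>\<^bsub>B\<^esub> v = a \<odot>\<^bsub>B\<^esub> v \<oplus>\<^bsub>B\<^esub> b \<odot>\<^bsub>B\<^esub> v"
    proof (intro allI impI)
      fix a b :: 'k and v
      assume "a \<in> carrier class_ring \<and> b \<in> carrier class_ring \<and> v \<in> carrier B"
      then obtain x where x: "x \<in> carrier A" "v = h x" using ex by blast
      have c: "a \<odot>\<^bsub>A\<^esub> x \<in> carrier A" "b \<odot>\<^bsub>A\<^esub> x \<in> carrier A" using x(1) by auto
      show "(a \<oplus>\<^bsub>class_ring\<^esub> b) \<odot>\<^bsub>B\<^esub> v = a \<odot>\<^bsub>B\<^esub> v \<oplus>\<^bsub>B\<^esub> b \<odot>\<^bsub>B\<^esub> v"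
        unfolding x(2) smult[OF x(1), symmetric] add[OF c, symmetric]
        by (rule arg_cong[of _ _ h], rule A.smult_l_distr) (use x(1) in auto)
    qed
    show "\<forall>a v w. a \<in> carrier class_ring \<and> v \<in> carrier B \<and> w \<in> carrier B \<longrightarrow>
        a \<odot>\<^bsub>B\<^esub> (v \<oplus>\<^bsub>B\<^esub> w) = a \<odot>\<^bsub>B\<^esub> v \<oplus>\<^bsub>B\<^esub> a \<odot>\<^bsub>B\<^esub> w"
    proof (intro allI impI)
      fix a :: 'k and v w
      assume "a \<in> carrier class_ring \<and> v \<in> carrier B \<and> w \<in> carrier B"
      then obtain x y where x: "x \<in> carrier A" "v = h x" and y: "y \<in> carrier A" "w = h y" using ex by blast
      have c: "a \<odot>\<^bsub>A\<^esub> x \<in> carrier A" "a \<odot>\<^bsub>A\<^esub> y \<in> carrier A" "x \<oplus>\<^bsub>A\<^esub> y \<in> carrier A" using x(1) y(1) by auto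
      show "a \<odot>\<^bsub>B\<^esub> (v \<oplus>\<^bsub>B\<^esub> w) = a \<odot>\<^bsub>B\<^esub> v \<oplus>\<^bsub>B\<^esub> a \<odot>\<^bsub>B\<^esub> w"
        unfolding x(2) y(2) smult[OF x(1), symmetric] smult[OF y(1), symmetric] add[OF x(1) y(1), symmetric]
          smult[OF c(3), symmetric] add[OF c(1,2), symmetric]
        by (rule arg_cong[of _ _ h], rule A.smult_r_distr) (use x(1) y(1) in auto)
    qed
  qed
qed

lemma vs_smult_closed:
  "vectorspace class_ring M \<Longrightarrow> x \<in> carrier M \<Longrightarrow> c \<odot>\<^bsub>M\<^esub> x \<in> carrier (M :: ('k::field, 'a) module)"
  by (rule module.smult_closed[OF vectorspace.axioms(1)]) auto

lemma vs_subspace_iff: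
  fixes M :: "('k::field, 'a) module"
  assumes "vectorspace class_ring M"
  shows "VectorSpace.subspace class_ring N M \<longleftrightarrow> N \<subseteq> carrier M \<and> \<zero>\<^bsub>M\<^esub> \<in> N \<and>
    (\<forall>x\<in>N. \<forall>y\<in>N. x \<oplus>\<^bsub>M\<^esub> y \<in> N) \<and> (\<forall>c. \<forall>x\<in>N. c \<odot>\<^bsub>M\<^esub> x \<in> N)"
proof -
  interpret M: vectorspace class_ring M by (rule assms)
  show ?thesis
  proof
    assume "VectorSpace.subspace class_ring N M"
    then have s: "submodule class_ring N M" by (rule subspace.submod)
    show "N \<subseteq> carrier M \<and> \<zero>\<^bsub>M\<^esub> \<in> N \<and> (\<forall>x\<in>N. \<forall>y\<in>N. x \<oplus>\<^bsub>M\<^esub> y \<in> N) \<and> (\<forall>c. \<forall>x\<in>N. c \<odot>\<^bsub>M\<^esub> x \<in> N)"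
      using s unfolding LinearCombinations.submodule_def by auto
  next
    assume "N \<subseteq> carrier M \<and> \<zero>\<^bsub>M\<^esub> \<in> N \<and> (\<forall>x\<in>N. \<forall>y\<in>N. x \<oplus>\<^bsub>M\<^esub> y \<in> N) \<and> (\<forall>c. \<forall>x\<in>N. c \<odot>\<^bsub>M\<^esub> x \<in> N)"
    then show "VectorSpace.subspace class_ring N M"
      unfolding VectorSpace.subspace_def LinearCombinations.submodule_def
      using assms M.module_axioms by auto
  qed
qed

section \<open>Quotients by subspaces\<close>

locale vs_quotient =
  fixes M :: "('k::field, 'a) module" and N :: "'a set"
  assumes vsM: "vectorspace class_ring M" and subN: "VectorSpace.subspace class_ring N M"
begin

sublocale M: vectorspace class_ring M by (rule vsM)

lemma N_sub: "N \<subseteq> carrier M" and N_zero: "\<zero>\<^bsub>M\<^esub> \<in> N"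
  and N_add: "x \<in> N \<Longrightarrow> y \<in> N \<Longrightarrow> x \<oplus>\<^bsub>M\<^esub> y \<in> N" and N_smult: "x \<in> N \<Longrightarrow> c \<odot>\<^bsub>M\<^esub> x \<in> N"
  using subN unfolding vs_subspace_iff[OF vsM] by auto

lemma N_uminus: "x \<in> N \<Longrightarrow> \<ominus>\<^bsub>M\<^esub> x \<in> N"
proof -
  assume x: "x \<in> N"
  then have "(- 1) \<odot>\<^bsub>M\<^esub> x \<in> N" by (rule N_smult)
  moreover have "(- 1) \<odot>\<^bsub>M\<^esub> x = \<ominus>\<^bsub>M\<^esub> x"
    using M.smult_l_minus[of 1 x] M.smult_one[of x] x N_sub by (auto simp: class_ring_simps)
  ultimately show ?thesis by simp
qed

sublocale A: abelian_subgroup N M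
proof (rule abelian_subgroupI3)
  show "additive_subgroup N M"
  proof (rule additive_subgroup.intro, rule subgroup.intro)
    show "N \<subseteq> carrier (add_monoid M)" using N_sub by simp
    show "inv\<^bsub>add_monoid M\<^esub> x \<in> N" if "x \<in> N" for x
      using N_uminus[OF that] by (simp add: a_inv_def)
  qed (use N_zero N_add in auto)
  show "abelian_group M" by (rule M.abelian_group_axioms)
qed

definition q :: "'a \<Rightarrow> 'a set" where "q x = N +>\<^bsub>M\<^esub> x"

lemma q_eq_iff: "x \<in> carrier M \<Longrightarrow> y \<in> carrier M \<Longrightarrow> q x = q y \<longleftrightarrow> x \<ominus>\<^bsub>M\<^esub> y \<in> N"
  unfolding q_def a_minus_def
  by (metis A.a_rcos_module A.a_rcos_self A.a_repr_independence')

lemma carrier_quotient: "carrier (quotient_module M N) = q ` carrier M"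
  by (auto simp: quotient_module_def FactRing_def A_RCOSETS_def' ring.defs q_def)

lemma zero_quotient: "\<zero>\<^bsub>quotient_module M N\<^esub> = N"
  by (simp add: quotient_module_def FactRing_def ring.defs)

lemma q_zero: "q \<zero>\<^bsub>M\<^esub> = N"
  unfolding q_def using N_sub by (rule M.a_coset_add_zero)

lemma q_add: "x \<in> carrier M \<Longrightarrow> y \<in> carrier M \<Longrightarrow> q x \<oplus>\<^bsub>quotient_module M N\<^esub> q y = q (x \<oplus>\<^bsub>M\<^esub> y)"
  unfolding q_def by (simp add: quotient_module_def FactRing_def ring.defs A.a_rcos_sum)

lemma q_mem: "x' \<in> q x \<longleftrightarrow> (\<exists>n\<in>N. x' = n \<oplus>\<^bsub>M\<^esub> x)"
  by (auto simp: q_def a_r_coset_def')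

lemma q_self: "x \<in> carrier M \<Longrightarrow> x \<in> q x"
  using N_zero by (auto simp: q_mem intro: bexI[of _ "\<zero>\<^bsub>M\<^esub>"])

lemma q_eqI: "n \<in> N \<Longrightarrow> x \<in> carrier M \<Longrightarrow> q (n \<oplus>\<^bsub>M\<^esub> x) = q x"
proof -
  assume n: "n \<in> N" "x \<in> carrier M"
  have nc: "n \<in> carrier M" using n N_sub by auto
  have "(n \<oplus>\<^bsub>M\<^esub> x) \<ominus>\<^bsub>M\<^esub> x = n"
    using nc n(2) by (simp add: a_minus_def M.a_assoc M.r_neg)
  then show ?thesis using n nc by (subst q_eq_iff) auto
qed

text \<open>The union over all representatives collapses to one coset, because multiples of elements
  of N stay in N.\<close>

lemma q_smult: "x \<in> carrier M \<Longrightarrow> c \<odot>\<^bsub>quotient_module M N\<^esub> q x = q (c \<odot>\<^bsub>M\<^esub> x)"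
proof -
  assume x: "x \<in> carrier M"
  have "q (c \<odot>\<^bsub>M\<^esub> x') = q (c \<odot>\<^bsub>M\<^esub> x)" if x': "x' \<in> q x" for x'
  proof -
    obtain n where n: "n \<in> N" "x' = n \<oplus>\<^bsub>M\<^esub> x" using x' by (auto simp: q_mem)
    have nc: "n \<in> carrier M" using n N_sub by auto
    have "c \<odot>\<^bsub>M\<^esub> x' = c \<odot>\<^bsub>M\<^esub> n \<oplus>\<^bsub>M\<^esub> c \<odot>\<^bsub>M\<^esub> x" unfolding n(2) using nc x by (intro M.smult_r_distr) auto
    then show ?thesis using q_eqI N_smult n x vs_smult_closed[OF vsM] by simp
  qed
  then have "(\<Union>x'\<in>q x. q (c \<odot>\<^bsub>M\<^esub> x')) = q (c \<odot>\<^bsub>M\<^esub> x)" using q_self[OF x] by blast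
  then show ?thesis by (simp add: quotient_module_def ring.defs q_def)
qed

lemma vs_quotient_module: "vectorspace class_ring (quotient_module M N)"
  by (rule vs_image[OF vsM, of q]) (auto simp: carrier_quotient q_add q_smult q_zero zero_quotient)

end

section \<open>Free spaces and linear maps\<close>

lemma smult_map_single [simp]:
  "Poly_Mapping.map ((*) c) (Poly_Mapping.single x a) = Poly_Mapping.single x (c * a :: 'k::field)"
  by (rule poly_mapping_eqI) (simp add: map.rep_eq lookup_single when_def)

lemma lookup_smult_map: "lkp (Poly_Mapping.map ((*) c) f) x = c * (lkp f x :: 'k::field)"
  by (simp add: map.rep_eq when_def)

lemma kys_smult_map: "kys (Poly_Mapping.map ((*) (c::'k::field)) f) \<subseteq> kys f"
  by (auto simp: kys_iff lookup_smult_map)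

lemma sum_singles: "(\<Sum>x\<in>kys f. Poly_Mapping.single x (lkp f x)) = f"
  using filt_id[of f "\<lambda>_. True"] by (simp add: filt_def)

lemma vs_free_space: "vectorspace class_ring (free_space X :: ('k::field, 'x \<Rightarrow>\<^sub>0 'k) module)"
proof (rule vs_criteria)
  show "field (class_ring :: 'k ring)" by (rule class_field)
  show "\<forall>v\<in>carrier (free_space X :: ('k, 'x \<Rightarrow>\<^sub>0 'k) module). \<exists>neg_v\<in>carrier (free_space X).
      v \<oplus>\<^bsub>free_space X\<^esub> neg_v = \<zero>\<^bsub>free_space X\<^esub>"
    by (intro ballI, rule_tac x = "- v" in bexI) (auto simp: free_space_def kys_uminus)
  show "\<forall>c v. c \<in> carrier class_ring \<and> v \<in> carrier (free_space X :: ('k, 'x \<Rightarrow>\<^sub>0 'k) module) \<longrightarrow>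
      c \<odot>\<^bsub>free_space X\<^esub> v \<in> carrier (free_space X)"
    using kys_smult_map by (force simp: free_space_def)
qed (use keys_add in \<open>force simp: free_space_def lookup_smult_map lookup_add algebra_simps
    intro!: poly_mapping_eqI\<close>)+

lemma free_space_simps [simp]:
  "carrier (free_space X) = {f. kys f \<subseteq> X}" "zero (free_space X) = 0" "add (free_space X) = (+)"
  "smult (free_space X) = (\<lambda>c. Poly_Mapping.map ((*) c))"
  by (simp_all add: free_space_def)

lemma free_space_minus:
  assumes "kys f \<subseteq> X" "kys g \<subseteq> X"
  shows "f \<ominus>\<^bsub>free_space X\<^esub> g = f - (g :: 'x \<Rightarrow>\<^sub>0 'k::field)"
proof -
  interpret F: vectorspace class_ring "free_space X :: ('k, 'x \<Rightarrow>\<^sub>0 'k) module" by (rule vs_free_space)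
  have "\<ominus>\<^bsub>free_space X\<^esub> g = - g"
    by (rule F.M.minus_equality) (use assms in \<open>auto simp: kys_uminus\<close>)
  then show ?thesis by (simp add: a_minus_def)
qed

abbreviation vsp :: "('k::field, 'a) module \<Rightarrow> bool" where "vsp \<equiv> vectorspace class_ring"

definition vlin :: "('k::field, 'a) module \<Rightarrow> ('k, 'b) module \<Rightarrow> ('a \<Rightarrow> 'b) \<Rightarrow> bool"
  where "vlin A B h \<longleftrightarrow> (\<forall>x\<in>carrier A. h x \<in> carrier B) \<and>
    (\<forall>x\<in>carrier A. \<forall>y\<in>carrier A. h (x \<oplus>\<^bsub>A\<^esub> y) = h x \<oplus>\<^bsub>B\<^esub> h y) \<and>
    (\<forall>c. \<forall>x\<in>carrier A. h (c \<odot>\<^bsub>A\<^esub> x) = c \<odot>\<^bsub>B\<^esub> h x)"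

lemma vlinD:
  assumes "vlin A B h"
  shows "x \<in> carrier A \<Longrightarrow> h x \<in> carrier B"
    and "x \<in> carrier A \<Longrightarrow> y \<in> carrier A \<Longrightarrow> h (x \<oplus>\<^bsub>A\<^esub> y) = h x \<oplus>\<^bsub>B\<^esub> h y"
    and "x \<in> carrier A \<Longrightarrow> h (c \<odot>\<^bsub>A\<^esub> x) = c \<odot>\<^bsub>B\<^esub> h x"
  using assms unfolding vlin_def by auto

lemma vsp_abelian_group: "vsp A \<Longrightarrow> abelian_group A"
  by (rule module.axioms(2)[OF vectorspace.axioms(1)])

lemma vlin_zero:
  assumes "vsp A" "vsp B" "vlin A B h"
  shows "h \<zero>\<^bsub>A\<^esub> = \<zero>\<^bsub>B\<^esub>"
proof -
  interpret A: abelian_group A using assms(1) by (rule vsp_abelian_group)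
  interpret B: abelian_group B using assms(2) by (rule vsp_abelian_group)
  have "h \<zero>\<^bsub>A\<^esub> \<oplus>\<^bsub>B\<^esub> h \<zero>\<^bsub>A\<^esub> = h \<zero>\<^bsub>A\<^esub>" using vlinD(2)[OF assms(3), of "\<zero>\<^bsub>A\<^esub>" "\<zero>\<^bsub>A\<^esub>"] by simp
  moreover have "h \<zero>\<^bsub>A\<^esub> \<in> carrier B" using vlinD(1)[OF assms(3)] by simp
  ultimately show ?thesis by (metis B.r_neg1 B.l_neg)
qed

lemma vlin_finsum:
  assumes "vsp A" "vsp B" "vlin A B h" "g \<in> S \<rightarrow> carrier A"
  shows "h (\<Oplus>\<^bsub>A\<^esub>s\<in>S. g s) = (\<Oplus>\<^bsub>B\<^esub>s\<in>S. h (g s))"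
proof -
  interpret A: abelian_group A using assms(1) by (rule vsp_abelian_group)
  interpret B: abelian_group B using assms(2) by (rule vsp_abelian_group)
  show ?thesis using assms(4)
  proof (induction S rule: infinite_finite_induct)
    case (insert x F)
    then have "g x \<in> carrier A" "g \<in> F \<rightarrow> carrier A" by auto
    moreover from this have "h (g x) \<in> carrier B" "(\<lambda>s. h (g s)) \<in> F \<rightarrow> carrier B"
      using vlinD(1)[OF assms(3)] by auto
    ultimately show ?case using insert.IH insert.hyps by (simp add: vlinD(2)[OF assms(3)])
  qed (use assms in \<open>auto simp: vlin_zero\<close>)
qed

lemma vsp_zero_smult:
  assumes "vsp A" shows "c \<odot>\<^bsub>A\<^esub> \<zero>\<^bsub>A\<^esub> = \<zero>\<^bsub>A\<^esub>" "x \<in> carrier A \<Longrightarrow> 0 \<odot>\<^bsub>A\<^esub> x = \<zero>\<^bsub>A\<^esub>"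
proof -
  interpret A: vectorspace class_ring A by (rule assms)
  show "c \<odot>\<^bsub>A\<^esub> \<zero>\<^bsub>A\<^esub> = \<zero>\<^bsub>A\<^esub>" using A.smult_r_null[of c] by simp
  show "x \<in> carrier A \<Longrightarrow> 0 \<odot>\<^bsub>A\<^esub> x = \<zero>\<^bsub>A\<^esub>" using A.smult_l_null[of x] by (simp add: class_ring_simps)
qed

lemma vsp_smult_finsum:
  assumes "vsp A" "g \<in> S \<rightarrow> carrier A"
  shows "c \<odot>\<^bsub>A\<^esub> (\<Oplus>\<^bsub>A\<^esub>s\<in>S. g s) = (\<Oplus>\<^bsub>A\<^esub>s\<in>S. c \<odot>\<^bsub>A\<^esub> g s)"
proof -
  interpret A: vectorspace class_ring A by (rule assms)
  show ?thesis
  proof (rule vlin_finsum[OF assms(1) assms(1) _ assms(2)])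
    show "vlin A A ((\<odot>\<^bsub>A\<^esub>) c)"
      unfolding vlin_def
    proof (intro conjI ballI allI)
      fix x d assume x: "x \<in> carrier A"
      show "c \<odot>\<^bsub>A\<^esub> (d \<odot>\<^bsub>A\<^esub> x) = d \<odot>\<^bsub>A\<^esub> (c \<odot>\<^bsub>A\<^esub> x)"
        using A.smult_assoc1[of c d x] A.smult_assoc1[of d c x] x by (simp add: class_ring_simps mult.commute)
    qed (auto intro: A.smult_r_distr)
  qed
qed

section \<open>Tensor products and their universal property\<close>

definition bil :: "('k::field, 'a) module \<Rightarrow> ('k, 'b) module \<Rightarrow> ('k, 'c) module \<Rightarrow> ('a \<Rightarrow> 'b \<Rightarrow> 'c) \<Rightarrow> bool"
  where "bil M N P \<phi> \<longleftrightarrow> (\<forall>v\<in>carrier N. vlin M P (\<lambda>u. \<phi> u v)) \<and> (\<forall>u\<in>carrier M. vlin N P (\<phi> u))"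

definition tensor_gens :: "('k::field, 'a) module \<Rightarrow> ('k, 'b) module \<Rightarrow> ('a \<times> 'b \<Rightarrow>\<^sub>0 'k) set"
  where "tensor_gens M N =
     ({Poly_Mapping.single (u \<oplus>\<^bsub>M\<^esub> u', v) 1 - Poly_Mapping.single (u, v) 1
         - Poly_Mapping.single (u', v) 1
       | u u' v. u \<in> carrier M \<and> u' \<in> carrier M \<and> v \<in> carrier N} \<union>
      {Poly_Mapping.single (u, v \<oplus>\<^bsub>N\<^esub> v') 1 - Poly_Mapping.single (u, v) 1
         - Poly_Mapping.single (u, v') 1
       | u v v'. u \<in> carrier M \<and> v \<in> carrier N \<and> v' \<in> carrier N} \<union>
      {Poly_Mapping.single (c \<odot>\<^bsub>M\<^esub> u, v) 1 - Poly_Mapping.single (u, v) c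
       | c u v. u \<in> carrier M \<and> v \<in> carrier N} \<union>
      {Poly_Mapping.single (u, c \<odot>\<^bsub>N\<^esub> v) 1 - Poly_Mapping.single (u, v) c
       | c u v. u \<in> carrier M \<and> v \<in> carrier N})"

locale tensor_pair =
  fixes M :: "('k::field, 'a) module" and N :: "('k, 'b) module"
  assumes vM: "vsp M" and vN: "vsp N"
begin

sublocale M: vectorspace class_ring M by (rule vM)
sublocale N: vectorspace class_ring N by (rule vN)

abbreviation Fs :: "('k, 'a \<times> 'b \<Rightarrow>\<^sub>0 'k) module" where "Fs \<equiv> free_space (carrier M \<times> carrier N)"
abbreviation Rel :: "('a \<times> 'b \<Rightarrow>\<^sub>0 'k) set" where "Rel \<equiv> tensor_relations M N"
abbreviation T :: "('k, ('a \<times> 'b \<Rightarrow>\<^sub>0 'k) set) module" where "T \<equiv> tensor M N"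
abbreviation pure :: "'a \<Rightarrow> 'b \<Rightarrow> ('a \<times> 'b \<Rightarrow>\<^sub>0 'k) set" where "pure \<equiv> pure_tensor M N"

lemma Rel_span: "Rel = LinearCombinations.module.span class_ring Fs (tensor_gens M N)"
  by (simp only: tensor_relations_def tensor_gens_def)

lemma diff_Fs: "f \<in> carrier Fs \<Longrightarrow> g \<in> carrier Fs \<Longrightarrow> f - g \<in> carrier Fs"
  using keys_diff[of f g] by auto

lemma single_Fs: "u \<in> carrier M \<Longrightarrow> v \<in> carrier N \<Longrightarrow> Poly_Mapping.single (u, v) c \<in> carrier Fs"
  by simp

lemma gens_Fs: "tensor_gens M N \<subseteq> carrier Fs"
  unfolding tensor_gens_def
  by (intro Un_least subsetI; elim CollectE exE conjE; hypsubst; intro diff_Fs single_Fs)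
     (auto intro: vs_smult_closed[OF vM] vs_smult_closed[OF vN])

lemma vFs: "vsp Fs" by (rule vs_free_space)

lemma subRel: "VectorSpace.subspace class_ring Rel Fs"
  unfolding Rel_span by (rule vectorspace.span_is_subspace[OF vFs gens_Fs])

lemma gens_Rel: "x \<in> tensor_gens M N \<Longrightarrow> x \<in> Rel"
  unfolding Rel_span
  using module.in_own_span[OF vectorspace.axioms(1)[OF vFs] gens_Fs] by blast

sublocale Q: vs_quotient Fs Rel
  by (rule vs_quotient.intro[OF vFs subRel])

lemma T_eq: "T = quotient_module Fs Rel" by (rule tensor_def)

lemma vT: "vsp T" unfolding T_eq by (rule Q.vs_quotient_module)

lemma pure_eq: "pure u v = Q.q (Poly_Mapping.single (u, v) 1)"
  by (simp add: pure_tensor_def Q.q_def)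

lemma q_eqI: "x \<in> carrier Fs \<Longrightarrow> y \<in> carrier Fs \<Longrightarrow> x - y \<in> tensor_gens M N \<Longrightarrow> Q.q x = Q.q y"
  using Q.q_eq_iff[of x y] gens_Rel by (simp add: free_space_minus)

lemma pure_closed: "u \<in> carrier M \<Longrightarrow> v \<in> carrier N \<Longrightarrow> pure u v \<in> carrier T"
  unfolding pure_eq T_eq Q.carrier_quotient by (intro imageI single_Fs)

lemma smult_pure: "u \<in> carrier M \<Longrightarrow> v \<in> carrier N \<Longrightarrow> c \<odot>\<^bsub>T\<^esub> pure u v = Q.q (Poly_Mapping.single (u, v) c)"
  unfolding pure_eq T_eq using Q.q_smult[OF single_Fs, of u v c 1] by simp

lemma pure_smult1:
  assumes uv: "u \<in> carrier M" "v \<in> carrier N"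
  shows "pure (c \<odot>\<^bsub>M\<^esub> u) v = c \<odot>\<^bsub>T\<^esub> pure u v"
  unfolding smult_pure[OF uv] unfolding pure_eq
  by (rule q_eqI; (intro single_Fs vs_smult_closed[OF vM] uv)?) (use uv in \<open>auto simp: tensor_gens_def\<close>)

lemma pure_smult2:
  assumes uv: "u \<in> carrier M" "v \<in> carrier N"
  shows "pure u (c \<odot>\<^bsub>N\<^esub> v) = c \<odot>\<^bsub>T\<^esub> pure u v"
  unfolding smult_pure[OF uv] unfolding pure_eq
  by (rule q_eqI; (intro single_Fs vs_smult_closed[OF vN] uv)?) (use uv in \<open>auto simp: tensor_gens_def\<close>)

lemma add_pure: "u \<in> carrier M \<Longrightarrow> v \<in> carrier N \<Longrightarrow> u' \<in> carrier M \<Longrightarrow> v' \<in> carrier N \<Longrightarrow>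
  pure u v \<oplus>\<^bsub>T\<^esub> pure u' v' = Q.q (Poly_Mapping.single (u, v) 1 + Poly_Mapping.single (u', v') 1)"
  unfolding pure_eq T_eq using Q.q_add[OF single_Fs single_Fs, of u v u' v' 1 1] by simp

lemma add_Fs: "f \<in> carrier Fs \<Longrightarrow> g \<in> carrier Fs \<Longrightarrow> f + g \<in> carrier Fs"
  using Poly_Mapping.keys_add[of f g] by auto

lemma pure_add1:
  assumes "u \<in> carrier M" "u' \<in> carrier M" "v \<in> carrier N"
  shows "pure (u \<oplus>\<^bsub>M\<^esub> u') v = pure u v \<oplus>\<^bsub>T\<^esub> pure u' v"
  unfolding add_pure[OF assms(1,3,2,3)] unfolding pure_eq
  by (rule q_eqI; (intro add_Fs single_Fs assms M.M.a_closed)?)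
     (unfold tensor_gens_def diff_diff_eq[symmetric], use assms in blast)

lemma pure_add2:
  assumes "u \<in> carrier M" "v \<in> carrier N" "v' \<in> carrier N"
  shows "pure u (v \<oplus>\<^bsub>N\<^esub> v') = pure u v \<oplus>\<^bsub>T\<^esub> pure u v'"
  unfolding add_pure[OF assms(1,2,1,3)] unfolding pure_eq
  by (rule q_eqI; (intro add_Fs single_Fs assms N.M.a_closed)?)
     (unfold tensor_gens_def diff_diff_eq[symmetric], use assms in blast)

lemma pure_bil: "bil M N T pure"
  unfolding bil_def vlin_def
  by (simp add: pure_closed pure_add1 pure_add2 pure_smult1 pure_smult2)

text \<open>Scalars are absorbed into the first factor, so no case for scalar multiples is
  required.\<close>

lemma tensor_induct [consumes 1, case_names zero add pure]:
  assumes x: "x \<in> carrier T" and P0: "P \<zero>\<^bsub>T\<^esub>"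
    and Padd: "\<And>x y. x \<in> carrier T \<Longrightarrow> y \<in> carrier T \<Longrightarrow> P x \<Longrightarrow> P y \<Longrightarrow> P (x \<oplus>\<^bsub>T\<^esub> y)"
    and Ppure: "\<And>u v. u \<in> carrier M \<Longrightarrow> v \<in> carrier N \<Longrightarrow> P (pure u v)"
  shows "P x"
proof -
  have *: "P (Q.q (\<Sum>s\<in>S. Poly_Mapping.single s (c s))) \<and> (\<Sum>s\<in>S. Poly_Mapping.single s (c s)) \<in> carrier Fs"
    if "finite S" "S \<subseteq> carrier M \<times> carrier N" for S and c :: "'a \<times> 'b \<Rightarrow> 'k"
    using that
  proof (induction S)
    case empty
    then show ?case using P0 by (simp add: T_eq Q.zero_quotient Q.q_zero[simplified])
  next
    case (insert s S)
    obtain u v where s: "s = (u, v)" "u \<in> carrier M" "v \<in> carrier N" using insert.prems by auto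
    have i: "Poly_Mapping.single s (c s) \<in> carrier Fs" "(\<Sum>s\<in>S. Poly_Mapping.single s (c s)) \<in> carrier Fs"
      "P (Q.q (\<Sum>s\<in>S. Poly_Mapping.single s (c s)))"
      using insert single_Fs[OF s(2,3)] by (auto simp: s(1))
    have "P (Q.q (Poly_Mapping.single s (c s)))"
      unfolding s(1) smult_pure[OF s(2,3), symmetric] pure_smult1[OF s(2,3), symmetric]
      using s(2,3) by (intro Ppure vs_smult_closed[OF vM])
    moreover have "Q.q (Poly_Mapping.single s (c s)) \<in> carrier T"
      "Q.q (\<Sum>s\<in>S. Poly_Mapping.single s (c s)) \<in> carrier T"
      unfolding T_eq Q.carrier_quotient using i by blast+
    ultimately have "P (Q.q (Poly_Mapping.single s (c s)) \<oplus>\<^bsub>T\<^esub> Q.q (\<Sum>s\<in>S. Poly_Mapping.single s (c s)))"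
      using Padd i(3) by blast
    then show ?case using Q.q_add[OF i(1,2)] add_Fs[OF i(1,2)] insert.hyps by (simp add: T_eq)
  qed
  obtain f where f: "kys f \<subseteq> carrier M \<times> carrier N" "x = Q.q f"
    using x unfolding T_eq Q.carrier_quotient by auto
  show ?thesis using *[OF finite_keys f(1), of "lkp f"] unfolding sum_singles f(2) by blast
qed

context
  fixes P :: "('k, 'c) module" and \<phi> :: "'a \<Rightarrow> 'b \<Rightarrow> 'c"
  assumes vP: "vsp P" and bil: "bil M N P \<phi>"
begin

interpretation P: vectorspace class_ring P by (rule vP)

text \<open>The linear map on formal sums that \<open>tensor_lift\<close> evaluates on a
  representative; it is studied on the free space first and then shown to vanish on the
  relations.\<close>

definition flin :: "('a \<times> 'b \<Rightarrow>\<^sub>0 'k) \<Rightarrow> 'c"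
  where "flin x = (\<Oplus>\<^bsub>P\<^esub> z \<in> kys x. lkp x z \<odot>\<^bsub>P\<^esub> \<phi> (fst z) (snd z))"

lemma phi_closed: "z \<in> carrier M \<times> carrier N \<Longrightarrow> \<phi> (fst z) (snd z) \<in> carrier P"
  using bil unfolding bil_def vlin_def by auto

lemma flin_superset:
  assumes "finite S" "kys x \<subseteq> S" "S \<subseteq> carrier M \<times> carrier N"
  shows "flin x = (\<Oplus>\<^bsub>P\<^esub> z \<in> S. lkp x z \<odot>\<^bsub>P\<^esub> \<phi> (fst z) (snd z))"
  unfolding flin_def
proof (rule P.M.add.finprod_mono_neutral_cong_left)
  show "\<And>i. i \<in> S - kys x \<Longrightarrow> lkp x i \<odot>\<^bsub>P\<^esub> \<phi> (fst i) (snd i) = \<zero>\<^bsub>P\<^esub>"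
    using phi_closed assms by (auto simp: kys_iff vsp_zero_smult[OF vP])
  show "(\<lambda>z. lkp x z \<odot>\<^bsub>P\<^esub> \<phi> (fst z) (snd z)) \<in> S \<rightarrow> carrier P"
    using phi_closed assms by (auto intro: vs_smult_closed[OF vP])
qed (use assms in auto)

lemma flin_vlin: "vlin Fs P flin"
  unfolding vlin_def
proof (intro conjI ballI allI)
  fix x assume x: "x \<in> carrier Fs"
  have cl: "(\<lambda>z. lkp w z \<odot>\<^bsub>P\<^esub> \<phi> (fst z) (snd z)) \<in> S \<rightarrow> carrier P" if "S \<subseteq> carrier M \<times> carrier N" for w S
    using that phi_closed by (auto intro: vs_smult_closed[OF vP])
  show "flin x \<in> carrier P" unfolding flin_def using cl x by (intro P.M.finsum_closed) auto
  show "flin (c \<odot>\<^bsub>Fs\<^esub> x) = c \<odot>\<^bsub>P\<^esub> flin x" for c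
  proof -
    have "flin (c \<odot>\<^bsub>Fs\<^esub> x) = (\<Oplus>\<^bsub>P\<^esub> z \<in> kys x. (c * lkp x z) \<odot>\<^bsub>P\<^esub> \<phi> (fst z) (snd z))"
      using x kys_smult_map[of c x] by (subst flin_superset[of "kys x"]) (auto simp: lookup_smult_map)
    also have "\<dots> = (\<Oplus>\<^bsub>P\<^esub> z \<in> kys x. c \<odot>\<^bsub>P\<^esub> (lkp x z \<odot>\<^bsub>P\<^esub> \<phi> (fst z) (snd z)))"
    proof (rule P.M.add.finprod_cong')
      fix z assume "z \<in> kys x"
      then have "\<phi> (fst z) (snd z) \<in> carrier P" using x phi_closed by auto
      then show "(c * lkp x z) \<odot>\<^bsub>P\<^esub> \<phi> (fst z) (snd z) = c \<odot>\<^bsub>P\<^esub> (lkp x z \<odot>\<^bsub>P\<^esub> \<phi> (fst z) (snd z))"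
        using P.smult_assoc1[of c "lkp x z" "\<phi> (fst z) (snd z)"] by (simp add: class_ring_simps)
    qed (use cl[of "kys x"] x in \<open>auto intro: vs_smult_closed[OF vP]\<close>)
    also have "\<dots> = c \<odot>\<^bsub>P\<^esub> flin x"
      unfolding flin_def using cl[of "kys x" x] x by (subst vsp_smult_finsum[OF vP]) auto
    finally show ?thesis .
  qed
  fix y assume y: "y \<in> carrier Fs"
  let ?S = "kys x \<union> kys y"
  have S: "finite ?S" "?S \<subseteq> carrier M \<times> carrier N" using x y by auto
  have "flin (x + y) = (\<Oplus>\<^bsub>P\<^esub> z \<in> ?S. lkp (x + y) z \<odot>\<^bsub>P\<^esub> \<phi> (fst z) (snd z))"
    using Poly_Mapping.keys_add[of x y] S by (intro flin_superset) auto
  also have "\<dots> = (\<Oplus>\<^bsub>P\<^esub> z \<in> ?S. lkp x z \<odot>\<^bsub>P\<^esub> \<phi> (fst z) (snd z) \<oplus>\<^bsub>P\<^esub> lkp y z \<odot>\<^bsub>P\<^esub> \<phi> (fst z) (snd z))"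
  proof (rule P.M.add.finprod_cong')
    fix z assume "z \<in> ?S"
    then have "\<phi> (fst z) (snd z) \<in> carrier P" using S phi_closed by blast
    then show "lkp (x + y) z \<odot>\<^bsub>P\<^esub> \<phi> (fst z) (snd z) =
        lkp x z \<odot>\<^bsub>P\<^esub> \<phi> (fst z) (snd z) \<oplus>\<^bsub>P\<^esub> lkp y z \<odot>\<^bsub>P\<^esub> \<phi> (fst z) (snd z)"
      using P.smult_l_distr[of "lkp x z" "lkp y z" "\<phi> (fst z) (snd z)"]
      by (simp add: class_ring_simps lookup_add)
  qed (use cl[OF S(2)] in \<open>auto intro!: P.M.a_closed simp: Pi_iff\<close>)
  also have "\<dots> = flin x \<oplus>\<^bsub>P\<^esub> flin y"
    using cl[OF S(2)] S by (subst P.M.finsum_addf) (auto simp: flin_superset[OF S(1) _ S(2)])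
  finally show "flin (x \<oplus>\<^bsub>Fs\<^esub> y) = flin x \<oplus>\<^bsub>P\<^esub> flin y" by simp
qed

lemma flin_single: "u \<in> carrier M \<Longrightarrow> v \<in> carrier N \<Longrightarrow> flin (Poly_Mapping.single (u, v) c) = c \<odot>\<^bsub>P\<^esub> \<phi> u v"
  using phi_closed[of "(u, v)"] vs_smult_closed[OF vP, of "\<phi> u v" c]
  by (subst flin_superset[of "{(u, v)}"]) auto

lemma flin_diff:
  assumes "x \<in> carrier Fs" "y \<in> carrier Fs" shows "flin (x - y) = flin x \<ominus>\<^bsub>P\<^esub> flin y"
proof -
  have d: "x - y \<in> carrier Fs" using assms by (rule diff_Fs)
  have c: "flin x \<in> carrier P" "flin y \<in> carrier P" "flin (x - y) \<in> carrier P"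
    using vlinD(1)[OF flin_vlin] assms d by blast+
  have "flin x = flin (x - y) \<oplus>\<^bsub>P\<^esub> flin y" using vlinD(2)[OF flin_vlin d assms(2)] by simp
  then show ?thesis using c by (simp add: a_minus_def P.M.a_assoc P.M.r_neg)
qed

lemma flin_gens: "x \<in> tensor_gens M N \<Longrightarrow> flin x = \<zero>\<^bsub>P\<^esub>"
proof -
  have l1: "vlin M P (\<lambda>u. \<phi> u v)" if "v \<in> carrier N" for v using bil that unfolding bil_def by blast
  have l2: "vlin N P (\<phi> u)" if "u \<in> carrier M" for u using bil that unfolding bil_def by blast
  have cl: "\<phi> u v \<in> carrier P" if "u \<in> carrier M" "v \<in> carrier N" for u v using phi_closed[of "(u, v)"] that by simp
  have one: "1 \<odot>\<^bsub>P\<^esub> x = x" if "x \<in> carrier P" for x using P.smult_one[OF that] by (simp add: class_ring_simps)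
  have min: "a \<ominus>\<^bsub>P\<^esub> b \<ominus>\<^bsub>P\<^esub> c = \<zero>\<^bsub>P\<^esub>" if "a = b \<oplus>\<^bsub>P\<^esub> c" "b \<in> carrier P" "c \<in> carrier P" for a b c
  proof -
    have "a \<ominus>\<^bsub>P\<^esub> b \<ominus>\<^bsub>P\<^esub> c = a \<ominus>\<^bsub>P\<^esub> a"
      unfolding that(1) a_minus_def using that(2,3) by (simp add: P.M.minus_add P.M.a_assoc)
    then show ?thesis using that by (simp add: a_minus_def P.M.r_neg)
  qed
  note s = single_Fs diff_Fs flin_diff flin_single one cl
  assume "x \<in> tensor_gens M N"
  then consider (a) u u' v where "x = Poly_Mapping.single (u \<oplus>\<^bsub>M\<^esub> u', v) 1 - Poly_Mapping.single (u, v) 1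
         - Poly_Mapping.single (u', v) 1" "u \<in> carrier M" "u' \<in> carrier M" "v \<in> carrier N"
    | (b) u v v' where "x = Poly_Mapping.single (u, v \<oplus>\<^bsub>N\<^esub> v') 1 - Poly_Mapping.single (u, v) 1
         - Poly_Mapping.single (u, v') 1" "u \<in> carrier M" "v \<in> carrier N" "v' \<in> carrier N"
    | (c) c u v where "x = Poly_Mapping.single (c \<odot>\<^bsub>M\<^esub> u, v) 1 - Poly_Mapping.single (u, v) c"
        "u \<in> carrier M" "v \<in> carrier N"
    | (d) c u v where "x = Poly_Mapping.single (u, c \<odot>\<^bsub>N\<^esub> v) 1 - Poly_Mapping.single (u, v) c"
        "u \<in> carrier M" "v \<in> carrier N"
    unfolding tensor_gens_def by blast
  then show ?thesis
  proof cases
    case a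
    have m: "u \<oplus>\<^bsub>M\<^esub> u' \<in> carrier M" using a by simp
    have "flin x = \<phi> (u \<oplus>\<^bsub>M\<^esub> u') v \<ominus>\<^bsub>P\<^esub> \<phi> u v \<ominus>\<^bsub>P\<^esub> \<phi> u' v"
      unfolding a(1) using a(2-4) m by (simp only: s)
    then show ?thesis using min[OF vlinD(2)[OF l1[OF a(4)] a(2,3)]] a cl by simp
  next
    case b
    have m: "v \<oplus>\<^bsub>N\<^esub> v' \<in> carrier N" using b by simp
    have "flin x = \<phi> u (v \<oplus>\<^bsub>N\<^esub> v') \<ominus>\<^bsub>P\<^esub> \<phi> u v \<ominus>\<^bsub>P\<^esub> \<phi> u v'"
      unfolding b(1) using b(2-4) m by (simp only: s)
    then show ?thesis using min[OF vlinD(2)[OF l2[OF b(2)] b(3,4)]] b cl by simp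
  next
    case c
    have m: "c \<odot>\<^bsub>M\<^esub> u \<in> carrier M" using c by (intro vs_smult_closed[OF vM])
    have "flin x = \<phi> (c \<odot>\<^bsub>M\<^esub> u) v \<ominus>\<^bsub>P\<^esub> c \<odot>\<^bsub>P\<^esub> \<phi> u v"
      unfolding c(1) using c(2,3) m by (simp only: s)
    then show ?thesis using vlinD(3)[OF l1[OF c(3)] c(2)] vs_smult_closed[OF vP cl[OF c(2,3)]]
      by (simp add: a_minus_def P.M.r_neg)
  next
    case d
    have m: "c \<odot>\<^bsub>N\<^esub> v \<in> carrier N" using d by (intro vs_smult_closed[OF vN])
    have "flin x = \<phi> u (c \<odot>\<^bsub>N\<^esub> v) \<ominus>\<^bsub>P\<^esub> c \<odot>\<^bsub>P\<^esub> \<phi> u v"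
      unfolding d(1) using d(2,3) m by (simp only: s)
    then show ?thesis using vlinD(3)[OF l2[OF d(2)] d(3)] vs_smult_closed[OF vP cl[OF d(2,3)]]
      by (simp add: a_minus_def P.M.r_neg)
  qed
qed

text \<open>The kernel of \<open>flin\<close> is a subspace that contains the generators, hence
  their span.\<close>

lemma flin_Rel: "x \<in> Rel \<Longrightarrow> flin x = \<zero>\<^bsub>P\<^esub>"
proof -
  let ?K = "{x \<in> carrier Fs. flin x = \<zero>\<^bsub>P\<^esub>}"
  have s: "VectorSpace.subspace class_ring ?K Fs"
    unfolding vs_subspace_iff[OF vFs]
  proof (intro conjI ballI allI)
    show "\<zero>\<^bsub>Fs\<^esub> \<in> ?K" using vlin_zero[OF vFs vP flin_vlin] by simp
    show "x \<oplus>\<^bsub>Fs\<^esub> y \<in> ?K" if "x \<in> ?K" "y \<in> ?K" for x y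
      using that vlinD(2)[OF flin_vlin, of x y] add_Fs[of x y] by simp
    show "c \<odot>\<^bsub>Fs\<^esub> x \<in> ?K" if "x \<in> ?K" for c x
      using that vlinD(3)[OF flin_vlin, of x c] vs_smult_closed[OF vFs, of x c] vsp_zero_smult[OF vP] by simp
  qed auto
  have "Rel \<subseteq> ?K" unfolding Rel_span
    by (rule module.span_is_subset[OF vectorspace.axioms(1)[OF vFs]])
       (use gens_Fs flin_gens subspace.submod[OF s] in auto)
  then show "x \<in> Rel \<Longrightarrow> flin x = \<zero>\<^bsub>P\<^esub>" by blast
qed

text \<open>All representatives of a class give the same sum, so the definite description in
  \<open>tensor_lift\<close> denotes it.\<close>

lemma lift_q: "x \<in> carrier Fs \<Longrightarrow> tensor_lift P \<phi> (Q.q x) = flin x"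
proof -
  assume x: "x \<in> carrier Fs"
  have *: "flin x' = flin x" if "x' \<in> Q.q x" for x'
  proof -
    from that have "\<exists>n\<in>Rel. x' = n \<oplus>\<^bsub>Fs\<^esub> x" by (rule Q.q_mem[THEN iffD1])
    then obtain n where n: "n \<in> Rel" "x' = n \<oplus>\<^bsub>Fs\<^esub> x" by (elim bexE)
    have nc: "n \<in> carrier Fs" by (rule subsetD[OF Q.N_sub n(1)])
    show ?thesis
      unfolding n(2) vlinD(2)[OF flin_vlin nc x] flin_Rel[OF n(1)]
      by (rule P.M.l_zero[OF vlinD(1)[OF flin_vlin x]])
  qed
  show ?thesis unfolding tensor_lift_def flin_def[symmetric]
  proof (rule the_equality)
    show "\<forall>x'\<in>Q.q x. flin x = flin x'" by (intro ballI, rule sym, rule *)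
    show "y = flin x" if "\<forall>x'\<in>Q.q x. y = flin x'" for y
      by (rule bspec[OF that Q.q_self[OF x]])
  qed
qed

lemma lift_vlin: "vlin T P (tensor_lift P \<phi>)"
proof -
  have ex: "\<exists>x\<in>carrier Fs. X = Q.q x" if "X \<in> carrier T" for X
    using that unfolding T_eq Q.carrier_quotient by blast
  show ?thesis
    unfolding vlin_def
  proof (intro conjI ballI allI)
    fix X assume "X \<in> carrier T"
    then obtain x where x: "x \<in> carrier Fs" "X = Q.q x" using ex by blast
    show "tensor_lift P \<phi> X \<in> carrier P"
      unfolding x(2) lift_q[OF x(1)] by (rule vlinD(1)[OF flin_vlin x(1)])
    show "tensor_lift P \<phi> (c \<odot>\<^bsub>T\<^esub> X) = c \<odot>\<^bsub>P\<^esub> tensor_lift P \<phi> X" for c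
      unfolding x(2) T_eq Q.q_smult[OF x(1)] lift_q[OF x(1)] lift_q[OF vs_smult_closed[OF vFs x(1)]]
      by (rule vlinD(3)[OF flin_vlin x(1)])
    fix Y assume "Y \<in> carrier T"
    then obtain y where y: "y \<in> carrier Fs" "Y = Q.q y" using ex by blast
    have xy: "x \<oplus>\<^bsub>Fs\<^esub> y \<in> carrier Fs" using add_Fs[OF x(1) y(1)] by simp
    show "tensor_lift P \<phi> (X \<oplus>\<^bsub>T\<^esub> Y) = tensor_lift P \<phi> X \<oplus>\<^bsub>P\<^esub> tensor_lift P \<phi> Y"
      unfolding x(2) y(2) T_eq Q.q_add[OF x(1) y(1)] lift_q[OF x(1)] lift_q[OF y(1)] lift_q[OF xy]
      by (rule vlinD(2)[OF flin_vlin x(1) y(1)])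
  qed
qed

lemma lift_pure: "u \<in> carrier M \<Longrightarrow> v \<in> carrier N \<Longrightarrow> tensor_lift P \<phi> (pure u v) = \<phi> u v"
proof -
  assume a: "u \<in> carrier M" "v \<in> carrier N"
  then have "\<phi> u v \<in> carrier P" using phi_closed[of "(u, v)"] by simp
  then show ?thesis unfolding pure_eq lift_q[OF single_Fs[OF a]] flin_single[OF a]
    using P.smult_one by (simp add: class_ring_simps)
qed

end

end

section \<open>Vanishing in coordinates\<close>

context bigraded
begin

text \<open>The column of a single matrix. It is not tied to a fixed list of columns, so that
  \<open>Van\<close> can range over all matrices coming from K.\<close>

definition form :: "(nat \<Rightarrow> nat \<Rightarrow> 'k) \<Rightarrow> nat \<Rightarrow> 'k laurent"
  where "form A v = (if v < n1 then
      \<Sum>j<n2. Poly_Mapping.single (Poly_Mapping.single (n1 + j) 1) (A v j)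
    else if v < N then
      - (\<Sum>i<n1. Poly_Mapping.single (Poly_Mapping.single i 1) (A i (v - n1)))
    else 0)"

definition H :: "nat \<Rightarrow> nat \<Rightarrow> 'k laurent set"
  where "H d e = {h. \<forall>\<alpha>\<in>kys h. rg {} \<alpha> \<and> xd \<alpha> = int d \<and> yd \<alpha> = int e}"

definition Fam :: "nat \<Rightarrow> nat \<Rightarrow> (nat \<Rightarrow> 'k laurent) set"
  where "Fam d e = {F. \<forall>v<N. F v \<in> H (d + (if v < n1 then 0 else 1)) (e + (if v < n1 then 1 else 0))}"

text \<open>Membership in the image of K tensor S_(d,e) in coordinates: a finite sum of pure
  tensors, of unbounded length, with scalars absorbed into the polynomials g.\<close>

definition represented :: "(nat \<Rightarrow> nat \<Rightarrow> 'k) set \<Rightarrow> nat \<Rightarrow> nat \<Rightarrow> (nat \<Rightarrow> 'k laurent) \<Rightarrow> bool"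
  where "represented S d e F \<longleftrightarrow> (\<exists>(m::nat) A g. (\<forall>l<m. A l \<in> S \<and> g l \<in> H d e) \<and>
    (\<forall>v<N. F v = (\<Sum>l<m. form (A l) v * g l)))"

definition Van :: "(nat \<Rightarrow> nat \<Rightarrow> 'k) set \<Rightarrow> nat \<Rightarrow> nat \<Rightarrow> bool"
  where "Van S d e \<longleftrightarrow> (\<forall>F\<in>Fam d e. (\<Sum>v<N. z v * F v) = 0 \<longrightarrow> represented S d e F)"

lemma H_0: "0 \<in> H d e" by (simp add: H_def)

lemma H_add: "a \<in> H d e \<Longrightarrow> b \<in> H d e \<Longrightarrow> a + b \<in> H d e"
  using Poly_Mapping.keys_add[of a b] unfolding H_def by blast

lemma H_uminus: "a \<in> H d e \<Longrightarrow> - a \<in> H d e"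
  by (simp add: H_def kys_uminus)

lemma H_sum: "(\<And>i. i \<in> S \<Longrightarrow> g i \<in> H d e) \<Longrightarrow> sum g S \<in> H d e"
  by (induction S rule: infinite_finite_induct) (auto intro: H_0 H_add)

lemma H_mult: "a \<in> H d e \<Longrightarrow> b \<in> H d' e' \<Longrightarrow> a * b \<in> H (d + d') (e + e')"
  by (fastforce simp: H_def xd_add yd_add dest!: kys_mult intro: rg_add)

lemma H_const: "Poly_Mapping.single 0 c \<in> H 0 0"
  by (simp add: H_def rg_def xd_def yd_def)

lemma H_1: "1 \<in> H 0 0" using H_const[of 1] by simp

lemma yd_single_less: "v < N \<Longrightarrow> yd (Poly_Mapping.single v c) = (if v < n1 then 0 else c)"
  by (simp add: yd_single)

lemma H_z: "v < N \<Longrightarrow> z v \<in> H (if v < n1 then 1 else 0) (if v < n1 then 0 else 1)"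
  using rg_single[of v 1 "{}"] by (auto simp: z_def H_def xd_single yd_single_less)

lemma H_zx: "i < n1 \<Longrightarrow> z i \<in> H 1 0" and H_zy: "j < n2 \<Longrightarrow> z (n1 + j) \<in> H 0 1"
  using H_z[of i] H_z[of "n1 + j"] by (auto simp: N_def)

lemma H_power: "a \<in> H d e \<Longrightarrow> a ^ k \<in> H (k * d) (k * e)"
  by (induction k) (auto simp: H_1 intro: H_mult)

lemma H_single: "Poly_Mapping.single \<alpha> c \<in> H d e \<longleftrightarrow> c = 0 \<or> rg {} \<alpha> \<and> xd \<alpha> = int d \<and> yd \<alpha> = int e"
  by (auto simp: H_def)

lemma represented_cong: "represented S d e F \<Longrightarrow> (\<And>v. v < N \<Longrightarrow> F v = G v) \<Longrightarrow> represented S d e G"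
  unfolding represented_def by auto

lemma represented_0: "represented S d e (\<lambda>v. 0)"
  unfolding represented_def by (rule exI[of _ 0]) simp

lemma represented_mult: "represented S d e F \<Longrightarrow> h \<in> H d' e' \<Longrightarrow> represented S (d + d') (e + e') (\<lambda>v. h * F v)"
proof -
  assume F: "represented S d e F" and h: "h \<in> H d' e'"
  obtain m :: nat and A g where *: "\<forall>l<m. A l \<in> S \<and> g l \<in> H d e" "\<forall>v<N. F v = (\<Sum>l<m. form (A l) v * g l)"
    using F unfolding represented_def by blast
  have "\<forall>l<m. A l \<in> S \<and> h * g l \<in> H (d + d') (e + e')"
    using * H_mult[OF h, of _ d e] by (simp add: add.commute)
  moreover have "\<forall>v<N. h * F v = (\<Sum>l<m. form (A l) v * (h * g l))"
    using * by (simp add: sum_distrib_left mult.left_commute)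
  ultimately show ?thesis unfolding represented_def
    by (intro exI[of _ m] exI[of _ A] exI[of _ "\<lambda>l. h * g l"] conjI)
qed

lemma sum_append: "(\<Sum>l<m + k. if l < m then p l else q (l - m)) = sum p {..<m} + sum q {..<k::nat}"
  for p q :: "nat \<Rightarrow> 'b::comm_monoid_add"
proof -
  have s: "{..<m + k} = {..<m} \<union> {m..<m + k}" by auto
  have "(\<Sum>l\<in>{m..<m + k}. if l < m then p l else q (l - m)) = sum q {..<k}"
    by (rule sum.reindex_bij_witness[of _ "\<lambda>j. m + j" "\<lambda>v. v - m"]) auto
  then show ?thesis unfolding s by (subst sum.union_disjoint) auto
qed

text \<open>\<open>bigraded_generated\<close> asks for one finite list of columns that serves all
  syzygies at once, whereas each representation brings its own. The lists are concatenated and the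
  coefficients padded with zeros.\<close>

lemma common_coefficients:
  assumes "finite Q" "\<And>F. F \<in> Q \<Longrightarrow> represented S d e F"
  shows "\<exists>(m::nat) A. (\<forall>l<m. A l \<in> S) \<and> (\<forall>F\<in>Q. \<exists>g. (\<forall>l<m. g l \<in> H d e) \<and>
    (\<forall>v<N. F v = (\<Sum>l<m. form (A l) v * g l)))"
  using assms
proof (induction Q)
  case empty
  show ?case by (rule exI[of _ 0]) simp
next
  case (insert F Q)
  obtain m :: nat and A where mA: "\<forall>l<m. A l \<in> S" and Q: "\<forall>F\<in>Q. \<exists>g. (\<forall>l<m. g l \<in> H d e) \<and>
      (\<forall>v<N. F v = (\<Sum>l<m. form (A l) v * g l))"
    using insert by blast
  obtain k :: nat and B h where kB: "\<forall>l<k. B l \<in> S \<and> h l \<in> H d e" and F: "\<forall>v<N. F v = (\<Sum>l<k. form (B l) v * h l)"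
    using insert.prems[of F] unfolding represented_def by blast
  define C where "C = (\<lambda>l. if l < m then A l else B (l - m))"
  have sp: "(\<Sum>l<m + k. form (C l) v * (if l < m then p l else q (l - m))) =
      (\<Sum>l<m. form (A l) v * p l) + (\<Sum>l<k. form (B l) v * q l)" for p q v
    unfolding sum_append[symmetric] by (intro sum.cong refl) (simp add: C_def)
  have "\<forall>l<m + k. C l \<in> S" using mA kB by (simp add: C_def)
  moreover have "\<exists>g. (\<forall>l<m + k. g l \<in> H d e) \<and> (\<forall>v<N. G v = (\<Sum>l<m + k. form (C l) v * g l))"
    if "G \<in> insert F Q" for G
  proof (cases "G = F")
    case True
    show ?thesis
    proof (intro exI[of _ "\<lambda>l. if l < m then 0 else h (l - m)"] conjI allI impI)
      show "(if l < m then 0 else h (l - m)) \<in> H d e" if "l < m + k" for l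
        using kB that by (simp add: H_0)
      show "G v = (\<Sum>l<m + k. form (C l) v * (if l < m then 0 else h (l - m)))" if "v < N" for v
        unfolding sp[of _ "\<lambda>_. 0" h] using F True that by simp
    qed
  next
    case False
    then have "G \<in> Q" using that by simp
    from bspec[OF Q this] obtain g
      where g: "\<forall>l<m. g l \<in> H d e" "\<forall>v<N. G v = (\<Sum>l<m. form (A l) v * g l)" by (elim exE conjE)
    show ?thesis
    proof (intro exI[of _ "\<lambda>l. if l < m then g l else (\<lambda>_. 0) (l - m)"] conjI allI impI)
      show "(if l < m then g l else (\<lambda>_. 0) (l - m)) \<in> H d e" for l
        using g by (simp add: H_0)
      show "G v = (\<Sum>l<m + k. form (C l) v * (if l < m then g l else (\<lambda>_. 0) (l - m)))" if "v < N" for v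
        unfolding sp[of _ _ "\<lambda>_. 0"] using g that by simp
    qed
  qed
  ultimately show ?case by (intro exI[of _ "m + k"] exI[of _ C] conjI ballI) simp_all
qed

lemma represented_add:
  assumes "represented S d e F" "represented S d e G"
  shows "represented S d e (\<lambda>v. F v + G v)"
proof -
  obtain m :: nat and A where mA: "\<forall>l<m. A l \<in> S" and Q: "\<forall>F\<in>{F, G}. \<exists>g. (\<forall>l<m. g l \<in> H d e) \<and>
      (\<forall>v<N. F v = (\<Sum>l<m. form (A l) v * g l))"
    using common_coefficients[of "{F, G}" S d e] assms by blast
  have "F \<in> {F, G}" "G \<in> {F, G}" by simp_all
  from bspec[OF Q this(1)] bspec[OF Q this(2)]
  obtain g h where "\<forall>l<m. g l \<in> H d e" "\<forall>v<N. F v = (\<Sum>l<m. form (A l) v * g l)"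
    "\<forall>l<m. h l \<in> H d e" "\<forall>v<N. G v = (\<Sum>l<m. form (A l) v * h l)"
    by (elim exE conjE)
  then show ?thesis unfolding represented_def using mA
    by (intro exI[of _ m] exI[of _ A] exI[of _ "\<lambda>l. g l + h l"]) (simp add: H_add sum.distrib distrib_left)
qed

lemma represented_uminus: "represented S d e F \<Longrightarrow> represented S d e (\<lambda>v. - F v)"
  using represented_mult[of S d e F "- 1" 0 0] H_uminus[OF H_1] by simp

lemma represented_sum: "(\<And>i. i \<in> I \<Longrightarrow> represented S d e (F i)) \<Longrightarrow> represented S d e (\<lambda>v. \<Sum>i\<in>I. F i v)"
  by (induction I rule: infinite_finite_induct) (auto intro: represented_0 represented_add)

section \<open>Koszul syzygies and propagation to larger bidegrees\<close>

definition syz :: "nat \<Rightarrow> nat \<Rightarrow> nat \<Rightarrow> 'k laurent"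
  where "syz a b v = (if v = a then z b else 0) - (if v = b then z a else 0)"

lemma z_syz: "a < N \<Longrightarrow> b < N \<Longrightarrow> (\<Sum>v<N. z v * syz a b v) = 0"
  by (simp add: syz_def right_diff_distrib sum_subtractf if_distrib[of "\<lambda>t. _ * t"] mult.commute
      cong: if_cong)

lemma syz_Fam:
  assumes ab: "a < n1" "n1 \<le> b" "b < N" and h: "h \<in> H d e"
  shows "(\<lambda>v. h * syz a b v) \<in> Fam d e"
proof -
  have "h * z b \<in> H d (e + 1)" "h * z a \<in> H (d + 1) e"
    using H_mult[OF h H_z[of b]] H_mult[OF h H_z[of a]] ab by auto
  then show ?thesis using ab H_uminus
    by (auto simp: Fam_def syz_def H_0)
qed

lemma Van_syz:
  assumes "Van S d e" "a < n1" "n1 \<le> b" "b < N" "h \<in> H d e"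
  shows "represented S d e (\<lambda>v. h * syz a b v)"
proof -
  have "(\<Sum>v<N. z v * (h * syz a b v)) = h * (\<Sum>v<N. z v * syz a b v)"
    by (simp add: sum_distrib_left mult.left_commute)
  then show ?thesis using assms z_syz[of a b] syz_Fam[of a b h d e] unfolding Van_def by simp
qed

lemma exists_x_variable:
  assumes "rg {} \<alpha>" "0 < xd \<alpha>"
  shows "\<exists>i<n1. 1 \<le> lkp \<alpha> i"
proof (rule ccontr)
  assume "\<not> ?thesis"
  then have "xd \<alpha> \<le> 0" unfolding xd_def by (intro sum_nonpos) force
  then show False using assms by simp
qed

lemma exists_y_variable:
  assumes "rg {} \<alpha>" "0 < yd \<alpha>"
  shows "\<exists>i. n1 \<le> i \<and> i < N \<and> 1 \<le> lkp \<alpha> i"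
proof (rule ccontr)
  assume "\<not> ?thesis"
  then have "yd \<alpha> \<le> 0" unfolding yd_def by (intro sum_nonpos) force
  then show False using assms by simp
qed

lemma rg_remove:
  assumes "rg {} \<alpha>" "v < N" "1 \<le> lkp \<alpha> v"
  shows "rg {} (\<alpha> - Poly_Mapping.single v 1)"
    and "xd (\<alpha> - Poly_Mapping.single v 1) = xd \<alpha> - (if v < n1 then 1 else 0)"
    and "yd (\<alpha> - Poly_Mapping.single v 1) = yd \<alpha> - (if v < n1 then 0 else 1)"
proof -
  have "kys (\<alpha> - Poly_Mapping.single v 1) \<subseteq> {..<N}"
    using keys_diff[of \<alpha> "Poly_Mapping.single v 1"] assms(1,2) by (auto simp: rg_def split: if_splits)
  then show "rg {} (\<alpha> - Poly_Mapping.single v 1)"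
    using assms by (auto simp: rg_def lookup_minus lookup_single when_def not_less)
  have "\<alpha> = (\<alpha> - Poly_Mapping.single v 1) + Poly_Mapping.single v 1" by simp
  then show "xd (\<alpha> - Poly_Mapping.single v 1) = xd \<alpha> - (if v < n1 then 1 else 0)"
    "yd (\<alpha> - Poly_Mapping.single v 1) = yd \<alpha> - (if v < n1 then 0 else 1)"
    using xd_add[of "\<alpha> - Poly_Mapping.single v 1" "Poly_Mapping.single v 1"]
      yd_add[of "\<alpha> - Poly_Mapping.single v 1" "Poly_Mapping.single v 1"] yd_single_less[OF assms(2), of 1]
    by (auto simp: xd_single)
qed

text \<open>Variables are split off one at a time; as long as a degree is positive, some variable of
  that group occurs in the monomial.\<close>

lemma split_monomial:
  assumes "rg {} \<alpha>" "xd \<alpha> = int (d + a)" "yd \<alpha> = int (e + b)"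
  shows "\<exists>\<beta> \<gamma>. \<alpha> = \<beta> + \<gamma> \<and> rg {} \<beta> \<and> xd \<beta> = int d \<and> yd \<beta> = int e \<and>
    rg {} \<gamma> \<and> xd \<gamma> = int a \<and> yd \<gamma> = int b"
  using assms
proof (induction "a + b" arbitrary: a b \<alpha>)
  case 0
  then show ?case by (intro exI[of _ \<alpha>] exI[of _ 0]) (auto simp: rg_def xd_def yd_def)
next
  case (Suc k)
  show ?case
  proof (cases "a = 0")
    case False
    then obtain a' where a: "a = Suc a'" using not0_implies_Suc by blast
    obtain i where i: "i < n1" "1 \<le> lkp \<alpha> i" using exists_x_variable[OF Suc.prems(1)] Suc.prems(2) a by auto
    have iN: "i < N" using i by (simp add: N_def)
    have "\<exists>\<beta> \<gamma>. \<alpha> - Poly_Mapping.single i 1 = \<beta> + \<gamma> \<and> rg {} \<beta> \<and> xd \<beta> = int d \<and> yd \<beta> = int e \<and>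
        rg {} \<gamma> \<and> xd \<gamma> = int a' \<and> yd \<gamma> = int b"
      using rg_remove[OF Suc.prems(1) iN i(2)] Suc.hyps(2) Suc.prems(2,3) i a by (intro Suc.hyps(1)) auto
    then obtain \<beta> \<gamma> where *: "\<alpha> - Poly_Mapping.single i 1 = \<beta> + \<gamma>" "rg {} \<beta>" "xd \<beta> = int d" "yd \<beta> = int e"
        "rg {} \<gamma>" "xd \<gamma> = int a'" "yd \<gamma> = int b" by blast
    show ?thesis
      by (rule exI[of _ \<beta>], rule exI[of _ "\<gamma> + Poly_Mapping.single i 1"])
         (use * rg_single[OF iN, of 1 "{}"] i iN a in
          \<open>auto simp: xd_add yd_add xd_single yd_single_less rg_add algebra_simps\<close>)
  next
    case True
    then obtain b' where b: "b = Suc b'" using Suc.hyps(2) by (cases b) auto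
    obtain i where i: "n1 \<le> i" "i < N" "1 \<le> lkp \<alpha> i" using exists_y_variable[OF Suc.prems(1)] Suc.prems(3) b by auto
    have "\<exists>\<beta> \<gamma>. \<alpha> - Poly_Mapping.single i 1 = \<beta> + \<gamma> \<and> rg {} \<beta> \<and> xd \<beta> = int d \<and> yd \<beta> = int e \<and>
        rg {} \<gamma> \<and> xd \<gamma> = int a \<and> yd \<gamma> = int b'"
      using rg_remove[OF Suc.prems(1) i(2,3)] Suc.hyps(2) Suc.prems(2,3) i b by (intro Suc.hyps(1)) auto
    then obtain \<beta> \<gamma> where *: "\<alpha> - Poly_Mapping.single i 1 = \<beta> + \<gamma>" "rg {} \<beta>" "xd \<beta> = int d" "yd \<beta> = int e"
        "rg {} \<gamma>" "xd \<gamma> = int a" "yd \<gamma> = int b'" by blast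
    show ?thesis
      by (rule exI[of _ \<beta>], rule exI[of _ "\<gamma> + Poly_Mapping.single i 1"])
         (use * rg_single[OF i(2), of 1 "{}"] i b in
          \<open>auto simp: xd_add yd_add xd_single yd_single_less rg_add algebra_simps\<close>)
  qed
qed

text \<open>The exponent \<open>\<nu>\<close> is that of the product with z_w. In a fixed
  multidegree \<open>\<nu>\<close> a family is just a vector of scalars on these unit families, and
  it lies in the kernel iff the scalars sum to zero.\<close>

definition unit_fam :: "(nat \<Rightarrow>\<^sub>0 int) \<Rightarrow> nat \<Rightarrow> nat \<Rightarrow> 'k laurent"
  where "unit_fam \<nu> w v = (if v = w then Poly_Mapping.single (\<nu> - Poly_Mapping.single w 1) 1 else 0)"

text \<open>For indices x and y of different groups the difference is a monomial times a Koszul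
  syzygy, and the monomial has a factor of bidegree (d, e), where vanishing is assumed. Indices of
  one group are joined through an index of the other, which exists because both degrees of
  \<open>\<nu>\<close> are positive.\<close>

lemma represented_unit_fam:
  assumes van: "Van S d e" and \<nu>: "rg {} \<nu>" "xd \<nu> = int (d + a) + 1" "yd \<nu> = int (e + b) + 1"
    and w: "w < N" "1 \<le> lkp \<nu> w" and w': "w' < N" "1 \<le> lkp \<nu> w'"
  shows "represented S (d + a) (e + b) (\<lambda>v. unit_fam \<nu> w v - unit_fam \<nu> w' v)"
proof -
  have xy: "represented S (d + a) (e + b) (\<lambda>v. unit_fam \<nu> x v - unit_fam \<nu> y v)"
    if x: "x < n1" "1 \<le> lkp \<nu> x" and y: "n1 \<le> y" "y < N" "1 \<le> lkp \<nu> y" for x y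
  proof -
    have xN: "x < N" using x by (simp add: N_def)
    let ?\<nu>' = "\<nu> - Poly_Mapping.single x 1"
    let ?\<mu> = "?\<nu>' - Poly_Mapping.single y 1"
    have y': "1 \<le> lkp ?\<nu>' y" using x y by (simp add: lookup_minus lookup_single when_def)
    note r = rg_remove[OF \<nu>(1) xN x(2)]
    note r' = rg_remove[OF r(1) y(2) y']
    obtain \<beta> \<gamma> where s: "?\<mu> = \<beta> + \<gamma>" "rg {} \<beta>" "xd \<beta> = int d" "yd \<beta> = int e"
        "rg {} \<gamma>" "xd \<gamma> = int a" "yd \<gamma> = int b"
      using split_monomial[OF r'(1), of d a e b] r r' \<nu> x y by auto
    have "represented S (d + a) (e + b)
        (\<lambda>v. Poly_Mapping.single \<gamma> 1 * (Poly_Mapping.single \<beta> 1 * syz x y v))"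
      using s x y by (intro represented_mult Van_syz[OF van]) (simp_all add: H_single)
    moreover have "Poly_Mapping.single \<gamma> 1 * (Poly_Mapping.single \<beta> 1 * syz x y v) =
        unit_fam \<nu> x v - unit_fam \<nu> y v" for v
    proof -
      have e1: "\<gamma> + (\<beta> + Poly_Mapping.single y 1) = \<nu> - Poly_Mapping.single x 1"
        and e2: "\<gamma> + (\<beta> + Poly_Mapping.single x 1) = \<nu> - Poly_Mapping.single y 1"
        using s(1) by (simp_all add: algebra_simps)
      show ?thesis
        using x y xN by (simp add: syz_def unit_fam_def z_def right_diff_distrib mult_single e1 e2)
    qed
    ultimately show ?thesis by simp
  qed
  obtain x0 where x0: "x0 < n1" "1 \<le> lkp \<nu> x0" using exists_x_variable[OF \<nu>(1)] \<nu>(2) by auto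
  obtain y0 where y0: "n1 \<le> y0" "y0 < N" "1 \<le> lkp \<nu> y0" using exists_y_variable[OF \<nu>(1)] \<nu>(3) by auto
  have base: "represented S (d + a) (e + b) (\<lambda>v. unit_fam \<nu> w v - unit_fam \<nu> x0 v)"
    if w: "w < N" "1 \<le> lkp \<nu> w" for w
  proof (cases "w < n1")
    case True
    show ?thesis
      by (rule represented_cong[OF represented_add[OF xy[OF True w(2) y0]
              represented_uminus[OF xy[OF x0 y0]]]]) simp
  next
    case False
    show ?thesis
      by (rule represented_cong[OF represented_uminus[OF xy[OF x0 _ w]]]) (use False in auto)
  qed
  show ?thesis
    by (rule represented_cong[OF represented_add[OF base[OF w] represented_uminus[OF base[OF w']]]]) simp
qed

lemma lookup_z_mult:
  assumes v: "v < N"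
  shows "lkp (z v * h) \<nu> = lkp h (\<nu> - Poly_Mapping.single v 1)"
proof -
  have "z v * h = z v * (\<Sum>\<mu>\<in>kys h. Poly_Mapping.single \<mu> (lkp h \<mu>))"
    by (simp add: sum_singles)
  also have "\<dots> = (\<Sum>\<mu>\<in>kys h. Poly_Mapping.single (Poly_Mapping.single v 1 + \<mu>) (lkp h \<mu>))"
    using v by (simp add: z_def sum_distrib_left mult_single)
  finally have e: "z v * h = (\<Sum>\<mu>\<in>kys h. Poly_Mapping.single (Poly_Mapping.single v 1 + \<mu>) (lkp h \<mu>))" .
  have "lkp (z v * h) \<nu> = (\<Sum>\<mu>\<in>kys h. if \<nu> - Poly_Mapping.single v 1 = \<mu> then lkp h \<mu> else 0)"
    unfolding e lookup_sum by (intro sum.cong refl) (auto simp: lookup_single when_def algebra_simps)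
  then show ?thesis by (simp add: sum.delta' kys_iff)
qed

text \<open>The relation splits according to the multidegree of the products z_v F_v. A vector of
  scalars with sum zero is a combination of differences of unit vectors against one fixed index
  v0.\<close>

lemma Van_mono:
  assumes van: "Van S d e" shows "Van S (d + a) (e + b)"
  unfolding Van_def
proof (intro ballI impI)
  fix F assume F: "F \<in> Fam (d + a) (e + b)" and rel: "(\<Sum>v<N. z v * F v) = 0"
  \<comment> \<open>The multidegrees that occur in some product z_v F_v.\<close>
  define U where "U = (\<Union>v<N. (\<lambda>\<mu>. \<mu> + Poly_Mapping.single v 1) ` kys (F v))"
  have U: "finite U" by (simp add: U_def)
  define c where "c \<nu> v = lkp (F v) (\<nu> - Poly_Mapping.single v 1)" for \<nu> v
  have c0: "(\<Sum>v<N. c \<nu> v) = 0" for \<nu>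
  proof -
    have "(\<Sum>v<N. c \<nu> v) = lkp (\<Sum>v<N. z v * F v) \<nu>"
      unfolding lookup_sum by (intro sum.cong refl) (simp add: c_def lookup_z_mult)
    then show ?thesis by (simp add: rel)
  qed
  have "represented S (d + a) (e + b) (\<lambda>v. \<Sum>w<N. Poly_Mapping.single 0 (c \<nu> w) * unit_fam \<nu> w v)"
    if \<nu>U: "\<nu> \<in> U" for \<nu>
  proof -
    have good: "rg {} \<nu> \<and> xd \<nu> = int (d + a) + 1 \<and> yd \<nu> = int (e + b) + 1 \<and> 1 \<le> lkp \<nu> v"
      if v: "v < N" and m: "\<nu> - Poly_Mapping.single v 1 \<in> kys (F v)" for v
    proof -
      let ?\<mu> = "\<nu> - Poly_Mapping.single v 1"
      have \<mu>: "rg {} ?\<mu>" "xd ?\<mu> = int (d + a + (if v < n1 then 0 else 1))"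
          "yd ?\<mu> = int (e + b + (if v < n1 then 1 else 0))"
        using F v m unfolding Fam_def H_def by blast+
      have \<nu>: "\<nu> = ?\<mu> + Poly_Mapping.single v 1" by simp
      have "rg {} \<nu>" by (subst \<nu>) (intro rg_add \<mu> rg_single v, simp)
      moreover have "xd \<nu> = int (d + a) + 1" "yd \<nu> = int (e + b) + 1"
        by (subst \<nu>, use \<mu> v in \<open>simp only: xd_add yd_add xd_single yd_single_less\<close>, simp)+
      moreover have "0 \<le> lkp ?\<mu> v" using \<mu>(1) unfolding rg_def by (metis empty_iff not_less)
      ultimately show ?thesis by (simp add: lookup_minus)
    qed
    obtain v0 \<mu> where m: "v0 < N" "\<mu> \<in> kys (F v0)" "\<nu> = \<mu> + Poly_Mapping.single v0 1"
      using \<nu>U unfolding U_def by blast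
    have v0: "v0 < N" "\<nu> - Poly_Mapping.single v0 1 \<in> kys (F v0)" using m by simp_all
    note g0 = good[OF v0]
    have "represented S (d + a) (e + b)
        (\<lambda>v. Poly_Mapping.single 0 (c \<nu> w) * (unit_fam \<nu> w v - unit_fam \<nu> v0 v))" if w: "w < N" for w
    proof (cases "c \<nu> w = 0")
      case True
      then show ?thesis by (simp add: represented_0)
    next
      case False
      then have "1 \<le> lkp \<nu> w" using good[OF w] by (simp add: c_def kys_iff)
      then have "represented S (d + a) (e + b) (\<lambda>v. unit_fam \<nu> w v - unit_fam \<nu> v0 v)"
        using represented_unit_fam[OF van] g0 w v0 by blast
      from represented_mult[OF this H_const] show ?thesis by simp
    qed
    then have "represented S (d + a) (e + b)
        (\<lambda>v. \<Sum>w\<in>{..<N}. Poly_Mapping.single 0 (c \<nu> w) * (unit_fam \<nu> w v - unit_fam \<nu> v0 v))"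
      by (intro represented_sum) auto
    then show ?thesis
    proof (rule represented_cong)
      fix v
      \<comment> \<open>The terms subtracted at v0 carry the total of the scalars, which is
        zero.\<close>
      have "(\<Sum>w<N. Poly_Mapping.single (0 :: nat \<Rightarrow>\<^sub>0 int) (c \<nu> w)) = Poly_Mapping.single 0 (\<Sum>w<N. c \<nu> w)"
        by (rule poly_mapping_eqI) (simp add: lookup_sum lookup_single when_def)
      then have "(\<Sum>w<N. Poly_Mapping.single 0 (c \<nu> w) * unit_fam \<nu> v0 v) = 0"
        by (simp add: c0 flip: sum_distrib_right)
      then show "(\<Sum>w<N. Poly_Mapping.single 0 (c \<nu> w) * (unit_fam \<nu> w v - unit_fam \<nu> v0 v)) =
          (\<Sum>w<N. Poly_Mapping.single 0 (c \<nu> w) * unit_fam \<nu> w v)"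
        by (simp add: right_diff_distrib sum_subtractf)
    qed
  qed
  then have "represented S (d + a) (e + b) (\<lambda>v. \<Sum>\<nu>\<in>U. \<Sum>w<N. Poly_Mapping.single 0 (c \<nu> w) * unit_fam \<nu> w v)"
    by (rule represented_sum)
  then show "represented S (d + a) (e + b) F"
  proof (rule represented_cong)
    fix v assume v: "v < N"
    have "(\<Sum>w<N. Poly_Mapping.single 0 (c \<nu> w) * unit_fam \<nu> w v) =
        Poly_Mapping.single (\<nu> - Poly_Mapping.single v 1) (lkp (F v) (\<nu> - Poly_Mapping.single v 1))" for \<nu>
    proof -
      have "(\<Sum>w<N. Poly_Mapping.single 0 (c \<nu> w) * unit_fam \<nu> w v) =
          (\<Sum>w<N. if v = w then Poly_Mapping.single (\<nu> - Poly_Mapping.single v 1) (c \<nu> v) else 0)"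
        by (intro sum.cong refl) (simp add: unit_fam_def mult_single)
      then show ?thesis using v by (simp add: c_def)
    qed
    then have "(\<Sum>\<nu>\<in>U. \<Sum>w<N. Poly_Mapping.single 0 (c \<nu> w) * unit_fam \<nu> w v) =
        (\<Sum>\<nu>\<in>U. Poly_Mapping.single (\<nu> - Poly_Mapping.single v 1) (lkp (F v) (\<nu> - Poly_Mapping.single v 1)))"
      by simp
    also have "\<dots> = (\<Sum>\<nu>\<in>(\<lambda>\<mu>. \<mu> + Poly_Mapping.single v 1) ` kys (F v).
        Poly_Mapping.single (\<nu> - Poly_Mapping.single v 1) (lkp (F v) (\<nu> - Poly_Mapping.single v 1)))"
    proof (rule sum.mono_neutral_right[OF U])
      show "(\<lambda>\<mu>. \<mu> + Poly_Mapping.single v 1) ` kys (F v) \<subseteq> U" using v by (auto simp: U_def)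
      show "\<forall>i\<in>U - (\<lambda>\<mu>. \<mu> + Poly_Mapping.single v 1) ` kys (F v).
          Poly_Mapping.single (i - Poly_Mapping.single v 1) (lkp (F v) (i - Poly_Mapping.single v 1)) = 0"
      proof
        fix i assume i: "i \<in> U - (\<lambda>\<mu>. \<mu> + Poly_Mapping.single v 1) ` kys (F v)"
        have "i = (i - Poly_Mapping.single v 1) + Poly_Mapping.single v 1" by simp
        then have "i - Poly_Mapping.single v 1 \<notin> kys (F v)" using i by blast
        then show "Poly_Mapping.single (i - Poly_Mapping.single v 1) (lkp (F v) (i - Poly_Mapping.single v 1)) = 0"
          by (simp add: kys_iff)
      qed
    qed
    also have "\<dots> = (\<Sum>\<mu>\<in>kys (F v). Poly_Mapping.single \<mu> (lkp (F v) \<mu>))"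
      by (subst sum.reindex) (auto simp: inj_on_def)
    finally show "(\<Sum>\<nu>\<in>U. \<Sum>w<N. Poly_Mapping.single 0 (c \<nu> w) * unit_fam \<nu> w v) = F v"
      by (simp add: sum_singles)
  qed
qed

text \<open>The D-th power of a product of two variables, one from each group, has bidegree (D, D),
  so its multiples of all Koszul syzygies are represented. There are finitely many of them, hence a
  single finite list of matrices yields \<open>bigraded_generated\<close>.\<close>

lemma Van_critical:
  assumes char: "\<And>k. 0 < k \<Longrightarrow> k + 4 \<le> n1 + n2 \<Longrightarrow> of_nat k \<noteq> (0 :: 'k)"
    and van: "Van S D D"
  shows "Van S (n2 - 2) (n1 - 2)"
  unfolding Van_def
proof (intro ballI impI)
  define G where "G i j i' j' = (\<lambda>v. (z i' * z (n1 + j')) ^ D * syz i (n1 + j) v)" for i j i' j'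
  define Q where "Q = (\<lambda>(i, j, i', j'). G i j i' j') ` ({..<n1} \<times> {..<n2} \<times> {..<n1} \<times> {..<n2})"
  have "represented S D D F" if "F \<in> Q" for F
  proof -
    obtain i j i' j' where q: "F = G i j i' j'" "i < n1" "j < n2" "i' < n1" "j' < n2"
      using \<open>F \<in> Q\<close> by (auto simp: Q_def)
    have "(z i' * z (n1 + j')) ^ D \<in> H D D"
      using H_power[OF H_mult[OF H_zx[OF q(4)] H_zy[OF q(5)]], of D] by simp
    then show ?thesis unfolding q(1) G_def using q by (intro Van_syz[OF van]) (auto simp: N_def)
  qed
  moreover have "finite Q" by (simp add: Q_def)
  ultimately obtain m :: nat and A where mA: "\<forall>l<m. A l \<in> S" and Qr: "\<forall>F\<in>Q. \<exists>g. (\<forall>l<m. g l \<in> H D D) \<and>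
      (\<forall>v<N. F v = (\<Sum>l<m. form (A l) v * g l))"
    using common_coefficients[of Q S D D] by auto
  \<comment> \<open>A new instance whose columns are the matrices just found; variables, degrees and
    charts are those of the surrounding one.\<close>
  interpret B: bigraded n1 n2 m A by (rule bigraded.intro[OF n1 n2])
  have fB: "B.f v l = form (A l) v" for v l by (simp add: B.f_def form_def)
  have gen: "bigraded_generated n1 n2 m A"
  proof (intro bigraded_generated.intro bigraded_generated_axioms.intro B.bigraded_axioms)
    show "of_nat k \<noteq> (0 :: 'k)" if "0 < k" "k + 4 \<le> n1 + n2" for k by (rule char[OF that])
    show "\<exists>D. \<forall>i<n1. \<forall>j<n2. \<forall>i'<n1. \<forall>j'<n2. \<exists>g. (\<forall>l. g l \<in> R {}) \<and>
      (\<forall>v<N. (\<Sum>l<m. B.f v l * g l) = (z i' * z (n1 + j')) ^ D *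
        ((if v = i then z (n1 + j) else 0) - (if v = n1 + j then z i else 0)))"
    proof (intro exI[of _ D] allI impI)
      fix i j i' j' assume q: "i < n1" "j < n2" "i' < n1" "j' < n2"
      then have "G i j i' j' \<in> Q"
        unfolding Q_def by (intro image_eqI[of _ _ "(i, j, i', j')"]) simp_all
      from bspec[OF Qr this] obtain g
        where g: "\<forall>l<m. g l \<in> H D D" "\<forall>v<N. G i j i' j' v = (\<Sum>l<m. form (A l) v * g l)"
        by (elim exE conjE)
      show "\<exists>g. (\<forall>l. g l \<in> R {}) \<and> (\<forall>v<N. (\<Sum>l<m. B.f v l * g l) = (z i' * z (n1 + j')) ^ D *
        ((if v = i then z (n1 + j) else 0) - (if v = n1 + j then z i else 0)))"
      proof (intro exI[of _ "\<lambda>l. if l < m then g l else 0"] conjI allI impI)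
        show "(if l < m then g l else 0) \<in> R {}" for l using g(1) by (auto simp: R_def H_def)
        fix v assume v: "v < N"
        have "(\<Sum>l<m. B.f v l * (if l < m then g l else 0)) = G i j i' j' v"
          using g(2) v by (simp add: fB)
        then show "(\<Sum>l<m. B.f v l * (if l < m then g l else 0)) = (z i' * z (n1 + j')) ^ D *
            ((if v = i then z (n1 + j) else 0) - (if v = n1 + j then z i else 0))"
          by (simp add: G_def syz_def)
      qed
    qed
  qed
  fix F assume F: "F \<in> Fam (n2 - 2) (n1 - 2)" and rel: "(\<Sum>v<N. z v * F v) = 0"
  have "\<exists>g. (\<forall>l. \<forall>\<alpha>\<in>kys (g l). rg {} \<alpha> \<and> xd \<alpha> = int n2 - 2 \<and> yd \<alpha> = int n1 - 2) \<and>
    (\<forall>v<N. (\<Sum>l<m. B.f v l * g l) = F v)"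
  proof (rule bigraded_generated.kernel_in_image[OF gen _ rel])
    fix v \<alpha> assume "v < N" "\<alpha> \<in> kys (F v)"
    then have "rg {} \<alpha>" "xd \<alpha> = int (n2 - 2 + (if v < n1 then 0 else 1))"
      "yd \<alpha> = int (n1 - 2 + (if v < n1 then 1 else 0))" using F unfolding Fam_def H_def by blast+
    then show "rg {} \<alpha> \<and> xd \<alpha> = int n2 - 2 + (if v < n1 then 0 else 1) \<and>
        yd \<alpha> = int n1 - 2 + (if v < n1 then 1 else 0)"
      using n1 n2 by (auto simp: of_nat_diff)
  qed
  then obtain g where g: "\<forall>l. \<forall>\<alpha>\<in>kys (g l). rg {} \<alpha> \<and> xd \<alpha> = int n2 - 2 \<and> yd \<alpha> = int n1 - 2"
      "\<forall>v<N. (\<Sum>l<m. form (A l) v * g l) = F v" unfolding fB by (elim exE conjE)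
  then have "\<forall>l<m. A l \<in> S \<and> g l \<in> H (n2 - 2) (n1 - 2)"
    using mA n1 n2 by (auto simp: H_def of_nat_diff)
  then show "represented S (n2 - 2) (n1 - 2) F" unfolding represented_def
    by (intro exI[of _ m] exI[of _ A] exI[of _ g] conjI) (use g(2) in simp_all)
qed

theorem Van_iff:
  assumes char: "\<And>k. 0 < k \<Longrightarrow> k + 4 \<le> n1 + n2 \<Longrightarrow> of_nat k \<noteq> (0 :: 'k)"
  shows "(\<exists>N. \<forall>d\<ge>N. \<forall>e\<ge>N. Van S d e) \<longleftrightarrow> Van S (n2 - 2) (n1 - 2)"
proof
  assume "\<exists>N. \<forall>d\<ge>N. \<forall>e\<ge>N. Van S d e"
  then obtain D where "Van S D D" by blast
  then show "Van S (n2 - 2) (n1 - 2)" using Van_critical[OF char] by blast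
next
  assume v: "Van S (n2 - 2) (n1 - 2)"
  have "Van S d e" if "d \<ge> n1 + n2" "e \<ge> n1 + n2" for d e
    using Van_mono[OF v, of "d - (n2 - 2)" "e - (n1 - 2)"] that by simp
  then show "\<exists>N. \<forall>d\<ge>N. \<forall>e\<ge>N. Van S d e" by blast
qed

end

section \<open>Coordinates on symmetric algebras\<close>

locale coordinates =
  fixes V :: "('k::field, 'v) module" and n :: nat and b :: "nat \<Rightarrow> 'v" and c :: "nat \<Rightarrow> 'v \<Rightarrow> 'k"
  assumes vV: "vsp V" and b_closed: "\<And>i. i < n \<Longrightarrow> b i \<in> carrier V"
    and c_add: "\<And>i u v. u \<in> carrier V \<Longrightarrow> v \<in> carrier V \<Longrightarrow> c i (u \<oplus>\<^bsub>V\<^esub> v) = c i u + c i v"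
    and c_smult: "\<And>i a u. u \<in> carrier V \<Longrightarrow> c i (a \<odot>\<^bsub>V\<^esub> u) = a * c i u"
    and c_b: "\<And>i j. i < n \<Longrightarrow> j < n \<Longrightarrow> c i (b j) = (if i = j then 1 else 0)"
    and expand: "\<And>v. v \<in> carrier V \<Longrightarrow> v = (\<Oplus>\<^bsub>V\<^esub>i\<in>{..<n}. c i v \<odot>\<^bsub>V\<^esub> b i)"

lemma exists_coordinates:
  fixes V :: "('k::field, 'v) module"
  assumes "vsp V" "vectorspace.fin_dim class_ring V" "vectorspace.dim class_ring V = n"
  shows "\<exists>b c. coordinates V n b c"
proof -
  interpret V: vectorspace class_ring V by (rule assms)
  obtain B where B: "finite B" "V.basis B" using V.finite_basis_exists[OF assms(2)] by blast
  have card: "card B = n" using V.dim_basis[OF B] assms(3) by simp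
  have BV: "B \<subseteq> carrier V" using B(2) unfolding V.basis_def by blast
  obtain b where b: "bij_betw b {..<n} B"
    using ex_bij_betw_nat_finite[OF B(1)] card by (auto simp: lessThan_atLeast0)
  define P where "P v a \<longleftrightarrow> a \<in> B \<rightarrow>\<^sub>E carrier class_ring \<and> V.lincomb a B = v" for v and a :: "'v \<Rightarrow> 'k"
  have ex1: "\<exists>!a. P v a" if "v \<in> carrier V" for v
    using V.basis_criterion[OF B(1) BV] B(2) that unfolding P_def by blast
  define a where "a v = (THE a. P v a)" for v
  have a: "P v (a v)" if "v \<in> carrier V" for v
    unfolding a_def by (rule theI'[OF ex1[OF that]])
  have uniq: "a v = x" if "P v x" "v \<in> carrier V" for v x using ex1[OF that(2)] a[OF that(2)] that(1) by blast
  define c where "c i v = a v (b i)" for i v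
  have bB: "b i \<in> B" if "i < n" for i using b that by (auto simp: bij_betw_def)
  show ?thesis
  \<comment> \<open>Coordinates with index n or more are set to zero, so that additivity and
    homogeneity hold for every index.\<close>
  proof (intro exI[of _ b] exI[of _ "\<lambda>i v. if i < n then c i v else 0"], unfold_locales)
    show "b i \<in> carrier V" if "i < n" for i using bB[OF that] BV by blast
    fix i and x :: 'k and u v
    show "(if i < n then c i (x \<odot>\<^bsub>V\<^esub> u) else 0) = x * (if i < n then c i u else 0)" if u: "u \<in> carrier V"
    proof (cases "i < n")
      case True
      have "P (x \<odot>\<^bsub>V\<^esub> u) (restrict (\<lambda>t. x * a u t) B)"
      proof -
        have l: "V.lincomb (restrict (\<lambda>t. x * a u t) B) B = V.lincomb (\<lambda>t. x * a u t) B"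
          using BV by (intro V.lincomb_cong) auto
        have "V.lincomb (\<lambda>t. x \<otimes>\<^bsub>class_ring\<^esub> a u t) B = x \<odot>\<^bsub>V\<^esub> V.lincomb (a u) B"
          using BV B(1) by (intro V.lincomb_smult) auto
        then show ?thesis using a[OF u] l by (simp add: P_def class_ring_simps)
      qed
      from uniq[OF this] show ?thesis using u bB[OF True] True
        by (simp add: c_def vs_smult_closed[OF assms(1)])
    qed simp
    show "(if i < n then c i (u \<oplus>\<^bsub>V\<^esub> v) else 0) = (if i < n then c i u else 0) + (if i < n then c i v else 0)"
      if uv: "u \<in> carrier V" "v \<in> carrier V"
    proof (cases "i < n")
      case True
      have "P (u \<oplus>\<^bsub>V\<^esub> v) (restrict (\<lambda>t. a u t + a v t) B)"
      proof -
        have l: "V.lincomb (restrict (\<lambda>t. a u t + a v t) B) B = V.lincomb (\<lambda>t. a u t + a v t) B"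
          using BV by (intro V.lincomb_cong) auto
        have "V.lincomb (\<lambda>t. a u t \<oplus>\<^bsub>class_ring\<^esub> a v t) B = V.lincomb (a u) B \<oplus>\<^bsub>V\<^esub> V.lincomb (a v) B"
          using BV B(1) by (intro V.lincomb_sum) auto
        then show ?thesis using a[OF uv(1)] a[OF uv(2)] l by (simp add: P_def class_ring_simps)
      qed
      from uniq[OF this] show ?thesis using uv bB[OF True] True by (simp add: c_def)
    qed simp
  next
    fix i j assume ij: "i < n" "j < n"
    have "P (b j) (restrict (\<lambda>t. if t = b j then 1 else 0) B)"
    proof -
      have "V.lincomb (restrict (\<lambda>t. if t = b j then 1 else 0) B) B =
          (\<Oplus>\<^bsub>V\<^esub>t\<in>B. if b j = t then t else \<zero>\<^bsub>V\<^esub>)"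
        unfolding V.lincomb_def
      proof (rule V.M.add.finprod_cong')
        fix t assume "t \<in> B"
        then show "restrict (\<lambda>t. if t = b j then 1 else 0) B t \<odot>\<^bsub>V\<^esub> t = (if b j = t then t else \<zero>\<^bsub>V\<^esub>)"
          using BV V.smult_one[of t] V.smult_l_null[of t] by (auto simp: class_ring_simps)
      qed (use BV in auto)
      also have "\<dots> = b j" using BV B(1) bB[OF ij(2)] by (subst V.M.add.finprod_singleton) auto
      finally show ?thesis by (simp add: P_def)
    qed
    from uniq[OF this] have "a (b j) = restrict (\<lambda>t. if t = b j then 1 else 0) B" using BV bB[OF ij(2)] by blast
    moreover have "b i = b j \<longleftrightarrow> i = j" using b ij by (auto simp: bij_betw_def inj_on_def)
    ultimately show "(if i < n then c i (b j) else 0) = (if i = j then 1 else 0)"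
      using ij bB by (simp add: c_def)
  next
    fix v assume v: "v \<in> carrier V"
    have "v = V.lincomb (a v) B" using a[OF v] by (simp add: P_def)
    also have "\<dots> = (\<Oplus>\<^bsub>V\<^esub>t\<in>b ` {..<n}. a v t \<odot>\<^bsub>V\<^esub> t)"
      using b by (simp add: V.lincomb_def bij_betw_def)
    also have "\<dots> = (\<Oplus>\<^bsub>V\<^esub>i\<in>{..<n}. a v (b i) \<odot>\<^bsub>V\<^esub> b i)"
      using b BV bB by (intro V.M.add.finprod_reindex) (auto simp: bij_betw_def intro!: vs_smult_closed[OF assms(1)])
    also have "\<dots> = (\<Oplus>\<^bsub>V\<^esub>i\<in>{..<n}. (if i < n then c i v else 0) \<odot>\<^bsub>V\<^esub> b i)"
      using BV bB by (intro V.M.add.finprod_cong') (auto simp: c_def intro!: vs_smult_closed[OF assms(1)])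
    finally show "v = (\<Oplus>\<^bsub>V\<^esub>i\<in>{..<n}. (if i < n then c i v else 0) \<odot>\<^bsub>V\<^esub> b i)" .
  qed
qed

lemma coordinates_direct_sum:
  fixes V1 :: "('k::field, 'a) module" and V2 :: "('k, 'b) module"
  assumes 1: "coordinates V1 n1 b1 c1" and 2: "coordinates V2 n2 b2 c2"
  shows "coordinates (direct_sum V1 V2) (n1 + n2)
    (\<lambda>v. if v < n1 then inj1 V1 V2 (b1 v) else inj2 V1 V2 (b2 (v - n1)))
    (\<lambda>v u. if v < n1 then c1 v (fst u) else c2 (v - n1) (snd u))"
proof -
  interpret A: coordinates V1 n1 b1 c1 by (rule 1)
  interpret B: coordinates V2 n2 b2 c2 by (rule 2)
  interpret A1: vectorspace class_ring V1 by (rule A.vV)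
  interpret B1: vectorspace class_ring V2 by (rule B.vV)
  let ?D = "direct_sum V1 V2"
  have vD: "vsp ?D" by (rule direct_sum_is_vs[OF A.vV B.vV])
  interpret D: vectorspace class_ring ?D by (rule vD)
  have z1: "c1 i \<zero>\<^bsub>V1\<^esub> = 0" for i using A.c_smult[of "\<zero>\<^bsub>V1\<^esub>" i 0] by (simp add: vsp_zero_smult[OF A.vV])
  have z2: "c2 i \<zero>\<^bsub>V2\<^esub> = 0" for i using B.c_smult[of "\<zero>\<^bsub>V2\<^esub>" i 0] by (simp add: vsp_zero_smult[OF B.vV])
  have l1: "vlin V1 ?D (inj1 V1 V2)" and l2: "vlin V2 ?D (inj2 V1 V2)"
    by (auto simp: vlin_def inj1_def inj2_def direct_sum_def vsp_zero_smult[OF A.vV] vsp_zero_smult[OF B.vV])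
  define bb where "bb = (\<lambda>v. if v < n1 then inj1 V1 V2 (b1 v) else inj2 V1 V2 (b2 (v - n1)))"
  define cc where "cc = (\<lambda>v u. if v < n1 then c1 v (fst u) else c2 (v - n1) (snd u))"
  have bb: "bb i \<in> carrier ?D" if "i < n1 + n2" for i
    using that A.b_closed B.b_closed vlinD(1)[OF l1] vlinD(1)[OF l2] by (auto simp: bb_def)
  have "coordinates ?D (n1 + n2) bb cc"
  proof (rule coordinates.intro[OF vD bb])
    show "cc i (u \<oplus>\<^bsub>?D\<^esub> v) = cc i u + cc i v" if "u \<in> carrier ?D" "v \<in> carrier ?D" for i u v
      using that A.c_add B.c_add by (auto simp: cc_def direct_sum_def)
    show "cc i (a \<odot>\<^bsub>?D\<^esub> u) = a * cc i u" if "u \<in> carrier ?D" for i a u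
      using that A.c_smult B.c_smult by (auto simp: cc_def direct_sum_def)
    show "cc i (bb j) = (if i = j then 1 else 0)" if "i < n1 + n2" "j < n1 + n2" for i j
      using that A.c_b B.c_b by (auto simp: cc_def bb_def inj1_def inj2_def z1 z2)
  next
    fix v assume v: "v \<in> carrier ?D"
    then have f: "fst v \<in> carrier V1" "snd v \<in> carrier V2" by (auto simp: direct_sum_def)
    have t: "(\<lambda>i. cc i v \<odot>\<^bsub>?D\<^esub> bb i) \<in> {..<n1 + n2} \<rightarrow> carrier ?D"
      using bb by (auto intro!: vs_smult_closed[OF vD])
    have s: "{..<n1 + n2} = {..<n1} \<union> {n1..<n1 + n2}" by auto
    have "(\<Oplus>\<^bsub>?D\<^esub>i\<in>{..<n1}. cc i v \<odot>\<^bsub>?D\<^esub> bb i) = (\<Oplus>\<^bsub>?D\<^esub>i\<in>{..<n1}. inj1 V1 V2 (c1 i (fst v) \<odot>\<^bsub>V1\<^esub> b1 i))"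
      using A.b_closed bb vlinD(3)[OF l1] vlinD(1)[OF l1] vs_smult_closed[OF A.vV]
      by (intro D.M.add.finprod_cong') (auto simp: cc_def bb_def)
    also have "\<dots> = inj1 V1 V2 (fst v)"
      using A.b_closed vs_smult_closed[OF A.vV] A.expand[OF f(1)]
      by (subst vlin_finsum[OF A.vV vD l1, symmetric]) auto
    finally have e1: "(\<Oplus>\<^bsub>?D\<^esub>i\<in>{..<n1}. cc i v \<odot>\<^bsub>?D\<^esub> bb i) = inj1 V1 V2 (fst v)" .
    have "(\<Oplus>\<^bsub>?D\<^esub>i\<in>{n1..<n1 + n2}. cc i v \<odot>\<^bsub>?D\<^esub> bb i) =
        (\<Oplus>\<^bsub>?D\<^esub>i\<in>(\<lambda>j. n1 + j) ` {..<n2}. cc i v \<odot>\<^bsub>?D\<^esub> bb i)"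
      using image_add_atLeastLessThan[of n1 0 n2] by (simp add: lessThan_atLeast0 add.commute)
    also have "\<dots> = (\<Oplus>\<^bsub>?D\<^esub>j\<in>{..<n2}. cc (n1 + j) v \<odot>\<^bsub>?D\<^esub> bb (n1 + j))"
      using bb by (intro D.M.add.finprod_reindex) (auto simp: inj_on_def intro!: vs_smult_closed[OF vD])
    also have "\<dots> = (\<Oplus>\<^bsub>?D\<^esub>i\<in>{..<n2}. inj2 V1 V2 (c2 i (snd v) \<odot>\<^bsub>V2\<^esub> b2 i))"
      using B.b_closed bb vlinD(3)[OF l2] vlinD(1)[OF l2] vs_smult_closed[OF B.vV]
      by (intro D.M.add.finprod_cong') (auto simp: cc_def bb_def)
    also have "\<dots> = inj2 V1 V2 (snd v)"
      using B.b_closed vs_smult_closed[OF B.vV] B.expand[OF f(2)]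
      by (subst vlin_finsum[OF B.vV vD l2, symmetric]) auto
    finally have e2: "(\<Oplus>\<^bsub>?D\<^esub>i\<in>{n1..<n1 + n2}. cc i v \<odot>\<^bsub>?D\<^esub> bb i) = inj2 V1 V2 (snd v)" .
    have "(\<Oplus>\<^bsub>?D\<^esub>i\<in>{..<n1 + n2}. cc i v \<odot>\<^bsub>?D\<^esub> bb i) = inj1 V1 V2 (fst v) \<oplus>\<^bsub>?D\<^esub> inj2 V1 V2 (snd v)"
      unfolding s e1[symmetric] e2[symmetric] using t by (intro D.M.finsum_Un_disjoint) auto
    also have "\<dots> = v" using f by (simp add: inj1_def inj2_def direct_sum_def prod_eq_iff)
    finally show "v = (\<Oplus>\<^bsub>?D\<^esub>i\<in>{..<n1 + n2}. cc i v \<odot>\<^bsub>?D\<^esub> bb i)" by simp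
  qed
  then show ?thesis by (simp only: bb_def cc_def)
qed

section \<open>Linear extension from monomials\<close>

definition ext :: "('m \<Rightarrow> ('q::comm_monoid_add) \<Rightarrow>\<^sub>0 'k) \<Rightarrow> ('m \<Rightarrow>\<^sub>0 'k) \<Rightarrow> ('q \<Rightarrow>\<^sub>0 'k::field)"
  where "ext \<phi> h = (\<Sum>m\<in>kys h. Poly_Mapping.single 0 (lkp h m) * \<phi> m)"

lemma ext_superset: "finite S \<Longrightarrow> kys h \<subseteq> S \<Longrightarrow> ext \<phi> h = (\<Sum>m\<in>S. Poly_Mapping.single 0 (lkp h m) * \<phi> m)"
  unfolding ext_def by (rule sum.mono_neutral_left) (auto simp: kys_iff)

lemma ext_0 [simp]: "ext \<phi> 0 = 0" by (simp add: ext_def)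

lemma ext_single: "ext \<phi> (Poly_Mapping.single m a) = Poly_Mapping.single 0 a * \<phi> m"
  by (subst ext_superset[of "{m}"]) auto

lemma ext_add: "ext \<phi> (f + g) = ext \<phi> f + ext \<phi> g"
proof -
  have "finite (kys f \<union> kys g)" by simp
  then show ?thesis
    using Poly_Mapping.keys_add[of f g]
    by (simp add: ext_superset[of "kys f \<union> kys g"] lookup_add single_add distrib_right sum.distrib)
qed

lemma ext_uminus: "ext \<phi> (- f) = - ext \<phi> f"
  using ext_add[of \<phi> f "- f"] by (simp add: eq_neg_iff_add_eq_0 add.commute)

lemma ext_diff: "ext \<phi> (f - g) = ext \<phi> f - ext \<phi> g"
  using ext_add[of \<phi> f "- g"] by (simp add: ext_uminus)

lemma ext_sum: "ext \<phi> (sum g S) = (\<Sum>i\<in>S. ext \<phi> (g i))"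
  by (induction S rule: infinite_finite_induct) (simp_all add: ext_add)

lemma single_0_mult:
  "Poly_Mapping.single 0 (x * y) = Poly_Mapping.single 0 x * Poly_Mapping.single (0 :: 'q::comm_monoid_add) (y :: 'k::field)"
  by (simp add: mult_single)

text \<open>Multiplicativity is assumed only on monomials that occur: the map \<open>ms\<close>, to
  which this is applied, respects sums only of nonnegative exponents.\<close>

lemma ext_mult:
  assumes "\<And>m m'. m \<in> kys f \<Longrightarrow> m' \<in> kys g \<Longrightarrow> \<phi> (m + m') = \<phi> m * \<phi> m'"
  shows "ext \<phi> (f * g) = ext \<phi> f * ext \<phi> (g :: 'm::cancel_comm_monoid_add \<Rightarrow>\<^sub>0 'k::field)"
proof -
  have "f * g = (\<Sum>m\<in>kys f. Poly_Mapping.single m (lkp f m)) * (\<Sum>m'\<in>kys g. Poly_Mapping.single m' (lkp g m'))"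
    by (simp add: sum_singles)
  also have "\<dots> = (\<Sum>m\<in>kys f. \<Sum>m'\<in>kys g. Poly_Mapping.single (m + m') (lkp f m * lkp g m'))"
    by (simp add: sum_product mult_single)
  finally have e: "f * g = (\<Sum>m\<in>kys f. \<Sum>m'\<in>kys g. Poly_Mapping.single (m + m') (lkp f m * lkp g m'))" .
  show ?thesis
    unfolding e ext_sum ext_single ext_def[of \<phi> f] ext_def[of \<phi> g] sum_product
    by (intro sum.cong refl) (simp add: assms single_0_mult mult.assoc mult.left_commute)
qed

lemma free_comm_algebra_simps [simp]:
  "carrier (free_comm_algebra X) = {f. \<forall>m \<in> kys f. set_mset m \<subseteq> X}"
  "mult (free_comm_algebra X) = (*)" "one (free_comm_algebra X) = 1"
  "zero (free_comm_algebra X) = 0" "add (free_comm_algebra X) = (+)"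
  "smult (free_comm_algebra X) = (\<lambda>c. Poly_Mapping.map ((*) c))"
  by (simp_all add: free_comm_algebra_def)

lemma vs_free_comm_algebra: "vsp (free_comm_algebra X)"
  by (rule vs_image[OF vs_free_space[of "{m. set_mset m \<subseteq> X}"], of "\<lambda>x. x"]) auto

lemma free_comm_algebra_mult:
  fixes f g :: "'x multiset \<Rightarrow>\<^sub>0 'k::field"
  assumes "f \<in> carrier (free_comm_algebra X)" "g \<in> carrier (free_comm_algebra X)"
  shows "f * g \<in> carrier (free_comm_algebra X)"
  using assms by (fastforce dest!: kys_mult)

lemma cring_free_comm_algebra: "cring (free_comm_algebra X :: ('k::field, 'x multiset \<Rightarrow>\<^sub>0 'k) module)"
proof (rule cringI)
  show "abelian_group (free_comm_algebra X :: ('k::field, 'x multiset \<Rightarrow>\<^sub>0 'k) module)"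
    by (rule vsp_abelian_group[OF vs_free_comm_algebra])
  show "comm_monoid (free_comm_algebra X :: ('k::field, 'x multiset \<Rightarrow>\<^sub>0 'k) module)"
  proof (rule comm_monoidI)
    fix f g :: "'x multiset \<Rightarrow>\<^sub>0 'k"
    assume "f \<in> carrier (free_comm_algebra X)" "g \<in> carrier (free_comm_algebra X)"
    then show "f \<otimes>\<^bsub>free_comm_algebra X\<^esub> g \<in> carrier (free_comm_algebra X)"
      using free_comm_algebra_mult by (simp only: free_comm_algebra_simps(2))
  qed (simp_all add: mult.assoc mult.commute)
qed (simp add: distrib_right)

section \<open>The symmetric algebra of a space with coordinates as a polynomial ring\<close>

locale sym_coordinates = coordinates V n b c
  for V :: "('k::field, 'v) module" and n :: nat and b :: "nat \<Rightarrow> 'v" and c :: "nat \<Rightarrow> 'v \<Rightarrow> 'k"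
begin

sublocale V: vectorspace class_ring V by (rule vV)

abbreviation A :: "('k, 'v multiset \<Rightarrow>\<^sub>0 'k) module" where "A \<equiv> free_comm_algebra (carrier V)"
abbreviation I :: "('v multiset \<Rightarrow>\<^sub>0 'k) set" where "I \<equiv> sym_relations V"
abbreviation S :: "('k, ('v multiset \<Rightarrow>\<^sub>0 'k) set) module" where "S \<equiv> sym_algebra V"

definition gens :: "('v multiset \<Rightarrow>\<^sub>0 'k) set"
  where "gens = {Poly_Mapping.single {#u \<oplus>\<^bsub>V\<^esub> v#} 1 - Poly_Mapping.single {#u#} 1
         - Poly_Mapping.single {#v#} 1 | u v. u \<in> carrier V \<and> v \<in> carrier V} \<union>
      {Poly_Mapping.single {#a \<odot>\<^bsub>V\<^esub> v#} 1 - Poly_Mapping.single {#v#} a | a v. v \<in> carrier V}"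

lemma I_eq: "I = Idl\<^bsub>A\<^esub> gens" by (simp only: sym_relations_def gens_def)

lemma ring_A: "ring A" by (rule cring.axioms(1)[OF cring_free_comm_algebra])

lemma vA: "vsp A" by (rule vs_free_comm_algebra)

lemma A_add: "f \<in> carrier A \<Longrightarrow> g \<in> carrier A \<Longrightarrow> f + g \<in> carrier A"
  using Poly_Mapping.keys_add[of f g] by auto

lemma A_diff: "f \<in> carrier A \<Longrightarrow> g \<in> carrier A \<Longrightarrow> f - g \<in> carrier A"
  using keys_diff[of f g] by auto

lemma A_single: "set_mset m \<subseteq> carrier V \<Longrightarrow> Poly_Mapping.single m a \<in> carrier A"
  by simp

lemma A_sum: "(\<And>i. i \<in> T \<Longrightarrow> g i \<in> carrier A) \<Longrightarrow> sum g T \<in> carrier A"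
proof (induction T rule: infinite_finite_induct)
  case (insert x F)
  have "g x \<in> carrier A" "sum g F \<in> carrier A" by (rule insert.prems, simp, rule insert.IH, rule insert.prems, simp)
  then show ?case unfolding sum.insert[OF insert.hyps] by (rule A_add)
qed simp_all

lemmas A_mult = free_comm_algebra_mult[of _ "carrier V"]

lemma gens_A: "gens \<subseteq> carrier A"
proof
  fix x assume "x \<in> gens"
  then consider u v where "x = Poly_Mapping.single {#u \<oplus>\<^bsub>V\<^esub> v#} 1 - Poly_Mapping.single {#u#} 1
         - Poly_Mapping.single {#v#} 1" "u \<in> carrier V" "v \<in> carrier V"
    | a v where "x = Poly_Mapping.single {#a \<odot>\<^bsub>V\<^esub> v#} 1 - Poly_Mapping.single {#v#} a" "v \<in> carrier V"
    unfolding gens_def by blast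
  then show "x \<in> carrier A"
  proof cases
    case 1
    show ?thesis unfolding 1(1) by (intro A_diff A_single) (use 1 in auto)
  next
    case 2
    show ?thesis unfolding 2(1) by (intro A_diff A_single) (use 2 vs_smult_closed[OF vV] in auto)
  qed
qed

lemma ideal_I: "ideal I A"
  unfolding I_eq by (rule ring.genideal_ideal[OF ring_A gens_A])

lemma gens_I: "x \<in> gens \<Longrightarrow> x \<in> I"
  unfolding I_eq using ring.genideal_self[OF ring_A gens_A] by (rule subsetD)

lemma I_mult: "x \<in> carrier A \<Longrightarrow> i \<in> I \<Longrightarrow> x * i \<in> I"
  using ideal.I_l_closed[OF ideal_I, of i x] by simp

lemma sub_I: "VectorSpace.subspace class_ring I A"
  unfolding vs_subspace_iff[OF vA]
proof (intro conjI ballI allI)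
  note s = ideal.axioms(1)[OF ideal_I]
  show "I \<subseteq> carrier A" by (rule additive_subgroup.a_subset[OF s])
  show "\<zero>\<^bsub>A\<^esub> \<in> I" by (rule additive_subgroup.zero_closed[OF s])
  show "x \<oplus>\<^bsub>A\<^esub> y \<in> I" if "x \<in> I" "y \<in> I" for x y
    by (rule additive_subgroup.a_closed[OF s that])
  show "a \<odot>\<^bsub>A\<^esub> x \<in> I" if "x \<in> I" for a x
    using I_mult[OF A_single[of "{#}" a] that] by (simp add: mult_map_scale_conv_mult)
qed

sublocale Q: vs_quotient A I by (rule vs_quotient.intro[OF vA sub_I])

lemma S_eq: "S = quotient_module A I" by (rule sym_algebra_def)

lemma vS: "vsp S" unfolding S_eq by (rule Q.vs_quotient_module)

lemma I_add: "x \<in> I \<Longrightarrow> y \<in> I \<Longrightarrow> x + y \<in> I" using Q.N_add[of x y] by simp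

lemma I_0: "0 \<in> I" using Q.N_zero by simp

lemma A_minus: "f \<in> carrier A \<Longrightarrow> g \<in> carrier A \<Longrightarrow> f \<ominus>\<^bsub>A\<^esub> g = f - g"
proof -
  assume f: "f \<in> carrier A" and g: "g \<in> carrier A"
  have ng: "- g \<in> carrier A" using g by (simp add: kys_uminus)
  have "\<ominus>\<^bsub>A\<^esub> g = - g" by (rule Q.M.M.minus_equality[OF _ g ng]) simp
  then show ?thesis by (simp add: a_minus_def)
qed

lemma q_eq_iff: "f \<in> carrier A \<Longrightarrow> g \<in> carrier A \<Longrightarrow> Q.q f = Q.q g \<longleftrightarrow> f - g \<in> I"
  by (simp only: Q.q_eq_iff A_minus)

lemma I_uminus: "x \<in> I \<Longrightarrow> - x \<in> I"
  using I_mult[OF A_single[of "{#}" "- 1"]] by (simp add: single_uminus)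

lemma S_cases: assumes "X \<in> carrier S" obtains f where "f \<in> carrier A" "X = Q.q f"
  using assms unfolding S_eq Q.carrier_quotient by (elim imageE)

lemma q_closed: "f \<in> carrier A \<Longrightarrow> Q.q f \<in> carrier S"
  unfolding S_eq Q.carrier_quotient by (rule imageI)

lemma q_add: "f \<in> carrier A \<Longrightarrow> g \<in> carrier A \<Longrightarrow> Q.q f \<oplus>\<^bsub>S\<^esub> Q.q g = Q.q (f + g)"
  unfolding S_eq using Q.q_add[of f g] by simp

lemma q_smult: "f \<in> carrier A \<Longrightarrow> a \<odot>\<^bsub>S\<^esub> Q.q f = Q.q (Poly_Mapping.single 0 a * f)"
  unfolding S_eq using Q.q_smult[of f a] by (simp add: mult_map_scale_conv_mult)

lemma q_mult: "f \<in> carrier A \<Longrightarrow> g \<in> carrier A \<Longrightarrow> Q.q f \<otimes>\<^bsub>S\<^esub> Q.q g = Q.q (f * g)"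
  using ideal.rcoset_mult_add[OF ideal_I, of f g]
  by (simp add: sym_algebra_def quotient_module_def ring.defs FactRing_def Q.q_def)

lemma one_S: "\<one>\<^bsub>S\<^esub> = Q.q 1"
  by (simp add: sym_algebra_def quotient_module_def ring.defs FactRing_def Q.q_def)

lemma zero_S: "\<zero>\<^bsub>S\<^esub> = Q.q 0"
  unfolding S_eq Q.zero_quotient using Q.q_zero by simp

lemma one_A: "1 \<in> carrier A" using A_single[of "{#}" 1] by simp

text \<open>Gives meaning to the finite products by which \<open>sym_part\<close> is
  generated.\<close>

lemma comm_monoid_S: "comm_monoid S"
proof (rule comm_monoidI)
  fix X Y assume X: "X \<in> carrier S" and Y: "Y \<in> carrier S"
  obtain f g where f: "f \<in> carrier A" "X = Q.q f" and g: "g \<in> carrier A" "Y = Q.q g"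
    using S_cases[OF X] S_cases[OF Y] by metis
  note fg = A_mult[OF f(1) g(1)]
  show "X \<otimes>\<^bsub>S\<^esub> Y \<in> carrier S" unfolding f(2) g(2) q_mult[OF f(1) g(1)] by (rule q_closed[OF fg])
  show "X \<otimes>\<^bsub>S\<^esub> Y = Y \<otimes>\<^bsub>S\<^esub> X"
    unfolding f(2) g(2) q_mult[OF f(1) g(1)] q_mult[OF g(1) f(1)] by (simp only: mult.commute)
  show "\<one>\<^bsub>S\<^esub> \<otimes>\<^bsub>S\<^esub> X = X" unfolding one_S f(2) q_mult[OF one_A f(1)] by simp
  fix Z assume "Z \<in> carrier S"
  then obtain h where h: "h \<in> carrier A" "Z = Q.q h" by (rule S_cases)
  show "X \<otimes>\<^bsub>S\<^esub> Y \<otimes>\<^bsub>S\<^esub> Z = X \<otimes>\<^bsub>S\<^esub> (Y \<otimes>\<^bsub>S\<^esub> Z)"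
    unfolding f(2) g(2) h(2) q_mult[OF f(1) g(1)] q_mult[OF g(1) h(1)] q_mult[OF fg h(1)]
      q_mult[OF f(1) A_mult[OF g(1) h(1)]] by (simp only: mult.assoc)
qed (unfold one_S, rule q_closed[OF one_A])

sublocale SM: comm_monoid S by (rule comm_monoid_S)

abbreviation \<chi> :: "'v \<Rightarrow> ('v multiset \<Rightarrow>\<^sub>0 'k) set" where "\<chi> \<equiv> sym_incl V"

lemma chi_eq: "\<chi> u = Q.q (Poly_Mapping.single {#u#} 1)"
  by (simp add: sym_incl_def Q.q_def)

lemma A_var: "u \<in> carrier V \<Longrightarrow> Poly_Mapping.single {#u#} a \<in> carrier A"
  by (rule A_single) simp

lemma chi_closed: "u \<in> carrier V \<Longrightarrow> \<chi> u \<in> carrier S"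
  unfolding chi_eq by (intro q_closed A_var)

lemma smult_chi: "u \<in> carrier V \<Longrightarrow> a \<odot>\<^bsub>S\<^esub> \<chi> u = Q.q (Poly_Mapping.single {#u#} a)"
  unfolding chi_eq by (subst q_smult[OF A_var]) (simp_all add: mult_single)

lemma chi_vlin: "vlin V S \<chi>"
  unfolding vlin_def
proof (intro conjI ballI allI)
  fix u assume u: "u \<in> carrier V"
  show "\<chi> u \<in> carrier S" by (rule chi_closed[OF u])
  show "\<chi> (a \<odot>\<^bsub>V\<^esub> u) = a \<odot>\<^bsub>S\<^esub> \<chi> u" for a
    unfolding smult_chi[OF u] unfolding chi_eq
    by (rule q_eq_iff[THEN iffD2, OF A_var[OF vs_smult_closed[OF vV u]] A_var[OF u] gens_I])
       (use u in \<open>auto simp: gens_def\<close>)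
  fix v assume v: "v \<in> carrier V"
  show "\<chi> (u \<oplus>\<^bsub>V\<^esub> v) = \<chi> u \<oplus>\<^bsub>S\<^esub> \<chi> v"
    unfolding chi_eq q_add[OF A_var[OF u] A_var[OF v]]
    by (rule q_eq_iff[THEN iffD2, OF A_var[OF V.M.a_closed[OF u v]] A_add[OF A_var[OF u] A_var[OF v]] gens_I])
       (use u v in \<open>auto simp: gens_def diff_diff_eq[symmetric]\<close>)
qed

definition lin :: "'v \<Rightarrow> 'k laurent"
  where "lin u = (\<Sum>i<n. Poly_Mapping.single (Poly_Mapping.single i 1) (c i u))"

lemma lin_add: "u \<in> carrier V \<Longrightarrow> v \<in> carrier V \<Longrightarrow> lin (u \<oplus>\<^bsub>V\<^esub> v) = lin u + lin v"
  by (simp add: lin_def c_add single_add sum.distrib)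

lemma lin_smult: "u \<in> carrier V \<Longrightarrow> lin (a \<odot>\<^bsub>V\<^esub> u) = Poly_Mapping.single 0 a * lin u"
  by (simp add: lin_def c_smult sum_distrib_left mult_single)

definition evm :: "'v multiset \<Rightarrow> 'k laurent" where "evm m = prod_mset (image_mset lin m)"

lemma evm_add: "evm (m + m') = evm m * evm m'" by (simp add: evm_def)

abbreviation evf :: "('v multiset \<Rightarrow>\<^sub>0 'k) \<Rightarrow> 'k laurent" where "evf \<equiv> ext evm"

lemma evf_mult: "evf (f * g) = evf f * evf g" by (rule ext_mult) (rule evm_add)

lemma evf_var: "evf (Poly_Mapping.single {#u#} a) = Poly_Mapping.single 0 a * lin u"
  by (simp add: ext_single evm_def)

lemma evf_const: "evf (Poly_Mapping.single {#} a) = Poly_Mapping.single 0 a"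
  by (simp add: ext_single evm_def)

lemma evf_gens: "x \<in> gens \<Longrightarrow> evf x = 0"
  by (auto simp: gens_def ext_diff evf_var lin_add lin_smult)

text \<open>The kernel of evaluation is an ideal, and it contains the defining relations because
  \<open>lin\<close> is linear.\<close>

lemma evf_I: "x \<in> I \<Longrightarrow> evf x = 0"
proof -
  let ?K = "{f \<in> carrier A. evf f = 0}"
  have "ideal ?K A"
  proof (rule idealI[OF ring_A])
    show "subgroup ?K (add_monoid A)"
    proof (rule subgroup.intro)
      show "inv\<^bsub>add_monoid A\<^esub> x \<in> ?K" if x: "x \<in> ?K" for x
      proof -
        have xA: "x \<in> carrier A" "- x \<in> carrier A" using x A_diff[of 0 x] by simp_all
        have "\<ominus>\<^bsub>A\<^esub> x = - x" by (rule Q.M.M.minus_equality[OF _ xA]) simp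
        then have "inv\<^bsub>add_monoid A\<^esub> x = - x" by (simp only: a_inv_def)
        then show ?thesis using x xA by (simp only: mem_Collect_eq ext_uminus) simp
      qed
    qed (use A_add in \<open>auto simp: ext_add\<close>)
    show "x \<otimes>\<^bsub>A\<^esub> a \<in> ?K" "a \<otimes>\<^bsub>A\<^esub> x \<in> ?K" if "a \<in> ?K" "x \<in> carrier A" for a x
      using that A_mult[of x a] A_mult[of a x] by (simp_all add: evf_mult del: free_comm_algebra_simps(1))
  qed
  then have "I \<subseteq> ?K" unfolding I_eq
    by (rule ring.genideal_minimal[OF ring_A]) (use gens_A evf_gens in \<open>auto simp del: free_comm_algebra_simps(1)\<close>)
  then show "x \<in> I \<Longrightarrow> evf x = 0" by blast
qed

text \<open>An arbitrary representative serves, since evaluation vanishes on the relations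
  (\<open>ev_q\<close>).\<close>

definition ev :: "('v multiset \<Rightarrow>\<^sub>0 'k) set \<Rightarrow> 'k laurent" where "ev X = evf (SOME f. f \<in> X)"

lemma ev_q: "f \<in> carrier A \<Longrightarrow> ev (Q.q f) = evf f"
proof -
  assume f: "f \<in> carrier A"
  have "(SOME g. g \<in> Q.q f) \<in> Q.q f" by (rule someI[of "\<lambda>g. g \<in> Q.q f", OF Q.q_self[OF f]])
  then obtain i where i: "i \<in> I" "(SOME g. g \<in> Q.q f) = i + f" unfolding Q.q_mem by auto
  then show ?thesis by (simp add: ev_def ext_add evf_I)
qed

lemma ev_add: "X \<in> carrier S \<Longrightarrow> Y \<in> carrier S \<Longrightarrow> ev (X \<oplus>\<^bsub>S\<^esub> Y) = ev X + ev Y"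
  by (elim S_cases) (simp only: q_add ev_q A_add ext_add)

lemma ev_mult: "X \<in> carrier S \<Longrightarrow> Y \<in> carrier S \<Longrightarrow> ev (X \<otimes>\<^bsub>S\<^esub> Y) = ev X * ev Y"
  by (elim S_cases) (simp only: q_mult ev_q A_mult evf_mult)

lemma A_const: "Poly_Mapping.single 0 a \<in> carrier A" using A_single[of "{#}" a] by simp

lemma ev_smult: "X \<in> carrier S \<Longrightarrow> ev (a \<odot>\<^bsub>S\<^esub> X) = Poly_Mapping.single 0 a * ev X"
proof (elim S_cases)
  fix f assume f: "f \<in> carrier A" "X = Q.q f"
  have "Poly_Mapping.single 0 a * f \<in> carrier A" by (rule A_mult[OF A_const f(1)])
  then show ?thesis using evf_const[of a] f(1)
    by (simp only: f(2) q_smult[OF f(1)] ev_q evf_mult zero_multiset_def[symmetric])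
qed

lemma ev_zero: "ev \<zero>\<^bsub>S\<^esub> = 0" unfolding zero_S by (subst ev_q) simp_all

lemma ev_one: "ev \<one>\<^bsub>S\<^esub> = 1" unfolding one_S using evf_const[of 1] by (subst ev_q[OF one_A]) simp

lemma ev_chi: "u \<in> carrier V \<Longrightarrow> ev (\<chi> u) = lin u"
  unfolding chi_eq by (subst ev_q[OF A_var]) (simp_all add: evf_var)

lemma ev_finprod: "g \<in> T \<rightarrow> carrier S \<Longrightarrow> ev (\<Otimes>\<^bsub>S\<^esub>i\<in>T. g i) = (\<Prod>i\<in>T. ev (g i))"
proof (induction T rule: infinite_finite_induct)
  case (insert x F)
  then have "g x \<in> carrier S" "g \<in> F \<rightarrow> carrier S" by auto
  then show ?case using insert by (simp add: ev_mult SM.finprod_closed)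
qed (simp_all add: ev_one)

definition NN :: "'k laurent set" where "NN = {h. \<forall>\<alpha>\<in>kys h. \<forall>v. 0 \<le> lkp \<alpha> v}"

lemma NN_add: "f \<in> NN \<Longrightarrow> g \<in> NN \<Longrightarrow> f + g \<in> NN"
  using Poly_Mapping.keys_add[of f g] unfolding NN_def by blast

lemma NN_0: "0 \<in> NN" by (simp add: NN_def)

lemma NN_sum: "(\<And>i. i \<in> T \<Longrightarrow> g i \<in> NN) \<Longrightarrow> sum g T \<in> NN"
  by (induction T rule: infinite_finite_induct) (auto intro: NN_add NN_0)

lemma NN_mult: "f \<in> NN \<Longrightarrow> g \<in> NN \<Longrightarrow> f * g \<in> NN"
  unfolding NN_def by (auto dest!: kys_mult simp: lookup_add)

lemma NN_const: "Poly_Mapping.single 0 a \<in> NN" by (simp add: NN_def)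

lemma NN_lin: "lin u \<in> NN"
  unfolding lin_def by (rule NN_sum) (simp add: NN_def lookup_single when_def)

lemma NN_evm: "evm m \<in> NN"
  unfolding evm_def using NN_const[of 1] by (induction m) (simp_all add: NN_mult NN_lin)

lemma NN_evf: "evf f \<in> NN"
  unfolding ext_def by (intro NN_sum NN_mult NN_const NN_evm)

text \<open>Negative exponents are truncated, so this is a monoid homomorphism only on the exponents
  occurring in \<open>NN\<close>, to which all evaluations belong.\<close>

definition ms :: "(nat \<Rightarrow>\<^sub>0 int) \<Rightarrow> 'v multiset"
  where "ms \<alpha> = (\<Sum>v<n. repeat_mset (nat (lkp \<alpha> v)) {#b v#})"

lemma ms_add: "\<forall>v. 0 \<le> lkp \<alpha> v \<Longrightarrow> \<forall>v. 0 \<le> lkp \<beta> v \<Longrightarrow> ms (\<alpha> + \<beta>) = ms \<alpha> + ms \<beta>"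
  unfolding ms_def sum.distrib[symmetric]
  by (intro sum.cong refl multiset_eqI) (simp add: lookup_add nat_add_distrib)

lemma ms_single: "i < n \<Longrightarrow> ms (Poly_Mapping.single i 1) = {#b i#}"
proof -
  assume i: "i < n"
  have "ms (Poly_Mapping.single i 1) = (\<Sum>v<n. if v = i then {#b v#} else {#})"
    unfolding ms_def by (intro sum.cong refl) (simp add: lookup_single when_def)
  then show ?thesis using i by (simp add: sum.delta)
qed

lemma ms_0: "ms 0 = {#}" by (simp add: ms_def)

lemma ms_V: "set_mset (ms \<alpha>) \<subseteq> carrier V"
  using b_closed by (auto simp: ms_def set_mset_sum split: if_splits)

abbreviation sec :: "'k laurent \<Rightarrow> 'v multiset \<Rightarrow>\<^sub>0 'k"
  where "sec \<equiv> ext (\<lambda>\<alpha>. Poly_Mapping.single (ms \<alpha>) 1)"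

lemma sec_A: "sec h \<in> carrier A"
  unfolding ext_def by (intro A_sum A_mult A_const A_single ms_V)

lemma sec_mult: "f \<in> NN \<Longrightarrow> g \<in> NN \<Longrightarrow> sec (f * g) = sec f * sec g"
  by (rule ext_mult) (simp add: NN_def ms_add mult_single)

lemma sec_var: "i < n \<Longrightarrow> sec (Poly_Mapping.single (Poly_Mapping.single i 1) a) = Poly_Mapping.single {#b i#} a"
  by (simp add: ext_single ms_single mult_single)

lemma finsum_A: "g \<in> T \<rightarrow> carrier A \<Longrightarrow> (\<Oplus>\<^bsub>A\<^esub>i\<in>T. g i) = (\<Sum>i\<in>T. g i)"
proof (induction T rule: infinite_finite_induct)
  case (insert x F)
  then have "g x \<in> carrier A" "g \<in> F \<rightarrow> carrier A" by auto
  then show ?case using insert.hyps insert.IH Q.M.M.finsum_insert[of F x g] by simp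
qed simp_all

lemma q_vlin: "vlin A S Q.q"
  unfolding vlin_def
proof (intro conjI ballI allI)
  fix x assume x: "x \<in> carrier A"
  show "Q.q x \<in> carrier S" by (rule q_closed[OF x])
  show "Q.q (a \<odot>\<^bsub>A\<^esub> x) = a \<odot>\<^bsub>S\<^esub> Q.q x" for a unfolding S_eq by (rule Q.q_smult[OF x, symmetric])
  show "Q.q (x \<oplus>\<^bsub>A\<^esub> y) = Q.q x \<oplus>\<^bsub>S\<^esub> Q.q y" if "y \<in> carrier A" for y
    unfolding S_eq by (rule Q.q_add[OF x that, symmetric])
qed

text \<open>Equality with the normal form in the basis variables, modulo the relations. Good
  elements contain constants and variables and are closed under sums and products, so they are
  everything; this makes \<open>ev\<close> injective.\<close>

definition good :: "('v multiset \<Rightarrow>\<^sub>0 'k) \<Rightarrow> bool"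
  where "good f \<longleftrightarrow> f \<in> carrier A \<and> f - sec (evf f) \<in> I"

lemma good_add: "good f \<Longrightarrow> good g \<Longrightarrow> good (f + g)"
  using I_add[of "f - sec (evf f)" "g - sec (evf g)"] A_add[of f g]
  unfolding good_def ext_add by (simp add: algebra_simps)

lemma good_mult:
  assumes f: "good f" and g: "good g" shows "good (f * g)"
proof -
  have "g * (f - sec (evf f)) + sec (evf f) * (g - sec (evf g)) \<in> I"
    using f g unfolding good_def by (intro I_add I_mult sec_A) auto
  then show ?thesis using f g A_mult[of f g]
    unfolding good_def evf_mult sec_mult[OF NN_evf NN_evf] by (simp add: algebra_simps)
qed

lemma good_const: "good (Poly_Mapping.single {#} a)"
  using I_0 A_const[of a]
  unfolding good_def evf_const unfolding ext_single ms_0 by (simp add: mult_single)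

text \<open>In the quotient \<open>sym_incl\<close> is linear, so the expansion of u in the basis
  carries over to its class.\<close>

lemma good_var: "u \<in> carrier V \<Longrightarrow> good (Poly_Mapping.single {#u#} 1)"
proof -
  assume u: "u \<in> carrier V"
  have t: "(\<lambda>i. Poly_Mapping.single {#b i#} (c i u)) \<in> {..<n} \<rightarrow> carrier A"
    using b_closed A_var by (intro Pi_I) (simp del: free_comm_algebra_simps)
  have cb: "(\<lambda>i. c i u \<odot>\<^bsub>V\<^esub> b i) \<in> {..<n} \<rightarrow> carrier V"
    using b_closed by (intro Pi_I vs_smult_closed[OF vV]) simp
  interpret S: vectorspace class_ring S by (rule vS)
  have s: "sec (lin u) = (\<Sum>i<n. Poly_Mapping.single {#b i#} (c i u))"
    unfolding lin_def ext_sum by (intro sum.cong refl sec_var) simp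
  have "\<chi> u = \<chi> (\<Oplus>\<^bsub>V\<^esub>i\<in>{..<n}. c i u \<odot>\<^bsub>V\<^esub> b i)" using expand[OF u] by simp
  also have "\<dots> = (\<Oplus>\<^bsub>S\<^esub>i\<in>{..<n}. \<chi> (c i u \<odot>\<^bsub>V\<^esub> b i))" by (rule vlin_finsum[OF vV vS chi_vlin cb])
  also have "\<dots> = (\<Oplus>\<^bsub>S\<^esub>i\<in>{..<n}. Q.q (Poly_Mapping.single {#b i#} (c i u)))"
  proof (rule S.M.add.finprod_cong')
    show "(\<lambda>i. Q.q (Poly_Mapping.single {#b i#} (c i u))) \<in> {..<n} \<rightarrow> carrier S"
      using t q_closed by blast
    fix i assume "i \<in> {..<n}"
    then have "b i \<in> carrier V" using b_closed by simp
    then show "\<chi> (c i u \<odot>\<^bsub>V\<^esub> b i) = Q.q (Poly_Mapping.single {#b i#} (c i u))"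
      by (simp only: vlinD(3)[OF chi_vlin] smult_chi)
  qed simp
  also have "\<dots> = Q.q (sec (lin u))"
    unfolding vlin_finsum[OF vA vS q_vlin t, symmetric] finsum_A[OF t] s ..
  finally have "Poly_Mapping.single {#u#} 1 - sec (lin u) \<in> I"
    unfolding chi_eq q_eq_iff[OF A_var[OF u] sec_A] .
  then show ?thesis unfolding good_def evf_var using u by simp
qed

lemma good_single: "set_mset m \<subseteq> carrier V \<Longrightarrow> good (Poly_Mapping.single m a)"
proof (induction m)
  case empty
  show ?case by (rule good_const)
next
  case (add u m)
  have "good (Poly_Mapping.single {#u#} 1 * Poly_Mapping.single m a)"
    using add by (intro good_mult good_var) auto
  then show ?case by (simp add: mult_single)
qed

lemma good_all: "f \<in> carrier A \<Longrightarrow> good f"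
proof -
  have *: "good (\<Sum>m\<in>M. Poly_Mapping.single m (a m))" if "finite M" "\<forall>m\<in>M. set_mset m \<subseteq> carrier V" for M and a :: "'v multiset \<Rightarrow> 'k"
    using that
  proof (induction M)
    case empty
    show ?case using good_const[of 0] by simp
  next
    case (insert m M)
    then show ?case by (simp add: good_add good_single)
  qed
  assume "f \<in> carrier A"
  then show ?thesis using *[OF finite_keys, of f "lkp f"] by (simp add: sum_singles)
qed

lemma ev_inj:
  assumes X: "X \<in> carrier S" and Y: "Y \<in> carrier S" and e: "ev X = ev Y"
  shows "X = Y"
proof -
  obtain f where f: "f \<in> carrier A" "X = Q.q f" using X by (rule S_cases)
  obtain g where g: "g \<in> carrier A" "Y = Q.q g" using Y by (rule S_cases)
  have "evf f = evf g" using e unfolding f(2) g(2) ev_q[OF f(1)] ev_q[OF g(1)] .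
  then have "f - g = (f - sec (evf f)) + - (g - sec (evf g))" by simp
  also have "\<dots> \<in> I" using good_all[OF f(1)] good_all[OF g(1)] unfolding good_def by (intro I_add I_uminus) auto
  finally show ?thesis unfolding f(2) g(2) q_eq_iff[OF f(1) g(1)] .
qed

end

section \<open>Coordinates on the Koszul complex\<close>

context coordinates
begin

text \<open>The i-th component of the isomorphism of V tensor W with the n-fold power of W given by
  the basis.\<close>

definition \<pi> :: "('k, 'w) module \<Rightarrow> nat \<Rightarrow> ('v \<times> 'w \<Rightarrow>\<^sub>0 'k) set \<Rightarrow> 'w"
  where "\<pi> W i = tensor_lift W (\<lambda>v w. c i v \<odot>\<^bsub>W\<^esub> w)"

context
  fixes W :: "('k, 'w) module"
  assumes vW: "vsp W"
begin

interpretation W: vectorspace class_ring W by (rule vW)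
interpretation V: vectorspace class_ring V by (rule vV)
interpretation T: tensor_pair V W by (rule tensor_pair.intro[OF vV vW])
interpretation T: vectorspace class_ring "tensor V W" by (rule T.vT)

lemma pi_bil: "bil V W W (\<lambda>v w. c i v \<odot>\<^bsub>W\<^esub> w)"
  unfolding bil_def vlin_def
proof (intro conjI ballI allI)
  fix v w assume v: "v \<in> carrier V" and w: "w \<in> carrier W"
  show "c i v \<odot>\<^bsub>W\<^esub> w \<in> carrier W" "c i v \<odot>\<^bsub>W\<^esub> w \<in> carrier W" by (rule vs_smult_closed[OF vW w])+
  show "c i (v \<oplus>\<^bsub>V\<^esub> u) \<odot>\<^bsub>W\<^esub> w = c i v \<odot>\<^bsub>W\<^esub> w \<oplus>\<^bsub>W\<^esub> c i u \<odot>\<^bsub>W\<^esub> w" if u: "u \<in> carrier V" for u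
    using W.smult_l_distr[of "c i v" "c i u" w] w by (simp add: c_add[OF v u] class_ring_simps)
  show "c i (a \<odot>\<^bsub>V\<^esub> v) \<odot>\<^bsub>W\<^esub> w = a \<odot>\<^bsub>W\<^esub> (c i v \<odot>\<^bsub>W\<^esub> w)" for a
    using W.smult_assoc1[of a "c i v" w] w by (simp add: c_smult[OF v] class_ring_simps)
  show "c i v \<odot>\<^bsub>W\<^esub> (w \<oplus>\<^bsub>W\<^esub> u) = c i v \<odot>\<^bsub>W\<^esub> w \<oplus>\<^bsub>W\<^esub> c i v \<odot>\<^bsub>W\<^esub> u" if u: "u \<in> carrier W" for u
    by (rule W.smult_r_distr) (use w u in auto)
  show "c i v \<odot>\<^bsub>W\<^esub> (a \<odot>\<^bsub>W\<^esub> w) = a \<odot>\<^bsub>W\<^esub> (c i v \<odot>\<^bsub>W\<^esub> w)" for a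
    using W.smult_assoc1[of a "c i v" w] W.smult_assoc1[of "c i v" a w] w
    by (simp add: class_ring_simps mult.commute)
qed

lemma pi_vlin: "vlin (tensor V W) W (\<pi> W i)"
  unfolding \<pi>_def by (rule T.lift_vlin[OF vW pi_bil])

lemma pi_pure: "v \<in> carrier V \<Longrightarrow> w \<in> carrier W \<Longrightarrow> \<pi> W i (pure_tensor V W v w) = c i v \<odot>\<^bsub>W\<^esub> w"
  unfolding \<pi>_def by (rule T.lift_pure[OF vW pi_bil])

lemma pure_sums:
  "(\<And>i. i < n \<Longrightarrow> g i \<in> carrier W) \<Longrightarrow> (\<lambda>i. pure_tensor V W (b i) (g i)) \<in> {..<n} \<rightarrow> carrier (tensor V W)"
  by (intro Pi_I T.pure_closed b_closed) auto

lemma pi_expand: "x \<in> carrier (tensor V W) \<Longrightarrow> x = (\<Oplus>\<^bsub>tensor V W\<^esub>i\<in>{..<n}. pure_tensor V W (b i) (\<pi> W i x))"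
proof (induction rule: T.tensor_induct)
  case zero
  have "pure_tensor V W (b i) \<zero>\<^bsub>W\<^esub> = \<zero>\<^bsub>tensor V W\<^esub>" if "i < n" for i
    using T.pure_bil b_closed[OF that] unfolding bil_def by (intro vlin_zero[OF vW T.vT]) auto
  then have "(\<Oplus>\<^bsub>tensor V W\<^esub>i\<in>{..<n}. pure_tensor V W (b i) (\<pi> W i \<zero>\<^bsub>tensor V W\<^esub>)) = \<zero>\<^bsub>tensor V W\<^esub>"
    unfolding vlin_zero[OF T.vT vW pi_vlin] by (intro T.M.add.finprod_one_eqI) simp
  then show ?case by simp
next
  case (add x y)
  have px: "\<pi> W i x \<in> carrier W" "\<pi> W i y \<in> carrier W" for i using vlinD(1)[OF pi_vlin] add by auto
  have "(\<Oplus>\<^bsub>tensor V W\<^esub>i\<in>{..<n}. pure_tensor V W (b i) (\<pi> W i (x \<oplus>\<^bsub>tensor V W\<^esub> y))) =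
      (\<Oplus>\<^bsub>tensor V W\<^esub>i\<in>{..<n}. pure_tensor V W (b i) (\<pi> W i x) \<oplus>\<^bsub>tensor V W\<^esub> pure_tensor V W (b i) (\<pi> W i y))"
    using add px by (intro T.M.add.finprod_cong')
      (auto simp: vlinD(2)[OF pi_vlin] T.pure_add2 b_closed intro!: T.M.a_closed T.pure_closed)
  also have "\<dots> = x \<oplus>\<^bsub>tensor V W\<^esub> y"
    unfolding T.M.finsum_addf[OF pure_sums[OF px(1)] pure_sums[OF px(2)]] add.IH[symmetric] ..
  finally show ?case by simp
next
  case (pure v w)
  have vl: "vlin V (tensor V W) (\<lambda>u. pure_tensor V W u w)" using T.pure_bil pure unfolding bil_def by blast
  have "pure_tensor V W v w = pure_tensor V W (\<Oplus>\<^bsub>V\<^esub>i\<in>{..<n}. c i v \<odot>\<^bsub>V\<^esub> b i) w"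
    using expand[OF pure(1)] by simp
  also have "\<dots> = (\<Oplus>\<^bsub>tensor V W\<^esub>i\<in>{..<n}. pure_tensor V W (c i v \<odot>\<^bsub>V\<^esub> b i) w)"
    using b_closed by (intro vlin_finsum[OF vV T.vT vl] Pi_I vs_smult_closed[OF vV]) simp
  also have "\<dots> = (\<Oplus>\<^bsub>tensor V W\<^esub>i\<in>{..<n}. pure_tensor V W (b i) (\<pi> W i (pure_tensor V W v w)))"
    unfolding pi_pure[OF pure]
    using pure by (intro T.M.add.finprod_cong')
      (auto simp: T.pure_smult1 T.pure_smult2 b_closed intro!: vs_smult_closed[OF T.vT] T.pure_closed)
  finally show ?case .
qed

lemma pi_inj:
  assumes "x \<in> carrier (tensor V W)" "y \<in> carrier (tensor V W)" "\<And>i. i < n \<Longrightarrow> \<pi> W i x = \<pi> W i y"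
  shows "x = y"
proof -
  have py: "\<pi> W i y \<in> carrier W" for i using vlinD(1)[OF pi_vlin] assms by auto
  have "x = (\<Oplus>\<^bsub>tensor V W\<^esub>i\<in>{..<n}. pure_tensor V W (b i) (\<pi> W i x))" by (rule pi_expand[OF assms(1)])
  also have "\<dots> = (\<Oplus>\<^bsub>tensor V W\<^esub>i\<in>{..<n}. pure_tensor V W (b i) (\<pi> W i y))"
    by (rule T.M.add.finprod_cong'[OF refl pure_sums[OF py]]) (use assms(3) in simp)
  also have "\<dots> = y" by (rule pi_expand[OF assms(2), symmetric])
  finally show ?thesis .
qed

lemma pi_surj:
  assumes g: "\<And>i. i < n \<Longrightarrow> g i \<in> carrier W"
  shows "\<exists>x\<in>carrier (tensor V W). \<forall>i<n. \<pi> W i x = g i"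
proof (intro bexI allI impI)
  let ?x = "\<Oplus>\<^bsub>tensor V W\<^esub>i\<in>{..<n}. pure_tensor V W (b i) (g i)"
  show "?x \<in> carrier (tensor V W)" by (rule T.M.finsum_closed[OF pure_sums[OF g]])
  fix j assume j: "j < n"
  have "\<pi> W j ?x = (\<Oplus>\<^bsub>W\<^esub>i\<in>{..<n}. \<pi> W j (pure_tensor V W (b i) (g i)))"
    by (rule vlin_finsum[OF T.vT vW pi_vlin pure_sums[OF g]])
  also have "\<dots> = (\<Oplus>\<^bsub>W\<^esub>i\<in>{..<n}. if j = i then g i else \<zero>\<^bsub>W\<^esub>)"
  proof (rule W.M.add.finprod_cong')
    fix i assume "i \<in> {..<n}"
    then have i: "i < n" by simp
    show "\<pi> W j (pure_tensor V W (b i) (g i)) = (if j = i then g i else \<zero>\<^bsub>W\<^esub>)"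
      unfolding pi_pure[OF b_closed[OF i] g[OF i]] c_b[OF j i]
      using W.smult_one[OF g[OF i]] g[OF i] by (simp add: vsp_zero_smult[OF vW] class_ring_simps)
  qed (use g in auto)
  also have "\<dots> = g j" by (rule W.M.add.finprod_singleton) (use j g in auto)
  finally show "\<pi> W j ?x = g j" .
qed

end

end

locale koszul_setup = bigraded n1 n2 \<kappa> K0 + X1: coordinates V1 n1 b1 c1 + X2: coordinates V2 n2 b2 c2
  for n1 n2 \<kappa> :: nat and K0 :: "nat \<Rightarrow> nat \<Rightarrow> nat \<Rightarrow> 'k::field"
    and V1 :: "('k, 'a) module" and b1 c1 and V2 :: "('k, 'b) module" and b2 c2
begin

abbreviation D where "D \<equiv> direct_sum V1 V2"

sublocale Y: sym_coordinates D "n1 + n2"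
  "\<lambda>v. if v < n1 then inj1 V1 V2 (b1 v) else inj2 V1 V2 (b2 (v - n1))"
  "\<lambda>v u. if v < n1 then c1 v (fst u) else c2 (v - n1) (snd u)"
  by (rule sym_coordinates.intro[OF coordinates_direct_sum[OF X1.coordinates_axioms X2.coordinates_axioms]])

abbreviation ev where "ev \<equiv> Y.ev"
abbreviation B where "B \<equiv> bisym V1 V2"
abbreviation P where "P d e \<equiv> sym_part V1 V2 d e"
abbreviation x1 where "x1 \<equiv> var1 V1 V2"
abbreviation x2 where "x2 \<equiv> var2 V1 V2"

definition l1 :: "'a \<Rightarrow> 'k laurent" where "l1 v = (\<Sum>i<n1. z i * Poly_Mapping.single 0 (c1 i v))"
definition l2 :: "'b \<Rightarrow> 'k laurent" where "l2 v = (\<Sum>j<n2. z (n1 + j) * Poly_Mapping.single 0 (c2 j v))"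

lemma c1_zero: "c1 i \<zero>\<^bsub>V1\<^esub> = 0"
  using X1.c_smult[of "\<zero>\<^bsub>V1\<^esub>" i 0] abelian_group.axioms(1)[OF vsp_abelian_group[OF X1.vV]]
  by (simp add: vsp_zero_smult[OF X1.vV] abelian_monoid.zero_closed)

lemma c2_zero: "c2 i \<zero>\<^bsub>V2\<^esub> = 0"
  using X2.c_smult[of "\<zero>\<^bsub>V2\<^esub>" i 0] abelian_group.axioms(1)[OF vsp_abelian_group[OF X2.vV]]
  by (simp add: vsp_zero_smult[OF X2.vV] abelian_monoid.zero_closed)

lemma lin_split: "Y.lin u = l1 (fst u) + l2 (snd u)"
proof -
  have s: "{..<n1 + n2} = {..<n1} \<union> {n1..<n1 + n2}" by auto
  have "(\<Sum>v\<in>{n1..<n1 + n2}. Poly_Mapping.single (Poly_Mapping.single v 1) (c2 (v - n1) (snd u))) = l2 (snd u)"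
    unfolding l2_def by (rule sum.reindex_bij_witness[of _ "\<lambda>j. n1 + j" "\<lambda>v. v - n1"])
      (auto simp: z_def N_def mult_single)
  moreover have "(\<Sum>v<n1. Poly_Mapping.single (Poly_Mapping.single v 1) (c1 v (fst u))) = l1 (fst u)"
    unfolding l1_def by (intro sum.cong refl) (simp add: z_def N_def mult_single)
  ultimately show ?thesis
    unfolding Y.lin_def s by (subst sum.union_disjoint) auto
qed

lemma inj1_D: "v \<in> carrier V1 \<Longrightarrow> inj1 V1 V2 v \<in> carrier D"
  and inj2_D: "w \<in> carrier V2 \<Longrightarrow> inj2 V1 V2 w \<in> carrier D"
  using abelian_group.axioms(1)[OF vsp_abelian_group[OF X1.vV]] abelian_group.axioms(1)[OF vsp_abelian_group[OF X2.vV]]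
  by (simp_all add: inj1_def inj2_def direct_sum_def abelian_monoid.zero_closed)

lemma x1_closed: "v \<in> carrier V1 \<Longrightarrow> x1 v \<in> carrier B"
  unfolding var1_def by (intro Y.chi_closed inj1_D)

lemma x2_closed: "v \<in> carrier V2 \<Longrightarrow> x2 v \<in> carrier B"
  unfolding var2_def by (intro Y.chi_closed inj2_D)

lemma ev_x1: "v \<in> carrier V1 \<Longrightarrow> ev (x1 v) = l1 v"
  unfolding var1_def Y.ev_chi[OF inj1_D] lin_split by (simp add: inj1_def l2_def c2_zero)

lemma ev_x2: "v \<in> carrier V2 \<Longrightarrow> ev (x2 v) = l2 v"
  unfolding var2_def Y.ev_chi[OF inj2_D] lin_split by (simp add: inj2_def l1_def c1_zero)

lemma H_l1: "l1 v \<in> H 1 0"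
  unfolding l1_def by (rule H_sum) (use H_mult[OF H_zx H_const] in simp)

lemma H_l2: "l2 v \<in> H 0 1"
  unfolding l2_def by (rule H_sum) (use H_mult[OF H_zy H_const] in simp)

lemma l1_b: "i < n1 \<Longrightarrow> l1 (b1 i) = z i"
proof -
  assume i: "i < n1"
  have "l1 (b1 i) = (\<Sum>j<n1. if j = i then z j else 0)"
    unfolding l1_def using i by (intro sum.cong refl) (simp add: X1.c_b)
  then show ?thesis using i by (simp add: sum.delta)
qed

lemma l2_b: "i < n2 \<Longrightarrow> l2 (b2 i) = z (n1 + i)"
proof -
  assume i: "i < n2"
  have "l2 (b2 i) = (\<Sum>j<n2. if j = i then z (n1 + j) else 0)"
    unfolding l2_def using i by (intro sum.cong refl) (simp add: X2.c_b)
  then show ?thesis using i by (simp add: sum.delta)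
qed

definition PG :: "nat \<Rightarrow> nat \<Rightarrow> (('a \<times> 'b) multiset \<Rightarrow>\<^sub>0 'k) set set"
  where "PG d e = {(\<Otimes>\<^bsub>B\<^esub> i\<in>{..<d}. x1 (x i)) \<otimes>\<^bsub>B\<^esub> (\<Otimes>\<^bsub>B\<^esub> j\<in>{..<e}. x2 (y j)) | x y.
       x \<in> {..<d} \<rightarrow> carrier V1 \<and> y \<in> {..<e} \<rightarrow> carrier V2}"

lemma P_eq: "P d e = B \<lparr> carrier := LinearCombinations.module.span class_ring B (PG d e) \<rparr>"
  by (simp only: sym_part_def PG_def)

lemma P_ops [simp]: "add (P d e) = add B" "zero (P d e) = zero B" "smult (P d e) = smult B"
  by (simp_all add: P_eq)

lemma PG_elem:
  assumes "x \<in> {..<d} \<rightarrow> carrier V1" "y \<in> {..<e} \<rightarrow> carrier V2"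
  shows "(\<Otimes>\<^bsub>B\<^esub> i\<in>{..<d}. x1 (x i)) \<otimes>\<^bsub>B\<^esub> (\<Otimes>\<^bsub>B\<^esub> j\<in>{..<e}. x2 (y j)) \<in> carrier B"
    and "ev ((\<Otimes>\<^bsub>B\<^esub> i\<in>{..<d}. x1 (x i)) \<otimes>\<^bsub>B\<^esub> (\<Otimes>\<^bsub>B\<^esub> j\<in>{..<e}. x2 (y j))) =
      (\<Prod>i<d. l1 (x i)) * (\<Prod>j<e. l2 (y j))"
proof -
  have t: "(\<lambda>i. x1 (x i)) \<in> {..<d} \<rightarrow> carrier B" "(\<lambda>j. x2 (y j)) \<in> {..<e} \<rightarrow> carrier B"
    using assms x1_closed x2_closed by (auto simp: Pi_iff)
  note cl = Y.SM.finprod_closed[OF t(1)] Y.SM.finprod_closed[OF t(2)]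
  show "(\<Otimes>\<^bsub>B\<^esub> i\<in>{..<d}. x1 (x i)) \<otimes>\<^bsub>B\<^esub> (\<Otimes>\<^bsub>B\<^esub> j\<in>{..<e}. x2 (y j)) \<in> carrier B"
    by (rule Y.SM.m_closed[OF cl])
  have "(\<Prod>i<d. ev (x1 (x i))) = (\<Prod>i<d. l1 (x i))" "(\<Prod>j<e. ev (x2 (y j))) = (\<Prod>j<e. l2 (y j))"
    using assms ev_x1 ev_x2 by (auto simp: Pi_iff intro!: prod.cong)
  then show "ev ((\<Otimes>\<^bsub>B\<^esub> i\<in>{..<d}. x1 (x i)) \<otimes>\<^bsub>B\<^esub> (\<Otimes>\<^bsub>B\<^esub> j\<in>{..<e}. x2 (y j))) =
      (\<Prod>i<d. l1 (x i)) * (\<Prod>j<e. l2 (y j))"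
    unfolding Y.ev_mult[OF cl] Y.ev_finprod[OF t(1)] Y.ev_finprod[OF t(2)] by simp
qed

lemma H_prod1: "(\<Prod>i<d. l1 (x i)) \<in> H d 0"
  by (induction d) (use H_1 H_mult[OF _ H_l1] in auto)

lemma H_prod2: "(\<Prod>i<d. l2 (x i)) \<in> H 0 d"
  by (induction d) (use H_1 H_mult[OF _ H_l2] in auto)

lemma PG_B: "PG d e \<subseteq> carrier B"
  unfolding PG_def using PG_elem(1) by blast

lemma PG_H: "X \<in> PG d e \<Longrightarrow> ev X \<in> H d e"
proof -
  assume "X \<in> PG d e"
  then obtain x y where xy: "x \<in> {..<d} \<rightarrow> carrier V1" "y \<in> {..<e} \<rightarrow> carrier V2"
    and X: "X = (\<Otimes>\<^bsub>B\<^esub> i\<in>{..<d}. x1 (x i)) \<otimes>\<^bsub>B\<^esub> (\<Otimes>\<^bsub>B\<^esub> j\<in>{..<e}. x2 (y j))"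
    unfolding PG_def by blast
  show "ev X \<in> H d e"
    unfolding X PG_elem(2)[OF xy] using H_mult[OF H_prod1[of x d] H_prod2[of y e]] by simp
qed

lemma vP: "vsp (P d e)"
  unfolding P_eq
  by (rule vectorspace.subspace_is_vs[OF Y.vS vectorspace.span_is_subspace[OF Y.vS PG_B]])

lemma H_smult: "h \<in> H d e \<Longrightarrow> Poly_Mapping.single 0 a * h \<in> H d e"
  using H_mult[OF H_const, of h d e] by simp

lemma P_sub: "X \<in> carrier (P d e) \<Longrightarrow> X \<in> carrier B \<and> ev X \<in> H d e"
proof -
  let ?U = "{X \<in> carrier B. ev X \<in> H d e}"
  interpret S: vectorspace class_ring B by (rule Y.vS)
  have s: "VectorSpace.subspace class_ring ?U B"
    unfolding vs_subspace_iff[OF Y.vS]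
    using Y.ev_add Y.ev_smult Y.ev_zero H_0 H_add H_smult vs_smult_closed[OF Y.vS] by auto
  have "LinearCombinations.module.span class_ring B (PG d e) \<subseteq> ?U"
    by (rule module.span_is_subset[OF vectorspace.axioms(1)[OF Y.vS]])
       (use PG_B PG_H subspace.submod[OF s] in auto)
  then show "X \<in> carrier (P d e) \<Longrightarrow> X \<in> carrier B \<and> ev X \<in> H d e" by (auto simp: P_eq)
qed

lemma PG_P: "X \<in> PG d e \<Longrightarrow> X \<in> carrier (P d e)"
  unfolding P_eq using module.in_own_span[OF vectorspace.axioms(1)[OF Y.vS] PG_B] by auto

text \<open>\<open>sym_part\<close> is spanned by products of exactly d and e vectors, so a monomial
  has to be written as a product of that shape, one variable at a time.\<close>

lemma monomial_x:
  assumes "rg {} \<alpha>" "xd \<alpha> = int d" "yd \<alpha> = int e"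
  shows "\<exists>x y. (\<forall>i<d. x i < n1) \<and> (\<forall>j<e. y j < n2) \<and>
    (\<Prod>i<d. z (x i)) * (\<Prod>j<e. z (n1 + y j)) = Poly_Mapping.single \<alpha> 1"
  using assms
proof (induction "d + e" arbitrary: d e \<alpha>)
  case 0
  have n: "0 \<le> lkp \<alpha> v" for v using 0(2) unfolding rg_def by (metis empty_iff not_less)
  have "(\<Sum>v<n1. lkp \<alpha> v) = 0" "(\<Sum>v\<in>{n1..<N}. lkp \<alpha> v) = 0" using 0 by (simp_all add: xd_def yd_def)
  then have "\<forall>v\<in>{..<n1}. lkp \<alpha> v = 0" "\<forall>v\<in>{n1..<N}. lkp \<alpha> v = 0"
    using n by (simp_all add: sum_nonneg_eq_0_iff)
  moreover have "lkp \<alpha> v = 0" if "N \<le> v" for v using 0(2) that by (auto simp: rg_def kys_iff subset_iff not_less)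
  ultimately have "lkp \<alpha> v = 0" for v by (cases "v < n1"; cases "v < N") auto
  then have "\<alpha> = 0" by (intro poly_mapping_eqI) simp
  then show ?case using 0 by simp
next
  case (Suc k)
  show ?case
  proof (cases d)
    case (Suc d')
    obtain i where i: "i < n1" "1 \<le> lkp \<alpha> i" using exists_x_variable[OF Suc.prems(1)] Suc.prems(2) Suc by auto
    have iN: "i < N" using i by (simp add: N_def)
    let ?\<beta> = "\<alpha> - Poly_Mapping.single i 1"
    have "\<exists>x y. (\<forall>i<d'. x i < n1) \<and> (\<forall>j<e. y j < n2) \<and>
        (\<Prod>i<d'. z (x i)) * (\<Prod>j<e. z (n1 + y j)) = Poly_Mapping.single ?\<beta> 1"
      using rg_remove[OF Suc.prems(1) iN i(2)] Suc.hyps(2) Suc.prems(2,3) i Suc by (intro Suc.hyps(1)) auto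
    then obtain x y where xy: "\<forall>i<d'. x i < n1" "\<forall>j<e. y j < n2"
        "(\<Prod>i<d'. z (x i)) * (\<Prod>j<e. z (n1 + y j)) = Poly_Mapping.single ?\<beta> 1" by blast
    have "(\<Prod>t<d. z ((x(d' := i)) t)) = (\<Prod>i<d'. z (x i)) * z i"
      unfolding Suc prod.lessThan_Suc by (intro arg_cong2[of _ _ _ _ "(*)"] prod.cong) auto
    then have "(\<Prod>t<d. z ((x(d' := i)) t)) * (\<Prod>j<e. z (n1 + y j)) = Poly_Mapping.single ?\<beta> 1 * z i"
      by (simp only: xy(3)[symmetric]) (simp only: ac_simps)
    also have "\<dots> = Poly_Mapping.single \<alpha> 1" using iN by (simp add: z_def mult_single)
    finally show ?thesis using xy i Suc
      by (intro exI[of _ "x(d' := i)"] exI[of _ y]) (auto simp: less_Suc_eq)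
  next
    case 0
    then obtain e' where e: "e = Suc e'" using Suc.hyps(2) by (cases e) auto
    obtain i where i: "n1 \<le> i" "i < N" "1 \<le> lkp \<alpha> i" using exists_y_variable[OF Suc.prems(1)] Suc.prems(3) e by auto
    let ?\<beta> = "\<alpha> - Poly_Mapping.single i 1"
    have "\<exists>x y. (\<forall>i<d. x i < n1) \<and> (\<forall>j<e'. y j < n2) \<and>
        (\<Prod>i<d. z (x i)) * (\<Prod>j<e'. z (n1 + y j)) = Poly_Mapping.single ?\<beta> 1"
      using rg_remove[OF Suc.prems(1) i(2,3)] Suc.hyps(2) Suc.prems(2,3) i e by (intro Suc.hyps(1)) auto
    then obtain x y where xy: "\<forall>i<d. x i < n1" "\<forall>j<e'. y j < n2"
        "(\<Prod>i<d. z (x i)) * (\<Prod>j<e'. z (n1 + y j)) = Poly_Mapping.single ?\<beta> 1" by blast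
    have "(\<Prod>t<e. z (n1 + (y(e' := i - n1)) t)) = (\<Prod>j<e'. z (n1 + y j)) * z i"
      unfolding e prod.lessThan_Suc using i(1) by (intro arg_cong2[of _ _ _ _ "(*)"] prod.cong) auto
    then have "(\<Prod>i<d. z (x i)) * (\<Prod>t<e. z (n1 + (y(e' := i - n1)) t)) = Poly_Mapping.single ?\<beta> 1 * z i"
      by (simp only: xy(3)[symmetric]) (simp only: ac_simps)
    also have "\<dots> = Poly_Mapping.single \<alpha> 1" using i by (simp add: z_def mult_single)
    finally show ?thesis using xy i e
      by (intro exI[of _ x] exI[of _ "y(e' := i - n1)"]) (auto simp: less_Suc_eq N_def)
  qed
qed

lemma monomial_PG:
  assumes "rg {} \<alpha>" "xd \<alpha> = int d" "yd \<alpha> = int e"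
  shows "\<exists>X\<in>PG d e. ev X = Poly_Mapping.single \<alpha> 1"
proof -
  obtain x y where xy: "\<forall>i<d. x i < n1" "\<forall>j<e. y j < n2"
      "(\<Prod>i<d. z (x i)) * (\<Prod>j<e. z (n1 + y j)) = Poly_Mapping.single \<alpha> 1"
    using monomial_x[OF assms] by blast
  have t: "(\<lambda>i. b1 (x i)) \<in> {..<d} \<rightarrow> carrier V1" "(\<lambda>j. b2 (y j)) \<in> {..<e} \<rightarrow> carrier V2"
    using xy X1.b_closed X2.b_closed by auto
  have "(\<Prod>i<d. l1 (b1 (x i))) = (\<Prod>i<d. z (x i))" "(\<Prod>j<e. l2 (b2 (y j))) = (\<Prod>j<e. z (n1 + y j))"
    using xy by (auto intro!: prod.cong l1_b l2_b)
  then have "ev ((\<Otimes>\<^bsub>B\<^esub> i\<in>{..<d}. x1 (b1 (x i))) \<otimes>\<^bsub>B\<^esub> (\<Otimes>\<^bsub>B\<^esub> j\<in>{..<e}. x2 (b2 (y j)))) =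
      Poly_Mapping.single \<alpha> 1"
    unfolding PG_elem(2)[OF t] xy(3)[symmetric] by simp
  moreover have "(\<Otimes>\<^bsub>B\<^esub> i\<in>{..<d}. x1 (b1 (x i))) \<otimes>\<^bsub>B\<^esub> (\<Otimes>\<^bsub>B\<^esub> j\<in>{..<e}. x2 (b2 (y j))) \<in> PG d e"
    unfolding PG_def mem_Collect_eq
    by (intro exI[of _ "\<lambda>i. b1 (x i)"] exI[of _ "\<lambda>j. b2 (y j)"] conjI refl t)
  ultimately show ?thesis by (rule bexI)
qed

lemma P_surj: "h \<in> H d e \<Longrightarrow> \<exists>X\<in>carrier (P d e). ev X = h"
proof -
  interpret p: vectorspace class_ring "P d e" by (rule vP)
  have *: "\<exists>X\<in>carrier (P d e). ev X = (\<Sum>\<alpha>\<in>M. Poly_Mapping.single \<alpha> (a \<alpha>))"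
    if "finite M" "\<forall>\<alpha>\<in>M. rg {} \<alpha> \<and> xd \<alpha> = int d \<and> yd \<alpha> = int e" for M and a :: "(nat \<Rightarrow>\<^sub>0 int) \<Rightarrow> 'k"
    using that
  proof (induction M)
    case empty
    have "\<zero>\<^bsub>B\<^esub> \<in> carrier (P d e)" using p.M.zero_closed by simp
    then show ?case using Y.ev_zero by (intro bexI[of _ "\<zero>\<^bsub>B\<^esub>"]) simp_all
  next
    case (insert \<alpha> M)
    obtain X where X: "X \<in> carrier (P d e)" "ev X = (\<Sum>\<alpha>\<in>M. Poly_Mapping.single \<alpha> (a \<alpha>))" using insert by auto
    obtain W where W: "W \<in> PG d e" "ev W = Poly_Mapping.single \<alpha> 1" using monomial_PG insert.prems by blast
    have WP: "W \<in> carrier (P d e)" by (rule PG_P[OF W(1)])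
    have aW: "a \<alpha> \<odot>\<^bsub>B\<^esub> W \<in> carrier (P d e)" using vs_smult_closed[OF vP WP] by simp
    have "a \<alpha> \<odot>\<^bsub>B\<^esub> W \<oplus>\<^bsub>B\<^esub> X \<in> carrier (P d e)" using p.M.a_closed[OF aW X(1)] by simp
    moreover have "ev (a \<alpha> \<odot>\<^bsub>B\<^esub> W \<oplus>\<^bsub>B\<^esub> X) = (\<Sum>\<alpha>\<in>insert \<alpha> M. Poly_Mapping.single \<alpha> (a \<alpha>))"
      using P_sub[OF aW] P_sub[OF X(1)] P_sub[OF WP] insert.hyps
      by (simp add: Y.ev_add Y.ev_smult W(2) X(2) mult_single)
    ultimately show ?case by (intro bexI)
  qed
  assume "h \<in> H d e"
  then show ?thesis using *[OF finite_keys, of h "lkp h"] unfolding H_def by (simp add: sum_singles)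
qed

text \<open>All monomials of the bidegree are values of \<open>ev\<close> on products of basis
  vectors; injectivity of \<open>ev\<close> then shows that the bidegree of the value decides
  membership.\<close>

lemma P_iff: "X \<in> carrier (P d e) \<longleftrightarrow> X \<in> carrier B \<and> ev X \<in> H d e"
proof
  assume X: "X \<in> carrier B \<and> ev X \<in> H d e"
  obtain Z where Z: "Z \<in> carrier (P d e)" "ev Z = ev X" using P_surj[of "ev X" d e] X by blast
  have "Z = X" using P_sub[OF Z(1)] X Z(2) by (intro Y.ev_inj) auto
  then show "X \<in> carrier (P d e)" using Z by simp
qed (rule P_sub)

end

section \<open>Coordinates on the middle term and the first map\<close>

context koszul_setup
begin

abbreviation T1 where "T1 d e \<equiv> tensor V1 (P d (e + 1))"
abbreviation T2 where "T2 d e \<equiv> tensor V2 (P (d + 1) e)"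
abbreviation M where "M d e \<equiv> koszul_middle V1 V2 d e"

lemmas vV1 = X1.vV and vV2 = X2.vV

lemma tp1: "tensor_pair V1 (P d e)" and tp2: "tensor_pair V2 (P d e)" and tpV: "tensor_pair V1 V2"
  by (rule tensor_pair.intro[OF vV1 vP] tensor_pair.intro[OF vV2 vP] tensor_pair.intro[OF vV1 vV2])+

lemmas vT1 = tensor_pair.vT[OF tp1] and vT2 = tensor_pair.vT[OF tp2] and vTV = tensor_pair.vT[OF tpV]

lemma vM: "vsp (M d e)"
  unfolding koszul_middle_def by (rule direct_sum_is_vs[OF vT1 vT2])

lemma M_carrier: "w \<in> carrier (M d e) \<longleftrightarrow> fst w \<in> carrier (T1 d e) \<and> snd w \<in> carrier (T2 d e)"
  by (cases w) (simp add: koszul_middle_def direct_sum_def)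

lemma M_add: "w \<oplus>\<^bsub>M d e\<^esub> w' = (fst w \<oplus>\<^bsub>T1 d e\<^esub> fst w', snd w \<oplus>\<^bsub>T2 d e\<^esub> snd w')"
  and M_smult: "a \<odot>\<^bsub>M d e\<^esub> w = (a \<odot>\<^bsub>T1 d e\<^esub> fst w, a \<odot>\<^bsub>T2 d e\<^esub> snd w)"
  by (simp_all add: koszul_middle_def direct_sum_def case_prod_beta)

lemma ev_vlin:
  assumes h: "vlin Q (P d e) h" and x: "x \<in> carrier Q"
  shows "h x \<in> carrier B" and "ev (h x) \<in> H d e"
    and "y \<in> carrier Q \<Longrightarrow> ev (h (x \<oplus>\<^bsub>Q\<^esub> y)) = ev (h x) + ev (h y)"
    and "ev (h (a \<odot>\<^bsub>Q\<^esub> x)) = Poly_Mapping.single 0 a * ev (h x)"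
proof -
  have m: "h y \<in> carrier B" "ev (h y) \<in> H d e" if "y \<in> carrier Q" for y
    using P_sub[OF vlinD(1)[OF h that]] by auto
  show "h x \<in> carrier B" "ev (h x) \<in> H d e" by (rule m[OF x])+
  show "y \<in> carrier Q \<Longrightarrow> ev (h (x \<oplus>\<^bsub>Q\<^esub> y)) = ev (h x) + ev (h y)"
    unfolding vlinD(2)[OF h x] P_ops by (rule Y.ev_add[OF m(1)[OF x] m(1)])
  show "ev (h (a \<odot>\<^bsub>Q\<^esub> x)) = Poly_Mapping.single 0 a * ev (h x)"
    unfolding vlinD(3)[OF h x] P_ops by (rule Y.ev_smult[OF m(1)[OF x]])
qed

lemma ev_vlin_zero:
  assumes "vsp Q" "vlin Q (P d e) h" shows "ev (h \<zero>\<^bsub>Q\<^esub>) = 0"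
  unfolding vlin_zero[OF assms(1) vP assms(2)] P_ops by (rule Y.ev_zero)

lemma ev_vlin_neg:
  assumes Q: "vsp Q" and h: "vlin Q (P d e) h" and x: "x \<in> carrier Q"
  shows "ev (h (\<ominus>\<^bsub>Q\<^esub> x)) = - ev (h x)"
proof -
  interpret Q: abelian_group Q by (rule vsp_abelian_group[OF Q])
  have "0 = ev (h (x \<oplus>\<^bsub>Q\<^esub> \<ominus>\<^bsub>Q\<^esub> x))" using ev_vlin_zero[OF Q h] Q.r_neg[OF x] by simp
  also have "\<dots> = ev (h x) + ev (h (\<ominus>\<^bsub>Q\<^esub> x))" by (rule ev_vlin(3)[OF h x Q.a_inv_closed[OF x]])
  finally show ?thesis by (simp add: eq_neg_iff_add_eq_0 add.commute)
qed

lemmas p1_vlin = X1.pi_vlin[OF vP] and p2_vlin = X2.pi_vlin[OF vP]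

text \<open>The n1 + n2 polynomial components of an element of the middle term. The value is zero
  beyond N, so that linearity holds for every index.\<close>

definition \<Theta> :: "nat \<Rightarrow> nat \<Rightarrow> ('a \<times> (('a \<times> 'b) multiset \<Rightarrow>\<^sub>0 'k) set \<Rightarrow>\<^sub>0 'k) set \<times>
    ('b \<times> (('a \<times> 'b) multiset \<Rightarrow>\<^sub>0 'k) set \<Rightarrow>\<^sub>0 'k) set \<Rightarrow> nat \<Rightarrow> 'k laurent"
  where "\<Theta> d e w v = (if v < n1 then ev (X1.\<pi> (P d (e + 1)) v (fst w))
    else if v < N then ev (X2.\<pi> (P (d + 1) e) (v - n1) (snd w)) else 0)"

lemma Theta_add: "w \<in> carrier (M d e) \<Longrightarrow> w' \<in> carrier (M d e) \<Longrightarrow>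
    \<Theta> d e (w \<oplus>\<^bsub>M d e\<^esub> w') v = \<Theta> d e w v + \<Theta> d e w' v"
  unfolding M_carrier M_add \<Theta>_def fst_conv snd_conv
  using ev_vlin(3)[OF p1_vlin, of "fst w" d "e + 1" "fst w'"] ev_vlin(3)[OF p2_vlin, of "snd w" "d + 1" e "snd w'"]
  by (simp only: if_True if_False split: if_splits) simp

lemma Theta_smult: "w \<in> carrier (M d e) \<Longrightarrow> \<Theta> d e (a \<odot>\<^bsub>M d e\<^esub> w) v = Poly_Mapping.single 0 a * \<Theta> d e w v"
  unfolding M_carrier M_smult \<Theta>_def fst_conv snd_conv
  using ev_vlin(4)[OF p1_vlin, of "fst w" d "e + 1"] ev_vlin(4)[OF p2_vlin, of "snd w" "d + 1" e]
  by (simp only: if_True if_False split: if_splits) simp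

lemma Theta_Fam: "w \<in> carrier (M d e) \<Longrightarrow> \<Theta> d e w \<in> Fam d e"
  unfolding M_carrier \<Theta>_def Fam_def
  using ev_vlin(2)[OF p1_vlin, of "fst w" d "e + 1"] ev_vlin(2)[OF p2_vlin, of "snd w" "d + 1" e]
  by simp

lemma Theta_zero: "\<Theta> d e \<zero>\<^bsub>M d e\<^esub> v = 0"
proof -
  interpret m: vectorspace class_ring "M d e" by (rule vM)
  have "\<Theta> d e \<zero>\<^bsub>M d e\<^esub> v = \<Theta> d e \<zero>\<^bsub>M d e\<^esub> v + \<Theta> d e \<zero>\<^bsub>M d e\<^esub> v"
    using Theta_add[OF m.M.zero_closed m.M.zero_closed, of v] m.M.r_zero[OF m.M.zero_closed] by (simp only:)
  then show ?thesis by (simp only: add_cancel_right_right)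
qed

lemma Theta_inj:
  assumes w: "w \<in> carrier (M d e)" "w' \<in> carrier (M d e)" and e: "\<And>v. v < N \<Longrightarrow> \<Theta> d e w v = \<Theta> d e w' v"
  shows "w = w'"
proof (rule prod_eqI)
  show "fst w = fst w'"
  proof (rule X1.pi_inj[OF vP])
    show m: "fst w \<in> carrier (T1 d e)" "fst w' \<in> carrier (T1 d e)" using w by (auto simp only: M_carrier)
    show "X1.\<pi> (P d (e + 1)) i (fst w) = X1.\<pi> (P d (e + 1)) i (fst w')" if "i < n1" for i
      using e[of i] that by (intro Y.ev_inj ev_vlin(1)[OF p1_vlin] m) (simp add: \<Theta>_def N_def)
  qed
  show "snd w = snd w'"
  proof (rule X2.pi_inj[OF vP])
    show m: "snd w \<in> carrier (T2 d e)" "snd w' \<in> carrier (T2 d e)" using w by (auto simp only: M_carrier)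
    show "X2.\<pi> (P (d + 1) e) i (snd w) = X2.\<pi> (P (d + 1) e) i (snd w')" if "i < n2" for i
      using e[of "n1 + i"] that by (intro Y.ev_inj ev_vlin(1)[OF p2_vlin] m) (simp add: \<Theta>_def N_def)
  qed
qed

lemma Theta_surj:
  assumes F: "F \<in> Fam d e"
  shows "\<exists>w\<in>carrier (M d e). \<forall>v<N. \<Theta> d e w v = F v"
proof -
  have i1: "F i \<in> ev ` carrier (P d (e + 1))" if "i < n1" for i
  proof -
    have "i < N" using that by (simp add: N_def)
    then have "F i \<in> H (d + (if i < n1 then 0 else 1)) (e + (if i < n1 then 1 else 0))"
      using F unfolding Fam_def by simp
    then have "\<exists>X\<in>carrier (P d (e + 1)). ev X = F i" using that by (intro P_surj) simp
    then show ?thesis by (elim bexE) (rule image_eqI, rule sym)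
  qed
  have i2: "F (n1 + j) \<in> ev ` carrier (P (d + 1) e)" if "j < n2" for j
  proof -
    have "n1 + j < N" using that by (simp add: N_def)
    then have "F (n1 + j) \<in> H (d + (if n1 + j < n1 then 0 else 1)) (e + (if n1 + j < n1 then 1 else 0))"
      using F unfolding Fam_def by (simp only: mem_Collect_eq)
    then have "\<exists>X\<in>carrier (P (d + 1) e). ev X = F (n1 + j)" by (intro P_surj) simp
    then show ?thesis by (elim bexE) (rule image_eqI, rule sym)
  qed
  define g where "g i = inv_into (carrier (P d (e + 1))) ev (F i)" for i
  define h where "h j = inv_into (carrier (P (d + 1) e)) ev (F (n1 + j))" for j
  have g: "g i \<in> carrier (P d (e + 1))" "ev (g i) = F i" if "i < n1" for i
    unfolding g_def by (rule inv_into_into[OF i1[OF that]], rule f_inv_into_f[OF i1[OF that]])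
  have h: "h j \<in> carrier (P (d + 1) e)" "ev (h j) = F (n1 + j)" if "j < n2" for j
    unfolding h_def by (rule inv_into_into[OF i2[OF that]], rule f_inv_into_f[OF i2[OF that]])
  have "\<exists>a\<in>carrier (T1 d e). \<forall>i<n1. X1.\<pi> (P d (e + 1)) i a = g i" by (rule X1.pi_surj[OF vP g(1)])
  then obtain a where a: "a \<in> carrier (T1 d e)" "\<forall>i<n1. X1.\<pi> (P d (e + 1)) i a = g i" by (elim bexE)
  have "\<exists>b\<in>carrier (T2 d e). \<forall>i<n2. X2.\<pi> (P (d + 1) e) i b = h i" by (rule X2.pi_surj[OF vP h(1)])
  then obtain b where b: "b \<in> carrier (T2 d e)" "\<forall>i<n2. X2.\<pi> (P (d + 1) e) i b = h i" by (elim bexE)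
  show ?thesis
  proof (rule bexI[of _ "(a, b)"])
    show "(a, b) \<in> carrier (M d e)" unfolding M_carrier using a b by simp
    show "\<forall>v<N. \<Theta> d e (a, b) v = F v"
    proof (intro allI impI)
      fix v assume v: "v < N"
      show "\<Theta> d e (a, b) v = F v"
      proof (cases "v < n1")
        case True
        then show ?thesis unfolding \<Theta>_def fst_conv a(2)[rule_format, OF True] using g(2) by simp
      next
        case False
        then have j: "v - n1 < n2" using v by (simp add: N_def)
        show ?thesis unfolding \<Theta>_def snd_conv b(2)[rule_format, OF j] using h(2)[OF j] False v by simp
      qed
    qed
  qed
qed

text \<open>Since \<open>ev\<close> is injective, bilinearity is checked on polynomials, where it is
  distributivity. The degrees p and q serve both groups of variables at once.\<close>

lemma mul_bil:
  assumes U: "vsp U" and xx: "\<And>u. u \<in> carrier U \<Longrightarrow> xx u \<in> carrier B" "\<And>u. u \<in> carrier U \<Longrightarrow> ev (xx u) \<in> H p q"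
    and add: "\<And>u u'. u \<in> carrier U \<Longrightarrow> u' \<in> carrier U \<Longrightarrow> ev (xx (u \<oplus>\<^bsub>U\<^esub> u')) = ev (xx u) + ev (xx u')"
    and smult: "\<And>a u. u \<in> carrier U \<Longrightarrow> ev (xx (a \<odot>\<^bsub>U\<^esub> u)) = Poly_Mapping.single 0 a * ev (xx u)"
    and de: "d' = d + p" "e' = e + q"
  shows "bil U (P d e) (P d' e') (\<lambda>u f. xx u \<otimes>\<^bsub>B\<^esub> f)"
proof -
  interpret U: vectorspace class_ring U by (rule U)
  interpret S: vectorspace class_ring B by (rule Y.vS)
  have cl: "xx u \<otimes>\<^bsub>B\<^esub> f \<in> carrier B" "ev (xx u \<otimes>\<^bsub>B\<^esub> f) = ev (xx u) * ev f"
    if "u \<in> carrier U" "f \<in> carrier B" for u f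
    using Y.SM.m_closed Y.ev_mult xx(1) that by blast+
  note sm = vs_smult_closed[OF Y.vS] vs_smult_closed[OF U]
  show ?thesis
    unfolding bil_def vlin_def P_ops
  proof (intro conjI ballI allI)
    fix u f assume u: "u \<in> carrier U" and fP: "f \<in> carrier (P d e)"
    have f: "f \<in> carrier B" "ev f \<in> H d e" using P_sub[OF fP] by auto
    show m: "xx u \<otimes>\<^bsub>B\<^esub> f \<in> carrier (P d' e')"
      unfolding P_iff de cl(2)[OF u f(1)]
      using cl(1)[OF u f(1)] H_mult[OF f(2) xx(2)[OF u]] by (simp add: mult.commute)
    show "xx u \<otimes>\<^bsub>B\<^esub> f \<in> carrier (P d' e')" by (rule m)
    show "xx (u \<oplus>\<^bsub>U\<^esub> u') \<otimes>\<^bsub>B\<^esub> f = xx u \<otimes>\<^bsub>B\<^esub> f \<oplus>\<^bsub>B\<^esub> xx u' \<otimes>\<^bsub>B\<^esub> f" if u': "u' \<in> carrier U" for u'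
      by (rule Y.ev_inj) (use u u' f in \<open>simp_all add: cl Y.ev_add add distrib_right\<close>)
    show "xx (a \<odot>\<^bsub>U\<^esub> u) \<otimes>\<^bsub>B\<^esub> f = a \<odot>\<^bsub>B\<^esub> (xx u \<otimes>\<^bsub>B\<^esub> f)" for a
      by (rule Y.ev_inj) (use u f in \<open>simp_all add: cl sm Y.ev_smult smult mult.assoc\<close>)
    show "xx u \<otimes>\<^bsub>B\<^esub> (f \<oplus>\<^bsub>B\<^esub> g) = xx u \<otimes>\<^bsub>B\<^esub> f \<oplus>\<^bsub>B\<^esub> xx u \<otimes>\<^bsub>B\<^esub> g" if "g \<in> carrier (P d e)" for g
      by (rule Y.ev_inj) (use u f P_sub[OF that] in \<open>simp_all add: cl Y.ev_add distrib_left\<close>)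
    show "xx u \<otimes>\<^bsub>B\<^esub> (a \<odot>\<^bsub>B\<^esub> f) = a \<odot>\<^bsub>B\<^esub> (xx u \<otimes>\<^bsub>B\<^esub> f)" for a
      by (rule Y.ev_inj) (use u f in \<open>simp_all add: cl sm Y.ev_smult mult.left_commute\<close>)
  qed
qed

lemma l1_lin: "u \<in> carrier V1 \<Longrightarrow> u' \<in> carrier V1 \<Longrightarrow> l1 (u \<oplus>\<^bsub>V1\<^esub> u') = l1 u + l1 u'"
  "u \<in> carrier V1 \<Longrightarrow> l1 (a \<odot>\<^bsub>V1\<^esub> u) = Poly_Mapping.single 0 a * l1 u"
  by (simp_all add: l1_def X1.c_add X1.c_smult single_add distrib_left sum.distrib single_0_mult
      sum_distrib_left mult.left_commute)

lemma l2_lin: "u \<in> carrier V2 \<Longrightarrow> u' \<in> carrier V2 \<Longrightarrow> l2 (u \<oplus>\<^bsub>V2\<^esub> u') = l2 u + l2 u'"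
  "u \<in> carrier V2 \<Longrightarrow> l2 (a \<odot>\<^bsub>V2\<^esub> u) = Poly_Mapping.single 0 a * l2 u"
  by (simp_all add: l2_def X2.c_add X2.c_smult single_add distrib_left sum.distrib single_0_mult
      sum_distrib_left mult.left_commute)

lemma mul1_bil: "bil V1 (P d e) (P (d + 1) e) (\<lambda>u f. x1 u \<otimes>\<^bsub>B\<^esub> f)"
proof (rule mul_bil[OF vV1 x1_closed])
  interpret V: vectorspace class_ring V1 by (rule vV1)
  show "ev (x1 u) \<in> H 1 0" if "u \<in> carrier V1" for u unfolding ev_x1[OF that] by (rule H_l1)
  show "ev (x1 (u \<oplus>\<^bsub>V1\<^esub> u')) = ev (x1 u) + ev (x1 u')" if "u \<in> carrier V1" "u' \<in> carrier V1" for u u'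
    using that by (simp add: ev_x1 l1_lin)
  show "ev (x1 (a \<odot>\<^bsub>V1\<^esub> u)) = Poly_Mapping.single 0 a * ev (x1 u)" if "u \<in> carrier V1" for a u
    using that vs_smult_closed[OF vV1 that] by (simp add: ev_x1 l1_lin)
qed simp_all

lemma mul2_bil: "bil V2 (P d e) (P d (e + 1)) (\<lambda>u f. x2 u \<otimes>\<^bsub>B\<^esub> f)"
proof (rule mul_bil[OF vV2 x2_closed])
  interpret V: vectorspace class_ring V2 by (rule vV2)
  show "ev (x2 u) \<in> H 0 1" if "u \<in> carrier V2" for u unfolding ev_x2[OF that] by (rule H_l2)
  show "ev (x2 (u \<oplus>\<^bsub>V2\<^esub> u')) = ev (x2 u) + ev (x2 u')" if "u \<in> carrier V2" "u' \<in> carrier V2" for u u'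
    using that by (simp add: ev_x2 l2_lin)
  show "ev (x2 (a \<odot>\<^bsub>V2\<^esub> u)) = Poly_Mapping.single 0 a * ev (x2 u)" if "u \<in> carrier V2" for a u
    using that vs_smult_closed[OF vV2 that] by (simp add: ev_x2 l2_lin)
qed simp_all

lemma bilD:
  assumes "bil U W Q \<phi>" "u \<in> carrier U" "w \<in> carrier W" shows "\<phi> u w \<in> carrier Q"
  using assms unfolding bil_def vlin_def by blast

lemma ev_mul1: "u \<in> carrier V1 \<Longrightarrow> g \<in> carrier (P d e) \<Longrightarrow> ev (x1 u \<otimes>\<^bsub>B\<^esub> g) = l1 u * ev g"
  using Y.ev_mult[OF x1_closed] P_sub ev_x1 by simp

lemma ev_mul2: "u \<in> carrier V2 \<Longrightarrow> g \<in> carrier (P d e) \<Longrightarrow> ev (x2 u \<otimes>\<^bsub>B\<^esub> g) = l2 u * ev g"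
  using Y.ev_mult[OF x2_closed] P_sub ev_x2 by simp

lemma ev_lift1:
  assumes "a \<in> carrier (tensor V1 (P d e))"
  shows "ev (tensor_lift (P (d + 1) e) (\<lambda>u f. x1 u \<otimes>\<^bsub>B\<^esub> f) a) = (\<Sum>i<n1. z i * ev (X1.\<pi> (P d e) i a))"
proof -
  note lv = tensor_pair.lift_vlin[OF tp1 vP mul1_bil]
  show ?thesis using assms
  proof (induction rule: tensor_pair.tensor_induct[OF tp1, consumes 1, case_names zero add pure])
    case zero
    show ?case by (simp only: ev_vlin_zero[OF vT1 lv] ev_vlin_zero[OF vT1 p1_vlin] mult_zero_right sum.neutral_const)
  next
    case (add x y)
    show ?case
      by (simp only: ev_vlin(3)[OF lv add.hyps] ev_vlin(3)[OF p1_vlin add.hyps] add.IH distrib_left sum.distrib)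
  next
    case (pure v f)
    have "z i * ev (X1.\<pi> (P d e) i (pure_tensor V1 (P d e) v f)) = z i * Poly_Mapping.single 0 (c1 i v) * ev f" for i
      using P_sub[OF pure(2)] by (simp add: X1.pi_pure[OF vP pure] Y.ev_smult mult.assoc)
    then show ?case
      by (simp only: tensor_pair.lift_pure[OF tp1 vP mul1_bil pure] ev_mul1[OF pure] l1_def sum_distrib_right)
  qed
qed

lemma ev_lift2:
  assumes "a \<in> carrier (tensor V2 (P d e))"
  shows "ev (tensor_lift (P d (e + 1)) (\<lambda>u f. x2 u \<otimes>\<^bsub>B\<^esub> f) a) = (\<Sum>i<n2. z (n1 + i) * ev (X2.\<pi> (P d e) i a))"
proof -
  note lv = tensor_pair.lift_vlin[OF tp2 vP mul2_bil]
  show ?thesis using assms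
  proof (induction rule: tensor_pair.tensor_induct[OF tp2, consumes 1, case_names zero add pure])
    case zero
    show ?case by (simp only: ev_vlin_zero[OF vT2 lv] ev_vlin_zero[OF vT2 p2_vlin] mult_zero_right sum.neutral_const)
  next
    case (add x y)
    show ?case
      by (simp only: ev_vlin(3)[OF lv add.hyps] ev_vlin(3)[OF p2_vlin add.hyps] add.IH distrib_left sum.distrib)
  next
    case (pure v f)
    have "z (n1 + i) * ev (X2.\<pi> (P d e) i (pure_tensor V2 (P d e) v f)) = z (n1 + i) * Poly_Mapping.single 0 (c2 i v) * ev f" for i
      using P_sub[OF pure(2)] by (simp add: X2.pi_pure[OF vP pure] Y.ev_smult mult.assoc)
    then show ?case
      by (simp only: tensor_pair.lift_pure[OF tp2 vP mul2_bil pure] ev_mul2[OF pure] l2_def sum_distrib_right)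
  qed
qed

lemma sum_N: "(\<Sum>v<N. g v) = (\<Sum>i<n1. g i) + (\<Sum>j<n2. g (n1 + j))" for g :: "nat \<Rightarrow> 'c::comm_monoid_add"
  using sum_append[where p = g and q = "\<lambda>j. g (n1 + j)" and m = n1 and k = n2]
  by (simp add: N_def if_distrib cong: if_cong)

lemma map1:
  assumes w: "w \<in> carrier (M d e)"
  shows "koszul_map1 V1 V2 d e w \<in> carrier B"
    and "ev (koszul_map1 V1 V2 d e w) = (\<Sum>v<N. z v * \<Theta> d e w v)"
proof -
  obtain a b where ab: "w = (a, b)" by (cases w)
  have a: "a \<in> carrier (T1 d e)" and b: "b \<in> carrier (T2 d e)" using w unfolding M_carrier ab by auto
  note l1 = tensor_pair.lift_vlin[OF tp1 vP mul1_bil] and l2 = tensor_pair.lift_vlin[OF tp2 vP mul2_bil]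
  interpret S: vectorspace class_ring B by (rule Y.vS)
  note c = ev_vlin(1)[OF l1 a] ev_vlin(1)[OF l2 b]
  have m: "koszul_map1 V1 V2 d e w =
      tensor_lift (P (d + 1) (e + 1)) (\<lambda>u f. x1 u \<otimes>\<^bsub>B\<^esub> f) a \<oplus>\<^bsub>B\<^esub>
      tensor_lift (P (d + 1) (e + 1)) (\<lambda>u f. x2 u \<otimes>\<^bsub>B\<^esub> f) b"
    unfolding koszul_map1_def ab prod.case P_ops ..
  show "koszul_map1 V1 V2 d e w \<in> carrier B" unfolding m by (rule S.M.a_closed[OF c])
  show "ev (koszul_map1 V1 V2 d e w) = (\<Sum>v<N. z v * \<Theta> d e w v)"
    unfolding m Y.ev_add[OF c] ev_lift1[OF a] ev_lift2[OF b] unfolding sum_N \<Theta>_def ab fst_conv snd_conv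
    by (intro arg_cong2[of _ _ _ _ "(+)"] sum.cong refl) (simp_all add: N_def)
qed

lemma map1_zero_iff:
  assumes w: "w \<in> carrier (M d e)"
  shows "koszul_map1 V1 V2 d e w = \<zero>\<^bsub>P (d + 1) (e + 1)\<^esub> \<longleftrightarrow> (\<Sum>v<N. z v * \<Theta> d e w v) = 0"
proof -
  interpret S: vectorspace class_ring B by (rule Y.vS)
  show ?thesis unfolding map1(2)[OF w, symmetric] P_ops
    using Y.ev_inj[OF map1(1)[OF w] S.M.zero_closed] Y.ev_zero by auto
qed

end

section \<open>The second map, its image, and the homology\<close>

context koszul_setup
begin

lemma form_add: "form (\<lambda>i j. A i j + A' i j) v = form A v + form A' v"
  by (simp add: form_def single_add sum.distrib)

lemma form_smult: "form (\<lambda>i j. a * A i j) v = Poly_Mapping.single 0 a * form A v"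
  by (simp add: form_def sum_distrib_left mult_single)

lemma form_0: "form (\<lambda>i j. 0) v = 0"
  by (simp add: form_def)

lemma z_form: "(\<Sum>v<N. z v * form A v) = 0"
proof -
  interpret b: bigraded n1 n2 1 "\<lambda>_. A" by (rule bigraded.intro[OF n1 n2])
  have "b.f v 0 = form A v" for v by (simp add: b.f_def form_def)
  then show ?thesis using b.z_f_rel[of 0] by simp
qed

text \<open>The coefficient matrix of a tensor in the two chosen bases.\<close>

definition \<tau> :: "('a \<times> 'b \<Rightarrow>\<^sub>0 'k) set \<Rightarrow> nat \<Rightarrow> nat \<Rightarrow> 'k"
  where "\<tau> t = (\<lambda>i j. c2 j (X1.\<pi> V2 i t))"

lemma tau_add: "t \<in> carrier (tensor V1 V2) \<Longrightarrow> t' \<in> carrier (tensor V1 V2) \<Longrightarrow>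
    \<tau> (t \<oplus>\<^bsub>tensor V1 V2\<^esub> t') = (\<lambda>i j. \<tau> t i j + \<tau> t' i j)"
  unfolding \<tau>_def by (simp add: vlinD[OF X1.pi_vlin[OF vV2]] X2.c_add)

lemma tau_smult: "t \<in> carrier (tensor V1 V2) \<Longrightarrow>
    \<tau> (a \<odot>\<^bsub>tensor V1 V2\<^esub> t) = (\<lambda>i j. a * \<tau> t i j)"
  unfolding \<tau>_def by (simp add: vlinD[OF X1.pi_vlin[OF vV2]] X2.c_smult)

lemma tau_pure: "u \<in> carrier V1 \<Longrightarrow> v \<in> carrier V2 \<Longrightarrow>
    \<tau> (pure_tensor V1 V2 u v) = (\<lambda>i j. c1 i u * c2 j v)"
  unfolding \<tau>_def by (simp add: X1.pi_pure[OF vV2] X2.c_smult)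

lemma tau_zero: "\<tau> \<zero>\<^bsub>tensor V1 V2\<^esub> = (\<lambda>i j. 0)"
  unfolding \<tau>_def vlin_zero[OF vTV vV2 X1.pi_vlin[OF vV2]] by (simp add: c2_zero)

text \<open>\<open>Theta_inj\<close> reduces bilinearity into the middle term to bilinearity of the
  coordinates G. It is needed twice, because \<open>koszul_map2\<close> nests one lift inside
  another.\<close>

lemma bil_Theta:
  assumes U: "vsp U" and W: "vsp W"
    and cl: "\<And>u w. u \<in> carrier U \<Longrightarrow> w \<in> carrier W \<Longrightarrow> \<phi> u w \<in> carrier (M d e)"
    and G: "\<And>u w v. u \<in> carrier U \<Longrightarrow> w \<in> carrier W \<Longrightarrow> \<Theta> d e (\<phi> u w) v = G u w v"
    and add1: "\<And>u u' w v. u \<in> carrier U \<Longrightarrow> u' \<in> carrier U \<Longrightarrow> w \<in> carrier W \<Longrightarrow>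
      G (u \<oplus>\<^bsub>U\<^esub> u') w v = G u w v + G u' w v"
    and smult1: "\<And>a u w v. u \<in> carrier U \<Longrightarrow> w \<in> carrier W \<Longrightarrow>
      G (a \<odot>\<^bsub>U\<^esub> u) w v = Poly_Mapping.single 0 a * G u w v"
    and add2: "\<And>u w w' v. u \<in> carrier U \<Longrightarrow> w \<in> carrier W \<Longrightarrow> w' \<in> carrier W \<Longrightarrow>
      G u (w \<oplus>\<^bsub>W\<^esub> w') v = G u w v + G u w' v"
    and smult2: "\<And>a u w v. u \<in> carrier U \<Longrightarrow> w \<in> carrier W \<Longrightarrow>
      G u (a \<odot>\<^bsub>W\<^esub> w) v = Poly_Mapping.single 0 a * G u w v"
  shows "bil U W (M d e) \<phi>"
proof -
  interpret U: abelian_group U by (rule vsp_abelian_group[OF U])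
  interpret W: abelian_group W by (rule vsp_abelian_group[OF W])
  interpret m: abelian_group "M d e" by (rule vsp_abelian_group[OF vM])
  show ?thesis
    unfolding bil_def vlin_def
  proof (intro conjI ballI allI)
    fix u w assume u: "u \<in> carrier U" and w: "w \<in> carrier W"
    note sU = vs_smult_closed[OF U u] and sW = vs_smult_closed[OF W w]
    note sM = vs_smult_closed[OF vM cl[OF u w]]
    show "\<phi> u w \<in> carrier (M d e)" "\<phi> u w \<in> carrier (M d e)" by (rule cl[OF u w])+
    show "\<phi> (a \<odot>\<^bsub>U\<^esub> u) w = a \<odot>\<^bsub>M d e\<^esub> \<phi> u w" for a
      by (rule Theta_inj[OF cl[OF sU w] sM]) (simp only: G[OF sU w] Theta_smult[OF cl[OF u w]] G[OF u w] smult1[OF u w])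
    show "\<phi> u (a \<odot>\<^bsub>W\<^esub> w) = a \<odot>\<^bsub>M d e\<^esub> \<phi> u w" for a
      by (rule Theta_inj[OF cl[OF u sW] sM]) (simp only: G[OF u sW] Theta_smult[OF cl[OF u w]] G[OF u w] smult2[OF u w])
    show "\<phi> (u \<oplus>\<^bsub>U\<^esub> u') w = \<phi> u w \<oplus>\<^bsub>M d e\<^esub> \<phi> u' w" if u': "u' \<in> carrier U" for u'
      by (rule Theta_inj[OF cl[OF U.a_closed[OF u u'] w] m.a_closed[OF cl[OF u w] cl[OF u' w]]])
         (simp only: G[OF U.a_closed[OF u u'] w] Theta_add[OF cl[OF u w] cl[OF u' w]] G[OF u w] G[OF u' w] add1[OF u u' w])
    show "\<phi> u (w \<oplus>\<^bsub>W\<^esub> w') = \<phi> u w \<oplus>\<^bsub>M d e\<^esub> \<phi> u w'" if w': "w' \<in> carrier W" for w'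
      by (rule Theta_inj[OF cl[OF u W.a_closed[OF w w']] m.a_closed[OF cl[OF u w] cl[OF u w']]])
         (simp only: G[OF u W.a_closed[OF w w']] Theta_add[OF cl[OF u w] cl[OF u w']] G[OF u w] G[OF u w'] add2[OF u w w'])
  qed
qed

text \<open>The inner bilinear map of \<open>koszul_map2\<close>, with the polynomial factor h held
  fixed.\<close>

definition \<psi> where "\<psi> d e h v1 v2 = (pure_tensor V1 (P d (e + 1)) v1 (x2 v2 \<otimes>\<^bsub>B\<^esub> h),
    \<ominus>\<^bsub>T2 d e\<^esub> pure_tensor V2 (P (d + 1) e) v2 (x1 v1 \<otimes>\<^bsub>B\<^esub> h))"

lemma psi:
  assumes v1: "v1 \<in> carrier V1" and v2: "v2 \<in> carrier V2" and h: "h \<in> carrier (P d e)"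
  shows "\<psi> d e h v1 v2 \<in> carrier (M d e)"
    and "\<Theta> d e (\<psi> d e h v1 v2) v = form (\<lambda>i j. c1 i v1 * c2 j v2) v * ev h"
proof -
  interpret t2: abelian_group "T2 d e" by (rule vsp_abelian_group[OF vT2])
  note m1 = bilD[OF mul1_bil v1 h] and m2 = bilD[OF mul2_bil v2 h]
  note p1 = tensor_pair.pure_closed[OF tp1 v1 m2] and p2 = tensor_pair.pure_closed[OF tp2 v2 m1]
  show "\<psi> d e h v1 v2 \<in> carrier (M d e)"
    unfolding M_carrier \<psi>_def fst_conv snd_conv by (intro conjI p1 t2.a_inv_closed p2)
  have "ev (X1.\<pi> (P d (e + 1)) v (pure_tensor V1 (P d (e + 1)) v1 (x2 v2 \<otimes>\<^bsub>B\<^esub> h))) =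
      Poly_Mapping.single 0 (c1 v v1) * (l2 v2 * ev h)"
    unfolding X1.pi_pure[OF vP v1 m2] P_ops Y.ev_smult[OF P_sub[OF m2, THEN conjunct1]] ev_mul2[OF v2 h] ..
  moreover have "ev (X2.\<pi> (P (d + 1) e) (v - n1) (\<ominus>\<^bsub>T2 d e\<^esub> pure_tensor V2 (P (d + 1) e) v2 (x1 v1 \<otimes>\<^bsub>B\<^esub> h))) =
      - (Poly_Mapping.single 0 (c2 (v - n1) v2) * (l1 v1 * ev h))"
    unfolding ev_vlin_neg[OF vT2 p2_vlin p2] X2.pi_pure[OF vP v2 m1] P_ops
      Y.ev_smult[OF P_sub[OF m1, THEN conjunct1]] ev_mul1[OF v1 h] ..
  moreover have "Poly_Mapping.single 0 (c1 v v1) * l2 v2 = form (\<lambda>i j. c1 i v1 * c2 j v2) v" if "v < n1"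
    using that by (simp add: form_def l2_def z_def N_def sum_distrib_left mult_single)
  moreover have "- (Poly_Mapping.single 0 (c2 (v - n1) v2) * l1 v1) = form (\<lambda>i j. c1 i v1 * c2 j v2) v"
    if "\<not> v < n1" "v < N"
    using that by (simp add: form_def l1_def z_def N_def sum_distrib_left mult_single mult.commute)
  moreover have "form (\<lambda>i j. c1 i v1 * c2 j v2) v = 0" if "\<not> v < N"
    using that by (simp add: form_def N_def)
  ultimately show "\<Theta> d e (\<psi> d e h v1 v2) v = form (\<lambda>i j. c1 i v1 * c2 j v2) v * ev h"
    unfolding \<Theta>_def \<psi>_def fst_conv snd_conv
    by (metis (no_types, lifting) mult.assoc mult_minus_left mult_zero_left)
qed

lemma psi_bil:
  assumes h: "h \<in> carrier (P d e)"
  shows "bil V1 V2 (M d e) (\<psi> d e h)"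
proof (rule bil_Theta[OF vV1 vV2, where G = "\<lambda>u w v. form (\<lambda>i j. c1 i u * c2 j w) v * ev h"])
  show "\<psi> d e h u w \<in> carrier (M d e)" if "u \<in> carrier V1" "w \<in> carrier V2" for u w by (rule psi(1)[OF that h])
  show "\<Theta> d e (\<psi> d e h u w) v = form (\<lambda>i j. c1 i u * c2 j w) v * ev h"
    if "u \<in> carrier V1" "w \<in> carrier V2" for u w v by (rule psi(2)[OF that h])
  fix a u w v assume u: "u \<in> carrier V1" and w: "w \<in> carrier V2"
  show "form (\<lambda>i j. c1 i (a \<odot>\<^bsub>V1\<^esub> u) * c2 j w) v * ev h =
      Poly_Mapping.single 0 a * (form (\<lambda>i j. c1 i u * c2 j w) v * ev h)"
    by (simp add: X1.c_smult[OF u] mult.assoc flip: form_smult)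
  show "form (\<lambda>i j. c1 i u * c2 j (a \<odot>\<^bsub>V2\<^esub> w)) v * ev h =
      Poly_Mapping.single 0 a * (form (\<lambda>i j. c1 i u * c2 j w) v * ev h)"
  proof -
    have "(\<lambda>i j. c1 i u * c2 j (a \<odot>\<^bsub>V2\<^esub> w)) = (\<lambda>i j. a * (c1 i u * c2 j w))"
      by (simp add: X2.c_smult[OF w] mult.left_commute)
    then show ?thesis by (simp only: form_smult mult.assoc)
  qed
next
  fix u u' w v assume u: "u \<in> carrier V1" "u' \<in> carrier V1" and w: "w \<in> carrier V2"
  show "form (\<lambda>i j. c1 i (u \<oplus>\<^bsub>V1\<^esub> u') * c2 j w) v * ev h =
      form (\<lambda>i j. c1 i u * c2 j w) v * ev h + form (\<lambda>i j. c1 i u' * c2 j w) v * ev h"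
    by (simp add: X1.c_add[OF u] distrib_right form_add)
next
  fix u w w' v assume u: "u \<in> carrier V1" and w: "w \<in> carrier V2" "w' \<in> carrier V2"
  show "form (\<lambda>i j. c1 i u * c2 j (w \<oplus>\<^bsub>V2\<^esub> w')) v * ev h =
      form (\<lambda>i j. c1 i u * c2 j w) v * ev h + form (\<lambda>i j. c1 i u * c2 j w') v * ev h"
    by (simp add: X2.c_add[OF w] distrib_left distrib_right form_add)
qed

lemma lift_psi:
  assumes t: "t \<in> carrier (tensor V1 V2)" and h: "h \<in> carrier (P d e)"
  shows "tensor_lift (M d e) (\<psi> d e h) t \<in> carrier (M d e)"
    and "\<Theta> d e (tensor_lift (M d e) (\<psi> d e h) t) v = form (\<tau> t) v * ev h"
proof -
  note lv = tensor_pair.lift_vlin[OF tpV vM psi_bil[OF h]]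
  show "tensor_lift (M d e) (\<psi> d e h) t \<in> carrier (M d e)" by (rule vlinD(1)[OF lv t])
  show "\<Theta> d e (tensor_lift (M d e) (\<psi> d e h) t) v = form (\<tau> t) v * ev h"
    using t
  proof (induction rule: tensor_pair.tensor_induct[OF tpV, consumes 1, case_names zero add pure])
    case zero
    show ?case by (simp add: vlin_zero[OF vTV vM lv] Theta_zero tau_zero form_0)
  next
    case (add x y)
    then show ?case
      by (simp only: vlinD(2)[OF lv] Theta_add[OF vlinD(1)[OF lv] vlinD(1)[OF lv]] tau_add form_add distrib_right)
  next
    case (pure v1 v2)
    show ?case
      by (simp only: tensor_pair.lift_pure[OF tpV vM psi_bil[OF h] pure] psi(2)[OF pure h] tau_pure[OF pure])
  qed
qed

context
  fixes KK :: "('a \<times> 'b \<Rightarrow>\<^sub>0 'k) set set"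
  assumes KK: "VectorSpace.subspace class_ring KK (tensor V1 V2)"
begin

abbreviation TK where "TK \<equiv> (tensor V1 V2) \<lparr> carrier := KK \<rparr>"

lemma vTK: "vsp TK" by (rule vectorspace.subspace_is_vs[OF vTV KK])

lemma KK_sub: "t \<in> KK \<Longrightarrow> t \<in> carrier (tensor V1 V2)"
  using KK unfolding vs_subspace_iff[OF vTV] by blast

lemma tpK: "tensor_pair TK (P d e)" by (rule tensor_pair.intro[OF vTK vP])

lemma lift_bil: "bil TK (P d e) (M d e) (\<lambda>t h. tensor_lift (M d e) (\<psi> d e h) t)"
proof (rule bil_Theta[OF vTK vP, where G = "\<lambda>t h v. form (\<tau> t) v * ev h"])
  interpret S: vectorspace class_ring B by (rule Y.vS)
  show "tensor_lift (M d e) (\<psi> d e h) t \<in> carrier (M d e)" if "t \<in> carrier TK" "h \<in> carrier (P d e)" for t h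
    using that KK_sub by (intro lift_psi(1)) simp_all
  show "\<Theta> d e (tensor_lift (M d e) (\<psi> d e h) t) v = form (\<tau> t) v * ev h"
    if "t \<in> carrier TK" "h \<in> carrier (P d e)" for t h v
    using that KK_sub by (intro lift_psi(2)) simp_all
  show "form (\<tau> (t \<oplus>\<^bsub>TK\<^esub> t')) v * ev h = form (\<tau> t) v * ev h + form (\<tau> t') v * ev h"
    if "t \<in> carrier TK" "t' \<in> carrier TK" for t t' h v
    using that KK_sub by (simp add: tau_add form_add distrib_right)
  show "form (\<tau> (a \<odot>\<^bsub>TK\<^esub> t)) v * ev h = Poly_Mapping.single 0 a * (form (\<tau> t) v * ev h)"
    if "t \<in> carrier TK" for a t h v
    using that KK_sub by (simp add: tau_smult form_smult mult.assoc)
  show "form (\<tau> t) v * ev (h \<oplus>\<^bsub>P d e\<^esub> h') = form (\<tau> t) v * ev h + form (\<tau> t) v * ev h'"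
    if "h \<in> carrier (P d e)" "h' \<in> carrier (P d e)" for t h h' v
    using P_sub[OF that(1)] P_sub[OF that(2)] by (simp add: Y.ev_add distrib_left)
  show "form (\<tau> t) v * ev (a \<odot>\<^bsub>P d e\<^esub> h) = Poly_Mapping.single 0 a * (form (\<tau> t) v * ev h)"
    if "h \<in> carrier (P d e)" for a t h v
    using P_sub[OF that(1)] by (simp add: Y.ev_smult mult.left_commute)
qed

lemma map2_eq: "koszul_map2 V1 V2 d e = tensor_lift (M d e) (\<lambda>t h. tensor_lift (M d e) (\<psi> d e h) t)"
  unfolding koszul_map2_def \<psi>_def[abs_def] ..

lemma source_eq: "koszul_source V1 V2 KK d e = tensor TK (P d e)"
  by (rule koszul_source_def)

lemma map2_vlin: "vlin (koszul_source V1 V2 KK d e) (M d e) (koszul_map2 V1 V2 d e)"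
  unfolding map2_eq source_eq by (rule tensor_pair.lift_vlin[OF tpK vM lift_bil])

lemma Theta_map2_pure:
  assumes "t \<in> KK" "h \<in> carrier (P d e)"
  shows "\<Theta> d e (koszul_map2 V1 V2 d e (pure_tensor TK (P d e) t h)) v = form (\<tau> t) v * ev h"
proof -
  have t: "t \<in> carrier TK" using assms by simp
  show ?thesis
    unfolding map2_eq tensor_pair.lift_pure[OF tpK vM lift_bil t assms(2)]
    by (rule lift_psi(2)[OF KK_sub[OF assms(1)] assms(2)])
qed

lemma vSrc: "vsp (koszul_source V1 V2 KK d e)"
  unfolding source_eq by (rule tensor_pair.vT[OF tpK])

lemma image_represented:
  assumes "x \<in> carrier (koszul_source V1 V2 KK d e)"
  shows "represented (\<tau> ` KK) d e (\<Theta> d e (koszul_map2 V1 V2 d e x))"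
  using assms unfolding source_eq
proof (induction rule: tensor_pair.tensor_induct[OF tpK, consumes 1, case_names zero add pure])
  case zero
  have "koszul_map2 V1 V2 d e \<zero>\<^bsub>tensor TK (P d e)\<^esub> = \<zero>\<^bsub>M d e\<^esub>"
    using vlin_zero[OF vSrc vM map2_vlin] by (simp only: source_eq)
  then show ?case by (intro represented_cong[OF represented_0]) (simp only: Theta_zero)
next
  case (add x y)
  note l = map2_vlin[of d e, unfolded source_eq]
  show ?case
    by (rule represented_cong[OF represented_add[OF add.IH]])
       (simp only: vlinD(2)[OF l add.hyps] Theta_add[OF vlinD(1)[OF l add.hyps(1)] vlinD(1)[OF l add.hyps(2)]])
next
  case (pure t h)
  have t: "t \<in> KK" using pure by simp
  show ?case unfolding represented_def
  proof (intro exI[of _ "1 :: nat"] exI[of _ "\<lambda>_. \<tau> t"] exI[of _ "\<lambda>_. ev h"] conjI allI impI)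
    show "\<tau> t \<in> \<tau> ` KK" using t by (rule imageI)
    show "ev h \<in> H d e" using P_sub[OF pure(2)] by simp
    show "\<Theta> d e (koszul_map2 V1 V2 d e (pure_tensor TK (P d e) t h)) v = (\<Sum>l<1::nat. form (\<tau> t) v * ev h)" for v
      unfolding Theta_map2_pure[OF t pure(2)] by simp
  qed
qed

text \<open>Each summand is the coordinate family of the image of a pure tensor, with preimages
  chosen for the matrix and the polynomial; equality of coordinates then gives equality in the
  middle term.\<close>

lemma represented_image:
  assumes w: "w \<in> carrier (M d e)" and r: "represented (\<tau> ` KK) d e (\<Theta> d e w)"
  shows "w \<in> koszul_map2 V1 V2 d e ` carrier (koszul_source V1 V2 KK d e)"
proof -
  interpret s: abelian_group "koszul_source V1 V2 KK d e" by (rule vsp_abelian_group[OF vSrc])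
  obtain m :: nat and A g where 1: "\<forall>l<m. A l \<in> \<tau> ` KK \<and> g l \<in> H d e"
    and 2: "\<forall>v<N. \<Theta> d e w v = (\<Sum>l<m. form (A l) v * g l)"
    using r unfolding represented_def by (elim exE conjE)
  have "\<exists>x\<in>carrier (koszul_source V1 V2 KK d e). \<forall>v. \<Theta> d e (koszul_map2 V1 V2 d e x) v = (\<Sum>l<m. form (A l) v * g l)"
    using 1
  proof (induction m)
    case 0
    show ?case
      by (rule bexI[OF _ s.zero_closed]) (simp add: vlin_zero[OF vSrc vM map2_vlin] Theta_zero)
  next
    case (Suc m)
    then obtain x where x: "x \<in> carrier (koszul_source V1 V2 KK d e)"
        "\<forall>v. \<Theta> d e (koszul_map2 V1 V2 d e x) v = (\<Sum>l<m. form (A l) v * g l)" by auto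
    obtain t where t: "t \<in> KK" "A m = \<tau> t" using Suc.prems by auto
    obtain h where h: "h \<in> carrier (P d e)" "ev h = g m" using P_surj[of "g m" d e] Suc.prems by auto
    let ?p = "pure_tensor TK (P d e) t h"
    have p: "?p \<in> carrier (koszul_source V1 V2 KK d e)"
      unfolding source_eq by (rule tensor_pair.pure_closed[OF tpK _ h(1)]) (simp add: t)
    have "\<Theta> d e (koszul_map2 V1 V2 d e (x \<oplus>\<^bsub>koszul_source V1 V2 KK d e\<^esub> ?p)) v = (\<Sum>l<Suc m. form (A l) v * g l)" for v
      unfolding vlinD(2)[OF map2_vlin x(1) p] Theta_add[OF vlinD(1)[OF map2_vlin x(1)] vlinD(1)[OF map2_vlin p]]
        Theta_map2_pure[OF t(1) h(1)] h(2) t(2)[symmetric] x(2)[rule_format] by simp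
    then show ?case using s.a_closed[OF x(1) p] by (intro bexI allI)
  qed
  then obtain x where x: "x \<in> carrier (koszul_source V1 V2 KK d e)"
    "\<forall>v. \<Theta> d e (koszul_map2 V1 V2 d e x) v = (\<Sum>l<m. form (A l) v * g l)" by blast
  have "w = koszul_map2 V1 V2 d e x"
    by (rule Theta_inj[OF w vlinD(1)[OF map2_vlin x(1)]]) (use 2 x(2) in simp)
  then show ?thesis using x(1) by (rule image_eqI)
qed

lemma represented_syzygy:
  assumes "represented S d e F" shows "(\<Sum>v<N. z v * F v) = 0"
proof -
  obtain m :: nat and A g where F: "\<forall>v<N. F v = (\<Sum>l<m. form (A l) v * g l)"
    using assms unfolding represented_def by (elim exE conjE)
  have "(\<Sum>v<N. z v * F v) = (\<Sum>v<N. \<Sum>l<m. z v * form (A l) v * g l)"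
    using F by (intro sum.cong refl) (simp add: sum_distrib_left mult.assoc)
  also have "\<dots> = (\<Sum>l<m. (\<Sum>v<N. z v * form (A l) v) * g l)"
    by (subst sum.swap) (simp add: sum_distrib_right)
  finally show ?thesis by (simp add: z_form)
qed

text \<open>The quotient is trivial exactly if every cycle is a boundary, and
  \<open>\<Theta>\<close> identifies cycles with kernel families and boundaries with represented
  ones.\<close>

lemma zero_space_iff: "zero_space (koszul_module V1 V2 KK d e) \<longleftrightarrow> Van (\<tau> ` KK) d e"
proof -
  let ?Z = "{w \<in> carrier (M d e). koszul_map1 V1 V2 d e w = \<zero>\<^bsub>P (d + 1) (e + 1)\<^esub>}"
  let ?I = "koszul_map2 V1 V2 d e ` carrier (koszul_source V1 V2 KK d e)"
  let ?M = "(M d e) \<lparr> carrier := ?Z \<rparr>"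
  interpret m: vectorspace class_ring "M d e" by (rule vM)
  interpret s: abelian_group "koszul_source V1 V2 KK d e" by (rule vsp_abelian_group[OF vSrc])
  have Z: "w \<in> ?Z \<longleftrightarrow> w \<in> carrier (M d e) \<and> (\<Sum>v<N. z v * \<Theta> d e w v) = 0" for w
    unfolding mem_Collect_eq by (rule conj_cong[OF refl map1_zero_iff])
  have subZ: "VectorSpace.subspace class_ring ?Z (M d e)"
    unfolding vs_subspace_iff[OF vM]
  proof (intro conjI ballI allI)
    show "\<zero>\<^bsub>M d e\<^esub> \<in> ?Z" unfolding Z by (simp add: Theta_zero)
    show "x \<oplus>\<^bsub>M d e\<^esub> y \<in> ?Z" if "x \<in> ?Z" "y \<in> ?Z" for x y
      using that unfolding Z by (simp add: Theta_add distrib_left sum.distrib)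
    show "a \<odot>\<^bsub>M d e\<^esub> x \<in> ?Z" if "x \<in> ?Z" for a x
    proof -
      have x: "x \<in> carrier (M d e)" "(\<Sum>v<N. z v * \<Theta> d e x v) = 0"
        using that unfolding Z by blast+
      have e: "(\<Sum>v<N. z v * \<Theta> d e (a \<odot>\<^bsub>M d e\<^esub> x) v) = Poly_Mapping.single 0 a * (\<Sum>v<N. z v * \<Theta> d e x v)"
        by (simp add: Theta_smult[OF x(1)] sum_distrib_left mult.left_commute)
      show ?thesis unfolding Z e x(2) by (intro conjI vs_smult_closed[OF vM x(1)] mult_zero_right)
    qed
  qed auto
  have vM': "vsp ?M" by (rule vectorspace.subspace_is_vs[OF vM subZ])
  have IZ: "?I \<subseteq> ?Z"
  proof
    fix w assume "w \<in> ?I"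
    then obtain x where x: "x \<in> carrier (koszul_source V1 V2 KK d e)" "w = koszul_map2 V1 V2 d e x" by (elim imageE)
    show "w \<in> ?Z" unfolding Z x(2)
      by (intro conjI vlinD(1)[OF map2_vlin x(1)] represented_syzygy[OF image_represented[OF x(1)]])
  qed
  have subI: "VectorSpace.subspace class_ring ?I ?M"
    unfolding vs_subspace_iff[OF vM']
  proof (intro conjI ballI allI)
    show "?I \<subseteq> carrier ?M" using IZ by simp
    show "\<zero>\<^bsub>?M\<^esub> \<in> ?I"
      using vlin_zero[OF vSrc vM map2_vlin, of d e] s.zero_closed by (intro image_eqI[of _ _ "\<zero>\<^bsub>koszul_source V1 V2 KK d e\<^esub>"]) simp_all
    show "x \<oplus>\<^bsub>?M\<^esub> y \<in> ?I" if "x \<in> ?I" "y \<in> ?I" for x y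
    proof -
      obtain p q where p: "p \<in> carrier (koszul_source V1 V2 KK d e)" "x = koszul_map2 V1 V2 d e p"
        and q: "q \<in> carrier (koszul_source V1 V2 KK d e)" "y = koszul_map2 V1 V2 d e q" using \<open>x \<in> ?I\<close> \<open>y \<in> ?I\<close> by (elim imageE)
      show ?thesis using vlinD(2)[OF map2_vlin p(1) q(1)] s.a_closed[OF p(1) q(1)]
        unfolding p(2) q(2) by (intro image_eqI[of _ _ "p \<oplus>\<^bsub>koszul_source V1 V2 KK d e\<^esub> q"]) simp_all
    qed
    show "a \<odot>\<^bsub>?M\<^esub> x \<in> ?I" if "x \<in> ?I" for a x
    proof -
      obtain p where p: "p \<in> carrier (koszul_source V1 V2 KK d e)" "x = koszul_map2 V1 V2 d e p" using \<open>x \<in> ?I\<close> by (elim imageE)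
      show ?thesis using vlinD(3)[OF map2_vlin p(1), of a] vs_smult_closed[OF vSrc p(1), of a]
        unfolding p(2) by (intro image_eqI[of _ _ "a \<odot>\<^bsub>koszul_source V1 V2 KK d e\<^esub> p"]) simp_all
    qed
  qed
  interpret q: vs_quotient ?M ?I by (rule vs_quotient.intro[OF vM' subI])
  have qI: "q.q w = ?I \<longleftrightarrow> w \<in> ?I" if w: "w \<in> ?Z" for w
  proof
    assume "q.q w = ?I"
    moreover have "w \<in> q.q w" by (rule q.q_self) (use w in simp)
    ultimately show "w \<in> ?I" by (simp only:)
  next
    assume I: "w \<in> ?I"
    have wM: "w \<in> carrier (M d e)" using w by simp
    have "q.q (w \<oplus>\<^bsub>?M\<^esub> \<zero>\<^bsub>?M\<^esub>) = q.q \<zero>\<^bsub>?M\<^esub>" by (rule q.q_eqI[OF I q.M.M.zero_closed])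
    then show "q.q w = ?I" unfolding q.q_zero using wM by simp
  qed
  have "zero_space (koszul_module V1 V2 KK d e) \<longleftrightarrow> q.q ` ?Z = {?I}"
    unfolding zero_space_def koszul_module_def q.zero_quotient q.carrier_quotient by simp
  also have "\<dots> \<longleftrightarrow> (\<forall>w\<in>?Z. w \<in> ?I)"
  proof
    assume e: "q.q ` ?Z = {?I}"
    show "\<forall>w\<in>?Z. w \<in> ?I"
    proof
      fix w assume w: "w \<in> ?Z"
      have "q.q w \<in> {?I}" unfolding e[symmetric] by (rule imageI[OF w])
      then show "w \<in> ?I" unfolding singleton_iff qI[OF w] .
    qed
  next
    assume a: "\<forall>w\<in>?Z. w \<in> ?I"
    have q1: "q.q w = ?I" if "w \<in> ?Z" for w using qI[OF that] a that by (simp only:)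
    have z0: "\<zero>\<^bsub>M d e\<^esub> \<in> ?Z" using subZ unfolding vs_subspace_iff[OF vM] by (elim conjE)
    show "q.q ` ?Z = {?I}"
    proof (rule equalityI)
      show "q.q ` ?Z \<subseteq> {?I}" by (rule image_subsetI, rule singletonI[THEN back_subst[of "\<lambda>t. t \<in> {?I}"]], rule q1[symmetric])
      show "{?I} \<subseteq> q.q ` ?Z"
        by (intro insert_subsetI empty_subsetI image_eqI[where x = "\<zero>\<^bsub>M d e\<^esub>" and A = ?Z and b = ?I and f = q.q, OF q1[OF z0, symmetric] z0])
    qed
  qed
  also have "\<dots> \<longleftrightarrow> Van (\<tau> ` KK) d e"
  proof
    assume a: "\<forall>w\<in>?Z. w \<in> ?I"
    show "Van (\<tau> ` KK) d e"
      unfolding Van_def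
    proof (intro ballI impI)
      fix F assume F: "F \<in> Fam d e" and rel: "(\<Sum>v<N. z v * F v) = 0"
      obtain w where w: "w \<in> carrier (M d e)" "\<forall>v<N. \<Theta> d e w v = F v" using Theta_surj[OF F] by (elim bexE)
      have "(\<Sum>v<N. z v * \<Theta> d e w v) = 0" using w(2) rel by simp
      then have "w \<in> ?Z" unfolding Z using w(1) by (intro conjI)
      then have "w \<in> ?I" by (rule bspec[OF a])
      then obtain x where x: "x \<in> carrier (koszul_source V1 V2 KK d e)" "w = koszul_map2 V1 V2 d e x" by (elim imageE)
      show "represented (\<tau> ` KK) d e F"
        by (rule represented_cong[OF image_represented[OF x(1)]]) (use w(2) x(2) in simp)
    qed
  next
    assume v: "Van (\<tau> ` KK) d e"
    show "\<forall>w\<in>?Z. w \<in> ?I"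
    proof
      fix w assume "w \<in> ?Z"
      then have w: "w \<in> carrier (M d e)" "(\<Sum>v<N. z v * \<Theta> d e w v) = 0" unfolding Z by blast+
      show "w \<in> ?I"
        by (rule represented_image[OF w(1)]) (use v w Theta_Fam[OF w(1)] in \<open>simp add: Van_def\<close>)
    qed
  qed
  finally show ?thesis .
qed

end

end

theorem theorem1p8:
  fixes V1 :: "('k::alg_closed_field, 'a) module" and V2 :: "('k, 'b) module"
    and K :: "('a \<times> 'b \<Rightarrow>\<^sub>0 'k) set set" and n1 n2 p :: nat
  assumes "CHAR('k) = p"
    and "vectorspace class_ring V1" and "vectorspace.fin_dim class_ring V1"
    and "vectorspace class_ring V2" and "vectorspace.fin_dim class_ring V2"
    and "vectorspace.dim class_ring V1 = n1" and "n1 \<ge> 2"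
    and "vectorspace.dim class_ring V2 = n2" and "n2 \<ge> 2"
    and "VectorSpace.subspace class_ring K (tensor V1 V2)"
    and "p = 0 \<or> p \<ge> n1 + n2 - 3"
  shows "(\<exists>N. \<forall>d\<ge>N. \<forall>e\<ge>N. zero_space (koszul_module V1 V2 K d e)) \<longleftrightarrow>
    zero_space (koszul_module V1 V2 K (n2 - 2) (n1 - 2))"
proof -
  obtain b1 c1 where 1: "coordinates V1 n1 b1 c1" using exists_coordinates[OF assms(2,3,6)] by (elim exE)
  obtain b2 c2 where 2: "coordinates V2 n2 b2 c2" using exists_coordinates[OF assms(4,5,8)] by (elim exE)
  \<comment> \<open>The list of columns is empty at this point: \<open>Van\<close> draws its columns
    from the matrices of K.\<close>
  interpret koszul_setup n1 n2 0 "\<lambda>_ _ _. 0 :: 'k" V1 b1 c1 V2 b2 c2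
    by (rule koszul_setup.intro[OF bigraded.intro[OF assms(7,9)] 1 2])
  have "of_nat k \<noteq> (0 :: 'k)" if "0 < k" "k + 4 \<le> n1 + n2" for k
  proof
    assume "of_nat k = (0 :: 'k)"
    then have "p dvd k" using assms(1) by (simp add: of_nat_eq_0_iff_char_dvd)
    \<comment> \<open>Characteristic zero would force k = 0; a positive p dividing k is at most n1 +
      n2 - 4, against the assumed bound.\<close>
    then have "p \<le> k" "p \<noteq> 0" using that(1) by (auto intro: dvd_imp_le)
    then show False using assms(11) that by linarith
  qed
  then show ?thesis unfolding zero_space_iff[OF assms(10)] by (rule Van_iff)
qed

end
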